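(* Let $(M,p)$ be the germ at a point $p\in M$ of an F-manifold $(M,\circ,e)$, and let $T_pM=\bigoplus_{k=1}^{l}(T_pM)_k$ be the eigenspace decomposition of the algebra $(T_pM,\circ,e(p))$. Then this decomposition extends to a unique decomposition $$(M,p)=\prod_{k=1}^{l}(M_k,p)$$ of the germ $(M,p)$ into a product of germs of F-manifolds, with $T_pM_k\cong (T_pM)_k$. The germs $(M_k,p)$ are irreducible germs of F-manifolds (already the algebras $T_pM_k\cong(T_pM)_k$ are irreducible). Moreover, an Euler field $E$ on $(M,p)$ of weight $d$ decomposes into a sum of Euler fields of the same weight $d$ on the germs $(M_k,p)$ of F-manifolds.
   Context: All manifolds are complex manifolds; $\mathcal O_M$ and $\mathcal T_M$ are the structure sheaf and the holomorphic tangent sheaf. An F-manifold is a triple $(M,\circ,e)$ where $M$ is a connected complex manifold of dimension $\ge 1$, $\circ$ is a commutative and associative $\mathcal O_M$-bilinear multiplication $\mathcal T_M\times\mathcal T_M\to\mathcal T_M$, $e$ is a global unit field, and for any two local vector fields $X,Y$ $$\mathrm{Lie}_{X\circ Y}(\circ)=X\circ \mathrm{Lie}_Y(\circ)+Y\circ\mathrm{Lie}_X(\circ),$$ where $\mathrm{Lie}_X(\circ)(Z,W)=[X,Z\circ W]-[X,Z]\circ W-Z\circ[X,W]$. An Euler field of weight $d\in\mathbb C$ is a vector field $E$ with $\mathrm{Lie}_E(\circ)=d\cdot\circ$. Eigenspace decomposition: a finite-dimensional commutative associative unital $\mathbb C$-algebra $Q$ decomposes uniquely as $Q=\bigoplus_{k=1}^l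 Q_k$ into the (nonzero) simultaneous generalized eigenspaces of all multiplication endomorphisms $x\circ:Q\to Q$, $x\in Q$; the $Q_k$ are irreducible local algebras with $Q_j\circ Q_k=0$ for $j\ne k$. The product of two F-manifolds $(M_1,\circ_1,e_1)$, $(M_2,\circ_2,e_2)$ is $(M_1\times M_2,\circ_1\oplus\circ_2,e_1+e_2)$. A germ of an F-manifold is irreducible if it is not a product of two germs of F-manifolds (of positive dimension). "Extends" means that the tangent space at $p$ of the factor $M_k$ (embedded in $M$ through $p$) is the subspace $(T_pM)_k\subset T_pM$. *)

theory Defs
  imports "HOL-Analysis.Analysis"
begin

text \<open>
  Complex manifolds are modelled on a complex linear subspace \<open>V\<close> of \<open>complex ^ 'n\<close> rather than
  on \<open>complex ^ 'n\<close> itself, so that the factors of a product decomposition, whose dimensions vary,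
  all live in one type.  Every \<open>d\<close>-dimensional germ with \<open>d \<le> CARD('n)\<close> has such a model.
  Tangent vectors of an open subset of \<open>V\<close> are elements of \<open>V\<close>.
\<close>

definition nbhd :: "(complex ^ 'n) set \<Rightarrow> complex ^ 'n \<Rightarrow> (complex ^ 'n) set \<Rightarrow> bool" where
  "nbhd V p U \<longleftrightarrow> openin (top_of_set V) U \<and> p \<in> U"

text \<open>
  The set \<open>U\<close> is meant to be open in a subspace \<open>V\<close>; the derivative is then only determined on
  \<open>V\<close>, and a complex linear derivative on \<open>V\<close> always has a complex linear extension.
\<close>

definition holo_on :: "(complex ^ 'n) set \<Rightarrow> (complex ^ 'n \<Rightarrow> complex ^ 'n) \<Rightarrow> bool" where
  "holo_on U f \<longleftrightarrow>
     (\<forall>x\<in>U. \<exists>D. Vector_Spaces.linear (*s) (*s) D \<and> (f has_derivative D) (at x within U))"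

text \<open>The differential \<open>df\<^sub>x(v)\<close>, as a complex directional derivative.\<close>

definition dif :: "(complex ^ 'n \<Rightarrow> complex ^ 'n) \<Rightarrow> complex ^ 'n \<Rightarrow> complex ^ 'n \<Rightarrow> complex ^ 'n" where
  "dif f x v = (\<chi> i. deriv (\<lambda>t. f (x + t *s v) $ i) 0)"

definition vfield :: "(complex ^ 'n) set \<Rightarrow> (complex ^ 'n) set \<Rightarrow> (complex ^ 'n \<Rightarrow> complex ^ 'n) \<Rightarrow> bool" where
  "vfield V U X \<longleftrightarrow> holo_on U X \<and> X ` U \<subseteq> V"

definition lie :: "(complex ^ 'n \<Rightarrow> complex ^ 'n) \<Rightarrow> (complex ^ 'n \<Rightarrow> complex ^ 'n) \<Rightarrow>
    complex ^ 'n \<Rightarrow> complex ^ 'n" where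
  "lie X Y x = dif Y x (X x) - dif X x (Y x)"

text \<open>A multiplication on the tangent spaces: \<open>m x v w\<close> is the product of \<open>v\<close> and \<open>w\<close> at \<open>x\<close>.\<close>

type_synonym 'n tmult = "complex ^ 'n \<Rightarrow> complex ^ 'n \<Rightarrow> complex ^ 'n \<Rightarrow> complex ^ 'n"

text \<open>\<open>lie_mult m X Z T\<close> is the vector field \<open>Lie\<^sub>X(\<circ>)(Z, T)\<close>.\<close>

definition lie_mult :: "'n tmult \<Rightarrow> (complex ^ 'n \<Rightarrow> complex ^ 'n) \<Rightarrow> (complex ^ 'n \<Rightarrow> complex ^ 'n) \<Rightarrow>
    (complex ^ 'n \<Rightarrow> complex ^ 'n) \<Rightarrow> complex ^ 'n \<Rightarrow> complex ^ 'n" where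
  "lie_mult m X Z T x =
     lie X (\<lambda>y. m y (Z y) (T y)) x - m x (lie X Z x) (T x) - m x (Z x) (lie X T x)"

text \<open>
  An \<open>\<O>\<close>-bilinear multiplication of vector fields is the same as a family of bilinear
  multiplications on the tangent spaces that depends holomorphically on the point.
\<close>

definition F_structure :: "(complex ^ 'n) set \<Rightarrow> (complex ^ 'n) set \<Rightarrow> 'n tmult \<Rightarrow>
    (complex ^ 'n \<Rightarrow> complex ^ 'n) \<Rightarrow> bool" where
  "F_structure V U m e \<longleftrightarrow>
     vec.subspace V \<and> V \<noteq> {0} \<and> openin (top_of_set V) U \<and>
     (\<forall>v\<in>V. \<forall>w\<in>V. vfield V U (\<lambda>x. m x v w)) \<and>
     (\<forall>x\<in>U. \<forall>u\<in>V. \<forall>v\<in>V. \<forall>w\<in>V. \<forall>a b. m x (a *s u + b *s v) w = a *s m x u w + b *s m x v w) \<and>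
     (\<forall>x\<in>U. \<forall>v\<in>V. \<forall>w\<in>V. m x v w = m x w v) \<and>
     (\<forall>x\<in>U. \<forall>u\<in>V. \<forall>v\<in>V. \<forall>w\<in>V. m x (m x u v) w = m x u (m x v w)) \<and>
     vfield V U e \<and> (\<forall>x\<in>U. \<forall>v\<in>V. m x (e x) v = v) \<and>
     (\<forall>W X Y Z T. openin (top_of_set V) W \<and> W \<subseteq> U \<and>
        vfield V W X \<and> vfield V W Y \<and> vfield V W Z \<and> vfield V W T \<longrightarrow>
        (\<forall>x\<in>W. lie_mult m (\<lambda>y. m y (X y) (Y y)) Z T x =
               m x (X x) (lie_mult m Y Z T x) + m x (Y x) (lie_mult m X Z T x)))"

definition euler_field :: "(complex ^ 'n) set \<Rightarrow> (complex ^ 'n) set \<Rightarrow> 'n tmult \<Rightarrow> complex \<Rightarrow>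
    (complex ^ 'n \<Rightarrow> complex ^ 'n) \<Rightarrow> bool" where
  "euler_field V U m d E \<longleftrightarrow> vfield V U E \<and>
     (\<forall>W Z T. openin (top_of_set V) W \<and> W \<subseteq> U \<and> vfield V W Z \<and> vfield V W T \<longrightarrow>
        (\<forall>x\<in>W. lie_mult m E Z T x = d *s m x (Z x) (T x)))"

text \<open>
  An F-manifold is given by an atlas of charts \<open>(U, \<phi>)\<close> together with the coordinate expressions
  of the multiplication and of the unit field in every chart.
\<close>

type_synonym ('a, 'n) chart = "'a set \<times> ('a \<Rightarrow> complex ^ 'n)"

record ('a, 'n::finite) fmanifold =
  man_top :: "'a topology"
  man_charts :: "('a, 'n) chart set"
  man_mult :: "('a, 'n) chart \<Rightarrow> 'n tmult"
  man_unit :: "('a, 'n) chart \<Rightarrow> complex ^ 'n \<Rightarrow> complex ^ 'n"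

definition transition :: "('a, 'n) chart \<Rightarrow> ('a, 'n) chart \<Rightarrow> complex ^ 'n \<Rightarrow> complex ^ 'n" where
  "transition c c' = snd c' \<circ> inv_into (fst c) (snd c)"

definition complex_manifold :: "'a topology \<Rightarrow> ('a, 'n::finite) chart set \<Rightarrow> bool" where
  "complex_manifold X A \<longleftrightarrow>
     Hausdorff_space X \<and> second_countable X \<and> \<Union>(fst ` A) = topspace X \<and>
     (\<forall>(U, \<phi>)\<in>A. openin X U \<and> open (\<phi> ` U) \<and>
        homeomorphic_map (subtopology X U) (top_of_set (\<phi> ` U)) \<phi>) \<and>
     (\<forall>c\<in>A. \<forall>c'\<in>A. holo_on (snd c ` (fst c \<inter> fst c')) (transition c c'))"

definition F_manifold :: "('a, 'n::finite) fmanifold \<Rightarrow> bool" where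
  "F_manifold M \<longleftrightarrow>
     complex_manifold (man_top M) (man_charts M) \<and>
     connected_space (man_top M) \<and> topspace (man_top M) \<noteq> {} \<and>
     (\<forall>c\<in>man_charts M. F_structure UNIV (snd c ` fst c) (man_mult M c) (man_unit M c)) \<and>
     (\<forall>c\<in>man_charts M. \<forall>c'\<in>man_charts M. \<forall>x\<in>snd c ` (fst c \<inter> fst c').
        (\<forall>v w. dif (transition c c') x (man_mult M c x v w) =
           man_mult M c' (transition c c' x) (dif (transition c c') x v) (dif (transition c c') x w)) \<and>
        dif (transition c c') x (man_unit M c x) = man_unit M c' (transition c c' x))"

text \<open>
  A germ of an F-manifold, represented in a chart with values in the subspace \<open>germ_space\<close>.  Only
  the values of \<open>germ_mult\<close> and \<open>germ_unit\<close> near \<open>germ_pt\<close> matter.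
\<close>

record 'n::finite fgerm =
  germ_space :: "(complex ^ 'n) set"
  germ_pt :: "complex ^ 'n"
  germ_mult :: "'n tmult"
  germ_unit :: "complex ^ 'n \<Rightarrow> complex ^ 'n"

definition F_germ :: "'n::finite fgerm \<Rightarrow> bool" where
  "F_germ G \<longleftrightarrow> (\<exists>U. nbhd (germ_space G) (germ_pt G) U \<and>
     F_structure (germ_space G) U (germ_mult G) (germ_unit G))"

definition euler_germ :: "'n::finite fgerm \<Rightarrow> complex \<Rightarrow> (complex ^ 'n \<Rightarrow> complex ^ 'n) \<Rightarrow> bool" where
  "euler_germ G d E \<longleftrightarrow> (\<exists>U. nbhd (germ_space G) (germ_pt G) U \<and>
     euler_field (germ_space G) U (germ_mult G) d E)"

definition germ_at :: "('a, 'n::finite) fmanifold \<Rightarrow> ('a, 'n) chart \<Rightarrow> 'a \<Rightarrow> 'n fgerm" where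
  "germ_at M c p = \<lparr>germ_space = UNIV, germ_pt = snd c p,
     germ_mult = man_mult M c, germ_unit = man_unit M c\<rparr>"

definition germ_iso :: "'n::finite fgerm \<Rightarrow> 'n fgerm \<Rightarrow> (complex ^ 'n \<Rightarrow> complex ^ 'n) \<Rightarrow> bool" where
  "germ_iso G H f \<longleftrightarrow> (\<exists>U W.
     nbhd (germ_space G) (germ_pt G) U \<and> nbhd (germ_space H) (germ_pt H) W \<and>
     bij_betw f U W \<and> holo_on U f \<and> holo_on W (inv_into U f) \<and> f (germ_pt G) = germ_pt H \<and>
     (\<forall>x\<in>U. (\<forall>v\<in>germ_space G. \<forall>w\<in>germ_space G.
        dif f x (germ_mult G x v w) = germ_mult H (f x) (dif f x v) (dif f x w)) \<and>
        dif f x (germ_unit G x) = germ_unit H (f x)))"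

definition direct_sum :: "'k set \<Rightarrow> ('k \<Rightarrow> (complex ^ 'n) set) \<Rightarrow> (complex ^ 'n) set \<Rightarrow> bool" where
  "direct_sum K V W \<longleftrightarrow> finite K \<and> (\<forall>k\<in>K. vec.subspace (V k)) \<and>
     W = {\<Sum>k\<in>K. y k |y. \<forall>k\<in>K. y k \<in> V k} \<and>
     (\<forall>y. (\<forall>k\<in>K. y k \<in> V k) \<and> (\<Sum>k\<in>K. y k) = 0 \<longrightarrow> (\<forall>k\<in>K. y k = 0))"

definition component :: "'k set \<Rightarrow> ('k \<Rightarrow> (complex ^ 'n) set) \<Rightarrow> 'k \<Rightarrow> complex ^ 'n \<Rightarrow> complex ^ 'n" where
  "component K V k x = (SOME y. (\<forall>j\<in>K. y j \<in> V j) \<and> x = (\<Sum>j\<in>K. y j)) k"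

text \<open>
  The product of a family of germs whose model spaces form an internal direct sum: the point
  \<open>(x\<^sub>k)\<close> of the product is written \<open>\<Sum>k\<in>K. x\<^sub>k\<close>.
\<close>

definition prod_germ :: "'k set \<Rightarrow> ('k \<Rightarrow> 'n::finite fgerm) \<Rightarrow> 'n fgerm" where
  "prod_germ K G = (let \<pi> = component K (\<lambda>k. germ_space (G k)) in
     \<lparr>germ_space = {\<Sum>k\<in>K. y k |y. \<forall>k\<in>K. y k \<in> germ_space (G k)},
      germ_pt = (\<Sum>k\<in>K. germ_pt (G k)),
      germ_mult = (\<lambda>x v w. \<Sum>k\<in>K. germ_mult (G k) (\<pi> k x) (\<pi> k v) (\<pi> k w)),
      germ_unit = (\<lambda>x. \<Sum>k\<in>K. germ_unit (G k) (\<pi> k x))\<rparr>)"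

definition germ_decomp :: "'n::finite fgerm \<Rightarrow> 'k set \<Rightarrow> ('k \<Rightarrow> 'n fgerm) \<Rightarrow> (complex ^ 'n \<Rightarrow> complex ^ 'n) \<Rightarrow> bool" where
  "germ_decomp H K G \<Psi> \<longleftrightarrow> (\<forall>k\<in>K. F_germ (G k)) \<and>
     direct_sum K (\<lambda>k. germ_space (G k)) (germ_space (prod_germ K G)) \<and>
     germ_iso (prod_germ K G) H \<Psi>"

text \<open>Factors have positive dimension by the condition \<open>V \<noteq> {0}\<close> in \<open>F_structure\<close>.\<close>

definition irreducible_germ :: "'n::finite fgerm \<Rightarrow> bool" where
  "irreducible_germ H \<longleftrightarrow> F_germ H \<and> \<not> (\<exists>(G :: bool \<Rightarrow> 'n fgerm) \<Psi>. germ_decomp H UNIV G \<Psi>)"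

text \<open>
  The embedding of the factor \<open>k\<close> through the base point is \<open>y \<mapsto> \<Psi> (y + (\<Sum>j\<in>K - {k}. germ_pt (G j)))\<close>.
  Its differential at \<open>germ_pt (G k)\<close> is the restriction to \<open>germ_space (G k)\<close> of the differential of
  \<open>\<Psi>\<close> at the base point.
\<close>

definition extends_to :: "'n::finite fgerm \<Rightarrow> 'k set \<Rightarrow> ('k \<Rightarrow> (complex ^ 'n) set) \<Rightarrow> ('k \<Rightarrow> 'n fgerm) \<Rightarrow>
    (complex ^ 'n \<Rightarrow> complex ^ 'n) \<Rightarrow> bool" where
  "extends_to H K Q G \<Psi> \<longleftrightarrow> germ_decomp H K G \<Psi> \<and>
     (\<forall>k\<in>K. dif \<Psi> (germ_pt (prod_germ K G)) ` germ_space (G k) = Q k)"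

text \<open>
  Finite-dimensional algebras with underlying space \<open>V\<close> and multiplication \<open>\<mu>\<close>.  The eigenvalue
  \<open>c x\<close> may be prescribed independently for every \<open>x\<close>.
\<close>

definition gen_eigenspace :: "(complex ^ 'n) set \<Rightarrow> (complex ^ 'n \<Rightarrow> complex ^ 'n \<Rightarrow> complex ^ 'n) \<Rightarrow>
    (complex ^ 'n \<Rightarrow> complex) \<Rightarrow> (complex ^ 'n) set" where
  "gen_eigenspace V \<mu> c = {v \<in> V. \<forall>x\<in>V. \<exists>N. ((\<lambda>w. \<mu> x w - c x *s w) ^^ N) v = 0}"

definition eigenspaces :: "(complex ^ 'n) set \<Rightarrow> (complex ^ 'n \<Rightarrow> complex ^ 'n \<Rightarrow> complex ^ 'n) \<Rightarrow>
    (complex ^ 'n) set set" where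
  "eigenspaces V \<mu> = {gen_eigenspace V \<mu> c |c. gen_eigenspace V \<mu> c \<noteq> {0}}"

definition algebra_iso :: "(complex ^ 'n) set \<Rightarrow> (complex ^ 'n \<Rightarrow> complex ^ 'n \<Rightarrow> complex ^ 'n) \<Rightarrow>
    (complex ^ 'n) set \<Rightarrow> (complex ^ 'n \<Rightarrow> complex ^ 'n \<Rightarrow> complex ^ 'n) \<Rightarrow>
    (complex ^ 'n \<Rightarrow> complex ^ 'n) \<Rightarrow> bool" where
  "algebra_iso V \<mu> V' \<mu>' f \<longleftrightarrow> bij_betw f V V' \<and>
     (\<forall>v\<in>V. \<forall>w\<in>V. \<forall>a b. f (a *s v + b *s w) = a *s f v + b *s f w) \<and>
     (\<forall>v\<in>V. \<forall>w\<in>V. f (\<mu> v w) = \<mu>' (f v) (f w))"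

definition irreducible_algebra :: "(complex ^ 'n) set \<Rightarrow>
    (complex ^ 'n \<Rightarrow> complex ^ 'n \<Rightarrow> complex ^ 'n) \<Rightarrow> bool" where
  "irreducible_algebra V \<mu> \<longleftrightarrow> V \<noteq> {0} \<and>
     \<not> (\<exists>A :: bool \<Rightarrow> (complex ^ 'n) set. direct_sum UNIV A V \<and>
          (\<forall>i. A i \<noteq> {0} \<and> (\<forall>v\<in>A i. \<forall>w\<in>A i. \<mu> v w \<in> A i)) \<and>
          (\<forall>v\<in>A True. \<forall>w\<in>A False. \<mu> v w = 0))"

end

theory Submission
  imports Defs "HOL-Complex_Analysis.Cauchy_Integral_Formula" "HOL-Real_Asymp.Real_Asymp"
    "HOL-Computational_Algebra.Fundamental_Theorem_Algebra"
begin

text \<open>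
  The idempotents of \<open>T\<^sub>pM\<close> that project to the eigenspaces extend uniquely to holomorphic idempotent
  vector fields \<open>e\<^sub>k\<close>, because \<open>2 a - e\<close> is invertible for an idempotent \<open>a\<close>.  From \<open>e\<^sub>k \<circ> e\<^sub>k = e\<^sub>k\<close> the
  integrability condition gives \<open>Lie(\<circ>) = 0\<close> along \<open>e\<^sub>k\<close>, and then the distributions \<open>ker (e\<^sub>k \<circ>)\<close> are
  involutive.  By the Frobenius theorem they are the kernels of the differentials of maps \<open>f\<^sub>k\<close> with
  values in the eigenspaces, and \<open>\<Sum> f\<^sub>k\<close> is a chart in which multiplication by \<open>e\<^sub>k\<close> is a constant
  projection.  Applied to constant fields of different factors, the integrability condition shows that
  the multiplication of a factor only depends on the coordinates of that factor; the same computation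
  splits Euler fields.  Any other decomposition has the same idempotent fields, since idempotents are
  isolated, so the change of coordinates respects the splitting and is itself a product.

  Frobenius is proved by Picard iteration along rays, which stays within holomorphic maps by Osgood's
  lemma.
\<close>

section \<open>Holomorphic maps on open subsets of subspaces\<close>

text \<open>The analytic obstacle is that \<open>holo_on\<close> asks only for a complex derivative
  at every point, while second derivatives of coordinate changes and the inverse function theorem
  need more. All further regularity comes from complex lines: Cauchy's estimate bounds the
  second-order remainder uniformly in the base point, so difference quotients converge locally
  uniformly to directional derivatives, which are therefore holomorphic again. Frobenius enters
  because splitting the tangent spaces by idempotents does not by itself split the manifold. For
  each idempotent field, flow lines in the kernel start on a transversal through p and sweep out the
  leaves. That a leaf is tangent to the whole kernel, and not only to the flow lines, is where
  involutivity is used: it makes the transversal defect of a variation of the flow satisfy a linear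
  homogeneous equation along each flow line.\<close>

abbreviation clin :: "(complex ^ 'n \<Rightarrow> complex ^ 'n) \<Rightarrow> bool" where
  "clin \<equiv> Vector_Spaces.linear (*s) (*s)"

lemma clinI:
  assumes "\<And>x y. D (x + y) = D x + D y" "\<And>c x. D (c *s x) = c *s D x"
  shows "clin D"
  unfolding Vector_Spaces.linear_def module_hom_def module_hom_axioms_def
  by (simp add: assms vec.module_axioms vec.vector_space_axioms)

lemma clin_add: "clin D \<Longrightarrow> D (x + y) = D x + D y"
  by (rule vec.linear_add)

lemma clin_scale: "clin D \<Longrightarrow> D (c *s x) = c *s D x"
  by (rule vec.linear_scale)

lemma clin_0: "clin D \<Longrightarrow> D 0 = 0"
  using clin_scale[of D 0 0] by simp

lemma clin_minus: "clin D \<Longrightarrow> D (- x) = - D x"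
  using clin_add[of D x "- x"] by (simp add: clin_0 eq_neg_iff_add_eq_0 add.commute)

lemma clin_diff: "clin D \<Longrightarrow> D (x - y) = D x - D y"
  using clin_add[of D x "- y"] by (simp add: clin_minus)

lemma clin_sum: "clin D \<Longrightarrow> D (sum g A) = (\<Sum>a\<in>A. D (g a))"
  by (induction A rule: infinite_finite_induct) (auto simp: clin_0 clin_add)

lemma scaleR_eq_smult: "r *\<^sub>R (x :: complex ^ 'n) = of_real r *s x"
  by (simp add: vec_eq_iff scaleR_conv_of_real[where 'a=complex] del: scaleR_conv_of_real)

lemma norm_smult: "norm (c *s (x :: complex ^ 'n)) = cmod c * norm x"
  by (simp add: norm_vec_def norm_mult L2_set_right_distrib)

lemma clin_bounded_linear: "clin D \<Longrightarrow> bounded_linear D"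
  unfolding linear_conv_bounded_linear[symmetric]
  by (rule linearI) (auto simp: clin_add clin_scale scaleR_eq_smult)

lemma bounded_linear_smult_left: "bounded_linear (\<lambda>t. t *s (v :: complex ^ 'n))"
  unfolding linear_conv_bounded_linear[symmetric]
  by (rule linearI) (auto simp: scaleR_eq_smult vec.scale_left_distrib scaleR_conv_of_real)

lemma clin_smult: "clin (\<lambda>v. c *s v)"
  by (rule clinI) (auto simp: vec.scale_right_distrib mult.commute)

lemma continuous_line: "continuous_on A (\<lambda>t. x + t *s (v :: complex ^ 'n))"
  by (intro continuous_intros bounded_linear.continuous_on[OF bounded_linear_smult_left])

lemma open_line_preimage:
  fixes V :: "(complex ^ 'n) set"
  assumes "vec.subspace V" "openin (top_of_set V) U" "x \<in> V" "v \<in> V"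
  shows "open {t. x + t *s v \<in> U}"
proof -
  obtain O' where O: "open O'" "U = V \<inter> O'"
    using assms(2) by (auto simp: openin_open)
  have "x + t *s v \<in> V" for t
    using assms by (simp add: vec.subspace_add vec.subspace_scale)
  then have "{t. x + t *s v \<in> U} = (\<lambda>t. x + t *s v) -` O'"
    using O by auto
  then show ?thesis
    by (simp add: open_vimage[OF O(1) continuous_line])
qed

text \<open>Relative openness of \<open>U\<close> in \<open>V\<close> makes the parameter set of the
  line open in the plane, so a derivative within \<open>U\<close> becomes a full one-variable
  derivative in the parameter.\<close>

lemma has_derivative_line:
  assumes "(f has_derivative D) (at x within U)" "clin D"
    and "vec.subspace V" "openin (top_of_set V) U" "x \<in> U" "v \<in> V"
  shows "((\<lambda>t. f (x + t *s v) $ i) has_field_derivative D v $ i) (at 0)"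
proof -
  let ?T = "{t. x + t *s v \<in> U}"
  have xV: "x \<in> V"
    using assms(4,5) openin_imp_subset by blast
  have T: "open ?T" "0 \<in> ?T"
    using open_line_preimage[OF assms(3,4) xV assms(6)] assms(5) by auto
  have 1: "((\<lambda>t. x + t *s v) has_derivative (\<lambda>t. t *s v)) (at 0 within ?T)"
    by (auto intro!: derivative_eq_intros bounded_linear_imp_has_derivative bounded_linear_smult_left)
  have 2: "(f has_derivative D) (at (x + 0 *s v) within (\<lambda>t. x + t *s v) ` ?T)"
    using assms(1) by (auto intro: has_derivative_subset)
  have "((\<lambda>t. f (x + t *s v)) has_derivative (\<lambda>t. D (t *s v))) (at 0 within ?T)"
    using has_derivative_in_compose[OF 1 2] by simp
  then have "((\<lambda>t. f (x + t *s v) $ i) has_derivative (\<lambda>t. D (t *s v) $ i)) (at 0 within ?T)"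
    by (rule bounded_linear.has_derivative[OF bounded_linear_vec_nth])
  then have "((\<lambda>t. f (x + t *s v) $ i) has_derivative (\<lambda>t. t * D v $ i)) (at 0)"
    unfolding at_within_open[OF T(2,1)] clin_scale[OF assms(2)] vector_smult_component .
  then show ?thesis
    unfolding has_field_derivative_def mult.commute[of "D v $ i"] .
qed

text \<open>Derivatives within \<open>U\<close> may differ off \<open>V\<close>; in the directions
  of \<open>V\<close> they all agree with \<open>dif\<close>, which makes \<open>dif\<close> a
  legitimate choice of differential.\<close>

lemma dif_unique:
  assumes "(f has_derivative D) (at x within U)" "clin D"
    and "vec.subspace V" "openin (top_of_set V) U" "x \<in> U" "v \<in> V"
  shows "dif f x v = D v"
  by (simp add: dif_def vec_eq_iff DERIV_imp_deriv[OF has_derivative_line[OF assms]])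

lemma dif_cong:
  assumes "vec.subspace V" "openin (top_of_set V) U" "x \<in> U" "v \<in> V" "\<And>y. y \<in> U \<Longrightarrow> f y = g y"
  shows "dif f x v = dif g x v"
proof -
  have xV: "x \<in> V"
    using assms(2,3) openin_imp_subset by blast
  have "\<forall>\<^sub>F t in nhds 0. f (x + t *s v) = g (x + t *s v)"
    using open_line_preimage[OF assms(1,2) xV assms(4)] assms(3,5)
    by (auto simp: eventually_nhds intro!: exI[of _ "{t. x + t *s v \<in> U}"])
  then have "deriv (\<lambda>t. f (x + t *s v) $ i) 0 = deriv (\<lambda>t. g (x + t *s v) $ i) 0" for i
    by (intro deriv_cong_ev) (auto elim!: eventually_mono)
  then show ?thesis
    by (simp add: dif_def)
qed

lemma holo_on_imp_continuous_on: "holo_on U f \<Longrightarrow> continuous_on U f"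
  by (auto simp: holo_on_def continuous_on_eq_continuous_within intro: has_derivative_continuous)

lemma holo_on_subset: "holo_on U f \<Longrightarrow> W \<subseteq> U \<Longrightarrow> holo_on W f"
  unfolding holo_on_def by (meson has_derivative_subset subsetD)

lemma holo_on_cong: "holo_on U f \<Longrightarrow> (\<And>x. x \<in> U \<Longrightarrow> f x = g x) \<Longrightarrow> holo_on U g"
  unfolding holo_on_def using has_derivative_transform[of _ U g f] by fastforce

lemma holo_on_compose:
  "holo_on U f \<Longrightarrow> holo_on W g \<Longrightarrow> f ` U \<subseteq> W \<Longrightarrow> holo_on U (\<lambda>x. g (f x))"
  unfolding holo_on_def
proof
  fix x assume *: "\<forall>x\<in>U. \<exists>D. clin D \<and> (f has_derivative D) (at x within U)"
    "\<forall>x\<in>W. \<exists>D. clin D \<and> (g has_derivative D) (at x within W)" "f ` U \<subseteq> W" "x \<in> U"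
  then obtain D E where DE: "clin D" "(f has_derivative D) (at x within U)"
    "clin E" "(g has_derivative E) (at (f x) within W)" by blast
  have "(g has_derivative E) (at (f x) within f ` U)"
    using DE(4) *(3) has_derivative_subset by blast
  from has_derivative_in_compose[OF DE(2) this]
  show "\<exists>D. clin D \<and> ((\<lambda>x. g (f x)) has_derivative D) (at x within U)"
    using DE by (intro exI[of _ "\<lambda>x. E (D x)"]) (auto intro!: clinI simp: clin_add clin_scale)
qed

lemma dif_props:
  assumes "holo_on U f" "vec.subspace V" "openin (top_of_set V) U" "x \<in> U"
  obtains D where "clin D" "(f has_derivative D) (at x within U)" "\<And>v. v \<in> V \<Longrightarrow> dif f x v = D v"
proof -
  obtain D where "clin D" "(f has_derivative D) (at x within U)"
    using assms unfolding holo_on_def by blast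
  then show ?thesis
    using that dif_unique assms by blast
qed

lemma dif_compose:
  assumes "holo_on U f" "holo_on W g" "f ` U \<subseteq> W"
    and "vec.subspace V" "openin (top_of_set V) U" "vec.subspace V'" "openin (top_of_set V') W"
    and "x \<in> U" "v \<in> V" "dif f x v \<in> V'"
  shows "dif (\<lambda>x. g (f x)) x v = dif g (f x) (dif f x v)"
proof -
  obtain D where D: "clin D" "(f has_derivative D) (at x within U)" "\<And>v. v \<in> V \<Longrightarrow> dif f x v = D v"
    using dif_props[OF assms(1,4,5,8)] by blast
  have fx: "f x \<in> W" using assms by auto
  obtain E where E: "clin E" "(g has_derivative E) (at (f x) within W)" "\<And>v. v \<in> V' \<Longrightarrow> dif g (f x) v = E v"
    using dif_props[OF assms(2,6,7) fx] by blast
  have "(g has_derivative E) (at (f x) within f ` U)"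
    using E assms(3) has_derivative_subset by blast
  from has_derivative_in_compose[OF D(2) this]
  have "dif (\<lambda>x. g (f x)) x v = E (D v)"
    using D E assms by (intro dif_unique[where U=U and V=V]) (auto intro!: clinI simp: clin_add clin_scale)
  then show ?thesis using D E assms by auto
qed

lemma clin_projection_exists:
  fixes V :: "(complex ^ 'n) set"
  assumes "vec.subspace V"
  obtains \<pi> where "clin \<pi>" "range \<pi> \<subseteq> V" "\<And>v. v \<in> V \<Longrightarrow> \<pi> v = v"
proof -
  have "\<exists>g. g ` UNIV \<subseteq> V \<and> clin g \<and> (\<forall>v\<in>V. g (id v) = v)"
    by (rule vec.linear_exists_left_inverse_on) (auto simp: vec.linear_id[unfolded id_def] id_def assms)
  then show ?thesis using that by auto
qed

lemma clin_holo_on: "clin D \<Longrightarrow> holo_on U D"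
  unfolding holo_on_def by (meson bounded_linear_imp_has_derivative clin_bounded_linear)

lemma dif_clin: "clin D \<Longrightarrow> dif D x v = D v"
  by (rule dif_unique[where U=UNIV and V=UNIV])
    (auto intro: bounded_linear_imp_has_derivative clin_bounded_linear vec.subspace_UNIV)

lemma dif_const [simp]: "dif (\<lambda>x. a) x v = 0"
  by (simp add: dif_def vec_eq_iff)

text \<open>A linear projection onto \<open>V'\<close> leaves \<open>f\<close> unchanged on
  \<open>U\<close>, so it also leaves the differential unchanged.\<close>

lemma dif_in_subspace:
  assumes "holo_on U f" "vec.subspace V" "openin (top_of_set V) U" "x \<in> U" "v \<in> V"
    and "vec.subspace V'" "f ` U \<subseteq> V'"
  shows "dif f x v \<in> V'"
proof -
  obtain \<pi> where \<pi>: "clin \<pi>" "range \<pi> \<subseteq> V'" "\<And>v. v \<in> V' \<Longrightarrow> \<pi> v = v"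
    using clin_projection_exists[OF assms(6)] by blast
  have "dif f x v = dif (\<lambda>x. \<pi> (f x)) x v"
    using assms \<pi> by (intro dif_cong[OF assms(2-5)]) force
  also have "\<dots> = \<pi> (dif f x v)"
    using dif_compose[OF assms(1) clin_holo_on[OF \<pi>(1), of UNIV] _ assms(2,3) vec.subspace_UNIV _ assms(4,5)] dif_clin[OF \<pi>(1)]
    by simp
  finally show ?thesis using \<pi>(2) by (metis rangeI subsetD)
qed

section \<open>Osgood's lemma\<close>

text \<open>Cauchy's inequality on discs of radius \<open>R / 2\<close> around the points of
  \<open>cball 0 (R / 2)\<close> bounds the second derivative by 2 M / (R / 2)^2; this is the origin
  of the constant 8.\<close>

lemma second_order_Taylor:
  assumes hol: "g holomorphic_on ball 0 R" and cont: "continuous_on (cball 0 R) g" and "0 < R"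
    and B: "\<And>t. norm t \<le> R \<Longrightarrow> norm (g t) \<le> M" and t: "norm t \<le> R / 2"
  shows "norm (g t - g 0 - t * deriv g 0) \<le> 8 * M / R\<^sup>2 * (norm t)\<^sup>2"
proof -
  let ?S = "cball (0::complex) (R / 2)"
  have sub: "ball z (R / 2) \<subseteq> ball 0 R" "cball z (R / 2) \<subseteq> cball 0 R" if "z \<in> ?S" for z
  proof -
    show "ball z (R / 2) \<subseteq> ball 0 R"
      using that by (auto simp: dist_norm) (smt (verit) field_sum_of_halves norm_minus_commute norm_triangle_sub)
    show "cball z (R / 2) \<subseteq> cball 0 R"
      using that by (auto simp: dist_norm) (smt (verit) field_sum_of_halves norm_minus_commute norm_triangle_sub)
  qed
  have "cmod ((deriv ^^ 0) g t - (\<Sum>i\<le>1. (deriv ^^ i) g 0 * (t - 0) ^ i / fact i))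
      \<le> (8 * M / R\<^sup>2) * cmod (t - 0) ^ Suc 1 / fact 1"
  proof (rule complex_Taylor[of ?S])
    fix i and x :: complex assume "x \<in> ?S"
    then have "x \<in> ball 0 R" using \<open>0 < R\<close> by auto
    then have "((deriv ^^ i) g has_field_derivative deriv ((deriv ^^ i) g) x) (at x)"
      by (intro holomorphic_derivI[of _ "ball 0 R"] holomorphic_higher_deriv hol) auto
    then show "((deriv ^^ i) g has_field_derivative (deriv ^^ Suc i) g x) (at x within ?S)"
      by (auto intro: has_field_derivative_at_within)
  next
    fix x :: complex assume x: "x \<in> ?S"
    have "cmod ((deriv ^^ 2) g x) \<le> fact 2 * M / (R / 2) ^ 2"
    proof (rule Cauchy_inequality)
      show "g holomorphic_on ball x (R / 2)"
        using hol sub[OF x] holomorphic_on_subset by blast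
      show "continuous_on (cball x (R / 2)) g"
        using cont sub[OF x] continuous_on_subset by blast
      show "cmod (g y) \<le> M" if "cmod (x - y) = R / 2" for y
        using sub(2)[OF x] that B[of y] by (force simp: dist_norm)
    qed (use \<open>0 < R\<close> in auto)
    then show "cmod ((deriv ^^ Suc 1) g x) \<le> 8 * M / R\<^sup>2"
      by (simp add: numeral_2_eq_2 power_divide)
  qed (use assms in auto)
  then show ?thesis
    by (simp add: power2_eq_square algebra_simps)
qed

text \<open>The hypotheses of Osgood's lemma, asked on all complex lines and not only on coordinate
  lines, so that \<open>dif\<close> is a genuine derivative in every direction.\<close>

definition line_holo :: "(complex ^ 'n) set \<Rightarrow> (complex ^ 'n \<Rightarrow> complex ^ 'n) \<Rightarrow> bool" where
  "line_holo S f \<longleftrightarrow> open S \<and> continuous_on S f \<and>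
     (\<forall>x\<in>S. \<forall>v i. (\<lambda>t. f (x + t *s v) $ i) holomorphic_on {t. x + t *s v \<in> S})"

lemma holo_on_open_has_derivative:
  assumes "holo_on S f" "open S" "x \<in> S"
  shows "clin (dif f x)" "(f has_derivative dif f x) (at x)"
proof -
  obtain D where D: "clin D" "(f has_derivative D) (at x within S)" "\<And>v. v \<in> UNIV \<Longrightarrow> dif f x v = D v"
    using dif_props[OF assms(1) vec.subspace_UNIV _ assms(3)] assms(2) by auto
  then have *: "dif f x = D" by blast
  show "clin (dif f x)" "(f has_derivative dif f x) (at x)"
    unfolding * using D(1,2) at_within_open[OF assms(3,2)] by auto
qed

lemma holo_on_imp_line_holo:
  assumes "holo_on S f" "open S"
  shows "line_holo S f"
  unfolding line_holo_def
proof (intro conjI ballI allI)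
  show "continuous_on S f" by (rule holo_on_imp_continuous_on[OF assms(1)])
  fix x v i
  have "\<exists>d. ((\<lambda>t. f (x + t *s v) $ i) has_field_derivative d) (at s)" if "x + s *s v \<in> S" for s
  proof -
    have "((\<lambda>t. f ((x + s *s v) + t *s v) $ i) has_field_derivative dif f (x + s *s v) v $ i) (at 0)"
      using holo_on_open_has_derivative[OF assms that] assms(2) that
      by (intro has_derivative_line[where U=S and V=UNIV])
        (auto intro: has_derivative_at_withinI simp: vec.subspace_UNIV)
    moreover have "(x + s *s v) + t *s v = x + (t + s) *s v" for t
      by (metis add.assoc add.commute vec.scale_left_distrib)
    ultimately have "((\<lambda>t. f (x + (t + s) *s v) $ i) has_field_derivative dif f (x + s *s v) v $ i) (at 0)"
      by simp
    then have "((\<lambda>t. f (x + t *s v) $ i) has_field_derivative dif f (x + s *s v) v $ i) (at (0 + s))"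
      by (rule DERIV_shift[THEN iffD2])
    then show ?thesis by auto
  qed
  moreover have "open {t. x + t *s v \<in> S}"
    using open_line_preimage[of UNIV S x v] assms(2) by (simp add: vec.subspace_UNIV)
  ultimately show "(\<lambda>t. f (x + t *s v) $ i) holomorphic_on {t. x + t *s v \<in> S}"
    by (simp add: holomorphic_on_open)
qed (use assms in auto)

text \<open>The one-variable chain rule. Linearity of \<open>dif\<close> cannot be taken for granted
  under \<open>line_holo\<close>, so homogeneity and additivity are obtained separately.\<close>

lemma dif_scale_line:
  assumes "line_holo S f" "x \<in> S"
  shows "dif f x (c *s v) = c *s dif f x v"
proof -
  have "deriv (\<lambda>t. f (x + t *s (c *s v)) $ i) 0 = c * deriv (\<lambda>t. f (x + t *s v) $ i) 0" for i
  proof -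
    have "open {t. x + t *s v \<in> S}"
      using open_line_preimage[of UNIV S x v] assms by (simp add: vec.subspace_UNIV line_holo_def)
    then have "((\<lambda>t. f (x + t *s v) $ i) has_field_derivative deriv (\<lambda>t. f (x + t *s v) $ i) 0) (at 0)"
      using assms by (intro holomorphic_derivI[of _ "{t. x + t *s v \<in> S}"]) (auto simp: line_holo_def)
    then have "((\<lambda>t. f (x + t *s v) $ i) has_field_derivative deriv (\<lambda>t. f (x + t *s v) $ i) 0) (at (0 * c))"
      by simp
    moreover have "((\<lambda>t. t * c) has_field_derivative c) (at 0)"
      by (auto intro!: derivative_eq_intros)
    ultimately have "((\<lambda>t. f (x + (t * c) *s v) $ i) has_field_derivative deriv (\<lambda>t. f (x + t *s v) $ i) 0 * c) (at 0)"
      by (rule DERIV_chain2[where g="\<lambda>t. t * c" and x=0 and s=UNIV and Db=c])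
    then show ?thesis by (simp add: DERIV_imp_deriv mult.commute[of c] vec.scale_scale)
  qed
  then show ?thesis by (simp add: dif_def vec_eq_iff)
qed

text \<open>Apply the one-variable estimate at parameter 1 on the line through \<open>y\<close> in
  direction \<open>w\<close>, coordinate by coordinate. The constant does not depend on
  \<open>y\<close>; everything about uniform convergence below rests on this.\<close>

lemma line_holo_Taylor:
  fixes f :: "complex ^ 'n \<Rightarrow> complex ^ 'n"
  assumes f: "line_holo S f" and r: "0 < r" "cball x r \<subseteq> S" and M: "\<And>y. y \<in> cball x r \<Longrightarrow> norm (f y) \<le> M"
    and y: "y \<in> cball x (r / 2)" and w: "norm w \<le> r / 4"
  shows "norm (f (y + w) - f y - dif f y w) \<le> real CARD('n) * (32 * M / r\<^sup>2) * (norm w)\<^sup>2"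
proof (cases "w = 0")
  case True
  have "y \<in> S"
  proof -
    have "cball x (r / 2) \<subseteq> cball x r" using r by auto
    then show ?thesis using r y by blast
  qed
  then have "dif f y (0 *s w) = 0" using dif_scale_line[OF f, of y 0 w] by simp
  then show ?thesis using True by simp
next
  case False
  \<comment> \<open>Parameters up to \<open>R\<close> move \<open>y\<close> by at most
    \<open>r / 2\<close> and so stay in the large ball; \<open>norm w \<le> r / 4\<close> gives
    \<open>R \<ge> 2\<close>, so that 1 lies within \<open>R / 2\<close>.\<close>
  define R where "R = r / (2 * norm w)"
  have R: "R \<ge> 2" "R > 0" using w False r by (auto simp: R_def field_simps)
  have in_ball: "y + t *s w \<in> cball x r" if "norm t \<le> R" for t
  proof -
    have "norm (t *s w) \<le> R * norm w" using that by (simp add: norm_smult mult_right_mono)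
    also have "\<dots> = r / 2" using False by (simp add: R_def)
    finally have "dist x (y + t *s w) \<le> dist x y + r / 2"
      using dist_triangle[of x "y + t *s w" y] by (simp add: dist_norm)
    then show ?thesis using y by auto
  qed
  then have inS: "y + t *s w \<in> S" if "norm t \<le> R" for t
    using that r by blast
  have "norm ((f (y + w) - f y - dif f y w) $ i) \<le> 32 * M / r\<^sup>2 * (norm w)\<^sup>2" for i
  proof -
    let ?g = "\<lambda>t. f (y + t *s w) $ i"
    have yS: "y \<in> S" using inS[of 0] R by simp
    have hol: "?g holomorphic_on cball 0 R"
      by (rule holomorphic_on_subset[of _ "{t. y + t *s w \<in> S}"]) (use f yS inS in \<open>auto simp: line_holo_def\<close>)
    have "norm (?g 1 - ?g 0 - 1 * deriv ?g 0) \<le> 8 * M / R\<^sup>2 * (norm (1::complex))\<^sup>2"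
    proof (rule second_order_Taylor)
      show "?g holomorphic_on ball 0 R" using hol by (rule holomorphic_on_subset) auto
      show "norm (?g t) \<le> M" if "norm t \<le> R" for t
        using M[OF in_ball[OF that]] Finite_Cartesian_Product.norm_nth_le[of "f (y + t *s w)" i] by linarith
    qed (use hol R in \<open>auto intro: holomorphic_on_imp_continuous_on\<close>)
    then show ?thesis
      using False r by (simp add: dif_def R_def power_divide power_mult_distrib field_simps)
  qed
  then have "(\<Sum>i\<in>UNIV. norm ((f (y + w) - f y - dif f y w) $ i)) \<le> (\<Sum>i\<in>(UNIV::'n set). 32 * M / r\<^sup>2 * (norm w)\<^sup>2)"
    by (intro sum_mono) auto
  moreover have "norm (f (y + w) - f y - dif f y w) \<le> (\<Sum>i\<in>UNIV. norm ((f (y + w) - f y - dif f y w) $ i))"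
    unfolding norm_vec_def by (rule L2_set_le_sum) auto
  ultimately show ?thesis
    by (simp add: mult.assoc)
qed

lemma line_holo_local_bound:
  fixes f :: "complex ^ 'n \<Rightarrow> complex ^ 'n"
  assumes "line_holo S f" "x \<in> S"
  obtains r K where "0 < r" "0 \<le> K" "cball x r \<subseteq> S"
    "\<And>y w. y \<in> cball x r \<Longrightarrow> norm w \<le> r \<Longrightarrow> norm (f (y + w) - f y - dif f y w) \<le> K * (norm (w :: complex ^ 'n))\<^sup>2"
proof -
  obtain r where r: "r > 0" "cball x r \<subseteq> S"
    using assms open_contains_cball[of S] unfolding line_holo_def by blast
  have "compact (f ` cball x r)"
    using assms r by (intro compact_continuous_image) (auto simp: line_holo_def intro: continuous_on_subset)
  then obtain M where M: "\<And>y. y \<in> cball x r \<Longrightarrow> norm (f y) \<le> M"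
    using compact_imp_bounded[of "f ` cball x r"] unfolding bounded_iff by blast
  have "0 \<le> M" using M[of x] r norm_ge_zero[of "f x"] by (simp del: norm_ge_zero)
  show ?thesis
  proof
    show "0 < r / 4" "0 \<le> real CARD('n) * (32 * M / r\<^sup>2)" using r \<open>0 \<le> M\<close> by auto
    have "cball x (r / 4) \<subseteq> cball x r" using r by auto
    then show "cball x (r / 4) \<subseteq> S" using r by blast
    show "norm (f (y + w) - f y - dif f y w) \<le> real CARD('n) * (32 * M / r\<^sup>2) * (norm w)\<^sup>2"
      if "y \<in> cball x (r / 4)" "norm w \<le> r / 4" for y w
      using line_holo_Taylor[OF assms(1) r M, where y=y and w=w] that r by auto
  qed
qed

lemma uniform_limit_null_comparison':
  assumes "\<forall>\<^sub>F n in F. \<forall>y\<in>A. dist (q n y) (l y) \<le> b n" "(b \<longlongrightarrow> (0::real)) F"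
  shows "uniform_limit A q l F"
  unfolding uniform_limit_iff
proof (intro allI impI)
  fix e :: real assume "e > 0"
  then have "\<forall>\<^sub>F n in F. b n < e" using order_tendstoD(2)[OF assms(2)] by blast
  with assms(1) show "\<forall>\<^sub>F n in F. \<forall>y\<in>A. dist (q n y) (l y) < e"
    by eventually_elim fastforce
qed

text \<open>The Taylor remainder is quadratic with one constant on the whole ball; multiplied by
  \<open>Suc n\<close> it still decays like \<open>1 / Suc n\<close>, uniformly in
  \<open>y\<close>.\<close>

lemma line_holo_difference_quotient:
  assumes "line_holo S f" "x \<in> S"
  obtains r where "0 < r" "cball x r \<subseteq> S"
    "uniform_limit (cball x r) (\<lambda>n y. of_nat (Suc n) *s (f (y + (1 / of_nat (Suc n)) *s v) - f y)) (\<lambda>y. dif f y (v :: complex ^ 'n)) sequentially"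
proof -
  obtain r K where r: "0 < r" "0 \<le> K" "cball x r \<subseteq> S" and
    K: "\<And>y w. y \<in> cball x r \<Longrightarrow> norm w \<le> r \<Longrightarrow> norm (f (y + w) - f y - dif f y w) \<le> K * (norm w)\<^sup>2"
    using line_holo_local_bound[OF assms] by metis
  have "\<forall>\<^sub>F n in sequentially. \<forall>y\<in>cball x r. norm (of_nat (Suc n) *s (f (y + (1 / of_nat (Suc n)) *s v) - f y) - dif f y v)
      \<le> K * (norm v)\<^sup>2 / real (Suc n)"
  proof -
    have "\<forall>\<^sub>F n in sequentially. norm v / r \<le> real n" by real_asymp
    then show ?thesis
    proof eventually_elim
      case (elim n)
      show ?case
      proof
        fix y assume y: "y \<in> cball x r"
        let ?w = "(1 / of_nat (Suc n)) *s v"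
        have nw: "norm ?w = norm v / real (Suc n)" by (simp add: norm_smult norm_divide del: of_nat_Suc)
        have "norm v \<le> real n * r" using elim r by (simp add: field_simps)
        also have "\<dots> \<le> r * real (Suc n)" using r by (simp add: algebra_simps)
        finally have "norm ?w \<le> r"
          unfolding nw by (simp add: field_simps)
        from K[OF y this] have *: "norm (f (y + ?w) - f y - dif f y ?w) \<le> K * (norm v / real (Suc n))\<^sup>2"
          unfolding nw .
        have "dif f y ?w = (1 / of_nat (Suc n)) *s dif f y v"
          using dif_scale_line[OF assms(1)] y r(3) by blast
        then have "of_nat (Suc n) *s (f (y + ?w) - f y) - dif f y v = of_nat (Suc n) *s (f (y + ?w) - f y - dif f y ?w)"
          by (simp add: vec.scale_right_diff_distrib del: of_nat_Suc)
        then have "norm (of_nat (Suc n) *s (f (y + ?w) - f y) - dif f y v) = real (Suc n) * norm (f (y + ?w) - f y - dif f y ?w)"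
          by (simp only: norm_smult norm_of_nat)
        also have "\<dots> \<le> real (Suc n) * (K * (norm v / real (Suc n))\<^sup>2)"
          using * by (intro mult_left_mono) auto
        also have "\<dots> = K * (norm v)\<^sup>2 / real (Suc n)"
          by (simp add: power2_eq_square field_simps del: of_nat_Suc)
        finally show "norm (of_nat (Suc n) *s (f (y + ?w) - f y) - dif f y v) \<le> K * (norm v)\<^sup>2 / real (Suc n)" .
      qed
    qed
  qed
  then have "\<forall>\<^sub>F n in sequentially. \<forall>y\<in>cball x r. dist (of_nat (Suc n) *s (f (y + (1 / of_nat (Suc n)) *s v) - f y)) (dif f y v)
      \<le> K * (norm v)\<^sup>2 / real (Suc n)"
    by (simp only: dist_norm)
  moreover have lim: "(\<lambda>n. K * (norm v)\<^sup>2 / real (Suc n)) \<longlonglongrightarrow> 0" by real_asymp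
  ultimately have "uniform_limit (cball x r) (\<lambda>n y. of_nat (Suc n) *s (f (y + (1 / of_nat (Suc n)) *s v) - f y)) (\<lambda>y. dif f y v) sequentially"
    by (rule uniform_limit_null_comparison')
  then show ?thesis using that r by blast
qed


text \<open>Evaluation along moving points, needed for difference quotients whose base point itself
  tends to \<open>x\<close>.\<close>

lemma uniform_limit_eval:
  fixes l :: "'a::metric_space \<Rightarrow> 'b::real_normed_vector"
  assumes "uniform_limit A q l sequentially" "\<forall>\<^sub>F n in sequentially. y n \<in> A" "y \<longlonglongrightarrow> x"
    "continuous_on A l" "x \<in> A"
  shows "(\<lambda>n. q n (y n)) \<longlonglongrightarrow> l x"
proof -
  have "(\<lambda>n. q n (y n) - l (y n)) \<longlonglongrightarrow> 0"
  proof (rule tendstoI)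
    fix e :: real assume "e > 0"
    then have "\<forall>\<^sub>F n in sequentially. \<forall>z\<in>A. dist (q n z) (l z) < e"
      using assms(1) by (simp add: uniform_limit_iff)
    with assms(2) show "\<forall>\<^sub>F n in sequentially. dist (q n (y n) - l (y n)) 0 < e"
      by eventually_elim (simp add: dist_norm)
  qed
  from tendsto_add[OF this continuous_on_tendsto_compose[OF assms(4,3,5,2)]] show ?thesis by simp
qed

text \<open>A smaller ball also keeps the displaced points in \<open>S\<close> from some index on,
  so that the quotients inherit continuity and holomorphy from \<open>f\<close>.\<close>

lemma line_holo_difference_quotient':
  fixes f :: "complex ^ 'n \<Rightarrow> complex ^ 'n"
  assumes "line_holo S f" "x \<in> S"
  obtains r N where "0 < r" "cball x r \<subseteq> S"
    "\<And>n y. n \<ge> N \<Longrightarrow> y \<in> cball x r \<Longrightarrow> y + (1 / of_nat (Suc n)) *s v \<in> S"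
    "uniform_limit (cball x r) (\<lambda>n y. of_nat (Suc n) *s (f (y + (1 / of_nat (Suc n)) *s v) - f y)) (\<lambda>y. dif f y v) sequentially"
proof -
  obtain r where r: "0 < r" "cball x r \<subseteq> S"
    "uniform_limit (cball x r) (\<lambda>n y. of_nat (Suc n) *s (f (y + (1 / of_nat (Suc n)) *s v) - f y)) (\<lambda>y. dif f y v) sequentially"
    using line_holo_difference_quotient[OF assms] by blast
  have sub: "cball x (r / 2) \<subseteq> cball x r" using r by auto
  have "(\<lambda>n. (norm v) / real (Suc n)) \<longlonglongrightarrow> 0" by real_asymp
  then have "\<forall>\<^sub>F n in sequentially. norm v / real (Suc n) < r / 2"
    by (rule order_tendstoD) (use r in auto)
  then obtain N where N: "\<And>n. n \<ge> N \<Longrightarrow> norm v / real (Suc n) < r / 2"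
    unfolding eventually_sequentially by blast
  show ?thesis
  proof
    show "0 < r / 2" using r by simp
    show "cball x (r / 2) \<subseteq> S" using sub r by blast
    show "y + (1 / of_nat (Suc n)) *s v \<in> S" if "n \<ge> N" "y \<in> cball x (r / 2)" for n y
    proof -
      have "dist x (y + (1 / of_nat (Suc n)) *s v) \<le> dist x y + norm ((1 / of_nat (Suc n)) *s v)"
        using dist_triangle[of x "y + (1 / of_nat (Suc n)) *s v" y] by (simp add: dist_norm)
      also have "norm ((1 / of_nat (Suc n)) *s v) = norm v / real (Suc n)"
        by (simp add: norm_smult norm_divide del: of_nat_Suc)
      finally have "dist x (y + (1 / of_nat (Suc n)) *s v) \<le> r" using N[OF that(1)] that(2) unfolding mem_cball by linarith
      then show ?thesis using r(2) by (auto simp del: of_nat_Suc)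
    qed
    show "uniform_limit (cball x (r / 2)) (\<lambda>n y. of_nat (Suc n) *s (f (y + (1 / of_nat (Suc n)) *s v) - f y)) (\<lambda>y. dif f y v) sequentially"
      using r(3) sub by (rule uniform_limit_on_subset)
  qed
qed

lemma continuous_on_smult: "continuous_on A f \<Longrightarrow> continuous_on A (\<lambda>x. c *s (f x :: complex ^ 'n))"
  by (rule bounded_linear.continuous_on[OF clin_bounded_linear[OF clin_smult]])

lemma continuous_on_open_local:
  assumes "open S" "\<And>x. x \<in> S \<Longrightarrow> \<exists>r>0. continuous_on (cball x r) f"
  shows "continuous_on S f"
proof (intro continuous_at_imp_continuous_on ballI)
  fix x assume "x \<in> S"
  then obtain r where r: "r > 0" "continuous_on (cball x r) f" using assms by blast
  then have "continuous_on (ball x r) f" using ball_subset_cball continuous_on_subset by blast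
  then show "isCont f x"
    using r(1) by (simp add: continuous_on_eq_continuous_at)
qed

text \<open>Locally uniform limits of continuous difference quotients are continuous.\<close>

lemma line_holo_dif_continuous:
  fixes f :: "complex ^ 'n \<Rightarrow> complex ^ 'n"
  assumes f: "line_holo S f"
  shows "continuous_on S (\<lambda>x. dif f x v)"
proof (rule continuous_on_open_local)
  show "open S" using f by (simp add: line_holo_def)
  fix x assume x: "x \<in> S"
  obtain r N where r: "0 < r" "cball x r \<subseteq> S" and
    N: "\<And>n y. n \<ge> N \<Longrightarrow> y \<in> cball x r \<Longrightarrow> y + (1 / of_nat (Suc n)) *s v \<in> S" and
    ul: "uniform_limit (cball x r) (\<lambda>n y. of_nat (Suc n) *s (f (y + (1 / of_nat (Suc n)) *s v) - f y)) (\<lambda>y. dif f y v) sequentially"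
    using line_holo_difference_quotient'[OF f x, of v] by blast
  have cont: "continuous_on S f" using f by (simp add: line_holo_def)
  have "\<forall>\<^sub>F n in sequentially. continuous_on (cball x r) (\<lambda>y. of_nat (Suc n) *s (f (y + (1 / of_nat (Suc n)) *s v) - f y))"
    unfolding eventually_sequentially
  proof (intro exI allI impI)
    fix n assume n: "n \<ge> N"
    have "continuous_on (cball x r) (\<lambda>y. f (y + (1 / of_nat (Suc n)) *s v))"
      by (rule continuous_on_compose2[OF cont]) (use N n in \<open>auto intro!: continuous_intros\<close>)
    moreover have "continuous_on (cball x r) f" using cont r continuous_on_subset by blast
    ultimately show "continuous_on (cball x r) (\<lambda>y. of_nat (Suc n) *s (f (y + (1 / of_nat (Suc n)) *s v) - f y))"
      by (intro continuous_on_smult continuous_on_diff)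
  qed
  then have "continuous_on (cball x r) (\<lambda>y. dif f y v)"
    by (rule uniform_limit_theorem[OF _ ul]) simp
  then show "\<exists>r>0. continuous_on (cball x r) (\<lambda>y. dif f y v)" using r by blast
qed

text \<open>The quotient for \<open>v + w\<close> at \<open>x\<close> is exactly the quotient for
  \<open>v\<close> at \<open>x\<close> plus the quotient for \<open>w\<close> at the displaced point
  \<open>x + v / Suc n\<close>. The latter has the right limit by uniform convergence and by
  continuity of the derivative in direction \<open>w\<close>.\<close>

lemma line_holo_dif_add:
  fixes f :: "complex ^ 'n \<Rightarrow> complex ^ 'n"
  assumes f: "line_holo S f" and x: "x \<in> S"
  shows "dif f x (v + w) = dif f x v + dif f x w"
proof -
  define q where "q = (\<lambda>v n y. of_nat (Suc n) *s (f (y + (1 / of_nat (Suc n)) *s v) - f y))"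
  have lim: "(\<lambda>n. q v n x) \<longlonglongrightarrow> dif f x v" for v
  proof -
    obtain r where "0 < r" "uniform_limit (cball x r) (q v) (\<lambda>y. dif f y v) sequentially"
      using line_holo_difference_quotient[OF f x, of v] unfolding q_def by blast
    then show ?thesis by (auto intro: tendsto_uniform_limitI)
  qed
  obtain r where r: "0 < r" "cball x r \<subseteq> S" and ul: "uniform_limit (cball x r) (q w) (\<lambda>y. dif f y w) sequentially"
    using line_holo_difference_quotient[OF f x, of w] unfolding q_def by blast
  define y where "y = (\<lambda>n. x + (1 / of_nat (Suc n)) *s v)"
  have "(\<lambda>n. 1 / complex_of_nat (Suc n)) \<longlonglongrightarrow> 0"
    using tendsto_of_real[OF LIMSEQ_inverse_real_of_nat, where 'a=complex]
    by (simp add: inverse_eq_divide del: of_nat_Suc)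
  then have "(\<lambda>n. (1 / of_nat (Suc n)) *s v) \<longlonglongrightarrow> 0 *s v"
    by (rule bounded_linear.tendsto[OF bounded_linear_smult_left])
  then have y: "y \<longlonglongrightarrow> x"
    unfolding y_def using tendsto_add[OF tendsto_const[of x]] by fastforce
  moreover have "\<forall>\<^sub>F n in sequentially. y n \<in> cball x r"
    using tendstoD[OF y r(1)] by eventually_elim (auto simp: dist_commute)
  ultimately have "(\<lambda>n. q w n (y n)) \<longlonglongrightarrow> dif f x w"
    using r continuous_on_subset[OF line_holo_dif_continuous[OF f] r(2)]
    by (intro uniform_limit_eval[OF ul]) auto
  then have "(\<lambda>n. q v n x + q w n (y n)) \<longlonglongrightarrow> dif f x v + dif f x w"
    using lim by (intro tendsto_add)
  moreover have "q v n x + q w n (y n) = q (v + w) n x" for n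
  proof -
    have "(x + (1 / of_nat (Suc n)) *s v) + (1 / of_nat (Suc n)) *s w = x + (1 / of_nat (Suc n)) *s (v + w)"
      by (simp only: vec.scale_right_distrib add.assoc)
    then show ?thesis
      by (simp add: q_def y_def vec.scale_right_diff_distrib vec.scale_right_distrib add.assoc del: of_nat_Suc)
  qed
  ultimately have "(\<lambda>n. q (v + w) n x) \<longlonglongrightarrow> dif f x v + dif f x w" by simp
  then show ?thesis using lim LIMSEQ_unique by blast
qed

text \<open>Homogeneity and additivity make \<open>dif f x\<close> complex linear, and the quadratic
  remainder bound turns it into a total derivative.\<close>

theorem Osgood:
  assumes "line_holo S f"
  shows "holo_on S f"
  unfolding holo_on_def
proof
  fix x assume x: "x \<in> S"
  have lin: "clin (dif f x)"
    by (rule clinI) (use line_holo_dif_add[OF assms x] dif_scale_line[OF assms x] in auto)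
  obtain r K where r: "0 < r" "0 \<le> K" "cball x r \<subseteq> S" and
    K: "\<And>y w. y \<in> cball x r \<Longrightarrow> norm w \<le> r \<Longrightarrow> norm (f (y + w) - f y - dif f y w) \<le> K * (norm w)\<^sup>2"
    using line_holo_local_bound[OF assms x] by metis
  have "(f has_derivative dif f x) (at x)"
    unfolding has_derivative_at_alt
  proof (intro conjI allI impI)
    show "bounded_linear (dif f x)" by (rule clin_bounded_linear[OF lin])
    fix e :: real assume "e > 0"
    \<comment> \<open>Forces \<open>K * norm (y - x) \<le> e\<close>; the \<open>+ 1\<close> covers
      \<open>K = 0\<close>.\<close>
    define d where "d = min r (e / (K + 1))"
    have "norm (f y - f x - dif f x (y - x)) \<le> e * norm (y - x)" if y: "norm (y - x) < d" for y
    proof -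
      have "norm (f y - f x - dif f x (y - x)) \<le> K * (norm (y - x))\<^sup>2"
        using K[of x "y - x"] y r by (simp add: d_def)
      also have "\<dots> \<le> e * norm (y - x)"
      proof -
        have "norm (y - x) * (K + 1) \<le> e"
          using y r(2) by (simp add: d_def field_simps)
        then have "K * norm (y - x) \<le> e"
          using norm_ge_zero[of "y - x"] by (simp add: algebra_simps del: norm_ge_zero)
        then show ?thesis
          by (simp add: power2_eq_square mult.assoc[symmetric] mult_right_mono)
      qed
      finally show ?thesis .
    qed
    moreover have "d > 0" using r \<open>e > 0\<close> by (simp add: d_def)
    ultimately show "\<exists>d>0. \<forall>y. norm (y - x) < d \<longrightarrow> norm (f y - f x - dif f x (y - x)) \<le> e * norm (y - x)"
      by blast
  qed
  then show "\<exists>D. clin D \<and> (f has_derivative D) (at x within S)"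
    using lin has_derivative_at_withinI by blast
qed

section \<open>Derivatives and limits of holomorphic maps\<close>

lemma bounded_bilinear_smult: "bounded_bilinear (\<lambda>c (v :: complex ^ 'n). c *s v)"
  by (rule bounded_bilinear.intro)
    (auto simp: vec.scale_left_distrib vec.scale_right_distrib scaleR_eq_smult norm_smult scaleR_conv_of_real
      mult.commute intro!: exI[of _ 1])

lemma holo_on_const [simp]: "holo_on S (\<lambda>x. a)"
  unfolding holo_on_def by (intro ballI exI[of _ "\<lambda>x. 0"]) (auto intro!: clinI)

lemma holo_on_ident [simp]: "holo_on S (\<lambda>x. x)"
  by (rule clin_holo_on) (auto intro: clinI)

lemma dif_has_derivative:
  assumes "(f has_derivative D) (at x)" "clin D"
  shows "dif f x v = D v"
  by (rule dif_unique[where U=UNIV and V=UNIV]) (use assms vec.subspace_UNIV in auto)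

lemma holo_on_add: "holo_on S f \<Longrightarrow> holo_on S g \<Longrightarrow> holo_on S (\<lambda>x. f x + g x)"
  unfolding holo_on_def
proof
  fix x assume *: "\<forall>x\<in>S. \<exists>D. clin D \<and> (f has_derivative D) (at x within S)"
    "\<forall>x\<in>S. \<exists>D. clin D \<and> (g has_derivative D) (at x within S)" "x \<in> S"
  then obtain D E where "clin D" "(f has_derivative D) (at x within S)" "clin E" "(g has_derivative E) (at x within S)"
    by blast
  then show "\<exists>D. clin D \<and> ((\<lambda>x. f x + g x) has_derivative D) (at x within S)"
    by (intro exI[of _ "\<lambda>v. D v + E v"])
      (auto intro!: clinI derivative_eq_intros simp: clin_add clin_scale vec.scale_right_distrib)
qed

text \<open>\<open>holo_on\<close> speaks only of maps into \<open>complex ^ 'n\<close>, so scalar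
  functions always occur as coordinates of such maps.\<close>

lemma holo_on_coord_smult: "holo_on S f \<Longrightarrow> holo_on S g \<Longrightarrow> holo_on S (\<lambda>x. f x $ i *s g x)"
  unfolding holo_on_def
proof
  fix x assume *: "\<forall>x\<in>S. \<exists>D. clin D \<and> (f has_derivative D) (at x within S)"
    "\<forall>x\<in>S. \<exists>D. clin D \<and> (g has_derivative D) (at x within S)" "x \<in> S"
  then obtain D E where DE: "clin D" "(f has_derivative D) (at x within S)" "clin E" "(g has_derivative E) (at x within S)"
    by blast
  have "((\<lambda>x. f x $ i *s g x) has_derivative (\<lambda>v. f x $ i *s E v + D v $ i *s g x)) (at x within S)"
    by (rule bounded_bilinear.FDERIV[OF bounded_bilinear_smult bounded_linear.has_derivative[OF bounded_linear_vec_nth DE(2)] DE(4)])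
  moreover have "clin (\<lambda>v. f x $ i *s E v + D v $ i *s g x)"
    using DE by (intro clinI) (auto simp: clin_add clin_scale vec.scale_right_distrib vec.scale_left_distrib ac_simps)
  ultimately show "\<exists>D. clin D \<and> ((\<lambda>x. f x $ i *s g x) has_derivative D) (at x within S)"
    by blast
qed

lemma holo_on_clin: "clin L \<Longrightarrow> holo_on S f \<Longrightarrow> holo_on S (\<lambda>x. L (f x))"
  by (rule holo_on_compose[of _ _ UNIV]) (auto intro: clin_holo_on)

lemma holo_on_smult: "holo_on S f \<Longrightarrow> holo_on S (\<lambda>x. c *s f x)"
  by (rule holo_on_clin[OF clin_smult])

lemma clin_uminus: "clin (\<lambda>v. - v)"
  by (rule clinI) auto

lemma holo_on_minus: "holo_on S f \<Longrightarrow> holo_on S (\<lambda>x. - f x)"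
  by (rule holo_on_clin[OF clin_uminus])

lemma holo_on_diff: "holo_on S f \<Longrightarrow> holo_on S g \<Longrightarrow> holo_on S (\<lambda>x. f x - g x)"
  using holo_on_add[OF _ holo_on_minus, of S f g] by simp

lemma holo_on_sum: "(\<And>i. i \<in> I \<Longrightarrow> holo_on S (f i)) \<Longrightarrow> holo_on S (\<lambda>x. \<Sum>i\<in>I. f i x)"
  by (induction I rule: infinite_finite_induct) (auto intro: holo_on_add)

context
  fixes S :: "(complex ^ 'n) set" and x :: "complex ^ 'n"
  assumes S: "open S" "x \<in> S"
begin

lemma dif_add:
  assumes "holo_on S f" "holo_on S g"
  shows "dif (\<lambda>x. f x + g x) x v = dif f x v + dif g x v"
  using holo_on_open_has_derivative[OF assms(1) S] holo_on_open_has_derivative[OF assms(2) S]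
  by (intro dif_has_derivative)
    (auto intro!: derivative_eq_intros clinI simp: clin_add clin_scale vec.scale_right_distrib)

lemma dif_coord_smult:
  assumes "holo_on S f" "holo_on S g"
  shows "dif (\<lambda>x. f x $ i *s g x) x v = f x $ i *s dif g x v + dif f x v $ i *s g x"
proof -
  note D = holo_on_open_has_derivative[OF assms(1) S]
  note E = holo_on_open_has_derivative[OF assms(2) S]
  have "((\<lambda>x. f x $ i *s g x) has_derivative (\<lambda>v. f x $ i *s dif g x v + dif f x v $ i *s g x)) (at x)"
    by (rule bounded_bilinear.FDERIV[OF bounded_bilinear_smult bounded_linear.has_derivative[OF bounded_linear_vec_nth D(2)] E(2)])
  moreover have "clin (\<lambda>v. f x $ i *s dif g x v + dif f x v $ i *s g x)"
    using D(1) E(1) by (intro clinI) (auto simp: clin_add clin_scale vec.scale_right_distrib vec.scale_left_distrib ac_simps)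
  ultimately show ?thesis by (rule dif_has_derivative)
qed

lemma dif_clin_compose:
  assumes "clin L" "holo_on S f"
  shows "dif (\<lambda>x. L (f x)) x v = L (dif f x v)"
  using dif_compose[OF assms(2) clin_holo_on[OF assms(1), of UNIV], of UNIV UNIV x v] S dif_clin[OF assms(1)]
  by (simp add: vec.subspace_UNIV)

lemma dif_smult: "holo_on S f \<Longrightarrow> dif (\<lambda>x. c *s f x) x v = c *s dif f x v"
  by (rule dif_clin_compose[OF clin_smult])

lemma dif_minus: "holo_on S f \<Longrightarrow> dif (\<lambda>x. - f x) x v = - dif f x v"
  by (rule dif_clin_compose[OF clin_uminus])

lemma dif_diff:
  assumes "holo_on S f" "holo_on S g"
  shows "dif (\<lambda>x. f x - g x) x v = dif f x v - dif g x v"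
  using dif_add[OF assms(1) holo_on_minus[OF assms(2)]] dif_minus[OF assms(2)] by simp

lemma dif_sum:
  "finite I \<Longrightarrow> (\<And>i. i \<in> I \<Longrightarrow> holo_on S (f i)) \<Longrightarrow> dif (\<lambda>x. \<Sum>i\<in>I. f i x) x v = (\<Sum>i\<in>I. dif (f i) x v)"
  by (induction I rule: finite_induct) (auto simp: dif_add holo_on_sum)

lemma dif_ident [simp]: "dif (\<lambda>x. x) y v = v"
  by (rule dif_clin) (auto intro: clinI)

lemma dif_cong_open: "(\<And>y. y \<in> S \<Longrightarrow> f y = g y) \<Longrightarrow> dif f x v = dif g x v"
  by (rule dif_cong[of UNIV S]) (use S vec.subspace_UNIV in auto)

end

lemma dif_compose_open:
  assumes "holo_on S f" "holo_on T g" "f ` S \<subseteq> T" "open S" "open T" "x \<in> S"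
  shows "dif (\<lambda>x. g (f x)) x v = dif g (f x) (dif f x v)"
  by (rule dif_compose[OF assms(1-3), where V=UNIV and V'=UNIV]) (use assms vec.subspace_UNIV in auto)

lemma holo_on_local:
  assumes "\<And>x. x \<in> S \<Longrightarrow> \<exists>T. open T \<and> x \<in> T \<and> holo_on T f"
  shows "holo_on S f"
  unfolding holo_on_def
proof
  fix x assume "x \<in> S"
  then obtain T where "open T" "x \<in> T" "holo_on T f" using assms by blast
  then show "\<exists>D. clin D \<and> (f has_derivative D) (at x within S)"
    using holo_on_open_has_derivative has_derivative_at_withinI by blast
qed

text \<open>Weierstrass' theorem. It is applied on each complex line, where derivatives converge
  along with the functions, and Osgood's lemma assembles the lines.\<close>

lemma holo_uniform_limit:
  fixes f :: "nat \<Rightarrow> complex ^ 'n \<Rightarrow> complex ^ 'n"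
  assumes S: "open S" and f: "\<And>n. holo_on S (f n)"
    and lim: "\<And>x. x \<in> S \<Longrightarrow> \<exists>r>0. cball x r \<subseteq> S \<and> uniform_limit (cball x r) f g sequentially"
  shows "holo_on S g" and "x \<in> S \<Longrightarrow> (\<lambda>n. dif (f n) x v) \<longlonglongrightarrow> dif g x v"
proof -
  have fl: "line_holo S (f n)" for n
    by (rule holo_on_imp_line_holo[OF f S])
  have line_lim: "\<exists>d>0. cball s d \<subseteq> {t. x + t *s v \<in> S} \<and>
      uniform_limit (cball s d) (\<lambda>n t. f n (x + t *s v) $ i) (\<lambda>t. g (x + t *s v) $ i) sequentially"
    if s: "s \<in> {t. x + t *s v \<in> S}" for x v i s
  proof -
    obtain r where r: "r > 0" "cball (x + s *s v) r \<subseteq> S" "uniform_limit (cball (x + s *s v) r) f g sequentially"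
      using lim s by blast
    \<comment> \<open>Parameters within \<open>d\<close> of \<open>s\<close> move the point by at
      most \<open>r\<close>; the \<open>+ 1\<close> allows \<open>v = 0\<close>.\<close>
    define d where "d = r / (norm v + 1)"
    have d: "d > 0" using r by (simp add: d_def add_nonneg_pos)
    have in_ball: "x + t *s v \<in> cball (x + s *s v) r" if "t \<in> cball s d" for t
    proof -
      have "(x + s *s v) - (x + t *s v) = (s - t) *s v"
        by (simp add: vec.scale_left_diff_distrib)
      then have "dist (x + s *s v) (x + t *s v) = dist s t * norm v"
        by (simp only: dist_norm norm_smult)
      also have "\<dots> \<le> d * (norm v + 1)" using that d by (intro mult_mono) auto
      also have "\<dots> = r" by (simp add: d_def add_nonneg_eq_0_iff)
      finally show ?thesis by simp
    qed
    have "uniform_limit (cball s d) (\<lambda>n t. f n (x + t *s v)) (\<lambda>t. g (x + t *s v)) sequentially"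
      unfolding uniform_limit_iff
    proof (intro allI impI)
      fix e :: real assume "e > 0"
      with r(3) have "\<forall>\<^sub>F n in sequentially. \<forall>y\<in>cball (x + s *s v) r. dist (f n y) (g y) < e"
        by (simp add: uniform_limit_iff)
      then show "\<forall>\<^sub>F n in sequentially. \<forall>t\<in>cball s d. dist (f n (x + t *s v)) (g (x + t *s v)) < e"
        by (rule eventually_mono) (use in_ball in blast)
    qed
    then have "uniform_limit (cball s d) (\<lambda>n t. f n (x + t *s v) $ i) (\<lambda>t. g (x + t *s v) $ i) sequentially"
      by (rule bounded_linear.uniform_limit[OF bounded_linear_vec_nth])
    then show ?thesis using d in_ball r(2) by blast
  qed
  have opn: "open {t. x + t *s v \<in> S}" for x v
    using open_line_preimage[of UNIV S x v] S by (simp add: vec.subspace_UNIV)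
  have fline: "(\<lambda>t. f n (x + t *s v) $ i) holomorphic_on {t. x + t *s v \<in> S}" if "x \<in> S" for n x v i
    using fl that by (auto simp: line_holo_def)
  have "line_holo S g"
    unfolding line_holo_def
  proof (intro conjI ballI allI S)
    show "continuous_on S g"
    proof (rule continuous_on_open_local[OF S])
      fix x assume "x \<in> S"
      then obtain r where r: "r > 0" "cball x r \<subseteq> S" "uniform_limit (cball x r) f g sequentially"
        using lim by blast
      have "continuous_on (cball x r) g"
        by (rule uniform_limit_theorem[OF _ r(3)])
          (simp_all add: holo_on_imp_continuous_on[OF holo_on_subset[OF f r(2)]])
      then show "\<exists>r>0. continuous_on (cball x r) g" using r by blast
    qed
    show "(\<lambda>t. g (x + t *s v) $ i) holomorphic_on {t. x + t *s v \<in> S}" if "x \<in> S" for x v i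
      by (rule holomorphic_uniform_sequence[OF opn fline[OF that] line_lim])
  qed
  then show g: "holo_on S g" by (rule Osgood)
  show "(\<lambda>n. dif (f n) x v) \<longlonglongrightarrow> dif g x v" if x: "x \<in> S"
  proof (rule vec_tendstoI)
    fix i
    have "\<exists>g'. \<forall>t\<in>{t. x + t *s v \<in> S}. ((\<lambda>t. g (x + t *s v) $ i) has_field_derivative g' t) (at t) \<and>
        (\<lambda>n. deriv (\<lambda>t. f n (x + t *s v) $ i) t) \<longlonglongrightarrow> g' t"
    proof (rule has_complex_derivative_uniform_sequence[OF opn _ line_lim])
      show "((\<lambda>t. f n (x + t *s v) $ i) has_field_derivative deriv (\<lambda>t. f n (x + t *s v) $ i) t) (at t)"
        if "t \<in> {t. x + t *s v \<in> S}" for n t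
        by (rule holomorphic_derivI[OF fline[OF x] opn that])
    qed
    then obtain g' where g': "\<forall>t\<in>{t. x + t *s v \<in> S}. ((\<lambda>t. g (x + t *s v) $ i) has_field_derivative g' t) (at t) \<and>
        (\<lambda>n. deriv (\<lambda>t. f n (x + t *s v) $ i) t) \<longlonglongrightarrow> g' t"
      by blast
    from bspec[OF g', of 0] x have "((\<lambda>t. g (x + t *s v) $ i) has_field_derivative g' 0) (at 0)"
      and lim0: "(\<lambda>n. deriv (\<lambda>t. f n (x + t *s v) $ i) 0) \<longlonglongrightarrow> g' 0" by auto
    then have "deriv (\<lambda>t. g (x + t *s v) $ i) 0 = g' 0" by (simp add: DERIV_imp_deriv)
    with lim0 show "(\<lambda>n. dif (f n) x v $ i) \<longlonglongrightarrow> dif g x v $ i"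
      by (simp add: dif_def)
  qed
qed

text \<open>The difference quotients are holomorphic and converge locally uniformly, so their limit
  is holomorphic. Differentiating the quotients for \<open>v\<close> in direction \<open>w\<close>
  gives the quotients of \<open>dif f _ w\<close> in direction \<open>v\<close>; comparing limits
  yields the symmetry.\<close>

lemma
  fixes f :: "complex ^ 'n \<Rightarrow> complex ^ 'n"
  assumes S: "open S" and f: "holo_on S f"
  shows holo_on_dif: "holo_on S (\<lambda>x. dif f x v)"
    and dif_dif_commute: "x \<in> S \<Longrightarrow> dif (\<lambda>y. dif f y v) x w = dif (\<lambda>y. dif f y w) x v"
proof -
  have fl: "line_holo S f" by (rule holo_on_imp_line_holo[OF f S])
  define q where "q = (\<lambda>v n y. of_nat (Suc n) *s (f (y + (1 / of_nat (Suc n)) *s v) - f y))"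
  \<comment> \<open>The shift by \<open>N\<close> discards the finitely many quotients whose
    displaced points may leave \<open>S\<close>.\<close>
  have *: "\<exists>r>0. \<exists>N. cball x r \<subseteq> S \<and> (\<forall>n. holo_on (ball x r) (q v (n + N))) \<and> 
      (\<forall>n. \<forall>y\<in>ball x r. y + (1 / of_nat (Suc (n + N))) *s v \<in> S) \<and>
      (\<forall>y\<in>ball x r. \<exists>d>0. cball y d \<subseteq> ball x r \<and> uniform_limit (cball y d) (\<lambda>n. q v (n + N)) (\<lambda>y. dif f y v) sequentially)"
    if x: "x \<in> S" for x v
  proof -
    obtain r N where r: "0 < r" "cball x r \<subseteq> S" and
      N: "\<And>n y. n \<ge> N \<Longrightarrow> y \<in> cball x r \<Longrightarrow> y + (1 / of_nat (Suc n)) *s v \<in> S" and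
      ul: "uniform_limit (cball x r) (q v) (\<lambda>y. dif f y v) sequentially"
      using line_holo_difference_quotient'[OF fl x, of v] unfolding q_def by blast
    have "holo_on (ball x r) (q v (n + N))" for n
    proof -
      have "holo_on (ball x r) (\<lambda>y. f (y + (1 / of_nat (Suc (n + N))) *s v))"
        by (rule holo_on_compose[OF _ f]) (use N[of "n + N"] in \<open>auto intro!: holo_on_add\<close>)
      moreover have "holo_on (ball x r) f"
        using f r(2) ball_subset_cball holo_on_subset by blast
      ultimately show ?thesis
        unfolding q_def by (intro holo_on_smult holo_on_diff)
    qed
    moreover have "\<exists>d>0. cball y d \<subseteq> ball x r \<and> uniform_limit (cball y d) (\<lambda>n. q v (n + N)) (\<lambda>y. dif f y v) sequentially"
      if y: "y \<in> ball x r" for y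
    proof -
      obtain d where d: "d > 0" "cball y d \<subseteq> ball x r"
        using open_contains_cball[THEN iffD1, OF open_ball, rule_format, OF y] by blast
      then have "cball y d \<subseteq> cball x r" using ball_subset_cball by blast
      with ul have "uniform_limit (cball y d) (q v) (\<lambda>y. dif f y v) sequentially"
        by (rule uniform_limit_on_subset)
      then have "uniform_limit (cball y d) (\<lambda>n. q v (n + N)) (\<lambda>y. dif f y v) sequentially"
        by (rule filterlim_compose) (rule filterlim_add_const_nat_at_top)
      with d show ?thesis by blast
    qed
    moreover have "y + (1 / of_nat (Suc (n + N))) *s v \<in> S" if "y \<in> ball x r" for n y
      using N[of "n + N" y] that by (auto simp del: of_nat_Suc)
    ultimately show ?thesis
      using r by (intro exI[of _ r] conjI exI[of _ N]) auto
  qed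
  show hd: "holo_on S (\<lambda>x. dif f x v)" for v
  proof (rule holo_on_local)
    fix x assume "x \<in> S"
    from *[OF this, of v] obtain r N where r: "r > 0" "\<And>n. holo_on (ball x r) (q v (n + N))"
      "\<And>y. y \<in> ball x r \<Longrightarrow> \<exists>d>0. cball y d \<subseteq> ball x r \<and> uniform_limit (cball y d) (\<lambda>n. q v (n + N)) (\<lambda>y. dif f y v) sequentially"
      by blast
    have "holo_on (ball x r) (\<lambda>y. dif f y v)"
      by (rule holo_uniform_limit(1)[OF open_ball r(2,3)])
    then show "\<exists>T. open T \<and> x \<in> T \<and> holo_on T (\<lambda>x. dif f x v)"
      using r(1) by (intro exI[of _ "ball x r"]) auto
  qed
  show "dif (\<lambda>y. dif f y v) x w = dif (\<lambda>y. dif f y w) x v" if x: "x \<in> S"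
  proof -
    from *[OF x, of v] obtain r N where r: "r > 0" "cball x r \<subseteq> S" "\<And>n. holo_on (ball x r) (q v (n + N))"
      "\<And>n y. y \<in> ball x r \<Longrightarrow> y + (1 / of_nat (Suc (n + N))) *s v \<in> S"
      "\<And>y. y \<in> ball x r \<Longrightarrow> \<exists>d>0. cball y d \<subseteq> ball x r \<and> uniform_limit (cball y d) (\<lambda>n. q v (n + N)) (\<lambda>y. dif f y v) sequentially"
      by blast
    have xr: "x \<in> ball x r" using r(1) by simp
    have "(\<lambda>n. dif (q v (n + N)) x w) \<longlonglongrightarrow> dif (\<lambda>y. dif f y v) x w"
      by (rule holo_uniform_limit(2)[OF open_ball r(3,5) xr])
    moreover have "dif (q v (n + N)) x w = of_nat (Suc (n + N)) *s
        (dif f (x + (1 / of_nat (Suc (n + N))) *s v) w - dif f x w)" for n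
    proof -
      let ?a = "(1 / of_nat (Suc (n + N))) *s v"
      have hs: "holo_on (ball x r) (\<lambda>y. y + ?a)" by (intro holo_on_add) auto
      have sub: "(\<lambda>y. y + ?a) ` ball x r \<subseteq> S" using r(4) by blast
      have hf: "holo_on (ball x r) f" using f r(2) ball_subset_cball holo_on_subset by blast
      have "dif (\<lambda>y. y + ?a) x w = w"
        by (subst dif_add[OF open_ball xr]) (auto simp: dif_ident[OF open_ball xr])
      then have eq: "dif (\<lambda>y. f (y + ?a)) x w = dif f (x + ?a) w"
        using dif_compose_open[OF hs f sub open_ball S xr] by simp
      have h: "holo_on (ball x r) (\<lambda>y. f (y + ?a))" by (rule holo_on_compose[OF hs f sub])
      show ?thesis
        unfolding q_def dif_smult[OF open_ball xr holo_on_diff[OF h hf]] dif_diff[OF open_ball xr h hf] eq ..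
    qed
    moreover have "(\<lambda>n. of_nat (Suc n) *s (dif f (x + (1 / of_nat (Suc n)) *s v) w - dif f x w)) \<longlonglongrightarrow> dif (\<lambda>y. dif f y w) x v"
    proof -
      obtain r where r: "0 < r" "cball x r \<subseteq> S" "uniform_limit (cball x r) (\<lambda>n y. of_nat (Suc n) *s (dif f (y + (1 / of_nat (Suc n)) *s v) w - dif f y w)) (\<lambda>y. dif (\<lambda>y. dif f y w) y v) sequentially"
        by (rule line_holo_difference_quotient[OF holo_on_imp_line_holo[OF hd S] x, of v w])
      then show ?thesis by (intro tendsto_uniform_limitI[OF r(3)]) auto
    qed
    then have "(\<lambda>n. of_nat (Suc (n + N)) *s (dif f (x + (1 / of_nat (Suc (n + N))) *s v) w - dif f x w)) \<longlonglongrightarrow> dif (\<lambda>y. dif f y w) x v"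
      by (rule LIMSEQ_ignore_initial_segment)
    ultimately show ?thesis using LIMSEQ_unique by simp
  qed
qed

section \<open>Fixed points, inverse functions and families of linear maps\<close>

text \<open>Banach's contraction principle, with completeness replaced by the theorem on uniform
  limits so that the fixed point is holomorphic. Both the flow in the Frobenius theorem and the
  idempotent fields are produced by it.\<close>

lemma holo_fixpoint:
  fixes P :: "(complex ^ 'n \<Rightarrow> complex ^ 'n) \<Rightarrow> complex ^ 'n \<Rightarrow> complex ^ 'n"
  assumes T: "open T" and B: "closed B" "bounded B"
    and f0: "holo_on T f0" "f0 ` T \<subseteq> B"
    and P: "\<And>f. holo_on T f \<Longrightarrow> f ` T \<subseteq> B \<Longrightarrow> holo_on T (P f)"
      "\<And>f. holo_on T f \<Longrightarrow> f ` T \<subseteq> B \<Longrightarrow> P f ` T \<subseteq> B"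
    and contr: "\<And>f g d z. holo_on T f \<Longrightarrow> f ` T \<subseteq> B \<Longrightarrow> holo_on T g \<Longrightarrow> g ` T \<subseteq> B \<Longrightarrow>
      (\<And>z. z \<in> T \<Longrightarrow> dist (f z) (g z) \<le> d) \<Longrightarrow> z \<in> T \<Longrightarrow> dist (P f z) (P g z) \<le> d / 2"
  obtains f where "holo_on T f" "f ` T \<subseteq> B" "\<And>z. z \<in> T \<Longrightarrow> P f z = f z"
proof -
  define F where "F = (\<lambda>n. (P ^^ n) f0)"
  have F: "holo_on T (F n)" "F n ` T \<subseteq> B" for n
    by (induction n) (use f0 P in \<open>auto simp: F_def\<close>)
  obtain M where M: "\<And>x. x \<in> B \<Longrightarrow> norm x \<le> M" using B(2) unfolding bounded_iff by blast
  define D where "D = 2 * M"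
  have step: "z \<in> T \<Longrightarrow> dist (F (Suc n) z) (F n z) \<le> D / 2 ^ n" for n z
  proof (induction n arbitrary: z)
    case 0
    then have "F (Suc 0) z \<in> B" "F 0 z \<in> B" using F(2) by blast+
    then have "norm (F (Suc 0) z) \<le> M" "norm (F 0 z) \<le> M" using M by blast+
    then show ?case unfolding dist_norm D_def using norm_triangle_ineq4[of "F (Suc 0) z" "F 0 z"] by simp
  next
    case (Suc n)
    have "dist (P (F (Suc n)) z) (P (F n) z) \<le> D / 2 ^ n / 2"
      by (rule contr[OF F(1,2) F(1,2) Suc.IH Suc.prems])
    then show ?case by (simp add: F_def)
  qed
  have "\<exists>g. uniform_limit T F g sequentially"
  proof -
    have h: "uniform_limit T (\<lambda>n z. \<Sum>k<n. F (Suc k) z - F k z) (\<lambda>z. suminf (\<lambda>k. F (Suc k) z - F k z)) sequentially"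
    proof (rule Weierstrass_m_test_ev[where M="\<lambda>n. D * (1 / 2) ^ n" and f="\<lambda>k z. F (Suc k) z - F k z"])
      show "\<forall>\<^sub>F n in sequentially. \<forall>x\<in>T. norm (F (Suc n) x - F n x) \<le> D * (1 / 2) ^ n"
        using step by (auto simp: dist_norm power_divide)
      show "summable (\<lambda>n. D * (1 / 2) ^ n)" by (intro summable_mult summable_geometric) auto
    qed
    define h where "h = (\<lambda>z. suminf (\<lambda>k. F (Suc k) z - F k z))"
    have "(\<Sum>k<n. F (Suc k) z - F k z) = F n z - F 0 z" for n z
      by (rule sum_lessThan_telescope)
    with h have h': "uniform_limit T (\<lambda>n z. F n z - F 0 z) h sequentially" by (simp add: h_def)
    have "uniform_limit T F (\<lambda>z. h z + F 0 z) sequentially"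
      unfolding uniform_limit_iff
    proof (intro allI impI)
      fix e :: real assume "e > 0"
      with h' have "\<forall>\<^sub>F n in sequentially. \<forall>z\<in>T. dist (F n z - F 0 z) (h z) < e"
        by (simp add: uniform_limit_iff)
      then show "\<forall>\<^sub>F n in sequentially. \<forall>z\<in>T. dist (F n z) (h z + F 0 z) < e"
        by (simp add: dist_norm algebra_simps)
    qed
    then show ?thesis by blast
  qed
  then obtain g where g: "uniform_limit T F g sequentially" by blast
  have lim: "(\<lambda>n. F n z) \<longlonglongrightarrow> g z" if "z \<in> T" for z
    using g that by (rule tendsto_uniform_limitI)
  have hg: "holo_on T g"
  proof (rule holo_uniform_limit(1)[OF T F(1)])
    fix x assume "x \<in> T"
    then obtain r where "r > 0" "cball x r \<subseteq> T" using T open_contains_cball[of T] by blast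
    then show "\<exists>r>0. cball x r \<subseteq> T \<and> uniform_limit (cball x r) F g sequentially"
      using g uniform_limit_on_subset by blast
  qed
  have gB: "g ` T \<subseteq> B"
  proof clarify
    fix z assume "z \<in> T"
    then show "g z \<in> B"
      using F(2) by (intro closed_sequentially[OF B(1) _ lim]) blast
  qed
  have "P g z = g z" if z: "z \<in> T" for z
  proof -
    have "(\<lambda>n. P (F n) z) \<longlonglongrightarrow> P g z"
    proof (rule tendstoI)
      fix e :: real assume "e > 0"
      then have "\<forall>\<^sub>F n in sequentially. \<forall>z\<in>T. dist (F n z) (g z) < e"
        using g by (simp add: uniform_limit_iff)
      then show "\<forall>\<^sub>F n in sequentially. dist (P (F n) z) (P g z) < e"
      proof eventually_elim
        case (elim n)
        then have "dist (P (F n) z) (P g z) \<le> e / 2"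
          by (intro contr[OF F hg gB _ z]) (auto intro: less_imp_le)
        then show ?case using \<open>e > 0\<close> by simp
      qed
    qed
    moreover have "(\<lambda>n. P (F n) z) \<longlonglongrightarrow> g z"
      using LIMSEQ_Suc[OF lim[OF z]] by (simp add: F_def)
    ultimately show ?thesis using LIMSEQ_unique by blast
  qed
  then show ?thesis using that hg gB by blast
qed

text \<open>The real inverse function theorem applies because the differential is continuous; the
  derivative of the inverse map inverts a complex linear bijection, hence is complex linear. Every
  map to be inverted is normalised to have identity differential at the base point.\<close>

lemma holo_inverse_function:
  fixes f :: "complex ^ 'n \<Rightarrow> complex ^ 'n"
  assumes S: "open S" "x0 \<in> S" and f: "holo_on S f" and id: "\<And>v. dif f x0 v = v"
  obtains U V g where "open U" "x0 \<in> U" "U \<subseteq> S" "open V" "f ` U = V" "holo_on V g" "g ` V = U"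
    "\<And>x. x \<in> U \<Longrightarrow> g (f x) = x" "\<And>y. y \<in> V \<Longrightarrow> f (g y) = y"
proof -
  define f' where "f' = (\<lambda>x. Blinfun (dif f x))"
  have f': "blinfun_apply (f' x) = dif f x" if "x \<in> S" for x
    unfolding f'_def using holo_on_open_has_derivative[OF f S(1) that]
    by (intro bounded_linear_Blinfun_apply clin_bounded_linear)
  have cont: "continuous_on S f'"
  proof (rule continuous_on_blinfun_componentwise)
    fix i :: "complex ^ 'n"
    have "continuous_on S (\<lambda>x. dif f x i)"
      by (rule holo_on_imp_continuous_on[OF holo_on_dif[OF S(1) f]])
    then show "continuous_on S (\<lambda>x. blinfun_apply (f' x) i)"
      using f' by (simp cong: continuous_on_cong)
  qed
  have "id_blinfun o\<^sub>L f' x0 = id_blinfun"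
    by (rule blinfun_eqI) (simp add: f'[OF S(2)] id)
  then obtain U V g g' where UV: "open U" "U \<subseteq> S" "x0 \<in> U" "open V" "f x0 \<in> V" "homeomorphism U V f g"
    "\<And>y. y \<in> V \<Longrightarrow> (g has_derivative (g' y)) (at y)"
    "\<And>y. y \<in> V \<Longrightarrow> g' y = inv (blinfun_apply (f'(g y)))"
    "\<And>y. y \<in> V \<Longrightarrow> bij (blinfun_apply (f'(g y)))"
    using inverse_function_theorem[of S f f' x0 id_blinfun] S f' cont holo_on_open_has_derivative[OF f S(1)]
    by metis
  have gU: "g y \<in> S" if "y \<in> V" for y
    using UV(2,6) that unfolding homeomorphism_def by blast
  have "holo_on V g"
    unfolding holo_on_def
  proof
    fix y assume y: "y \<in> V"
    have c: "clin (dif f (g y))" using holo_on_open_has_derivative[OF f S(1) gU[OF y]] by blast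
    have b: "bij (dif f (g y))" using UV(9)[OF y] f'[OF gU[OF y]] by simp
    have g'y: "g' y = inv (dif f (g y))" using UV(8)[OF y] f'[OF gU[OF y]] by simp
    have "clin (g' y)"
      unfolding g'y
    proof (rule clinI)
      show "inv (dif f (g y)) (u + v) = inv (dif f (g y)) u + inv (dif f (g y)) v" for u v
        by (rule inv_f_eq[OF bij_is_inj[OF b]]) (simp add: clin_add[OF c] surj_f_inv_f[OF bij_is_surj[OF b]])
      show "inv (dif f (g y)) (k *s u) = k *s inv (dif f (g y)) u" for k u
        by (rule inv_f_eq[OF bij_is_inj[OF b]]) (simp add: clin_scale[OF c] surj_f_inv_f[OF bij_is_surj[OF b]])
    qed
    then show "\<exists>D. clin D \<and> (g has_derivative D) (at y within V)"
      using UV(7)[OF y] has_derivative_at_withinI by blast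
  qed
  then show ?thesis
    using that[of U V g] UV unfolding homeomorphism_def by blast
qed

section \<open>Linear maps depending on a point\<close>

lemma clin_expand:
  assumes "clin A"
  shows "A v = (\<Sum>i\<in>UNIV. v $ i *s A (axis i 1))"
proof -
  have "A v = A (\<Sum>i\<in>UNIV. v $ i *s axis i 1)" by (simp add: basis_expansion)
  then show ?thesis by (simp add: clin_sum[OF assms] clin_scale[OF assms])
qed

text \<open>Holomorphy of \<open>A\<close> is given on constant vectors only, just as
  \<open>F_structure\<close> states it for the multiplication; expanding \<open>Y x\<close> in the
  standard basis extends it to varying arguments.\<close>

lemma holo_on_linear_family:
  assumes lin: "\<And>x. x \<in> S \<Longrightarrow> clin (A x)" and A: "\<And>v. holo_on S (\<lambda>x. A x v)" and Y: "holo_on S Y"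
  shows "holo_on S (\<lambda>x. A x (Y x))"
proof (rule holo_on_cong)
  show "holo_on S (\<lambda>x. \<Sum>i\<in>UNIV. Y x $ i *s A x (axis i 1))"
    by (intro holo_on_sum holo_on_coord_smult A Y)
qed (rule clin_expand[OF lin, symmetric])

lemma dif_linear_family:
  assumes S: "open S" "x \<in> S" and lin: "\<And>x. x \<in> S \<Longrightarrow> clin (A x)"
    and A: "\<And>v. holo_on S (\<lambda>x. A x v)" and Y: "holo_on S Y"
  shows "dif (\<lambda>y. A y (Y y)) x h = dif (\<lambda>y. A y (Y x)) x h + A x (dif Y x h)"
proof -
  have 1: "dif (\<lambda>y. A y v) x h = (\<Sum>i\<in>UNIV. v $ i *s dif (\<lambda>y. A y (axis i 1)) x h)" for v
  proof -
    have "dif (\<lambda>y. A y v) x h = dif (\<lambda>y. \<Sum>i\<in>UNIV. v $ i *s A y (axis i 1)) x h"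
      using clin_expand[OF lin] by (rule dif_cong_open[OF S])
    then show ?thesis by (simp add: dif_sum[OF S] dif_smult[OF S] A holo_on_smult)
  qed
  have "dif (\<lambda>y. A y (Y y)) x h = dif (\<lambda>y. \<Sum>i\<in>UNIV. Y y $ i *s A y (axis i 1)) x h"
    using clin_expand[OF lin] by (rule dif_cong_open[OF S])
  also have "\<dots> = (\<Sum>i\<in>UNIV. Y x $ i *s dif (\<lambda>y. A y (axis i 1)) x h + dif Y x h $ i *s A x (axis i 1))"
    by (simp add: dif_sum[OF S] dif_coord_smult[OF S] A Y holo_on_coord_smult)
  also have "\<dots> = dif (\<lambda>y. A y (Y x)) x h + A x (dif Y x h)"
    unfolding 1[of "Y x"] clin_expand[OF lin[OF S(2)], of "dif Y x h"] by (rule sum.distrib)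
  finally show ?thesis .
qed

lemma continuous_on_linear_family:
  assumes lin: "\<And>x. x \<in> S \<Longrightarrow> clin (A x)" and A: "\<And>v. continuous_on S (\<lambda>x. A x v)" and Y: "continuous_on S Y"
  shows "continuous_on S (\<lambda>x. A x (Y x))"
proof -
  have "continuous_on S (\<lambda>x. \<Sum>i\<in>UNIV. Y x $ i *s A x (axis i 1))"
    by (intro continuous_on_sum bounded_bilinear.continuous_on[OF bounded_bilinear_smult] A
        bounded_linear.continuous_on[OF bounded_linear_vec_nth] Y)
  then show ?thesis
    by (rule continuous_on_eq) (rule clin_expand[OF lin, symmetric])
qed

lemma linear_family_bound:
  fixes A :: "'a \<Rightarrow> complex ^ 'n \<Rightarrow> complex ^ 'n"
  assumes lin: "\<And>x. x \<in> S \<Longrightarrow> clin (A x)" and A: "\<And>i x. x \<in> S \<Longrightarrow> norm (A x (axis i 1)) \<le> C" and x: "x \<in> S"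
  shows "norm (A x v) \<le> real CARD('n) * C * norm v"
proof -
  have "norm (A x v) \<le> (\<Sum>i\<in>UNIV. norm (v $ i *s A x (axis i 1)))"
    unfolding clin_expand[OF lin[OF x], of v] by (rule norm_sum)
  also have "\<dots> \<le> (\<Sum>i\<in>(UNIV :: 'n set). norm v * C)"
    unfolding norm_smult using A[OF x] Finite_Cartesian_Product.norm_nth_le[of v] by (intro sum_mono mult_mono) auto
  finally show ?thesis by (simp add: mult_ac)
qed

lemma linear_family_compact_bound:
  fixes A :: "'a::topological_space \<Rightarrow> complex ^ 'n \<Rightarrow> complex ^ 'n"
  assumes K: "compact K" and lin: "\<And>x. x \<in> K \<Longrightarrow> clin (A x)" and A: "\<And>v. continuous_on K (\<lambda>x. A x v)"
  obtains C where "C \<ge> 0" "\<And>x v. x \<in> K \<Longrightarrow> norm (A x v) \<le> C * norm v"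
proof -
  have "\<exists>c. \<forall>x\<in>K. norm (A x (axis i 1)) \<le> c" for i
    using compact_imp_bounded[OF compact_continuous_image[OF A K, of "axis i 1"]] by (auto simp: bounded_iff)
  then obtain c where c: "\<And>i x. x \<in> K \<Longrightarrow> norm (A x (axis i 1)) \<le> c i" by metis
  define C where "C = (\<Sum>i\<in>UNIV. \<bar>c i\<bar>)"
  have "c i \<le> C" for i
    unfolding C_def using member_le_sum[of i UNIV "\<lambda>i. \<bar>c i\<bar>"] by auto
  then have "norm (A x (axis i 1)) \<le> C" if "x \<in> K" for i x using c[OF that, of i] order_trans by blast
  moreover have "C \<ge> 0" by (simp add: C_def sum_nonneg)
  ultimately show ?thesis using that[of "real CARD('n) * C"] linear_family_bound[of K A C] lin by simp
qed

lemma linear_family_small: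
  fixes A :: "complex ^ 'n \<Rightarrow> complex ^ 'n \<Rightarrow> complex ^ 'n"
  assumes S: "open S" "x0 \<in> S" and lin: "\<And>x. x \<in> S \<Longrightarrow> clin (A x)"
    and A: "\<And>v. continuous_on S (\<lambda>x. A x v)" and "e > 0"
  shows "\<forall>\<^sub>F x in nhds x0. \<forall>v. norm (A x v - A x0 v) \<le> e * norm v"
proof -
  define c where "c = e / real CARD('n)"
  have c: "c > 0" using \<open>e > 0\<close> by (simp add: c_def)
  have "\<forall>\<^sub>F x in nhds x0. dist (A x (axis i 1)) (A x0 (axis i 1)) < c" for i
  proof -
    have "isCont (\<lambda>x. A x (axis i 1)) x0" using A[of "axis i 1"] S by (simp add: continuous_on_eq_continuous_at)
    then have "((\<lambda>x. A x (axis i 1)) \<longlongrightarrow> A x0 (axis i 1)) (nhds x0)"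
      unfolding isCont_def tendsto_at_iff_tendsto_nhds[of "\<lambda>x. A x (axis i 1)" x0] .
    then show ?thesis using c by (rule tendstoD)
  qed
  then have "\<forall>\<^sub>F x in nhds x0. \<forall>i. dist (A x (axis i 1)) (A x0 (axis i 1)) < c"
    by (rule eventually_all_finite)
  moreover have "\<forall>\<^sub>F x in nhds x0. x \<in> S" using S by (rule eventually_nhds_in_open)
  ultimately show ?thesis
  proof eventually_elim
    case (elim x)
    show ?case
    proof
      fix v
      have "norm (A x v - A x0 v) \<le> real CARD('n) * c * norm v"
      proof (rule linear_family_bound[of "{x}" "\<lambda>x v. A x v - A x0 v"])
        show "clin (\<lambda>v. A y v - A x0 v)" if "y \<in> {x}" for y
          using lin[of y] lin[OF S(2)] elim(2) that
          by (intro clinI) (auto simp: clin_add clin_scale vec.scale_right_diff_distrib)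
        show "norm (A y (axis i 1) - A x0 (axis i 1)) \<le> c" if "y \<in> {x}" for i y
          using elim(1) that by (simp add: dist_norm less_imp_le)
      qed simp
      then show "norm (A x v - A x0 v) \<le> e * norm v" by (simp add: c_def)
    qed
  qed
qed

text \<open>The energy \<open>|k|\<^sup>2\<close>, damped by an exponential, decreases.\<close>

lemma linear_ode_zero:
  fixes k :: "real \<Rightarrow> complex ^ 'n"
  assumes k: "\<And>t. t \<in> {0..1} \<Longrightarrow> (k has_vector_derivative A t (k t)) (at t)"
    and A: "\<And>t v. t \<in> {0..1} \<Longrightarrow> norm (A t v) \<le> C * norm v"
    and "k 0 = 0" "t \<in> {0..1}"
  shows "k t = 0"
proof -
  define g where "g = (\<lambda>t. exp (- (2 * C * t)) * (k t \<bullet> k t))"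
  have g: "(g has_real_derivative exp (- (2 * C * s)) * (2 * (k s \<bullet> A s (k s)) - 2 * C * (k s \<bullet> k s))) (at s)"
    if "s \<in> {0..1}" for s
  proof -
    have "((\<lambda>t. k t \<bullet> k t) has_derivative (\<lambda>h. k s \<bullet> (h *\<^sub>R A s (k s)) + (h *\<^sub>R A s (k s)) \<bullet> k s)) (at s)"
      using k[OF that] unfolding has_vector_derivative_def by (intro has_derivative_inner)
    then have "((\<lambda>t. k t \<bullet> k t) has_real_derivative 2 * (k s \<bullet> A s (k s))) (at s)"
      unfolding has_field_derivative_def
      by (rule has_derivative_eq_rhs) (auto simp: inner_commute)
    then show ?thesis
      unfolding g_def by (auto intro!: derivative_eq_intros simp: algebra_simps)
  qed
  have "g t \<le> g 0"
  proof (rule DERIV_nonpos_imp_nonincreasing[of 0 t])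
    show "0 \<le> t" using assms(4) by simp
    fix s assume "0 \<le> s" "s \<le> t"
    then have s: "s \<in> {0..1}" using assms(4) by simp
    have "k s \<bullet> A s (k s) \<le> norm (k s) * norm (A s (k s))" by (rule norm_cauchy_schwarz)
    also have "\<dots> \<le> norm (k s) * (C * norm (k s))" using A[OF s] by (intro mult_left_mono) auto
    finally have "2 * (k s \<bullet> A s (k s)) - 2 * C * (k s \<bullet> k s) \<le> 0"
      by (simp add: power2_norm_eq_inner[symmetric] power2_eq_square algebra_simps)
    then have "exp (- (2 * C * s)) * (2 * (k s \<bullet> A s (k s)) - 2 * C * (k s \<bullet> k s)) \<le> 0"
      by (simp add: mult_nonneg_nonpos)
    then show "\<exists>y. (g has_real_derivative y) (at s) \<and> y \<le> 0" using g[OF s] by blast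
  qed
  then have "k t \<bullet> k t \<le> 0" using \<open>k 0 = 0\<close> by (simp add: g_def mult_le_0_iff)
  then have "k t \<bullet> k t = 0" using inner_ge_zero[of "k t"] by linarith
  then show ?thesis by (rule inner_eq_zero_iff[THEN iffD1])
qed

section \<open>The Frobenius theorem for fields of projections\<close>

text \<open>
  The Frobenius theorem for the distribution \<open>ker P\<close> of a holomorphic field \<open>P\<close> of projections:
  \<open>involutive\<close> says \<open>P (Lie\<^sub>X P) = 0\<close> for the sections \<open>X = a - P a\<close> of \<open>ker P\<close>.
\<close>

locale involutive_kernel =
  fixes S :: "(complex ^ 'n) set" and p :: "complex ^ 'n" and P :: "complex ^ 'n \<Rightarrow> complex ^ 'n \<Rightarrow> complex ^ 'n"
  assumes open_S: "open S" and p_in: "p \<in> S"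
    and P_clin: "x \<in> S \<Longrightarrow> clin (P x)"
    and P_idem: "x \<in> S \<Longrightarrow> P x (P x v) = P x v"
    and P_holo: "holo_on S (\<lambda>x. P x v)"
    and involutive: "x \<in> S \<Longrightarrow> P x (dif (\<lambda>y. P y v) x (a - P x a) - P x (dif (\<lambda>y. P y a) x v) + dif (\<lambda>y. P y a) x (P x v)) = 0"
begin

abbreviation "dP x v h \<equiv> dif (\<lambda>y. P y v) x h"

lemma dP_clin: "x \<in> S \<Longrightarrow> clin (dP x v)"
  by (rule holo_on_open_has_derivative(1)[OF P_holo open_S])

lemma dP_clin_left: 
  assumes x: "x \<in> S"
  shows "clin (\<lambda>v. dP x v h)"
proof (rule clinI)
  have "dP x (u + v) h = dif (\<lambda>y. P y u + P y v) x h" for u v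
    by (rule dif_cong_open[OF open_S x]) (simp add: clin_add[OF P_clin])
  then show "dP x (u + v) h = dP x u h + dP x v h" for u v
    by (simp add: dif_add[OF open_S x P_holo P_holo])
  have "dP x (c *s v) h = dif (\<lambda>y. c *s P y v) x h" for c v
    by (rule dif_cong_open[OF open_S x]) (simp add: clin_scale[OF P_clin])
  then show "dP x (c *s v) h = c *s dP x v h" for c v
    by (simp add: dif_smult[OF open_S x P_holo])
qed

text \<open>The product rule applied to \<open>P y (P y v) = P y v\<close>.\<close>

lemma dP_idem:
  assumes x: "x \<in> S"
  shows "dP x (P x v) h + P x (dP x v h) = dP x v h"
proof -
  have "dif (\<lambda>y. P y (P y v)) x h = dP x v h"
    by (rule dif_cong_open[OF open_S x]) (rule P_idem)
  then show ?thesis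
    using dif_linear_family[OF open_S x P_clin P_holo P_holo, where h=h] by metis
qed

text \<open>The left side thus depends on \<open>v\<close> only through \<open>P x v\<close>. This
  closes the variational equation of the flow: it becomes an equation for the transversal part
  alone.\<close>

lemma Lie_P:
  assumes x: "x \<in> S"
  shows "dP x v (a - P x a) - P x (dP x a v) =
    dP x (P x v) (a - P x a) - P x (dP x a (P x v))"
proof -
  note L = clin_add[OF P_clin[OF x]] clin_diff[OF P_clin[OF x]] P_idem[OF x]
  have 1: "P x (dP x v (a - P x a)) - P x (dP x a v) + P x (dP x a (P x v)) = 0"
    using involutive[OF x, of v a] by (simp add: L)
  have 2: "dP x v (a - P x a) = dP x (P x v) (a - P x a) + P x (dP x v (a - P x a))"
    using dP_idem[OF x, of v "a - P x a"] by simp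
  show ?thesis
    using 1 by (subst 2) (simp add: algebra_simps)
qed

section \<open>Rays in the kernel of \<open>P p\<close> and integrals along them\<close>

definition P0 where "P0 = P p"
definition n where "n z = z - P0 z"
text \<open>Only the component in the kernel of \<open>P0\<close> is contracted; the transversal
  coordinate \<open>P0 z\<close> labels the leaf and stays fixed.\<close>

definition ray where "ray s z = P0 z + of_real s *s n z" for s :: real

lemma P0_clin: "clin P0" unfolding P0_def by (rule P_clin[OF p_in])

lemma P0_idem [simp]: "P0 (P0 z) = P0 z" unfolding P0_def by (rule P_idem[OF p_in])

lemma n_clin: "clin n"
  by (rule clinI) (auto simp: n_def clin_add[OF P0_clin] clin_scale[OF P0_clin] vec.scale_right_diff_distrib)

lemma n_simps [simp]: "P0 (n z) = 0" "n (P0 z) = 0" "n (n z) = n z" "n 0 = 0" "P0 0 = 0"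
  by (simp_all add: n_def clin_diff[OF P0_clin] clin_0[OF P0_clin])

lemma ray_clin: "clin (ray s)"
  by (rule clinI) (auto simp: ray_def clin_add[OF P0_clin] clin_scale[OF P0_clin] clin_add[OF n_clin]
      clin_scale[OF n_clin] vec.scale_right_distrib mult_ac)

lemma P0_ray [simp]: "P0 (ray s z) = P0 z"
  by (simp add: ray_def clin_add[OF P0_clin] clin_scale[OF P0_clin])

lemma n_ray [simp]: "n (ray s z) = of_real s *s n z"
  by (simp add: ray_def clin_add[OF n_clin] clin_scale[OF n_clin])

lemma ray_0 [simp]: "ray s 0 = 0"
  by (simp add: ray_def)

lemma ray_1 [simp]: "ray 1 z = z"
  by (simp add: ray_def n_def)

text \<open>For an oblique projection \<open>P0\<close> a ball need not be stable under
  \<open>ray s\<close> with 0 \<le> s \<le> 1; this product of two balls is.\<close>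

definition Omega where "Omega d = {z. norm (P0 z) < d \<and> norm (n z) < d}"

lemma clin_continuous_on: "clin L \<Longrightarrow> continuous_on A L"
  by (rule holo_on_imp_continuous_on[OF clin_holo_on])

lemma open_Omega: "open (Omega d)"
  unfolding Omega_def
  by (intro open_Collect_conj open_Collect_less continuous_on_norm continuous_on_const clin_continuous_on P0_clin n_clin)

lemma convex_Omega: "convex (Omega d)"
proof -
  have "Omega d = P0 -` ball 0 d \<inter> n -` ball 0 d" by (auto simp: Omega_def)
  then show ?thesis
    by (simp add: convex_Int convex_linear_vimage bounded_linear.linear[OF clin_bounded_linear] P0_clin n_clin)
qed

lemma zero_in_Omega: "d > 0 \<Longrightarrow> 0 \<in> Omega d"
  by (simp add: Omega_def)

lemma ray_in_Omega: "z \<in> Omega d \<Longrightarrow> s \<in> {0..1} \<Longrightarrow> ray s z \<in> Omega d"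
  unfolding Omega_def by (auto simp: norm_smult intro: le_less_trans[OF mult_left_le_one_le])

text \<open>The time integral of Picard's operator, with time absorbed into \<open>n z\<close>: the
  operator then acts on maps of \<open>z\<close> alone, to which the holomorphic fixed point lemma
  applies.\<close>

definition ray_integral where "ray_integral g z = integral (cbox 0 1) (\<lambda>s. g (ray s z))"

lemma continuous_on_ray: "continuous_on A (\<lambda>(z, s). ray s z)"
  unfolding ray_def split_beta
  by (intro continuous_intros bounded_bilinear.continuous_on[OF bounded_bilinear_smult]
      continuous_on_compose2[OF clin_continuous_on[OF P0_clin]] continuous_on_compose2[OF clin_continuous_on[OF n_clin]]) auto

lemma continuous_on_ray_compose:
  assumes "continuous_on (Omega d) g"
  shows "continuous_on (Omega d \<times> cbox 0 1) (\<lambda>(z, s). g (ray s z))"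
  using continuous_on_compose2[OF assms continuous_on_ray[of "Omega d \<times> cbox 0 1"]] ray_in_Omega
  by (force simp: split_beta)

lemma continuous_on_ray_fixed:
  fixes g :: "complex ^ 'n \<Rightarrow> complex ^ 'n"
  assumes "continuous_on (Omega d) g" "z \<in> Omega d"
  shows "continuous_on (cbox 0 1) (\<lambda>s. g (ray s z))"
proof -
  have "continuous_on (cbox 0 (1::real)) (\<lambda>s. (\<lambda>(z, s). g (ray s z)) (z, s))"
    by (rule continuous_on_compose2[OF continuous_on_ray_compose[OF assms(1)]])
      (use assms(2) in \<open>auto intro!: continuous_intros\<close>)
  then show ?thesis by simp
qed

lemma ray_integrable:
  fixes g :: "complex ^ 'n \<Rightarrow> complex ^ 'n"
  assumes "continuous_on (Omega d) g" "z \<in> Omega d"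
  shows "(\<lambda>s. g (ray s z)) integrable_on cbox 0 1"
  by (rule integrable_continuous[OF continuous_on_ray_fixed[OF assms]])

lemma dif_ray_compose:
  assumes g: "holo_on (Omega d) g" and z: "z \<in> Omega d" and s: "s \<in> {0..1}"
  shows "dif (\<lambda>z. g (ray s z)) z v = dif g (ray s z) (ray s v)"
proof -
  have "dif (\<lambda>z. g (ray s z)) z v = dif g (ray s z) (dif (ray s) z v)"
    by (rule dif_compose_open[OF clin_holo_on[OF ray_clin] g _ open_Omega open_Omega z])
      (use ray_in_Omega s in blast)
  then show ?thesis by (simp add: dif_clin[OF ray_clin])
qed

text \<open>Differentiation under the integral sign gives holomorphy on every complex line; with
  continuity in \<open>z\<close>, Osgood's lemma applies.\<close>

lemma
  assumes g: "holo_on (Omega d) g"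
  shows holo_ray_integral: "holo_on (Omega d) (ray_integral g)"
    and dif_ray_integral: "z \<in> Omega d \<Longrightarrow>
      dif (ray_integral g) z v = integral (cbox 0 1) (\<lambda>s. dif g (ray s z) (ray s v))"
proof -
  note cont = holo_on_imp_continuous_on[OF g]
  have comp: "ray_integral g z $ i = integral (cbox 0 1) (\<lambda>s. g (ray s z) $ i)" if "z \<in> Omega d" for z i
    unfolding ray_integral_def
    using integral_linear[OF ray_integrable[OF cont that] bounded_linear_vec_nth[of i]] by (simp add: o_def)
  have gl: "line_holo (Omega d) g" by (rule holo_on_imp_line_holo[OF g open_Omega])
  have cd: "continuous_on (Omega d) (\<lambda>x. dif g x w)" for w
    by (rule holo_on_imp_continuous_on[OF holo_on_dif[OF open_Omega g]])
  \<comment> \<open>Splitting \<open>ray s v\<close> leaves directions independent of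
    \<open>s\<close>, for which continuity of the directional derivative is known.\<close>
  have dsplit: "dif g y (ray s v) = dif g y (P0 v) + of_real s *s dif g y (n v)" if "y \<in> Omega d" for y s v
    unfolding ray_def using holo_on_open_has_derivative(1)[OF g open_Omega that] by (simp add: clin_add clin_scale)
  have contd: "continuous_on (Omega d \<times> cbox 0 1) (\<lambda>(z, s). dif g (ray s z) (ray s v))" for v
  proof -
    have "continuous_on (Omega d \<times> cbox 0 1) (\<lambda>(z, s). dif g (ray s z) (P0 v) + of_real s *s dif g (ray s z) (n v))"
      using continuous_on_ray_compose[OF cd[of "P0 v"]] continuous_on_ray_compose[OF cd[of "n v"]]
      by (auto simp: split_beta intro!: continuous_intros bounded_bilinear.continuous_on[OF bounded_bilinear_smult])
    then show ?thesis
      by (rule continuous_on_eq) (use dsplit ray_in_Omega in auto)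
  qed
  have line: "((\<lambda>t. ray_integral g (z + t *s v) $ i) has_field_derivative
      integral (cbox 0 1) (\<lambda>s. dif g (ray s (z + t *s v)) (ray s v) $ i)) (at t)"
    if z: "z \<in> Omega d" and t: "z + t *s v \<in> Omega d" for z v i t
  proof -
    let ?T = "{t. z + t *s v \<in> Omega d}"
    have T: "open ?T" using open_line_preimage[of UNIV "Omega d" z v] open_Omega by (simp add: vec.subspace_UNIV)
    have cT: "convex ?T"
    proof -
      have "linear (\<lambda>t. t *s v)" by (rule bounded_linear.linear[OF bounded_linear_smult_left])
      moreover have "?T = (\<lambda>t. t *s v) -` ((\<lambda>x. x + - z) ` Omega d)" by (force simp: image_iff algebra_simps)
      ultimately show ?thesis
        using convex_linear_vimage[OF _ convex_translation[OF convex_Omega, of "- z" d]] by (simp add: add.commute)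
    qed
    have pair: "continuous_on (?T \<times> cbox 0 1) (\<lambda>(t, s). (z + t *s v, s))"
      by (auto simp: split_beta intro!: continuous_intros bounded_bilinear.continuous_on[OF bounded_bilinear_smult])
    have "((\<lambda>t. integral (cbox 0 1) (\<lambda>s. g (ray s (z + t *s v)) $ i)) has_field_derivative
      integral (cbox 0 1) (\<lambda>s. dif g (ray s (z + t *s v)) (ray s v) $ i)) (at t within ?T)"
    proof (rule leibniz_rule_field_derivative[OF _ _ _ _ cT])
      fix t and s :: real assume t: "t \<in> ?T" and s: "s \<in> cbox 0 1"
      have "holo_on (Omega d) (\<lambda>z. g (ray s z))"
        by (rule holo_on_compose[OF clin_holo_on[OF ray_clin] g]) (use ray_in_Omega s in auto)
      from holo_on_open_has_derivative[OF this open_Omega, of "z + t *s v"] t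
      have "((\<lambda>r. g (ray s ((z + t *s v) + r *s v)) $ i) has_field_derivative dif (\<lambda>z. g (ray s z)) (z + t *s v) v $ i) (at 0)"
        by (intro has_derivative_line[where U="Omega d" and V=UNIV])
          (auto simp: vec.subspace_UNIV open_Omega intro: has_derivative_at_withinI)
      moreover have "(z + t *s v) + r *s v = z + (r + t) *s v" for r
        by (metis add.assoc add.commute vec.scale_left_distrib)
      ultimately have "((\<lambda>r. g (ray s (z + (r + t) *s v)) $ i) has_field_derivative dif g (ray s (z + t *s v)) (ray s v) $ i) (at 0)"
        using dif_ray_compose[OF g, of "z + t *s v" s v] t s by simp
      then have "((\<lambda>r. g (ray s (z + r *s v)) $ i) has_field_derivative dif g (ray s (z + t *s v)) (ray s v) $ i) (at (0 + t))"
        by (rule DERIV_shift[THEN iffD2])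
      then show "((\<lambda>r. g (ray s (z + r *s v)) $ i) has_field_derivative dif g (ray s (z + t *s v)) (ray s v) $ i) (at t within ?T)"
        by (simp add: has_field_derivative_at_within)
    next
      fix t assume "t \<in> ?T"
      then have "continuous_on (cbox 0 1) (\<lambda>s. g (ray s (z + t *s v)))" by (intro continuous_on_ray_fixed[OF cont]) simp
      then show "(\<lambda>s. g (ray s (z + t *s v)) $ i) integrable_on cbox 0 1"
        by (intro integrable_continuous bounded_linear.continuous_on[OF bounded_linear_vec_nth])
    next
      have "continuous_on (?T \<times> cbox 0 1) (\<lambda>x. (\<lambda>(z, s). dif g (ray s z) (ray s v)) ((\<lambda>(t, s). (z + t *s v, s)) x))"
        by (rule continuous_on_compose2[OF contd pair]) auto
      from bounded_linear.continuous_on[OF bounded_linear_vec_nth[of i] this]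
      show "continuous_on (?T \<times> cbox 0 1) (\<lambda>(t, s). dif g (ray s (z + t *s v)) (ray s v) $ i)"
        by (simp add: split_beta)
    qed (use t in simp)
    then have "((\<lambda>t. ray_integral g (z + t *s v) $ i) has_field_derivative
      integral (cbox 0 1) (\<lambda>s. dif g (ray s (z + t *s v)) (ray s v) $ i)) (at t within ?T)"
      unfolding has_field_derivative_def
      by (rule has_derivative_transform[rotated 2]) (use t comp in auto)
    then show ?thesis using at_within_open[OF _ T, of t] t by auto
  qed
  have "line_holo (Omega d) (ray_integral g)"
    unfolding line_holo_def
  proof (intro conjI ballI allI open_Omega)
    show "continuous_on (Omega d) (ray_integral g)"
      unfolding ray_integral_def by (rule integral_continuous_on_param[OF continuous_on_ray_compose[OF cont]])
    show "(\<lambda>t. ray_integral g (z + t *s v) $ i) holomorphic_on {t. z + t *s v \<in> Omega d}" if "z \<in> Omega d" for z v i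
      unfolding holomorphic_on_def field_differentiable_def
      using line[OF that, THEN has_field_derivative_at_within] by blast
  qed
  then show "holo_on (Omega d) (ray_integral g)" by (rule Osgood)
  show "dif (ray_integral g) z v = integral (cbox 0 1) (\<lambda>s. dif g (ray s z) (ray s v))" if z: "z \<in> Omega d"
  proof -
    have "continuous_on (cbox 0 1) (\<lambda>s. (\<lambda>(z, s). dif g (ray s z) (ray s v)) (z, s))"
      by (rule continuous_on_compose2[OF contd]) (use z in \<open>auto intro!: continuous_intros\<close>)
    then have "(\<lambda>s. dif g (ray s z) (ray s v)) integrable_on cbox 0 1"
      by (intro integrable_continuous) simp
    then have "integral (cbox 0 1) (\<lambda>s. dif g (ray s z) (ray s v)) $ i = integral (cbox 0 1) (\<lambda>s. dif g (ray s z) (ray s v) $ i)" for i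
      using integral_linear[OF _ bounded_linear_vec_nth[of i]] by (fastforce simp: o_def)
    then show ?thesis
      using DERIV_imp_deriv[OF line[OF z, of 0 v]] z by (simp add: dif_def[of "ray_integral g"] vec_eq_iff)
  qed
qed

text \<open>The fundamental theorem of calculus for \<open>s *\<^sub>R g (ray s z)\<close>; the
  factor \<open>s\<close> matches \<open>ray s (n z) = of_real s *s n z\<close>.\<close>

lemma ray_integral_Euler:
  assumes g: "holo_on (Omega d) g" and z: "z \<in> Omega d"
  shows "dif (ray_integral g) z (n z) + ray_integral g z = g z"
proof -
  note cont = holo_on_imp_continuous_on[OF g]
  have int: "((\<lambda>s. g (ray s z) + dif g (ray s z) (ray s (n z))) has_integral (1 *\<^sub>R g (ray 1 z) - 0 *\<^sub>R g (ray 0 z))) {0..1}"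
  proof (rule fundamental_theorem_of_calculus)
    fix s :: real assume s: "s \<in> {0..1}"
    have sO: "ray s z \<in> Omega d" by (rule ray_in_Omega[OF z s])
    note D = holo_on_open_has_derivative[OF g open_Omega sO]
    have "((\<lambda>s. ray s z) has_derivative (\<lambda>h. of_real h *s n z)) (at s)"
      unfolding ray_def
      by (auto intro!: derivative_eq_intros bounded_linear.has_derivative[OF bounded_linear_smult_left])
    from has_derivative_compose[OF this D(2)]
    have "((\<lambda>s. g (ray s z)) has_derivative (\<lambda>h. h *\<^sub>R dif g (ray s z) (n z))) (at s)"
      by (simp add: clin_scale[OF D(1)] scaleR_eq_smult)
    then have "((\<lambda>s. s *\<^sub>R g (ray s z)) has_vector_derivative g (ray s z) + s *\<^sub>R dif g (ray s z) (n z)) (at s)"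
      unfolding has_vector_derivative_def
      by (auto intro!: derivative_eq_intros simp: algebra_simps)
    moreover have r: "ray s (n z) = of_real s *s n z" by (simp add: ray_def)
    have "s *\<^sub>R dif g (ray s z) (n z) = dif g (ray s z) (ray s (n z))"
      unfolding r clin_scale[OF D(1)] scaleR_eq_smult ..
    ultimately show "((\<lambda>s. s *\<^sub>R g (ray s z)) has_vector_derivative g (ray s z) + dif g (ray s z) (ray s (n z))) (at s within {0..1})"
      by (simp add: has_vector_derivative_at_within)
  qed simp
  have i1: "(\<lambda>s. g (ray s z)) integrable_on cbox 0 1" by (rule ray_integrable[OF cont z])
  then have "(\<lambda>s. (g (ray s z) + dif g (ray s z) (ray s (n z))) - g (ray s z)) integrable_on cbox 0 1"
    using int by (intro integrable_diff) (auto simp: integrable_on_def)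
  then have i2: "(\<lambda>s. dif g (ray s z) (ray s (n z))) integrable_on cbox 0 1" by simp
  have "integral (cbox 0 1) (\<lambda>s. g (ray s z) + dif g (ray s z) (ray s (n z))) = g z"
    using integral_unique[OF int] by simp
  then show ?thesis
    unfolding dif_ray_integral[OF g z] using integral_add[OF i1 i2]
    by (simp add: ray_integral_def add.commute)
qed

end

section \<open>The flow along the rays and the first integral it provides\<close>

context involutive_kernel
begin

lemma ray_integral_norm_le:
  fixes g :: "complex ^ 'n \<Rightarrow> complex ^ 'n"
  assumes "continuous_on (Omega d) g" "z \<in> Omega d" "\<And>y. y \<in> Omega d \<Longrightarrow> norm (g y) \<le> B"
  shows "norm (ray_integral g z) \<le> B"
proof -
  have "norm (integral {0..1} (\<lambda>s. g (ray s z))) \<le> B * (1 - 0)"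
    using continuous_on_ray_fixed[OF assms(1,2)] assms(3) ray_in_Omega[OF assms(2)]
    by (intro integral_bound) auto
  then show ?thesis by (simp add: ray_integral_def)
qed

lemma ray_integral_diff:
  fixes g h :: "complex ^ 'n \<Rightarrow> complex ^ 'n"
  assumes "continuous_on (Omega d) g" "continuous_on (Omega d) h" "z \<in> Omega d"
  shows "ray_integral g z - ray_integral h z = ray_integral (\<lambda>y. g y - h y) z"
  unfolding ray_integral_def
  by (rule integral_diff[symmetric, OF ray_integrable[OF assms(1,3)] ray_integrable[OF assms(2,3)]])

text \<open>
  The time one map of the fields \<open>a - P a\<close> with \<open>a = n z\<close>, started at \<open>p + P0 z\<close>: since \<open>n z\<close>
  is constant up to a factor along rays, Picard's operator can be written with the integrals
  of the columns of \<open>P\<close>.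
\<close>

definition picard where
  "picard \<Phi> z = p + z - (\<Sum>i\<in>UNIV. n z $ i *s ray_integral (\<lambda>y. P (\<Phi> y) (axis i 1)) z)"

lemma holo_P_compose:
  assumes "holo_on T \<Phi>" "\<Phi> ` T \<subseteq> S"
  shows "holo_on T (\<lambda>y. P (\<Phi> y) v)"
  by (rule holo_on_compose[OF assms(1) P_holo assms(2)])

lemma holo_picard:
  assumes "holo_on (Omega d) \<Phi>" "\<Phi> ` Omega d \<subseteq> S"
  shows "holo_on (Omega d) (picard \<Phi>)"
  unfolding picard_def
  by (intro holo_on_diff holo_on_add holo_on_sum holo_on_coord_smult holo_ray_integral holo_P_compose
      clin_holo_on[OF n_clin] assms) auto

text \<open>Picard's operator preserves maps into a fixed ball around \<open>p\<close>, and
  contracts them, once \<open>d\<close> is small compared with a bound \<open>C\<close> for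
  \<open>P\<close> and a common Lipschitz constant \<open>L\<close> for its columns on that
  ball.\<close>

lemma flow_exists:
  obtains d \<Phi> where "d > 0" "holo_on (Omega d) \<Phi>" "\<Phi> ` Omega d \<subseteq> S" "\<And>z. z \<in> Omega d \<Longrightarrow> picard \<Phi> z = \<Phi> z"
proof -
  obtain r where r: "r > 0" "cball p r \<subseteq> S"
    using open_S p_in open_contains_cball[of S] by blast
  have rS: "x \<in> S" if "x \<in> cball p r" for x using r that by blast
  obtain C where C: "C \<ge> 0" "\<And>x v. x \<in> cball p r \<Longrightarrow> norm (P x v) \<le> C * norm v"
  proof (rule linear_family_compact_bound[of "cball p r" P])
    show "continuous_on (cball p r) (\<lambda>x. P x v)" for v
      using holo_on_imp_continuous_on[OF P_holo] r(2) by (rule continuous_on_subset)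
  qed (use P_clin rS in auto)
  have "\<exists>c\<ge>0. \<forall>x h. x \<in> cball p r \<longrightarrow> norm (dP x (axis i 1) h) \<le> c * norm h" for i
  proof -
    obtain c where "c \<ge> 0" "\<And>x h. x \<in> cball p r \<Longrightarrow> norm (dP x (axis i 1) h) \<le> c * norm h"
    proof (rule linear_family_compact_bound[of "cball p r" "\<lambda>x. dP x (axis i 1)"])
      show "continuous_on (cball p r) (\<lambda>x. dP x (axis i 1) h)" for h
        using holo_on_imp_continuous_on[OF holo_on_dif[OF open_S P_holo]] r(2) by (rule continuous_on_subset)
    qed (use dP_clin rS in auto)
    then show ?thesis by blast
  qed
  then obtain l where l: "\<And>i. l i \<ge> 0" "\<And>i x h. x \<in> cball p r \<Longrightarrow> norm (dP x (axis i 1) h) \<le> l i * norm h"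
    by metis
  define L where "L = (\<Sum>i\<in>UNIV. l i)"
  have L: "L \<ge> 0" "l i \<le> L" for i
    unfolding L_def using l(1) member_le_sum[of i UNIV l] by (auto intro: sum_nonneg)
  have Lip: "norm (P x (axis i 1) - P y (axis i 1)) \<le> L * norm (x - y)" if "x \<in> cball p r" "y \<in> cball p r" for x y i
  proof (rule differentiable_bound[where S="cball p r" and f'="\<lambda>z. dP z (axis i 1)"])
    fix z assume z: "z \<in> cball p r"
    show "((\<lambda>x. P x (axis i 1)) has_derivative dP z (axis i 1)) (at z within cball p r)"
      using holo_on_open_has_derivative(2)[OF P_holo open_S rS[OF z]] by (rule has_derivative_at_withinI)
    show "onorm (dP z (axis i 1)) \<le> L"
    proof (rule onorm_le)
      fix h
      have "norm (dP z (axis i 1) h) \<le> l i * norm h" by (rule l(2)[OF z])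
      also have "\<dots> \<le> L * norm h" using L(2) by (intro mult_right_mono) auto
      finally show "norm (dP z (axis i 1) h) \<le> L * norm h" .
    qed
  qed (use that in auto)
  define N where "N = real CARD('n)"
  have N: "N \<ge> 0" by (simp add: N_def)
  \<comment> \<open>The first bound gives \<open>2 * d + N * (d * C) \<le> r\<close>, so values stay
    in the ball; the second gives \<open>N * L * d \<le> 1 / 2\<close>, the contraction factor. The
    summand 2 keeps the denominators positive.\<close>
  define d where "d = min (r / (2 + N * C)) (1 / (2 * (N * L) + 2))"
  have d: "d > 0" "d * (2 + N * C) \<le> r" "N * L * d \<le> 1 / 2"
  proof -
    have pos: "2 + N * C > 0" "2 * (N * L) + 2 > 0" using N C(1) L(1) by (auto intro: add_pos_nonneg add_nonneg_pos)
    then show "d > 0" using r by (simp add: d_def)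
    have "d \<le> r / (2 + N * C)" by (simp add: d_def)
    then show "d * (2 + N * C) \<le> r" using pos by (simp add: pos_le_divide_eq)
    have "d \<le> 1 / (2 * (N * L) + 2)" by (simp add: d_def)
    then have "d * (2 * (N * L) + 2) \<le> 1" using pos by (simp add: pos_le_divide_eq)
    then show "N * L * d \<le> 1 / 2" using \<open>d > 0\<close> by (simp add: algebra_simps)
  qed
  have nz: "norm (n z $ i) \<le> d" if "z \<in> Omega d" for z i
    using that Finite_Cartesian_Product.norm_nth_le[of "n z" i] by (auto simp: Omega_def)
  have sumb: "norm (\<Sum>i\<in>UNIV. n z $ i *s w i) \<le> N * (d * B)" if "z \<in> Omega d" "\<And>i. norm (w i) \<le> B" for z B w
  proof -
    have "norm (\<Sum>i\<in>UNIV. n z $ i *s w i) \<le> (\<Sum>i\<in>(UNIV::'n set). d * B)"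
      by (rule sum_norm_le) (auto simp: norm_smult intro!: mult_mono nz that less_imp_le[OF d(1)])
    then show ?thesis by (simp add: N_def)
  qed
  define B where "B = cball p r"
  have cP: "continuous_on (Omega d) (\<lambda>y. P (f y) v)" if "holo_on (Omega d) f" "f ` Omega d \<subseteq> B" for f v
    by (rule holo_on_imp_continuous_on[OF holo_P_compose]) (use that r(2) B_def in auto)
  have "\<exists>f. holo_on (Omega d) f \<and> f ` Omega d \<subseteq> B \<and> (\<forall>z\<in>Omega d. picard f z = f z)"
  proof (rule holo_fixpoint[of "Omega d" B "\<lambda>z. p" picard])
    show "closed B" "bounded B" by (auto simp: B_def)
    show "(\<lambda>z. p) ` Omega d \<subseteq> B" using r by (auto simp: B_def)
    fix f assume f: "holo_on (Omega d) f" "f ` Omega d \<subseteq> B"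
    show "holo_on (Omega d) (picard f)"
      by (rule holo_picard[OF f(1)]) (use f(2) r(2) B_def in auto)
    show "picard f ` Omega d \<subseteq> B"
    proof clarify
      fix z assume z: "z \<in> Omega d"
      have "norm (ray_integral (\<lambda>y. P (f y) (axis i 1)) z) \<le> C" for i
        by (rule ray_integral_norm_le[OF cP[OF f] z]) (use C(2)[of _ "axis i 1"] f(2) in \<open>force simp: B_def\<close>)
      then have "norm (\<Sum>i\<in>UNIV. n z $ i *s ray_integral (\<lambda>y. P (f y) (axis i 1)) z) \<le> N * (d * C)"
        by (rule sumb[OF z])
      moreover have "norm z \<le> 2 * d"
        using z norm_triangle_ineq[of "P0 z" "n z"] by (auto simp: Omega_def n_def)
      ultimately have "norm (z - (\<Sum>i\<in>UNIV. n z $ i *s ray_integral (\<lambda>y. P (f y) (axis i 1)) z)) \<le> 2 * d + N * (d * C)"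
        using norm_triangle_ineq4 order_trans add_mono by meson
      also have "\<dots> \<le> r" using d(2) by (simp add: algebra_simps)
      finally show "picard f z \<in> B"
        by (simp add: B_def picard_def dist_norm norm_minus_commute algebra_simps)
    qed
  next
    fix f g D z
    assume f: "holo_on (Omega d) f" "f ` Omega d \<subseteq> B" and g: "holo_on (Omega d) g" "g ` Omega d \<subseteq> B"
      and D: "\<And>z. z \<in> Omega d \<Longrightarrow> dist (f z) (g z) \<le> D" and z: "z \<in> Omega d"
    have "D \<ge> 0" using D[OF z] zero_le_dist order_trans by blast
    have "norm (ray_integral (\<lambda>y. P (f y) (axis i 1) - P (g y) (axis i 1)) z) \<le> L * D" for i
    proof (rule ray_integral_norm_le[OF _ z])
      show "continuous_on (Omega d) (\<lambda>y. P (f y) (axis i 1) - P (g y) (axis i 1))"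
        by (intro continuous_on_diff cP f g)
      fix y assume y: "y \<in> Omega d"
      have "norm (P (f y) (axis i 1) - P (g y) (axis i 1)) \<le> L * norm (f y - g y)"
        by (rule Lip) (use f g y B_def in auto)
      also have "\<dots> \<le> L * D" using D[OF y] L(1) by (intro mult_left_mono) (auto simp: dist_norm)
      finally show "norm (P (f y) (axis i 1) - P (g y) (axis i 1)) \<le> L * D" .
    qed
    then have "norm (\<Sum>i\<in>UNIV. n z $ i *s ray_integral (\<lambda>y. P (f y) (axis i 1) - P (g y) (axis i 1)) z) \<le> N * (d * (L * D))"
      by (rule sumb[OF z])
    also have "N * (d * (L * D)) = (N * L * d) * D" by simp
    also have "\<dots> \<le> (1 / 2) * D" using d(3) \<open>D \<ge> 0\<close> by (rule mult_right_mono)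
    finally have *: "norm (\<Sum>i\<in>UNIV. n z $ i *s ray_integral (\<lambda>y. P (f y) (axis i 1) - P (g y) (axis i 1)) z) \<le> D / 2" by simp
    have "picard g z - picard f z = (\<Sum>i\<in>UNIV. n z $ i *s ray_integral (\<lambda>y. P (f y) (axis i 1) - P (g y) (axis i 1)) z)"
      unfolding picard_def
      by (simp add: ray_integral_diff[OF cP[OF f] cP[OF g] z, symmetric] vec.scale_right_diff_distrib sum_subtractf)
    with * have "norm (picard g z - picard f z) \<le> D / 2" by (simp only:)
    then show "dist (picard f z) (picard g z) \<le> D / 2"
      unfolding dist_norm norm_minus_commute[of "picard f z"] .
  qed (auto simp: open_Omega)
  then show ?thesis using that d(1) r(2) unfolding B_def by (meson order_trans)
qed

context
  fixes d \<Phi>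
  assumes d: "d > 0" and \<Phi>: "holo_on (Omega d) \<Phi>" "\<Phi> ` Omega d \<subseteq> S" and fixp: "\<And>z. z \<in> Omega d \<Longrightarrow> picard \<Phi> z = \<Phi> z"
begin

lemma flow_in: "z \<in> Omega d \<Longrightarrow> \<Phi> z \<in> S"
  using \<Phi>(2) by blast

lemma flow_0: "\<Phi> 0 = p"
  using fixp[OF zero_in_Omega[OF d]] by (simp add: picard_def)

lemma dif_flow:
  assumes z: "z \<in> Omega d"
  shows "dif \<Phi> z v = v - (\<Sum>i\<in>UNIV. n z $ i *s dif (ray_integral (\<lambda>y. P (\<Phi> y) (axis i 1))) z v
    + n v $ i *s ray_integral (\<lambda>y. P (\<Phi> y) (axis i 1)) z)"
proof -
  note hr = holo_ray_integral[OF holo_P_compose[OF \<Phi>]]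
  have "dif \<Phi> z v = dif (picard \<Phi>) z v"
    by (rule dif_cong_open[OF open_Omega z]) (simp add: fixp)
  also have "\<dots> = v - (\<Sum>i\<in>UNIV. n z $ i *s dif (ray_integral (\<lambda>y. P (\<Phi> y) (axis i 1))) z v
    + n v $ i *s ray_integral (\<lambda>y. P (\<Phi> y) (axis i 1)) z)"
    unfolding picard_def
    by (simp add: dif_diff[OF open_Omega z] dif_add[OF open_Omega z] dif_sum[OF open_Omega z]
        dif_coord_smult[OF open_Omega z] dif_ident[OF open_Omega z] hr clin_holo_on[OF n_clin] dif_clin[OF n_clin]
        holo_on_add holo_on_sum holo_on_coord_smult)
  finally show ?thesis .
qed

text \<open>At 0 the rays are constant, and the correction in Picard's operator reduces to
  \<open>P0 (n v)\<close>, which vanishes.\<close>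

lemma dif_flow_0: "dif \<Phi> 0 v = v"
proof -
  have "ray_integral (\<lambda>y. P (\<Phi> y) (axis i 1)) 0 = P0 (axis i 1)" for i
    by (simp add: ray_integral_def flow_0 P0_def)
  then have "dif \<Phi> 0 v = v - (\<Sum>i\<in>UNIV. n v $ i *s P0 (axis i 1))"
    by (simp add: dif_flow[OF zero_in_Omega[OF d]])
  also have "\<dots> = v - P0 (n v)"
    unfolding clin_expand[OF P0_clin, symmetric] ..
  finally show ?thesis by simp
qed

text \<open>The Euler identity for ray integrals turns Picard's integral equation into a
  differential one: in direction \<open>n z\<close> the flow moves with a velocity in the kernel of
  \<open>P\<close>.\<close>

lemma flow_equation:
  assumes z: "z \<in> Omega d"
  shows "dif \<Phi> z (n z) = n z - P (\<Phi> z) (n z)"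
proof -
  have "dif \<Phi> z (n z) = n z - (\<Sum>i\<in>UNIV. n z $ i *s P (\<Phi> z) (axis i 1))"
    unfolding dif_flow[OF z] n_simps
    using ray_integral_Euler[OF holo_P_compose[OF \<Phi>] z]
    by (simp add: vec.scale_right_distrib[symmetric])
  then show ?thesis
    by (simp add: clin_expand[OF P_clin[OF flow_in[OF z]], of "n z"])
qed

text \<open>
  Differentiating the flow equation shows that \<open>q = P (d\<Phi> w)\<close> satisfies a linear differential
  equation along every ray.
\<close>

lemma flow_variation:
  assumes z: "z \<in> Omega d" and w: "P0 w = 0"
  defines "q \<equiv> \<lambda>z. P (\<Phi> z) (dif \<Phi> z w)"
  shows "dif q z (n z) + q z = dP (\<Phi> z) (q z) (n z - P (\<Phi> z) (n z)) - P (\<Phi> z) (dP (\<Phi> z) (n z) (q z))"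
proof -
  let ?x = "\<Phi> z" and ?u = "n z"
  let ?c = "dif \<Phi> z w"
  have x: "?x \<in> S" by (rule flow_in[OF z])
  note O = open_Omega z
  note lin\<Phi> = holo_on_open_has_derivative(1)[OF \<Phi>(1) open_Omega]
  have dPc: "dif (\<lambda>y. P (\<Phi> y) v) z h = dP ?x v (dif \<Phi> z h)" for v h
    by (rule dif_compose_open[OF \<Phi>(1) P_holo \<Phi>(2) open_Omega open_S z])
  have hPn: "holo_on (Omega d) (\<lambda>y. P (\<Phi> y) (n y))"
    by (rule holo_on_linear_family[where A="\<lambda>y. P (\<Phi> y)", OF P_clin[OF flow_in] holo_P_compose[OF \<Phi>] clin_holo_on[OF n_clin]])
  have nw: "n w = w" using w by (simp add: n_def)
  have "dif q z ?u = dif (\<lambda>y. P (\<Phi> y) ?c) z ?u + P ?x (dif (\<lambda>y. dif \<Phi> y w) z ?u)"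
    unfolding q_def
    by (rule dif_linear_family[OF O P_clin[OF flow_in] holo_P_compose[OF \<Phi>] holo_on_dif[OF open_Omega \<Phi>(1)]])
  also have "dif (\<lambda>y. P (\<Phi> y) ?c) z ?u = dP ?x ?c (?u - P ?x ?u)"
    unfolding dPc flow_equation[OF z] ..
  \<comment> \<open>Symmetry of second derivatives moves \<open>w\<close> outside, so that the flow
    equation itself can be differentiated in direction \<open>w\<close>.\<close>
  also have "dif (\<lambda>y. dif \<Phi> y w) z ?u = dif (\<lambda>y. dif \<Phi> y ?u) z w"
    by (rule dif_dif_commute[OF open_Omega \<Phi>(1) z])
  also have "dif (\<lambda>y. dif \<Phi> y ?u) z w = w - P ?x w - dP ?x ?u ?c - ?c"
  proof -
    have "dif (\<lambda>y. dif \<Phi> y (n y)) z w = dif (\<lambda>y. dif \<Phi> y ?u) z w + dif \<Phi> z (dif n z w)"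
      by (rule dif_linear_family[OF O lin\<Phi> holo_on_dif[OF open_Omega \<Phi>(1)] clin_holo_on[OF n_clin]])
    moreover have "dif (\<lambda>y. dif \<Phi> y (n y)) z w = dif (\<lambda>y. n y - P (\<Phi> y) (n y)) z w"
      by (rule dif_cong_open[OF O]) (rule flow_equation)
    moreover have "\<dots> = w - dif (\<lambda>y. P (\<Phi> y) (n y)) z w"
      unfolding dif_diff[OF O clin_holo_on[OF n_clin] hPn] dif_clin[OF n_clin] nw ..
    moreover have "dif (\<lambda>y. P (\<Phi> y) (n y)) z w = dif (\<lambda>y. P (\<Phi> y) ?u) z w + P ?x (dif n z w)"
      by (rule dif_linear_family[where A="\<lambda>y. P (\<Phi> y)" and Y=n, OF O P_clin[OF flow_in] holo_P_compose[OF \<Phi>] clin_holo_on[OF n_clin]])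
    ultimately show ?thesis by (simp add: dif_clin[OF n_clin] nw dPc algebra_simps)
  qed
  finally have 1: "dif q z ?u = dP ?x ?c (?u - P ?x ?u) + P ?x (w - P ?x w - dP ?x ?u ?c - ?c)" .
  note lP = clin_add[OF P_clin[OF x]] clin_diff[OF P_clin[OF x]] P_idem[OF x]
  have "dif q z ?u = dP ?x ?c (?u - P ?x ?u) - P ?x (dP ?x ?u ?c) - q z"
    unfolding 1 by (simp add: lP q_def)
  then show ?thesis
    using Lie_P[OF x, of ?c ?u] by (simp add: q_def)
qed

text \<open>For \<open>q\<close> as in the variation formula, \<open>t *\<^sub>R q (ray t z)\<close>
  starts at 0 whatever the value of \<open>q\<close> there, and its derivative is the left side of
  that formula taken at \<open>ray t z\<close>. The formula makes the equation linear and
  homogeneous, so the solution is still 0 at time 1.\<close>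

lemma flow_tangent:
  assumes z: "z \<in> Omega d" and w: "P0 w = 0"
  shows "P (\<Phi> z) (dif \<Phi> z w) = 0"
proof -
  define q where "q = (\<lambda>z. P (\<Phi> z) (dif \<Phi> z w))"
  define A where "A = (\<lambda>t v. dP (\<Phi> (ray t z)) v (n z - P (\<Phi> (ray t z)) (n z)) - P (\<Phi> (ray t z)) (dP (\<Phi> (ray t z)) (n z) v))"
  have hq: "holo_on (Omega d) q"
    unfolding q_def by (rule holo_on_linear_family[OF P_clin[OF flow_in] holo_P_compose[OF \<Phi>] holo_on_dif[OF open_Omega \<Phi>(1)]])
  have c1: "continuous_on (cbox 0 1) (\<lambda>t. \<Phi> (ray t z))"
    by (rule continuous_on_ray_fixed[OF holo_on_imp_continuous_on[OF \<Phi>(1)] z])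
  have in_S: "\<Phi> (ray t z) \<in> S" if "t \<in> cbox 0 1" for t
    using flow_in[OF ray_in_Omega[OF z]] that by simp
  note cS = continuous_on_compose2[OF _ c1, of S]
  have cP: "continuous_on (cbox 0 1) (\<lambda>t. P (\<Phi> (ray t z)) v)" for v
    by (rule cS[OF holo_on_imp_continuous_on[OF P_holo]]) (use in_S in auto)
  have cdP: "continuous_on (cbox 0 1) (\<lambda>t. dP (\<Phi> (ray t z)) v h)" for v h
    by (rule cS[OF holo_on_imp_continuous_on[OF holo_on_dif[OF open_S P_holo]]]) (use in_S in auto)
  have cA: "continuous_on (cbox 0 1) (\<lambda>t. A t v)" for v
    unfolding A_def
    by (intro continuous_on_diff continuous_on_linear_family[OF dP_clin[OF in_S] cdP] continuous_on_linear_family[OF P_clin[OF in_S] cP]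
        continuous_on_const cP cdP)
  have lA: "clin (A t)" if "t \<in> cbox 0 1" for t
  proof -
    note l = P_clin[OF in_S[OF that]] dP_clin_left[OF in_S[OF that]] dP_clin[OF in_S[OF that]]
    show ?thesis
      unfolding A_def
      by (rule clinI) (simp_all add: clin_add[OF l(1)] clin_scale[OF l(1)] clin_add[OF l(2)] clin_scale[OF l(2)]
        clin_add[OF l(3)] clin_scale[OF l(3)] vec.scale_right_diff_distrib)
  qed
  obtain C where C: "\<And>t v. t \<in> cbox 0 1 \<Longrightarrow> norm (A t v) \<le> C * norm v"
    using linear_family_compact_bound[OF compact_cbox lA cA] by blast
  have "(\<lambda>t. t *\<^sub>R q (ray t z)) 1 = 0"
  proof (rule linear_ode_zero[where A=A and C=C])
    fix t :: real assume t: "t \<in> {0..1}"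
    have tO: "ray t z \<in> Omega d" by (rule ray_in_Omega[OF z t])
    note D = holo_on_open_has_derivative[OF hq open_Omega tO]
    have "((\<lambda>s. ray s z) has_derivative (\<lambda>h. of_real h *s n z)) (at t)"
      unfolding ray_def
      by (auto intro!: derivative_eq_intros bounded_linear.has_derivative[OF bounded_linear_smult_left])
    from has_derivative_compose[OF this D(2)]
    have "((\<lambda>s. q (ray s z)) has_derivative (\<lambda>h. h *\<^sub>R dif q (ray t z) (n z))) (at t)"
      by (simp add: clin_scale[OF D(1)] scaleR_eq_smult)
    then have "((\<lambda>s. s *\<^sub>R q (ray s z)) has_vector_derivative q (ray t z) + t *\<^sub>R dif q (ray t z) (n z)) (at t)"
      unfolding has_vector_derivative_def
      by (auto intro!: derivative_eq_intros simp: algebra_simps)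
    moreover have "q (ray t z) + t *\<^sub>R dif q (ray t z) (n z) = A t (t *\<^sub>R q (ray t z))"
    proof -
      have S: "\<Phi> (ray t z) \<in> S" by (rule flow_in[OF tO])
      note l = P_clin[OF S] dP_clin_left[OF S] dP_clin[OF S]
      have "t *\<^sub>R dif q (ray t z) (n z) = dif q (ray t z) (n (ray t z))"
        unfolding n_ray clin_scale[OF D(1)] scaleR_eq_smult ..
      then have "q (ray t z) + t *\<^sub>R dif q (ray t z) (n z) = dP (\<Phi> (ray t z)) (q (ray t z)) (n (ray t z) - P (\<Phi> (ray t z)) (n (ray t z)))
         - P (\<Phi> (ray t z)) (dP (\<Phi> (ray t z)) (n (ray t z)) (q (ray t z)))"
        using flow_variation[OF tO w] by (simp add: q_def add.commute)
      also have "\<dots> = of_real t *s A t (q (ray t z))"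
        unfolding A_def n_ray
        by (simp add: clin_scale[OF l(1)] clin_scale[OF l(2)] clin_scale[OF l(3)] clin_diff[OF l(3)] vec.scale_right_diff_distrib)
      also have "\<dots> = A t (t *\<^sub>R q (ray t z))"
        using lA[of t] t by (simp add: clin_scale scaleR_eq_smult)
      finally show ?thesis .
    qed
    ultimately show "((\<lambda>s. s *\<^sub>R q (ray s z)) has_vector_derivative A t (t *\<^sub>R q (ray t z))) (at t)" by simp
    show "norm (A t v) \<le> C * norm v" for v using C t by simp
  qed auto
  then show ?thesis by (simp add: q_def)
qed

end

text \<open>The flow is invertible near 0, and the function is the leaf label \<open>P0\<close> of
  its inverse. If \<open>v\<close> lies in the kernel of \<open>P x\<close> and \<open>a\<close> is
  its preimage under the differential of the flow, then the part \<open>n a\<close> is tangent to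
  the leaf, so the transversal part \<open>P0 a\<close> must also be mapped into the kernel; near
  \<open>p\<close> this forces it to be 0.\<close>

theorem first_integral:
  obtains T f where "open T" "p \<in> T" "T \<subseteq> S" "holo_on T f" "f p = 0" "\<And>x. x \<in> T \<Longrightarrow> P p (f x) = f x"
    "\<And>x v. x \<in> T \<Longrightarrow> P x v = 0 \<Longrightarrow> dif f x v = 0" "\<And>v. dif f p v = P p v"
proof -
  obtain d \<Phi> where d: "d > 0" and \<Phi>: "holo_on (Omega d) \<Phi>" "\<Phi> ` Omega d \<subseteq> S" and fixp: "\<And>z. z \<in> Omega d \<Longrightarrow> picard \<Phi> z = \<Phi> z"
    using flow_exists by blast
  note flow = d \<Phi> fixp
  note O = open_Omega zero_in_Omega[OF d]
  obtain U V g where UV: "open U" "0 \<in> U" "U \<subseteq> Omega d" "open V" "\<Phi> ` U = V" "holo_on V g" "g ` V = U"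
    "\<And>x. x \<in> U \<Longrightarrow> g (\<Phi> x) = x" "\<And>y. y \<in> V \<Longrightarrow> \<Phi> (g y) = y"
    using holo_inverse_function[OF O \<Phi>(1) dif_flow_0[OF flow]] by metis
  \<comment> \<open>Adding \<open>n b\<close> completes the transversal map to an endomorphism that
    is the identity at 0 and therefore injective nearby.\<close>
  define B where "B = (\<lambda>z b. n b + P (\<Phi> z) (dif \<Phi> z (P0 b)))"
  have hq: "holo_on (Omega d) (\<lambda>z. P (\<Phi> z) (dif \<Phi> z w))" for w
    by (rule holo_on_linear_family[OF P_clin[OF flow_in[OF flow]] holo_P_compose[OF \<Phi>] holo_on_dif[OF open_Omega \<Phi>(1)]])
  have B0: "B 0 b = b" for b
  proof -
    have "B 0 b = n b + P p (P0 b)"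
      by (simp only: B_def dif_flow_0[OF flow] flow_0[OF flow])
    also have "\<dots> = b" unfolding P0_def[symmetric] P0_idem by (simp add: n_def)
    finally show ?thesis .
  qed
  have "\<forall>\<^sub>F z in nhds 0. \<forall>b. norm (B z b - B 0 b) \<le> 1 / 2 * norm b"
  proof (rule linear_family_small[OF O])
    fix z assume z: "z \<in> Omega d"
    note l = P_clin[OF flow_in[OF flow z]] holo_on_open_has_derivative(1)[OF \<Phi>(1) open_Omega z] n_clin P0_clin
    show "clin (B z)"
      unfolding B_def by (rule clinI) (simp_all add: l[THEN clin_add] l[THEN clin_scale] vec.scale_right_distrib)
  next
    show "continuous_on (Omega d) (\<lambda>z. B z b)" for b
      unfolding B_def by (intro holo_on_imp_continuous_on holo_on_add hq) auto
  qed auto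
  then obtain W where W: "open W" "0 \<in> W" "\<And>z b. z \<in> W \<Longrightarrow> norm (B z b - b) \<le> 1 / 2 * norm b"
    unfolding eventually_nhds B0 by blast
  define T where "T = V \<inter> g -` W"
  have gp: "g p = 0" using UV(8)[OF UV(2)] flow_0[OF flow] by simp
  have pV: "p \<in> V" using UV(2,5) flow_0[OF flow] by (metis imageI)
  have dg: "dif \<Phi> (g x) (dif g x v) = v" if "x \<in> V" for x v
  proof -
    have "dif (\<lambda>y. \<Phi> (g y)) x v = dif \<Phi> (g x) (dif g x v)"
      by (rule dif_compose_open[OF UV(6) \<Phi>(1) _ UV(4) open_Omega that]) (use UV in auto)
    moreover have "dif (\<lambda>y. \<Phi> (g y)) x v = dif (\<lambda>y. y) x v"
      by (rule dif_cong_open[OF UV(4) that]) (rule UV(9))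
    ultimately show ?thesis by (simp add: dif_ident[OF UV(4) that])
  qed
  have df: "dif (\<lambda>x. P0 (g x)) x v = P0 (dif g x v)" if "x \<in> V" for x v
    by (rule dif_clin_compose[OF UV(4) that P0_clin UV(6)])
  have "open T"
    unfolding T_def using continuous_open_preimage[OF holo_on_imp_continuous_on[OF UV(6)] UV(4) W(1)] .
  moreover have "p \<in> T" using pV gp W(2) by (simp add: T_def)
  moreover have "T \<subseteq> S" unfolding T_def using UV(3,5) \<Phi>(2) by blast
  moreover have "holo_on T (\<lambda>x. P0 (g x))"
    by (rule holo_on_clin[OF P0_clin holo_on_subset[OF UV(6)]]) (simp add: T_def)
  moreover have "P0 (g p) = 0" using gp by simp
  moreover have "P p (P0 (g x)) = P0 (g x)" for x by (simp add: P0_def[symmetric])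
  moreover have "dif (\<lambda>x. P0 (g x)) x v = 0" if x: "x \<in> T" and v: "P x v = 0" for x v
  proof -
    have xV: "x \<in> V" using x by (simp add: T_def)
    have gx: "g x \<in> W" "g x \<in> Omega d" "\<Phi> (g x) = x" using x UV by (auto simp: T_def)
    define a where "a = dif g x v"
    have lD: "clin (dif \<Phi> (g x))" by (rule holo_on_open_has_derivative(1)[OF \<Phi>(1) open_Omega gx(2)])
    have xS: "x \<in> S" using flow_in[OF flow gx(2)] gx(3) by simp
    have "P x (dif \<Phi> (g x) (P0 a)) + P x (dif \<Phi> (g x) (n a)) = P x (dif \<Phi> (g x) (P0 a + n a))"
      by (simp add: clin_add[OF lD] clin_add[OF P_clin[OF xS]])
    also have "P0 a + n a = a" by (simp add: n_def)
    also have "P x (dif \<Phi> (g x) a) = 0" using dg[OF xV, of v] v by (simp add: a_def)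
    finally have "P x (dif \<Phi> (g x) (P0 a)) = 0"
      using flow_tangent[OF flow gx(2), of "n a"] gx(3) by simp
    then have "B (g x) (P0 a) = 0" by (simp add: B_def gx(3))
    then have "norm (P0 a) \<le> 1 / 2 * norm (P0 a)" using W(3)[OF gx(1), of "P0 a"] by simp
    then have "P0 a = 0" by simp
    then show ?thesis by (simp add: df[OF xV] a_def)
  qed
  moreover have "dif (\<lambda>x. P0 (g x)) p v = P p v" for v
    using df[OF pV] dg[OF pV] dif_flow_0[OF flow] by (simp add: gp P0_def[symmetric])
  ultimately show ?thesis using that by blast
qed

end

section \<open>The eigenspace decomposition of an algebra\<close>

locale unital_algebra =
  fixes \<mu> :: "complex ^ 'n \<Rightarrow> complex ^ 'n \<Rightarrow> complex ^ 'n" and u :: "complex ^ 'n"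
  assumes mult_clin: "clin (\<mu> v)"
    and mult_commute: "\<mu> v w = \<mu> w v"
    and mult_assoc: "\<mu> (\<mu> x y) z = \<mu> x (\<mu> y z)"
    and mult_unit: "\<mu> u v = v"
begin

lemmas mult_add_right = clin_add[OF mult_clin]
lemmas mult_scale_right = clin_scale[OF mult_clin]
lemmas mult_diff_right = clin_diff[OF mult_clin]
lemmas mult_zero_right [simp] = clin_0[OF mult_clin]
lemmas mult_sum_right = clin_sum[OF mult_clin]

lemma mult_add_left: "\<mu> (v + w) x = \<mu> v x + \<mu> w x"
  by (simp add: mult_commute[of _ x] mult_add_right)

lemma mult_scale_left: "\<mu> (c *s v) x = c *s \<mu> v x"
  by (simp add: mult_commute[of _ x] mult_scale_right)

lemma mult_diff_left: "\<mu> (v - w) x = \<mu> v x - \<mu> w x"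
  by (simp add: mult_commute[of _ x] mult_diff_right)

lemma mult_zero_left [simp]: "\<mu> 0 x = 0"
  by (simp add: mult_commute[of _ x])

lemma mult_sum_left: "\<mu> (\<Sum>i\<in>I. f i) x = (\<Sum>i\<in>I. \<mu> (f i) x)"
  by (simp add: mult_commute[of _ x] mult_sum_right)

lemma mult_left_commute: "\<mu> x (\<mu> y z) = \<mu> y (\<mu> x z)"
  by (metis mult_assoc mult_commute)

lemma funpow_clin: "clin (\<mu> y ^^ N)"
  by (induction N) (auto intro!: clinI simp: clin_add clin_scale mult_add_right mult_scale_right)

lemma funpow_mult: "(\<mu> y ^^ N) (\<mu> x v) = \<mu> x ((\<mu> y ^^ N) v)"
  by (induction N) (simp_all add: mult_left_commute[of y x])

lemma funpow_funpow_commute: "(\<mu> y ^^ N) ((\<mu> x ^^ M) v) = (\<mu> x ^^ M) ((\<mu> y ^^ N) v)"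
  by (induction M) (simp_all add: funpow_mult)

lemma funpow_zero_mono: "(\<mu> y ^^ N) v = 0 \<Longrightarrow> (\<mu> y ^^ (N + M)) v = 0"
  by (simp add: add.commute[of N] funpow_add clin_0[OF funpow_clin])

abbreviation "GE \<equiv> gen_eigenspace UNIV \<mu>"

text \<open>Subtracting the eigenvalue is again multiplication by an element, so all operators
  involved are multiplications and commute.\<close>

lemma gen_eigenspace_iff: "v \<in> GE c \<longleftrightarrow> (\<forall>x. \<exists>N. (\<mu> (x - c x *s u) ^^ N) v = 0)"
proof -
  have "(\<lambda>w. \<mu> x w - c x *s w) = \<mu> (x - c x *s u)" for x
    by (simp add: fun_eq_iff mult_diff_left mult_scale_left mult_unit)
  then show ?thesis by (simp add: gen_eigenspace_def)
qed

lemma gen_eigenspace_subspace: "vec.subspace (GE c)"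
proof (rule vec.subspaceI)
  show "0 \<in> GE c" by (auto simp: gen_eigenspace_iff intro!: exI[of _ 0])
  show "v + w \<in> GE c" if "v \<in> GE c" "w \<in> GE c" for v w
    unfolding gen_eigenspace_iff
  proof
    fix x
    obtain N M where N: "(\<mu> (x - c x *s u) ^^ N) v = 0" and M: "(\<mu> (x - c x *s u) ^^ M) w = 0"
      using \<open>v \<in> GE c\<close> \<open>w \<in> GE c\<close> unfolding gen_eigenspace_iff by blast
    have "(\<mu> (x - c x *s u) ^^ (N + M)) v = 0" "(\<mu> (x - c x *s u) ^^ (N + M)) w = 0"
      using funpow_zero_mono[OF N, of M] funpow_zero_mono[OF M, of N] by (simp_all only: add.commute)
    then show "\<exists>N. (\<mu> (x - c x *s u) ^^ N) (v + w) = 0"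
      by (intro exI[of _ "N + M"]) (simp add: clin_add[OF funpow_clin])
  qed
  show "r *s v \<in> GE c" if "v \<in> GE c" for r v
    using that unfolding gen_eigenspace_iff by (metis clin_scale[OF funpow_clin] vec.scale_zero_right)
qed

lemma gen_eigenspace_ideal: "v \<in> GE c \<Longrightarrow> \<mu> x v \<in> GE c"
  unfolding gen_eigenspace_iff by (metis funpow_mult mult_zero_right)

text \<open>The last nonzero iterate of \<open>v\<close> under \<open>x - a *s u\<close> is an
  eigenvector of \<open>x\<close> for \<open>a\<close>. On it \<open>x - b *s u\<close> acts as the
  scalar \<open>a - b\<close>, some power of which must vanish.\<close>

lemma generalized_eigenvalue_unique:
  assumes "v \<noteq> 0" "(\<mu> (x - a *s u) ^^ N) v = 0" "(\<mu> (x - b *s u) ^^ M) v = 0"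
  shows "a = b"
proof -
  let ?y = "x - a *s u" and ?z = "x - b *s u"
  define K where "K = (LEAST N. (\<mu> ?y ^^ N) v = 0)"
  have K: "(\<mu> ?y ^^ K) v = 0" unfolding K_def using assms(2) by (rule LeastI)
  with \<open>v \<noteq> 0\<close> obtain J where J: "K = Suc J" by (cases K) auto
  define w where "w = (\<mu> ?y ^^ J) v"
  have "w \<noteq> 0" using not_less_Least[of J "\<lambda>N. (\<mu> ?y ^^ N) v = 0"] J by (auto simp: w_def K_def)
  have "\<mu> ?y w = 0" using K by (simp add: J w_def)
  define r where "r = a - b"
  have "\<mu> ?z w = r *s w"
    using \<open>\<mu> ?y w = 0\<close> by (simp add: r_def mult_diff_left mult_scale_left mult_unit vec.scale_left_diff_distrib)
  then have "(\<mu> ?z ^^ L) w = r ^ L *s w" for L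
    by (induction L) (simp_all add: mult_scale_right mult.commute[of r])
  moreover have "(\<mu> ?z ^^ M) w = 0"
    unfolding w_def funpow_funpow_commute[where y="?z"] assms(3) by (rule clin_0[OF funpow_clin])
  ultimately show ?thesis using \<open>w \<noteq> 0\<close> unfolding r_def by (metis vec.scale_eq_0_iff power_eq_0_iff right_minus_eq)
qed

lemma gen_eigenspace_disjoint:
  assumes "v \<in> GE c" "v \<in> GE c'" "GE c \<noteq> GE c'"
  shows "v = 0"
proof (rule ccontr)
  assume "v \<noteq> 0"
  have "c x = c' x" for x
    using assms(1,2) generalized_eigenvalue_unique[OF \<open>v \<noteq> 0\<close>] unfolding gen_eigenspace_iff by metis
  then show False using assms(3) by presburger
qed

section \<open>Eigenvectors in ideals and the splitting into eigenspaces\<close>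

definition ideal where "ideal W \<longleftrightarrow> vec.subspace W \<and> (\<forall>x. \<forall>w\<in>W. \<mu> x w \<in> W)"

text \<open>The vector \<open>p(x) w\<close>, computed by Horner's scheme.\<close>

definition poly_act where "poly_act x w p = fold_coeffs (\<lambda>a v. a *s w + \<mu> x v) p 0"

lemma poly_act_0 [simp]: "poly_act x w 0 = 0"
  by (simp add: poly_act_def)

lemma poly_act_pCons [simp]: "poly_act x w (pCons a p) = a *s w + \<mu> x (poly_act x w p)"
  by (cases "p = 0 \<and> a = 0") (auto simp: poly_act_def)

lemma poly_act_smult: "poly_act x w (Polynomial.smult c p) = c *s poly_act x w p"
  by (induction p) (simp_all add: vec.scale_right_distrib mult_scale_right)

lemma poly_act_add: "poly_act x w (p + q) = poly_act x w p + poly_act x w q"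
  by (induction p q rule: poly_induct2) (simp_all add: vec.scale_left_distrib mult_add_right)

lemma poly_act_monom: "poly_act x w (Polynomial.monom 1 k) = (\<mu> x ^^ k) w"
  by (induction k) (simp_all add: monom_0 monom_Suc)

lemma poly_act_in: "ideal W \<Longrightarrow> w \<in> W \<Longrightarrow> poly_act x w p \<in> W"
  by (induction p) (auto simp: ideal_def vec.subspace_0 vec.subspace_add vec.subspace_scale)

text \<open>Otherwise no power of \<open>x\<close> applied to \<open>w\<close> lies in the span of
  the lower ones, and there would be \<open>CARD('n) + 1\<close> independent vectors.\<close>

lemma annihilating_poly: "\<exists>p\<noteq>0. poly_act x w p = 0"
proof (rule ccontr)
  assume nex: "\<not> (\<exists>p\<noteq>0. poly_act x w p = 0)"
  let ?v = "\<lambda>k. (\<mu> x ^^ k) w"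
  have sub: "vec.subspace {poly_act x w p |p. \<forall>i\<ge>k. Polynomial.coeff p i = 0}" for k
  proof (rule vec.subspaceI)
    show "0 \<in> {poly_act x w p |p. \<forall>i\<ge>k. Polynomial.coeff p i = 0}"
      by (auto intro!: exI[of _ 0])
    fix a b c assume "a \<in> {poly_act x w p |p. \<forall>i\<ge>k. Polynomial.coeff p i = 0}"
    then obtain p where p: "a = poly_act x w p" "\<forall>i\<ge>k. Polynomial.coeff p i = 0" by blast
    then show "c *s a \<in> {poly_act x w p |p. \<forall>i\<ge>k. Polynomial.coeff p i = 0}"
      by (auto simp: poly_act_smult intro!: exI[of _ "Polynomial.smult c p"])
    assume "b \<in> {poly_act x w p |p. \<forall>i\<ge>k. Polynomial.coeff p i = 0}"
    then obtain q where q: "b = poly_act x w q" "\<forall>i\<ge>k. Polynomial.coeff q i = 0" by blast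
    with p show "a + b \<in> {poly_act x w p |p. \<forall>i\<ge>k. Polynomial.coeff p i = 0}"
      by (auto simp: poly_act_add intro!: exI[of _ "p + q"])
  qed
  have notin: "?v k \<notin> vec.span (?v ` {..<k})" for k
  proof
    assume "?v k \<in> vec.span (?v ` {..<k})"
    moreover have "vec.span (?v ` {..<k}) \<subseteq> {poly_act x w p |p. \<forall>i\<ge>k. Polynomial.coeff p i = 0}"
      by (rule vec.span_minimal[OF _ sub]) (force simp: poly_act_monom[symmetric])
    ultimately obtain p where p: "?v k = poly_act x w p" "\<forall>i\<ge>k. Polynomial.coeff p i = 0" by auto
    have "poly_act x w (Polynomial.monom 1 k + Polynomial.smult (- 1) p) = 0"
      by (simp only: poly_act_add poly_act_smult poly_act_monom p(1)) simp
    moreover have "Polynomial.coeff (Polynomial.monom 1 k + Polynomial.smult (- 1) p) k = 1"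
      using p(2) by simp
    then have "Polynomial.monom 1 k + Polynomial.smult (- 1) p \<noteq> 0" by (metis coeff_0 zero_neq_one)
    ultimately show False using nex by blast
  qed
  have "vec.independent (?v ` {..<m}) \<and> card (?v ` {..<m}) = m" for m
  proof (induction m)
    case (Suc m)
    have nin: "?v m \<notin> ?v ` {..<m}" using notin[of m] by (rule contra_subsetD[OF vec.span_superset])
    have "vec.independent (insert (?v m) (?v ` {..<m}))"
      by (rule vec.independent_insertI[OF notin[of m] conjunct1[OF Suc.IH]])
    moreover have "card (insert (?v m) (?v ` {..<m})) = Suc m"
      unfolding card_insert_disjoint[OF finite_imageI[OF finite_lessThan] nin] conjunct2[OF Suc.IH] ..
    ultimately show ?case unfolding lessThan_Suc image_insert by (rule conjI)
  qed (simp add: vec.independent_empty)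
  note ind = this[of "Suc CARD('n)"]
  have "card (?v ` {..<Suc CARD('n)}) \<le> vec.dim (?v ` {..<Suc CARD('n)})"
    using vec.dim_eq_card_independent[OF conjunct1[OF ind]] by linarith
  also have "\<dots> \<le> CARD('n)" by (rule dim_subset_UNIV_cart_gen)
  finally show False using conjunct2[OF ind] by linarith
qed

text \<open>Take an annihilating polynomial of minimal degree and a root \<open>c\<close> of it. The
  cofactor of the root sends \<open>w\<close> to a nonzero vector by minimality, and
  \<open>x\<close> acts on that vector as \<open>c\<close>.\<close>

lemma eigenvector_exists:
  assumes W: "ideal W" "W \<noteq> {0}"
  shows "\<exists>c. \<exists>w\<in>W. w \<noteq> 0 \<and> \<mu> x w = c *s w"
proof -
  obtain w where w: "w \<in> W" "w \<noteq> 0" using W by (auto simp: ideal_def dest: vec.subspace_0)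
  let ?A = "\<lambda>p. p \<noteq> 0 \<and> poly_act x w p = 0"
  obtain p0 where "?A p0" using annihilating_poly[of x w] by (elim exE)
  then have "\<exists>p. ?A p \<and> (\<forall>q. ?A q \<longrightarrow> Polynomial.degree p \<le> Polynomial.degree q)"
    by (rule ex_has_least_nat)
  then obtain p where "?A p \<and> (\<forall>q. ?A q \<longrightarrow> Polynomial.degree p \<le> Polynomial.degree q)" by (elim exE)
  then have p: "p \<noteq> 0" "poly_act x w p = 0" and min: "\<And>q. ?A q \<Longrightarrow> Polynomial.degree p \<le> Polynomial.degree q"
    by simp_all
  have deg: "Polynomial.degree p \<noteq> 0"
  proof
    assume "Polynomial.degree p = 0"
    then obtain a where "p = [:a:]" by (rule degree_eq_zeroE)
    then show False using p w by simp
  qed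
  then have "\<not> constant (poly p)" by (simp add: constant_degree)
  then obtain c where "poly p c = 0" using fundamental_theorem_of_algebra by blast
  then obtain q where q: "p = [:- c, 1:] * q" by (auto simp: poly_eq_0_iff_dvd elim: dvdE)
  have "q \<noteq> 0" using q p by auto
  moreover have "Polynomial.degree p = Polynomial.degree [:- c, 1:] + Polynomial.degree q"
    unfolding q by (rule degree_mult_eq) (use \<open>q \<noteq> 0\<close> in auto)
  ultimately have "poly_act x w q \<noteq> 0" using min[of q] by auto
  moreover have "\<mu> x (poly_act x w q) = c *s poly_act x w q"
  proof -
    have "p = Polynomial.smult (- c) q + pCons 0 q" by (simp add: q)
    then have "0 = poly_act x w (Polynomial.smult (- c) q + pCons 0 q)" using p(2) by simp
    also have "\<dots> = \<mu> x (poly_act x w q) - c *s poly_act x w q"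
      unfolding poly_act_add poly_act_smult poly_act_pCons by simp
    finally show ?thesis by simp
  qed
  ultimately show ?thesis using poly_act_in[OF W(1) w(1)] by blast
qed

lemma injective_on_ideal_surjective:
  assumes W: "vec.subspace W" and L: "clin L" "L ` W \<subseteq> W" "\<And>w. w \<in> W \<Longrightarrow> L w = 0 \<Longrightarrow> w = 0"
  shows "L ` W = W"
proof -
  have "inj_on L W"
    using L(3) W by (auto simp: inj_on_def) (metis clin_diff[OF L(1)] right_minus_eq vec.subspace_diff)
  then have "inj_on L (vec.span W)" unfolding vec.span_eq_iff[THEN iffD2, OF W] .
  then have "vec.dim (L ` W) = vec.dim W" by (rule vec.dim_image_eq[OF L(1)])
  then show ?thesis
    using vec.subspace_dim_equal[OF vec.linear_subspace_image[OF L(1) W] W L(2)] by simp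
qed

text \<open>The kernels of the powers of \<open>y\<close> on \<open>W\<close> stabilise at the
  exponent \<open>m\<close> with the largest kernel dimension. \<open>K\<close> is this stable
  kernel, and the image of the same power is the complement; commutativity makes both
  ideals.\<close>

lemma Fitting:
  fixes y :: "complex ^ 'n"
  assumes W: "ideal W"
  defines "K \<equiv> {w \<in> W. \<exists>N. (\<mu> y ^^ N) w = 0}"
  obtains I where "ideal K" "ideal I" "I \<subseteq> W" "K \<inter> I = {0}" "\<And>w. w \<in> W \<Longrightarrow> \<exists>a\<in>K. \<exists>b\<in>I. w = a + b"
proof -
  have sW: "vec.subspace W" and iW: "\<And>x w. w \<in> W \<Longrightarrow> \<mu> x w \<in> W" using W by (auto simp: ideal_def)
  define k where "k m = {w \<in> W. (\<mu> y ^^ m) w = 0}" for m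
  have sk: "vec.subspace (k m)" for m
    unfolding k_def by (rule vec.subspaceI)
      (use sW in \<open>auto simp: clin_0[OF funpow_clin] clin_add[OF funpow_clin] clin_scale[OF funpow_clin]
        vec.subspace_0 vec.subspace_add vec.subspace_scale\<close>)
  have mono: "k m \<subseteq> k (m + j)" for m j
    unfolding k_def using funpow_zero_mono by blast
  have "\<exists>m. True \<and> (\<forall>j. True \<longrightarrow> vec.dim (k j) \<le> vec.dim (k m))"
    by (rule ex_has_greatest_nat[of _ 0 _ "Suc CARD('n)"]) (simp_all add: less_Suc_eq_le dim_subset_UNIV_cart_gen)
  then obtain m where m: "\<And>j. vec.dim (k j) \<le> vec.dim (k m)" by blast
  have stable: "k (m + j) = k m" for j
    using vec.subspace_dim_equal[OF sk sk mono m] by blast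
  have Kk: "K = k m"
  proof
    show "K \<subseteq> k m"
    proof
      fix w assume "w \<in> K"
      then obtain N where "w \<in> W" "(\<mu> y ^^ N) w = 0" by (auto simp: K_def)
      then have "w \<in> k (m + N)" using funpow_zero_mono[of N y w m] by (simp add: k_def add.commute)
      then show "w \<in> k m" using stable by blast
    qed
  qed (auto simp: K_def k_def)
  define I where "I = (\<mu> y ^^ m) ` W"
  have powW: "(\<mu> y ^^ j) w \<in> W" if "w \<in> W" for j w
    by (induction j) (use that iW in auto)
  have sI: "vec.subspace I"
    unfolding I_def by (rule vec.linear_subspace_image[OF funpow_clin sW])
  have iI: "\<mu> x w \<in> I" if wI: "w \<in> I" for x w
  proof -
    obtain v where "v \<in> W" "w = (\<mu> y ^^ m) v" using wI by (auto simp: I_def)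
    then have "\<mu> x w = (\<mu> y ^^ m) (\<mu> x v)" by (simp add: funpow_mult)
    then show ?thesis using iW \<open>v \<in> W\<close> by (auto simp: I_def)
  qed
  have KI: "w = 0" if wk: "w \<in> k j" and wI: "w \<in> I" for w j
  proof -
    obtain v where v: "v \<in> W" "w = (\<mu> y ^^ m) v" using wI by (auto simp: I_def)
    then have "v \<in> k (m + j)" using wk by (simp add: k_def funpow_add add.commute[of m])
    then have "v \<in> k m" using stable by blast
    then show ?thesis using v by (simp add: k_def)
  qed
  show ?thesis
  proof (rule that)
    show "ideal K"
      unfolding ideal_def Kk using sk iW by (auto simp: k_def funpow_mult)
    show "ideal I" using sI iI by (simp add: ideal_def)
    show "I \<subseteq> W" using powW by (auto simp: I_def)
    show "K \<inter> I = {0}" using KI[of _ m] sk sI Kk by (auto dest: vec.subspace_0)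
    fix w assume w: "w \<in> W"
    \<comment> \<open>The power is injective on \<open>I\<close>, hence surjective there by
      dimension; so \<open>w\<close> and some \<open>b\<close> in \<open>I\<close> have the same
      image, and \<open>w - b\<close> lies in the kernel.\<close>
    have "(\<mu> y ^^ m) ` I = I"
    proof (rule injective_on_ideal_surjective[OF sI funpow_clin])
      show "(\<mu> y ^^ m) ` I \<subseteq> I" using \<open>I \<subseteq> W\<close> by (auto simp: I_def)
      show "w = 0" if "w \<in> I" "(\<mu> y ^^ m) w = 0" for w
        using KI[of w m] that \<open>I \<subseteq> W\<close> by (auto simp: k_def)
    qed
    moreover have "(\<mu> y ^^ m) w \<in> I" using w by (auto simp: I_def)
    ultimately obtain b where b: "b \<in> I" "(\<mu> y ^^ m) w = (\<mu> y ^^ m) b" by (metis imageE)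
    then have "w - b \<in> K"
      using w \<open>I \<subseteq> W\<close> sW by (auto simp: Kk k_def clin_diff[OF funpow_clin] intro: vec.subspace_diff)
    then show "\<exists>a\<in>K. \<exists>b\<in>I. w = a + b" using b by (intro bexI[of _ "w - b"] bexI[of _ b]) auto
  qed
qed

text \<open>Choose one eigenvalue \<open>c x\<close> on \<open>W\<close> for every \<open>x\<close>.
  If \<open>W\<close> is not contained in the generalized eigenspace of \<open>c\<close>, some
  \<open>x - c x *s u\<close> is not nilpotent on \<open>W\<close>, yet kills an eigenvector; its
  Fitting splitting is proper on both sides, and the induction on dimension applies.\<close>

lemma ideal_in_span:
  "ideal W \<Longrightarrow> W \<subseteq> vec.span (\<Union>(eigenspaces UNIV \<mu>))"
proof (induction "vec.dim W" arbitrary: W rule: less_induct)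
  case less
  note W = less.prems
  have sW: "vec.subspace W" using W by (simp add: ideal_def)
  show ?case
  proof (cases "W = {0}")
    case True
    then show ?thesis by (simp add: vec.span_zero)
  next
    case False
    define c where "c x = (SOME c. \<exists>w\<in>W. w \<noteq> 0 \<and> \<mu> x w = c *s w)" for x
    have c: "\<exists>w\<in>W. w \<noteq> 0 \<and> \<mu> x w = c x *s w" for x
      unfolding c_def by (rule someI_ex[OF eigenvector_exists[OF W False]])
    show ?thesis
    proof (cases "W \<subseteq> GE c")
      case True
      then have "GE c \<in> eigenspaces UNIV \<mu>"
        using False sW vec.subspace_0 unfolding eigenspaces_def by blast
      then show ?thesis using True vec.span_superset[of "\<Union>(eigenspaces UNIV \<mu>)"] by blast
    next
      case False
      then obtain w where "w \<in> W" "w \<notin> GE c" by blast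
      then obtain x where w: "w \<in> W" "\<And>N. (\<mu> (x - c x *s u) ^^ N) w \<noteq> 0"
        unfolding gen_eigenspace_iff by blast
      define K where "K = {w \<in> W. \<exists>N. (\<mu> (x - c x *s u) ^^ N) w = 0}"
      obtain I where KI: "ideal K" "ideal I" "I \<subseteq> W" "K \<inter> I = {0}" "\<And>w. w \<in> W \<Longrightarrow> \<exists>a\<in>K. \<exists>b\<in>I. w = a + b"
        using Fitting[OF W, of "x - c x *s u"] unfolding K_def by blast
      obtain v where v: "v \<in> W" "v \<noteq> 0" "\<mu> x v = c x *s v" using c by blast
      have "(\<mu> (x - c x *s u) ^^ 1) v = 0"
        using v by (simp add: mult_diff_left mult_scale_left mult_unit)
      then have "v \<in> K" using v K_def by blast
      have dimlt: "vec.dim J < vec.dim W" if "ideal J" "J \<subseteq> W" "J \<noteq> W" for J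
        using vec.subspace_dim_equal[of J W] that sW by (auto simp: ideal_def not_le[symmetric])
      have "K \<subseteq> W" "K \<noteq> W" using w by (auto simp: K_def)
      moreover have "I \<noteq> W" using v \<open>v \<in> K\<close> KI(4) by blast
      ultimately have "K \<subseteq> vec.span (\<Union>(eigenspaces UNIV \<mu>))" "I \<subseteq> vec.span (\<Union>(eigenspaces UNIV \<mu>))"
        using less.hyps dimlt KI(1-3) by blast+
      then show ?thesis using KI(5) vec.span_add by blast
    qed
  qed
qed

lemma eigenspace_props:
  assumes "Q \<in> eigenspaces UNIV \<mu>"
  shows "vec.subspace Q" "\<And>x v. v \<in> Q \<Longrightarrow> \<mu> x v \<in> Q" "Q \<noteq> {0}"
  using assms gen_eigenspace_subspace gen_eigenspace_ideal by (auto simp: eigenspaces_def)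

lemma eigenspaces_disjoint:
  "Q \<in> eigenspaces UNIV \<mu> \<Longrightarrow> R \<in> eigenspaces UNIV \<mu> \<Longrightarrow> Q \<noteq> R \<Longrightarrow> v \<in> Q \<Longrightarrow> v \<in> R \<Longrightarrow> v = 0"
  using gen_eigenspace_disjoint by (auto simp: eigenspaces_def)

lemma eigenspaces_mult_0:
  assumes "Q \<in> eigenspaces UNIV \<mu>" "R \<in> eigenspaces UNIV \<mu>" "Q \<noteq> R" "v \<in> Q" "w \<in> R"
  shows "\<mu> v w = 0"
  using eigenspaces_disjoint[OF assms(1-3)] eigenspace_props(2)[OF assms(1,4), of w]
    eigenspace_props(2)[OF assms(2,5), of v] mult_commute by metis

text \<open>The unit is a combination of finitely many vectors, each in some eigenspace. An
  eigenspace not among these would be annihilated by the unit, because different eigenspaces have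
  product 0; so there are only finitely many. Grouping the summands gives the components of the
  unit.\<close>

lemma unit_decomposition:
  obtains e where "finite (eigenspaces UNIV \<mu>)" "\<And>Q. Q \<in> eigenspaces UNIV \<mu> \<Longrightarrow> e Q \<in> Q"
    "(\<Sum>Q\<in>eigenspaces UNIV \<mu>. e Q) = u"
proof -
  let ?K = "eigenspaces UNIV \<mu>"
  have "u \<in> vec.span (\<Union>?K)"
    using ideal_in_span[of UNIV] by (auto simp: ideal_def vec.subspace_UNIV)
  then obtain t r where t: "finite t" "t \<subseteq> \<Union>?K" "u = (\<Sum>a\<in>t. r a *s a)"
    unfolding vec.span_explicit by blast
  then have "\<forall>a\<in>t. \<exists>Q. Q \<in> ?K \<and> a \<in> Q" by blast
  then obtain q where q: "\<And>a. a \<in> t \<Longrightarrow> q a \<in> ?K \<and> a \<in> q a" by metis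
  have "?K \<subseteq> q ` t"
  proof (rule ccontr)
    assume "\<not> ?K \<subseteq> q ` t"
    then obtain Q where Q: "Q \<in> ?K" "Q \<notin> q ` t" by blast
    then obtain v where v: "v \<in> Q" "v \<noteq> 0" using eigenspace_props[OF Q(1)] vec.subspace_0 by blast
    have "\<mu> u v = (\<Sum>a\<in>t. r a *s \<mu> a v)"
      unfolding t(3) mult_sum_left mult_scale_left ..
    also have "\<dots> = 0"
    proof (rule sum.neutral, rule ballI)
      fix a assume "a \<in> t"
      then have "\<mu> a v = 0" using q Q v eigenspaces_mult_0[of "q a" Q a v] by blast
      then show "r a *s \<mu> a v = 0" by simp
    qed
    finally show False using v by (simp add: mult_unit)
  qed
  then have fin: "finite ?K" using t(1) finite_subset by blast
  define e where "e Q = (\<Sum>a\<in>{a\<in>t. q a = Q}. r a *s a)" for Q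
  have "e Q \<in> Q" if "Q \<in> ?K" for Q
    unfolding e_def using q eigenspace_props(1)[OF that] by (intro vec.subspace_sum) (auto intro: vec.subspace_scale)
  moreover have "(\<Sum>Q\<in>?K. e Q) = u"
    unfolding e_def t(3) by (rule sum.group[OF t(1) fin]) (use q in auto)
  ultimately show ?thesis using that fin by blast
qed

end

text \<open>\<open>e Q\<close> is the component of the unit in \<open>Q\<close>; multiplication by
  it is the projection to \<open>Q\<close>.\<close>

locale decomposed_algebra = unital_algebra +
  fixes K e
  assumes K_def: "K = eigenspaces UNIV \<mu>" and finite_K: "finite K"
    and e_in: "Q \<in> K \<Longrightarrow> e Q \<in> Q" and e_sum: "(\<Sum>Q\<in>K. e Q) = u"
begin

lemma e_mult_same: 
  assumes "Q \<in> K" "v \<in> Q"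
  shows "\<mu> (e Q) v = v"
proof -
  have "v = (\<Sum>R\<in>K. \<mu> (e R) v)"
    using mult_unit[of v] unfolding e_sum[symmetric] mult_sum_left by simp
  also have "\<dots> = (\<Sum>R\<in>K. if R = Q then \<mu> (e Q) v else 0)"
    by (rule sum.cong) (use assms e_in eigenspaces_mult_0 K_def in auto)
  also have "\<dots> = \<mu> (e Q) v" using assms finite_K by simp
  finally show ?thesis by simp
qed

lemma e_mult_other: "Q \<in> K \<Longrightarrow> R \<in> K \<Longrightarrow> Q \<noteq> R \<Longrightarrow> v \<in> R \<Longrightarrow> \<mu> (e Q) v = 0"
  using eigenspaces_mult_0 e_in K_def by blast

lemma e_mult_in: "Q \<in> K \<Longrightarrow> \<mu> (e Q) v \<in> Q"
  using eigenspace_props(2) e_in K_def mult_commute by metis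

lemma sum_e_mult: "(\<Sum>Q\<in>K. \<mu> (e Q) v) = v"
  unfolding mult_sum_left[symmetric] e_sum mult_unit ..

lemma e_mult_sum:
  assumes "Q \<in> K" "\<And>R. R \<in> K \<Longrightarrow> y R \<in> R"
  shows "\<mu> (e Q) (\<Sum>R\<in>K. y R) = y Q"
proof -
  have "\<mu> (e Q) (\<Sum>R\<in>K. y R) = (\<Sum>R\<in>K. \<mu> (e Q) (y R))" by (rule mult_sum_right)
  also have "\<dots> = (\<Sum>R\<in>K. if R = Q then y Q else 0)"
    by (rule sum.cong) (use assms e_mult_same e_mult_other in auto)
  finally show ?thesis using assms(1) finite_K by simp
qed

lemma eigenspaces_direct_sum: "direct_sum K (\<lambda>Q. Q) UNIV"
  unfolding direct_sum_def
proof (intro conjI ballI allI impI finite_K)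
  show "vec.subspace Q" if "Q \<in> K" for Q using that eigenspace_props K_def by blast
  show "UNIV = {\<Sum>Q\<in>K. y Q |y. \<forall>Q\<in>K. y Q \<in> Q}"
    using sum_e_mult e_mult_in by (auto intro!: exI[of _ "\<lambda>Q. \<mu> (e Q) _"] simp: sum_e_mult e_mult_in)
  show "y Q = 0" if "(\<forall>Q\<in>K. y Q \<in> Q) \<and> (\<Sum>Q\<in>K. y Q) = 0" "Q \<in> K" for y Q
    using e_mult_sum[of Q y] that by simp
qed

lemma component_eq: "Q \<in> K \<Longrightarrow> component K (\<lambda>Q. Q) Q x = \<mu> (e Q) x"
proof -
  assume Q: "Q \<in> K"
  let ?P = "\<lambda>y. (\<forall>R\<in>K. y R \<in> R) \<and> x = (\<Sum>R\<in>K. y R)"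
  have "?P (\<lambda>R. \<mu> (e R) x)" by (simp add: sum_e_mult e_mult_in)
  then have "?P (Eps ?P)" by (rule someI[of ?P])
  then have y: "\<And>R. R \<in> K \<Longrightarrow> Eps ?P R \<in> R" "x = (\<Sum>R\<in>K. Eps ?P R)" by blast+
  have "\<mu> (e Q) x = \<mu> (e Q) (\<Sum>R\<in>K. Eps ?P R)" by (rule arg_cong[OF y(2)])
  also have "\<dots> = Eps ?P Q" by (rule e_mult_sum[OF Q y(1)])
  finally show ?thesis unfolding component_def ..
qed

text \<open>A splitting of \<open>Q\<close> splits its unit, and the part \<open>y True\<close> acts
  as 1 on one summand and as 0 on the other. But every element has a single generalized eigenvalue
  on \<open>Q\<close>.\<close>

lemma eigenspace_irreducible:
  assumes Q: "Q \<in> K"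
  shows "irreducible_algebra Q \<mu>"
  unfolding irreducible_algebra_def
proof (intro conjI notI)
  assume "Q = {0}"
  then show False using Q eigenspace_props K_def by blast
next
  assume "\<exists>A :: bool \<Rightarrow> (complex ^ 'a) set. direct_sum UNIV A Q \<and>
          (\<forall>i. A i \<noteq> {0} \<and> (\<forall>v\<in>A i. \<forall>w\<in>A i. \<mu> v w \<in> A i)) \<and>
          (\<forall>v\<in>A True. \<forall>w\<in>A False. \<mu> v w = 0)"
  then obtain A :: "bool \<Rightarrow> (complex ^ 'a) set" where A: "direct_sum UNIV A Q" "\<And>i. A i \<noteq> {0}"
    "\<And>i v w. v \<in> A i \<Longrightarrow> w \<in> A i \<Longrightarrow> \<mu> v w \<in> A i" "\<And>v w. v \<in> A True \<Longrightarrow> w \<in> A False \<Longrightarrow> \<mu> v w = 0"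
    by blast
  have sA: "vec.subspace (A i)" for i using A(1) by (simp add: direct_sum_def)
  have Qsum: "Q = {y False + y True |y. y False \<in> A False \<and> y True \<in> A True}"
    using A(1) unfolding direct_sum_def by (simp add: UNIV_bool)
  then obtain y where y: "e Q = y False + y True" "y False \<in> A False" "y True \<in> A True" using e_in[OF Q] by blast
  have sub: "A i \<subseteq> Q" for i
  proof
    fix v assume "v \<in> A i"
    then have "(\<lambda>j. if j = i then v else 0) False \<in> A False \<and> (\<lambda>j. if j = i then v else 0) True \<in> A True"
      using sA vec.subspace_0 by auto
    moreover have "v = (\<lambda>j. if j = i then v else 0) False + (\<lambda>j. if j = i then v else 0) True" by (cases i) auto
    ultimately show "v \<in> Q" unfolding Qsum mem_Collect_eq by (rule exI[rotated, where x="\<lambda>j. if j = i then v else 0", OF conjI[rotated]])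
  qed
  have act1: "\<mu> (y True) v = v" if "v \<in> A True" for v
    using e_mult_same[OF Q, of v] that sub A(4)[OF that y(2)] mult_commute[of "y False" v]
    by (auto simp: y(1) mult_add_left)
  have act0: "\<mu> (y True) v = 0" if "v \<in> A False" for v
    using A(4)[OF y(3) that] .
  have "\<exists>v\<in>A i. v \<noteq> 0" for i
    using A(2)[of i] vec.subspace_0[OF sA[of i]] by blast
  then obtain v w where v: "v \<in> A True" "v \<noteq> 0" and w: "w \<in> A False" "w \<noteq> 0"
    by blast
  obtain c where c: "Q = GE c" using Q K_def by (auto simp: eigenspaces_def)
  have vw: "v \<in> GE c" "w \<in> GE c" using sub v w c by auto
  have "(\<mu> (y True - 1 *s u) ^^ 1) v = 0" "(\<mu> (y True - 0 *s u) ^^ 1) w = 0"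
    using act1[OF v(1)] act0[OF w(1)] by (simp_all add: mult_diff_left mult_scale_left mult_unit)
  then have "c (y True) = 1" "c (y True) = 0"
    using vw generalized_eigenvalue_unique[OF v(2)] generalized_eigenvalue_unique[OF w(2)]
    unfolding gen_eigenspace_iff by metis+
  then show False by simp
qed

end

section \<open>Idempotent vector fields\<close>

lemma F_structureI:
  fixes m :: "'n::finite tmult"
  assumes T: "open T" and m: "\<And>v w. holo_on T (\<lambda>x. m x v w)" and alg: "\<And>x. x \<in> T \<Longrightarrow> unital_algebra (m x) (e x)"
    and e: "holo_on T e"
    and int: "\<And>W X Y Z V x. open W \<Longrightarrow> W \<subseteq> T \<Longrightarrow> holo_on W X \<Longrightarrow> holo_on W Y \<Longrightarrow> holo_on W Z \<Longrightarrow> holo_on W V \<Longrightarrow> x \<in> W \<Longrightarrow>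
      lie_mult m (\<lambda>y. m y (X y) (Y y)) Z V x = m x (X x) (lie_mult m Y Z V x) + m x (Y x) (lie_mult m X Z V x)"
  shows "F_structure UNIV T m e"
  unfolding F_structure_def
proof (intro conjI ballI allI impI)
  show "(UNIV :: (complex ^ 'n) set) \<noteq> {0}"
    by (metis UNIV_I axis_eq_0_iff singletonD zero_neq_one)
  fix x assume x: "x \<in> T"
  interpret A: unital_algebra "m x" "e x" by (rule alg[OF x])
  show "m x (a *s u + b *s v) w = a *s m x u w + b *s m x v w" for a b u v w
    unfolding A.mult_add_left A.mult_scale_left ..
  show "m x v w = m x w v" for v w by (rule A.mult_commute)
  show "m x (m x u v) w = m x u (m x v w)" for u v w by (rule A.mult_assoc)
  show "m x (e x) v = v" for v by (rule A.mult_unit)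
qed (use T m e int in \<open>auto simp: vfield_def vec.subspace_UNIV\<close>)

lemma eventually_nhdsE:
  assumes "\<forall>\<^sub>F x in nhds p. P x"
  obtains T where "open T" "p \<in> T" "\<And>x. x \<in> T \<Longrightarrow> P x"
  using assms unfolding eventually_nhds by blast

locale F_manifold_chart =
  fixes S :: "(complex ^ 'n) set" and m :: "'n tmult" and e :: "complex ^ 'n \<Rightarrow> complex ^ 'n"
  assumes F_structure: "F_structure UNIV S m e"
begin

lemma open_S: "open S"
  using F_structure by (simp add: F_structure_def)

lemma mult_holo: "holo_on S (\<lambda>x. m x v w)"
  using F_structure by (auto simp: F_structure_def vfield_def)

lemma unit_holo: "holo_on S e"
  using F_structure by (auto simp: F_structure_def vfield_def)

lemma integrability:
  assumes "open W" "W \<subseteq> S" "holo_on W X" "holo_on W Y" "holo_on W Z" "holo_on W T" "x \<in> W"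
  shows "lie_mult m (\<lambda>y. m y (X y) (Y y)) Z T x =
    m x (X x) (lie_mult m Y Z T x) + m x (Y x) (lie_mult m X Z T x)"
  using F_structure assms unfolding F_structure_def by (simp add: vfield_def)

lemma algebra_at:
  assumes "x \<in> S"
  shows "unital_algebra (m x) (e x)"
proof -
  have comm: "m x v w = m x w v" for v w
    using F_structure assms by (simp add: F_structure_def)
  have "\<forall>x\<in>S. \<forall>u\<in>UNIV. \<forall>v\<in>UNIV. \<forall>w\<in>UNIV. \<forall>a b. m x (a *s u + b *s v) w = a *s m x u w + b *s m x v w"
    using F_structure unfolding F_structure_def by (elim conjE) assumption
  then have lin: "m x (a *s u + b *s v) w = a *s m x u w + b *s m x v w" for a b u v w
    using assms by blast
  show ?thesis
  proof (rule unital_algebra.intro)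
    show "clin (m x v)" for v
    proof (rule clinI)
      show "m x v (u + w) = m x v u + m x v w" for u w
        using lin[of 1 u 1 w v] by (simp add: comm[of v])
      show "m x v (c *s u) = c *s m x v u" for c u
        using lin[of c u 0 0 v] by (simp add: comm[of v])
    qed
    show "m x v w = m x w v" for v w by (rule comm)
    have "\<forall>x\<in>S. \<forall>u\<in>UNIV. \<forall>v\<in>UNIV. \<forall>w\<in>UNIV. m x (m x u v) w = m x u (m x v w)"
      using F_structure unfolding F_structure_def by (elim conjE) assumption
    then show "m x (m x u v) w = m x u (m x v w)" for u v w
      using assms by blast
    have "\<forall>x\<in>S. \<forall>v\<in>UNIV. m x (e x) v = v"
      using F_structure unfolding F_structure_def by (elim conjE) assumption
    then show "m x (e x) v = v" for v
      using assms by blast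
  qed
qed

lemma mult_clin: "x \<in> S \<Longrightarrow> clin (m x v)"
  by (rule unital_algebra.mult_clin[OF algebra_at])

lemma mult_clin_left: "x \<in> S \<Longrightarrow> clin (\<lambda>v. m x v w)"
  by (rule clinI) (simp_all add: unital_algebra.mult_add_left[OF algebra_at] unital_algebra.mult_scale_left[OF algebra_at])

lemma holo_mult_fields:
  assumes "W \<subseteq> S" "holo_on W X" "holo_on W Y"
  shows "holo_on W (\<lambda>x. m x (X x) (Y x))"
proof (rule holo_on_linear_family[where A="\<lambda>x. m x (X x)"])
  show "clin (m x (X x))" if "x \<in> W" for x using mult_clin that assms(1) by blast
  show "holo_on W (\<lambda>x. m x (X x) v)" for v
  proof (rule holo_on_linear_family[where A="\<lambda>x u. m x u v"])
    show "clin (\<lambda>u. m x u v)" if "x \<in> W" for x using mult_clin_left that assms(1) by blast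
    show "holo_on W (\<lambda>x. m x u v)" for u using mult_holo assms(1) by (rule holo_on_subset)
  qed (rule assms)
qed (rule assms)

lemma restrict:
  assumes "open T" "T \<subseteq> S"
  shows "F_structure UNIV T m e"
proof (rule F_structureI)
  show "unital_algebra (m x) (e x)" if "x \<in> T" for x
    by (rule algebra_at) (use that assms in blast)
  fix W X Y Z V x
  assume "open W" "W \<subseteq> T" "holo_on W X" "holo_on W Y" "holo_on W Z" "holo_on W V" "x \<in> W"
  then show "lie_mult m (\<lambda>y. m y (X y) (Y y)) Z V x =
    m x (X x) (lie_mult m Y Z V x) + m x (Y x) (lie_mult m X Z V x)"
    using assms(2) by (intro integrability) auto
qed (intro assms holo_on_subset[OF mult_holo] holo_on_subset[OF unit_holo])+

lemma mult_bound:
  assumes p: "p \<in> S"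
  obtains C r where "C > 0" "r > 0" "cball p r \<subseteq> S" "\<And>x v w. x \<in> cball p r \<Longrightarrow> norm (m x v w) \<le> C * norm v * norm w"
proof -
  obtain r where r: "r > 0" "cball p r \<subseteq> S"
    using open_S p open_contains_cball[of S] by blast
  have inS: "x \<in> S" if "x \<in> cball p r" for x using r that by blast
  have "\<exists>c\<ge>0. \<forall>x v. x \<in> cball p r \<longrightarrow> norm (m x v (axis i 1)) \<le> c * norm v" for i
  proof -
    obtain c where "c \<ge> 0" "\<And>x v. x \<in> cball p r \<Longrightarrow> norm (m x v (axis i 1)) \<le> c * norm v"
    proof (rule linear_family_compact_bound[of "cball p r" "\<lambda>x v. m x v (axis i 1)"])
      show "continuous_on (cball p r) (\<lambda>x. m x v (axis i 1))" for v
        using holo_on_imp_continuous_on[OF mult_holo] r(2) by (rule continuous_on_subset)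
    qed (use mult_clin_left inS in auto)
    then show ?thesis by blast
  qed
  then obtain c where c: "\<And>i. c i \<ge> 0" "\<And>i x v. x \<in> cball p r \<Longrightarrow> norm (m x v (axis i 1)) \<le> c i * norm v"
    by metis
  define C where "C = (\<Sum>i\<in>UNIV. c i)"
  have C: "C \<ge> 0" "c i \<le> C" for i
    unfolding C_def using c(1) member_le_sum[of i UNIV c] by (auto intro: sum_nonneg)
  have "norm (m x v w) \<le> (real CARD('n) * C + 1) * norm v * norm w" if x: "x \<in> cball p r" for x v w
  proof -
    have "norm (m x v w) \<le> real CARD('n) * (C * norm v) * norm w"
    proof (rule linear_family_bound[of "{x}" "\<lambda>x. m x v"])
      show "norm (m y v (axis i 1)) \<le> C * norm v" if "y \<in> {x}" for i y
        using c(2)[OF x, of v i] mult_right_mono[OF C(2) norm_ge_zero[of v], of i] that by auto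
    qed (use mult_clin inS x in auto)
    also have "\<dots> \<le> (real CARD('n) * C + 1) * norm v * norm w"
      by (simp add: algebra_simps)
    finally show ?thesis .
  qed
  moreover have "real CARD('n) * C + 1 > 0" using C(1) by (simp add: add_nonneg_pos)
  ultimately show ?thesis using that r by blast
qed

text \<open>The difference h of two commuting idempotents satisfies h^3 = h. Hence |h| \<le> (C
  |h|)^2 |h|, which is impossible for h \<noteq> 0 when C |h| < 1.\<close>

lemma idempotents_eq:
  assumes "x \<in> S" "m x a a = a" "m x b b = b" "\<And>v w. norm (m x v w) \<le> C * norm v * norm w" "C * norm (a - b) < 1" "C > 0"
  shows "a = b"
proof (rule ccontr)
  interpret A: unital_algebra "m x" "e x" by (rule algebra_at[OF assms(1)])
  assume "a \<noteq> b"
  let ?h = "a - b"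
  define c where "c = m x a b"
  have ab: "m x a c = c" "m x b c = c" "m x b a = c"
    using assms(2,3) A.mult_assoc[of a a b] A.mult_left_commute[of b a b] A.mult_commute by (auto simp: c_def)
  have h: "m x ?h a = a - c" "m x ?h b = c - b" "m x ?h c = 0"
    unfolding A.mult_diff_left assms(2,3) ab c_def[symmetric] by simp_all
  have hh: "m x ?h ?h = (a - c) - (c - b)"
    unfolding A.mult_diff_right h ..
  have "m x ?h (m x ?h ?h) = ?h"
    unfolding hh A.mult_diff_right h by simp
  then have "norm ?h \<le> C * norm ?h * norm (m x ?h ?h)" using assms(4)[of ?h "m x ?h ?h"] by simp
  also have "\<dots> \<le> C * norm ?h * (C * norm ?h * norm ?h)"
    using assms(4)[of ?h ?h] assms(6) by (intro mult_left_mono) auto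
  also have "\<dots> = ((C * norm ?h) * (C * norm ?h)) * norm ?h" by simp
  also have "\<dots> < 1 * norm ?h"
  proof (rule mult_strict_right_mono)
    show "C * norm ?h * (C * norm ?h) < 1"
      using mult_strict_mono[of "C * norm ?h" 1 "C * norm ?h" 1] assms(5,6) by simp
  qed (use \<open>a \<noteq> b\<close> in simp)
  finally show False by simp
qed

text \<open>One bound for the multiplication near \<open>p\<close> makes the isolation of
  idempotents uniform there, and continuity keeps the two fields within the critical
  distance.\<close>

lemma idempotent_fields_agree:
  assumes T: "open T" "p \<in> T" "T \<subseteq> S" and "continuous_on T a" "continuous_on T b" "a p = b p"
    and "\<And>x. x \<in> T \<Longrightarrow> m x (a x) (a x) = a x" "\<And>x. x \<in> T \<Longrightarrow> m x (b x) (b x) = b x"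
  shows "\<forall>\<^sub>F x in nhds p. a x = b x"
proof -
  have "p \<in> S" using T by blast
  obtain C r where C: "C > 0" "r > 0" "\<And>x v w. x \<in> cball p r \<Longrightarrow> norm (m x v w) \<le> C * norm v * norm w"
    using mult_bound[OF \<open>p \<in> S\<close>] by metis
  have "continuous_on T (\<lambda>x. C * norm (a x - b x))"
    by (intro continuous_intros assms)
  then have "isCont (\<lambda>x. C * norm (a x - b x)) p" using T by (simp add: continuous_on_eq_continuous_at)
  then have "((\<lambda>x. C * norm (a x - b x)) \<longlongrightarrow> C * norm (a p - b p)) (nhds p)"
    unfolding isCont_def tendsto_at_iff_tendsto_nhds[of "\<lambda>x. C * norm (a x - b x)" p] .
  then have "\<forall>\<^sub>F x in nhds p. C * norm (a x - b x) < 1"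
    by (rule order_tendstoD) (simp add: assms)
  moreover have "\<forall>\<^sub>F x in nhds p. x \<in> T" using T by (intro eventually_nhds_in_open)
  moreover have "\<forall>\<^sub>F x in nhds p. x \<in> ball p r" using C by (intro eventually_nhds_in_open) auto
  ultimately show ?thesis
  proof eventually_elim
    case (elim x)
    show ?case
      by (rule idempotents_eq[of x _ _ C]) (use elim assms C T in auto)
  qed
qed

text \<open>Newton's method: \<open>2 a - e p\<close> is its own inverse and is the derivative of \<open>v \<mapsto> v\<^sup>2 - v\<close> at \<open>a\<close>.\<close>

lemma idempotent_extends:
  assumes p: "p \<in> S" and a: "m p a a = a"
  obtains T E where "open T" "p \<in> T" "T \<subseteq> S" "holo_on T E" "E p = a" "\<And>x. x \<in> T \<Longrightarrow> m x (E x) (E x) = E x"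
proof -
  interpret A: unital_algebra "m p" "e p" by (rule algebra_at[OF p])
  define N where "N = m p ((a + a) - e p)"
  have N_clin: "clin N" unfolding N_def by (rule A.mult_clin)
  have NN: "N (N v) = v" for v
  proof -
    have aa: "m p a (m p a v) = m p a v" using a A.mult_assoc[of a a v] by simp
    have Nx: "N x = m p a x + m p a x - x" for x
      by (simp only: N_def A.mult_diff_left A.mult_add_left A.mult_unit)
    show ?thesis
      unfolding Nx A.mult_diff_right A.mult_add_right aa by simp
  qed
  obtain B where B: "B > 0" "\<And>v. norm (N v) \<le> B * norm v"
    using bounded_linear.pos_bounded[OF clin_bounded_linear[OF N_clin]] by (metis mult.commute)
  obtain C r0 where C: "C > 0" "r0 > 0" "cball p r0 \<subseteq> S" "\<And>x v w. x \<in> cball p r0 \<Longrightarrow> norm (m x v w) \<le> C * norm v * norm w"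
    using mult_bound[OF p] by metis
  \<comment> \<open>Gives \<open>C * (2 * r) = 1 / (4 * B)\<close>: replacing \<open>a + a\<close>
    by \<open>v + w\<close> within the ball costs \<open>1 / (4 * B)\<close>, moving the point costs
    as much again, and \<open>N\<close> multiplies by at most \<open>B\<close>. The total is the
    contraction factor 1/2.\<close>
  define r where "r = 1 / (8 * C * B)"
  have r: "r > 0" using B C by (simp add: r_def)
  have "\<forall>\<^sub>F x in nhds p. \<forall>h. norm (m x (a + a) h - m p (a + a) h) \<le> 1 / (4 * B) * norm h"
    by (rule linear_family_small[OF open_S p mult_clin holo_on_imp_continuous_on[OF mult_holo]]) (use B in auto)
  moreover have "\<forall>\<^sub>F x in nhds p. norm (m x a a - a) < r / (2 * B)"
  proof -
    have "continuous_on S (\<lambda>x. norm (m x a a - a))"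
      by (intro continuous_intros holo_on_imp_continuous_on[OF mult_holo])
    then have "isCont (\<lambda>x. norm (m x a a - a)) p" using open_S p by (simp add: continuous_on_eq_continuous_at)
    then have "((\<lambda>x. norm (m x a a - a)) \<longlongrightarrow> norm (m p a a - a)) (nhds p)"
      unfolding isCont_def tendsto_at_iff_tendsto_nhds[of "\<lambda>x. norm (m x a a - a)" p] .
    then show ?thesis by (rule order_tendstoD) (use a r B in simp)
  qed
  moreover have "\<forall>\<^sub>F x in nhds p. x \<in> ball p r0" using C by (intro eventually_nhds_in_open) auto
  ultimately have "\<forall>\<^sub>F x in nhds p. (\<forall>h. norm (m x (a + a) h - m p (a + a) h) \<le> 1 / (4 * B) * norm h) \<and>
      norm (m x a a - a) < r / (2 * B) \<and> x \<in> ball p r0"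
    by eventually_elim simp
  then obtain T where T: "open T" "p \<in> T" and small: "\<And>x h. x \<in> T \<Longrightarrow> norm (m x (a + a) h - m p (a + a) h) \<le> 1 / (4 * B) * norm h"
    "\<And>x. x \<in> T \<Longrightarrow> norm (m x a a - a) < r / (2 * B)" "T \<subseteq> ball p r0"
    unfolding eventually_nhds by blast
  have TC: "x \<in> cball p r0" "x \<in> S" if "x \<in> T" for x using that small(3) C(3) ball_subset_cball by blast+
  \<comment> \<open>The Newton step with the inverse derivative frozen at \<open>a\<close> and
    \<open>p\<close>; its fixed points are exactly the idempotents because \<open>N\<close> is
    injective.\<close>
  define G where "G x v = v - N (m x v v - v)" for x v
  have contr: "norm (G x v - G x w) \<le> norm (v - w) / 2" if x: "x \<in> T" and v: "v \<in> cball a r" and w: "w \<in> cball a r" for x v w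
  proof -
    interpret X: unital_algebra "m x" "e x" by (rule algebra_at[OF TC(2)[OF x]])
    define h where "h = v - w"
    have h: "N (m p (a + a) h - h) = h"
      using NN[of h] by (simp only: N_def A.mult_diff_left A.mult_unit)
    have sq: "(m x v v - v) - (m x w w - w) = m x (v + w) h - h"
      unfolding h_def X.mult_diff_right X.mult_add_left X.mult_commute[of w v] by simp
    have "G x v - G x w = h - (N (m x v v - v) - N (m x w w - w))"
      by (simp add: G_def h_def)
    also have "\<dots> = N (m p (a + a) h - h) - N (m x (v + w) h - h)"
      unfolding clin_diff[OF N_clin, symmetric] sq h ..
    also have "\<dots> = N (m p (a + a) h - m x (v + w) h)"
      unfolding clin_diff[OF N_clin, symmetric] by (rule arg_cong[where f=N]) simp
    also have "m p (a + a) h - m x (v + w) h = (m p (a + a) h - m x (a + a) h) + m x ((a + a) - (v + w)) h"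
      by (simp add: X.mult_diff_left)
    finally have eq: "G x v - G x w = N ((m p (a + a) h - m x (a + a) h) + m x ((a + a) - (v + w)) h)" .
    have "norm ((a + a) - (v + w)) \<le> 2 * r"
    proof -
      have "(a + a) - (v + w) = (a - v) + (a - w)" by simp
      then have "norm ((a + a) - (v + w)) \<le> norm (a - v) + norm (a - w)" using norm_triangle_ineq by metis
      then show ?thesis using v w by (simp add: dist_norm)
    qed
    then have "C * norm ((a + a) - (v + w)) * norm h \<le> C * (2 * r) * norm h"
      using C(1) by (intro mult_right_mono mult_left_mono) auto
    moreover have "C * (2 * r) = 1 / (4 * B)" using C(1) B(1) by (simp add: r_def field_simps)
    ultimately have 2: "norm (m x ((a + a) - (v + w)) h) \<le> 1 / (4 * B) * norm h"
      using C(4)[OF TC(1)[OF x], of "(a + a) - (v + w)" h] by simp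
    have 1: "norm (m p (a + a) h - m x (a + a) h) \<le> 1 / (4 * B) * norm h"
      using small(1)[OF x, of h] by (simp add: norm_minus_commute)
    have "norm (G x v - G x w) \<le> B * (1 / (4 * B) * norm h + 1 / (4 * B) * norm h)"
      unfolding eq using B(2) 1 2 B(1)
      by (meson add_mono less_imp_le mult_left_mono norm_triangle_le order_trans)
    also have "\<dots> = norm h / 2" using B(1) by (simp add: field_simps)
    finally show ?thesis by (simp add: h_def)
  qed
  have start: "norm (G x a - a) \<le> r / 2" if "x \<in> T" for x
  proof -
    have "norm (G x a - a) = norm (N (m x a a - a))" by (simp add: G_def)
    also have "\<dots> \<le> B * norm (m x a a - a)" by (rule B(2))
    also have "\<dots> \<le> B * (r / (2 * B))" using small(2)[OF that] B(1) by (intro mult_left_mono) auto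
    finally show ?thesis using B(1) by simp
  qed
  have a_in: "a \<in> cball a r" using r by simp
  have into: "G x v \<in> cball a r" if "x \<in> T" "v \<in> cball a r" for x v
  proof -
    have "norm (G x v - a) \<le> norm (G x v - G x a) + norm (G x a - a)"
      using norm_triangle_ineq[of "G x v - G x a" "G x a - a"] by simp
    also have "\<dots> \<le> r" using contr[OF that a_in] start[OF that(1)] that(2) by (simp add: dist_norm norm_minus_commute)
    finally show ?thesis by (simp add: dist_norm norm_minus_commute)
  qed
  obtain E where E: "holo_on T E" "E ` T \<subseteq> cball a r" "\<And>x. x \<in> T \<Longrightarrow> G x (E x) = E x"
  proof (rule holo_fixpoint[of T "cball a r" "\<lambda>_. a" "\<lambda>f x. G x (f x)"])
    show "holo_on T (\<lambda>x. G x (f x))" if "holo_on T f" for f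
      unfolding G_def
      by (intro holo_on_diff holo_on_clin[OF N_clin] that holo_mult_fields) (use TC in auto)
    show "(\<lambda>x. G x (f x)) ` T \<subseteq> cball a r" if "f ` T \<subseteq> cball a r" for f
      using that into by blast
    show "dist (G z (f z)) (G z (g z)) \<le> d / 2"
      if "f ` T \<subseteq> cball a r" "g ` T \<subseteq> cball a r" "\<And>z. z \<in> T \<Longrightarrow> dist (f z) (g z) \<le> d" "z \<in> T" for f g d z
    proof -
      have "norm (G z (f z) - G z (g z)) \<le> norm (f z - g z) / 2"
        by (rule contr) (use that in auto)
      also have "\<dots> \<le> d / 2" using that(3)[OF that(4)] by (simp add: dist_norm)
      finally show ?thesis by (simp add: dist_norm)
    qed
  qed (use T r in auto)
  have "m x (E x) (E x) = E x" if "x \<in> T" for x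
  proof -
    have "N (m x (E x) (E x) - E x) = 0" using E(3)[OF that] by (simp add: G_def)
    then have "m x (E x) (E x) - E x = N 0" using NN by metis
    then show ?thesis by (simp add: clin_0[OF N_clin])
  qed
  moreover have "E p = a"
  proof -
    have "G p a = a" by (simp add: G_def a clin_0[OF N_clin])
    then have "norm (E p - a) \<le> norm (E p - a) / 2"
      using contr[OF T(2) _ a_in, of "E p"] E(2,3) T(2) by fastforce
    then show ?thesis by simp
  qed
  moreover have "T \<subseteq> S" using TC by blast
  ultimately show ?thesis using that T E(1) by blast
qed

text \<open>The idempotents are extended one at a time. The products of two of them are again
  idempotent and vanish at \<open>p\<close>, hence near \<open>p\<close>. Only this orthogonality
  makes their sum idempotent, and then the sum is the unit near \<open>p\<close> for the same
  reason.\<close>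

lemma orthogonal_idempotents_extend:
  assumes p: "p \<in> S" and D: "decomposed_algebra (m p) (e p) K \<epsilon>"
  obtains T E where "open T" "p \<in> T" "T \<subseteq> S" "\<And>Q. Q \<in> K \<Longrightarrow> holo_on T (E Q)" "\<And>Q. Q \<in> K \<Longrightarrow> E Q p = \<epsilon> Q"
    "\<And>Q x. Q \<in> K \<Longrightarrow> x \<in> T \<Longrightarrow> m x (E Q x) (E Q x) = E Q x"
    "\<And>Q R x. Q \<in> K \<Longrightarrow> R \<in> K \<Longrightarrow> Q \<noteq> R \<Longrightarrow> x \<in> T \<Longrightarrow> m x (E Q x) (E R x) = 0"
    "\<And>x. x \<in> T \<Longrightarrow> (\<Sum>Q\<in>K. E Q x) = e x"
proof -
  interpret D: decomposed_algebra "m p" "e p" K \<epsilon> by (rule D)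
  have "\<exists>T E. open T \<and> p \<in> T \<and> T \<subseteq> S \<and> holo_on T E \<and> E p = \<epsilon> Q \<and> (\<forall>x\<in>T. m x (E x) (E x) = E x)" if "Q \<in> K" for Q
    using idempotent_extends[OF p D.e_mult_same[OF that D.e_in[OF that]]] by metis
  then obtain T E where TE: "\<And>Q. Q \<in> K \<Longrightarrow> open (T Q) \<and> p \<in> T Q \<and> T Q \<subseteq> S \<and> holo_on (T Q) (E Q) \<and> E Q p = \<epsilon> Q \<and>
    (\<forall>x\<in>T Q. m x (E Q x) (E Q x) = E Q x)" by metis
  define T1 where "T1 = S \<inter> (\<Inter>Q\<in>K. T Q)"
  have T1: "open T1" "p \<in> T1" "T1 \<subseteq> S" "\<And>Q. Q \<in> K \<Longrightarrow> T1 \<subseteq> T Q"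
    using TE p open_S D.finite_K by (auto simp: T1_def intro!: open_Int open_INT)
  have E: "holo_on T1 (E Q)" "E Q p = \<epsilon> Q" "\<And>x. x \<in> T1 \<Longrightarrow> m x (E Q x) (E Q x) = E Q x" if "Q \<in> K" for Q
    using TE[OF that] T1(4)[OF that] holo_on_subset by blast+
  have orth: "\<forall>\<^sub>F x in nhds p. m x (E Q x) (E R x) = 0" if "Q \<in> K" "R \<in> K" "Q \<noteq> R" for Q R
  proof (rule idempotent_fields_agree[OF T1(1-3)])
    show "continuous_on T1 (\<lambda>x. m x (E Q x) (E R x))"
      by (rule holo_on_imp_continuous_on[OF holo_mult_fields[OF T1(3) E(1) E(1)]]) (use that in auto)
    show "m p (E Q p) (E R p) = 0"
      using D.e_mult_other[OF that D.e_in[OF that(2)]] E(2) that by simp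
    show "m x (m x (E Q x) (E R x)) (m x (E Q x) (E R x)) = m x (E Q x) (E R x)" if x: "x \<in> T1" for x
    proof -
      interpret X: unital_algebra "m x" "e x" by (rule algebra_at) (use x T1(3) in blast)
      have "m x (m x (E Q x) (E R x)) (m x (E Q x) (E R x)) = m x (m x (E Q x) (E Q x)) (m x (E R x) (E R x))"
        by (simp only: X.mult_assoc X.mult_commute X.mult_left_commute)
      then show ?thesis using E(3)[OF _ x] \<open>Q \<in> K\<close> \<open>R \<in> K\<close> by simp
    qed
    show "m x 0 0 = 0" if x: "x \<in> T1" for x
      by (rule unital_algebra.mult_zero_right[OF algebra_at]) (use x T1(3) in blast)
  qed auto
  have "\<forall>\<^sub>F x in nhds p. \<forall>Q\<in>K. \<forall>R\<in>K. Q \<noteq> R \<longrightarrow> m x (E Q x) (E R x) = 0"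
    using orth by (intro eventually_ball_finite ballI D.finite_K) (auto simp: eventually_conj_iff)
  moreover have "\<forall>\<^sub>F x in nhds p. x \<in> T1" using T1 by (intro eventually_nhds_in_open)
  ultimately have "\<forall>\<^sub>F x in nhds p. (\<forall>Q\<in>K. \<forall>R\<in>K. Q \<noteq> R \<longrightarrow> m x (E Q x) (E R x) = 0) \<and> x \<in> T1"
    by eventually_elim simp
  then obtain T2 where T2': "open T2" "p \<in> T2"
    "\<And>x. x \<in> T2 \<Longrightarrow> (\<forall>Q\<in>K. \<forall>R\<in>K. Q \<noteq> R \<longrightarrow> m x (E Q x) (E R x) = 0) \<and> x \<in> T1"
    using eventually_nhdsE by blast
  then have T2: "open T2" "p \<in> T2" "T2 \<subseteq> T1"
    "\<And>Q R x. Q \<in> K \<Longrightarrow> R \<in> K \<Longrightarrow> Q \<noteq> R \<Longrightarrow> x \<in> T2 \<Longrightarrow> m x (E Q x) (E R x) = 0"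
    by auto
  have T2S: "T2 \<subseteq> S" using T1 T2 by blast
  have E2: "holo_on T2 (E Q)" "\<And>x. x \<in> T2 \<Longrightarrow> m x (E Q x) (E Q x) = E Q x" if "Q \<in> K" for Q
    using E[OF that] T2(3) holo_on_subset by blast+
  have "\<forall>\<^sub>F x in nhds p. (\<Sum>Q\<in>K. E Q x) = e x"
  proof (rule idempotent_fields_agree[OF T2(1,2) T2S])
    show "continuous_on T2 (\<lambda>x. \<Sum>Q\<in>K. E Q x)"
      by (intro holo_on_imp_continuous_on holo_on_sum E2)
    show "continuous_on T2 e" using unit_holo T2S holo_on_imp_continuous_on holo_on_subset by blast
    show "(\<Sum>Q\<in>K. E Q p) = e p" using D.e_sum E(2) by simp
    show "m x (e x) (e x) = e x" if "x \<in> T2" for x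
      by (rule unital_algebra.mult_unit[OF algebra_at]) (use that T2S in blast)
    show "m x (\<Sum>Q\<in>K. E Q x) (\<Sum>Q\<in>K. E Q x) = (\<Sum>Q\<in>K. E Q x)" if x: "x \<in> T2" for x
    proof -
      interpret X: unital_algebra "m x" "e x" by (rule algebra_at) (use x T2S in blast)
      have "m x (E Q x) (\<Sum>R\<in>K. E R x) = E Q x" if Q: "Q \<in> K" for Q
      proof -
        have "m x (E Q x) (\<Sum>R\<in>K. E R x) = (\<Sum>R\<in>K. if R = Q then E Q x else 0)"
          unfolding X.mult_sum_right by (rule sum.cong) (use E2(2) T2(4) Q x in auto)
        then show ?thesis using Q D.finite_K by simp
      qed
      then show ?thesis unfolding X.mult_sum_left by (intro sum.cong) auto
    qed
  qed
  moreover have "\<forall>\<^sub>F x in nhds p. x \<in> T2" using T2 by (intro eventually_nhds_in_open)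
  ultimately have "\<forall>\<^sub>F x in nhds p. (\<Sum>Q\<in>K. E Q x) = e x \<and> x \<in> T2"
    by eventually_elim simp
  then obtain T3 where T3: "open T3" "p \<in> T3" "T3 \<subseteq> T2" "\<And>x. x \<in> T3 \<Longrightarrow> (\<Sum>Q\<in>K. E Q x) = e x"
    unfolding eventually_nhds by blast
  show ?thesis
  proof (rule that[OF T3(1,2)])
    show "T3 \<subseteq> S" using T3(3) T2S by blast
    show "holo_on T3 (E Q)" if "Q \<in> K" for Q using E2(1)[OF that] T3(3) by (rule holo_on_subset)
    show "E Q p = \<epsilon> Q" if "Q \<in> K" for Q by (rule E(2)[OF that])
    show "m x (E Q x) (E Q x) = E Q x" if "Q \<in> K" "x \<in> T3" for Q x using E2(2) that T3(3) by blast
    show "m x (E Q x) (E R x) = 0" if "Q \<in> K" "R \<in> K" "Q \<noteq> R" "x \<in> T3" for Q R x using T2(4) that T3(3) by blast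
    show "(\<Sum>Q\<in>K. E Q x) = e x" if "x \<in> T3" for x by (rule T3(4)[OF that])
  qed
qed

end

section \<open>Straightening and change of coordinates\<close>

lemma lie_swap: "lie X Y x = - lie Y X x"
  by (simp add: lie_def)

lemma lie_cong:
  assumes "open S" "x \<in> S" "\<And>y. y \<in> S \<Longrightarrow> X y = X' y" "\<And>y. y \<in> S \<Longrightarrow> Y y = Y' y"
  shows "lie X Y x = lie X' Y' x"
  unfolding lie_def using assms dif_cong_open[OF assms(1,2), of X X'] dif_cong_open[OF assms(1,2), of Y Y'] by simp

lemma lie_mult_cong:
  assumes S: "open S" "x \<in> S" and eq: "\<And>y. y \<in> S \<Longrightarrow> X y = X' y" "\<And>y. y \<in> S \<Longrightarrow> Z y = Z' y" "\<And>y. y \<in> S \<Longrightarrow> V y = V' y"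
  shows "lie_mult m X Z V x = lie_mult m X' Z' V' x"
proof -
  have l: "lie X Y x = lie X' Y' x" if "\<And>y. y \<in> S \<Longrightarrow> Y y = Y' y" for Y Y'
    by (rule lie_cong[OF S eq(1) that])
  have "lie X (\<lambda>y. m y (Z y) (V y)) x = lie X' (\<lambda>y. m y (Z' y) (V' y)) x"
    by (rule l) (simp add: eq)
  moreover have "lie X Z x = lie X' Z' x" "lie X V x = lie X' V' x"
    by (rule l; simp add: eq)+
  ultimately show ?thesis
    unfolding lie_mult_def eq(2)[OF S(2)] eq(3)[OF S(2)] by simp
qed

lemma euler_fieldD:
  assumes "euler_field UNIV U m d X" "open W" "W \<subseteq> U" "holo_on W Z" "holo_on W T" "x \<in> W"
  shows "lie_mult m X Z T x = d *s m x (Z x) (T x)"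
proof -
  have "\<forall>W Z T. openin (top_of_set UNIV) W \<and> W \<subseteq> U \<and> vfield UNIV W Z \<and> vfield UNIV W T \<longrightarrow>
      (\<forall>x\<in>W. lie_mult m X Z T x = d *s m x (Z x) (T x))"
    using assms(1) unfolding euler_field_def by (rule conjunct2)
  from this[rule_format, of W Z T] show ?thesis using assms by (simp add: vfield_def)
qed

locale F_manifold_idempotents = F_manifold_chart S m e for S :: "(complex ^ 'n) set" and m e +
  fixes K :: "'k set" and E :: "'k \<Rightarrow> complex ^ 'n \<Rightarrow> complex ^ 'n"
  assumes finite_K: "finite K"
    and E_holo: "Q \<in> K \<Longrightarrow> holo_on S (E Q)"
    and E_idem: "Q \<in> K \<Longrightarrow> x \<in> S \<Longrightarrow> m x (E Q x) (E Q x) = E Q x"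
    and E_orth: "Q \<in> K \<Longrightarrow> R \<in> K \<Longrightarrow> Q \<noteq> R \<Longrightarrow> x \<in> S \<Longrightarrow> m x (E Q x) (E R x) = 0"
    and E_sum: "x \<in> S \<Longrightarrow> (\<Sum>Q\<in>K. E Q x) = e x"

context F_manifold_chart
begin

text \<open>For L = Lie(\<circ>) along f, integrability at f \<circ> f = f reads L = 2 f \<circ> L.
  Multiplying by f gives f \<circ> L = 2 f \<circ> L, so f \<circ> L = 0 and then L = 0.\<close>

lemma lie_mult_idempotent:
  assumes f: "holo_on S f" "\<And>x. x \<in> S \<Longrightarrow> m x (f x) (f x) = f x"
    and Z: "holo_on S Z" and V: "holo_on S V" and x: "x \<in> S"
  shows "lie_mult m f Z V x = 0"
proof -
  interpret A: unital_algebra "m x" "e x" by (rule algebra_at[OF x])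
  let ?L = "lie_mult m f Z V x"
  have "lie_mult m (\<lambda>y. m y (f y) (f y)) Z V x = ?L"
    by (rule lie_mult_cong[OF open_S x]) (simp_all add: f(2))
  then have L: "?L = m x (f x) ?L + m x (f x) ?L"
    using integrability[OF open_S subset_refl f(1) f(1) Z V x] by simp
  have "m x (f x) ?L = m x (f x) (m x (f x) ?L + m x (f x) ?L)"
    using L by (rule arg_cong)
  also have "\<dots> = m x (f x) ?L + m x (f x) ?L"
    unfolding A.mult_add_right A.mult_assoc[symmetric] f(2)[OF x] ..
  finally have "m x (f x) ?L = 0" by simp
  then show ?thesis using L by simp
qed

text \<open>Bracketing with \<open>f\<close> is a derivation of the multiplication, so
  differentiating g \<circ> g = g allows the same cancellation.\<close>

lemma lie_idempotent_idempotent: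
  assumes f: "holo_on S f" "\<And>x. x \<in> S \<Longrightarrow> m x (f x) (f x) = f x"
    and g: "holo_on S g" "\<And>x. x \<in> S \<Longrightarrow> m x (g x) (g x) = g x" and x: "x \<in> S"
  shows "lie f g x = 0"
proof -
  interpret A: unital_algebra "m x" "e x" by (rule algebra_at[OF x])
  let ?L = "lie f g x"
  have "lie f (\<lambda>y. m y (g y) (g y)) x = ?L"
    by (rule lie_cong[OF open_S x]) (simp_all add: g(2))
  then have L: "?L = m x (g x) ?L + m x (g x) ?L"
    using lie_mult_idempotent[OF f g(1) g(1) x] by (simp add: lie_mult_def A.mult_commute[of ?L] diff_diff_eq)
  have "m x (g x) ?L = m x (g x) (m x (g x) ?L + m x (g x) ?L)"
    using L by (rule arg_cong)
  also have "\<dots> = m x (g x) ?L + m x (g x) ?L"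
    unfolding A.mult_add_right A.mult_assoc[symmetric] g(2)[OF x] ..
  finally have "m x (g x) ?L = 0" by simp
  then show ?thesis using L by simp
qed

text \<open>Let g = e - f be the complementary idempotent and X = g \<circ> a the typical section of
  the kernel. Integrability writes Lie(\<circ>) along X as g \<circ> Lie_a(\<circ>) plus a multiple
  of Lie_g(\<circ>) = 0, so f annihilates it. The bracket [X, f] is also annihilated by f, because
  Lie_f(\<circ>) and [f, g] vanish. Evaluating Lie_X(\<circ>) on f and v then leaves precisely the
  involutivity condition.\<close>

lemma idempotent_involutive_kernel:
  assumes p: "p \<in> S" and f: "holo_on S f" "\<And>x. x \<in> S \<Longrightarrow> m x (f x) (f x) = f x"
  shows "involutive_kernel S p (\<lambda>x. m x (f x))"
proof (rule involutive_kernel.intro)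
  show "open S" by (rule open_S)
  show "p \<in> S" by (rule p)
  show "clin (m x (f x))" if "x \<in> S" for x by (rule mult_clin[OF that])
  show "m x (f x) (m x (f x) v) = m x (f x) v" if "x \<in> S" for x v
    using unital_algebra.mult_assoc[OF algebra_at[OF that], of "f x" "f x" v] f(2)[OF that] by simp
  show P: "holo_on S (\<lambda>x. m x (f x) v)" for v
    by (intro holo_mult_fields f) auto
  fix x v a assume x: "x \<in> S"
  interpret A: unital_algebra "m x" "e x" by (rule algebra_at[OF x])
  let ?P = "\<lambda>a x. m x (f x) a"
  define g where "g = (\<lambda>x. e x - f x)"
  define X where "X = (\<lambda>y. m y (g y) a)"
  have g: "holo_on S g" unfolding g_def by (intro holo_on_diff unit_holo f)
  have gf: "m y (f y) (m y (g y) w) = 0" if "y \<in> S" for y w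
  proof -
    interpret Y: unital_algebra "m y" "e y" by (rule algebra_at[OF that])
    have "m y (f y) (g y) = 0"
      unfolding g_def Y.mult_diff_right f(2)[OF that] using Y.mult_commute[of "f y" "e y"] by (simp add: Y.mult_unit)
    then show ?thesis by (simp add: Y.mult_assoc[symmetric])
  qed
  have g_idem: "m y (g y) (g y) = g y" if "y \<in> S" for y
  proof -
    interpret Y: unital_algebra "m y" "e y" by (rule algebra_at[OF that])
    have "m y (g y) (g y) = m y (e y) (g y) - m y (f y) (g y)"
      by (simp add: g_def Y.mult_diff_left)
    also have "m y (f y) (g y) = 0" using gf[OF that, of "e y"] Y.mult_commute[of "g y" "e y"] by (simp add: Y.mult_unit)
    finally show ?thesis by (simp add: Y.mult_unit)
  qed
  have Xeq: "X y = a - m y (f y) a" if "y \<in> S" for y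
    using unital_algebra.mult_diff_left[OF algebra_at[OF that], of "e y" "f y" a]
      unital_algebra.mult_unit[OF algebra_at[OF that], of a] by (simp add: X_def g_def)
  have hX: "holo_on S X" unfolding X_def by (intro holo_mult_fields g) auto
  have dX: "dif X x w = - dif (?P a) x w" for w
  proof -
    have "dif X x w = dif (\<lambda>y. a - m y (f y) a) x w"
      by (rule dif_cong_open[OF open_S x Xeq])
    then show ?thesis by (simp add: dif_diff[OF open_S x holo_on_const P])
  qed
  have l1: "lie X (?P v) x = dif (?P v) x (a - m x (f x) a) + dif (?P a) x (m x (f x) v)"
    unfolding lie_def dX Xeq[OF x] by simp
  have l2: "lie X (\<lambda>_. v) x = dif (?P a) x v"
    unfolding lie_def dX by simp
  have "lie_mult m f g (\<lambda>_. a) x = 0"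
    by (rule lie_mult_idempotent[OF f g holo_on_const x])
  moreover have "lie f g x = 0"
    by (rule lie_idempotent_idempotent[OF f g g_idem x])
  ultimately have "lie f X x = m x (g x) (lie f (\<lambda>_. a) x)"
    by (simp add: lie_mult_def X_def)
  then have "lie X f x = - m x (g x) (lie f (\<lambda>_. a) x)" by (subst lie_swap) simp
  also have "\<dots> = m x (g x) (- lie f (\<lambda>_. a) x)"
    using clin_minus[OF A.mult_clin] by simp
  finally have "m x (f x) (m x (lie X f x) v) = 0"
    using gf[OF x] by (simp add: A.mult_assoc)
  moreover have "m x (f x) (lie_mult m X f (\<lambda>_. v) x) = 0"
  proof -
    have "lie_mult m X f (\<lambda>_. v) x = m x (g x) (lie_mult m (\<lambda>_. a) f (\<lambda>_. v) x) + m x a (lie_mult m g f (\<lambda>_. v) x)"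
      unfolding X_def by (rule integrability[OF open_S subset_refl g holo_on_const f(1) holo_on_const x])
    also have "lie_mult m g f (\<lambda>_. v) x = 0"
      by (rule lie_mult_idempotent[OF g g_idem f(1) holo_on_const x])
    finally show ?thesis by (simp add: gf[OF x])
  qed
  ultimately have "m x (f x) (lie X (?P v) x - m x (f x) (lie X (\<lambda>_. v) x)) = 0"
    unfolding lie_mult_def A.mult_diff_right by simp
  then show "m x (f x) (dif (?P v) x (a - m x (f x) a) - m x (f x) (dif (?P a) x v) + dif (?P a) x (m x (f x) v)) = 0"
    unfolding l1 l2 by (simp add: algebra_simps)
qed

end

locale biholomorphism =
  fixes U V :: "(complex ^ 'n) set" and F \<Psi> :: "complex ^ 'n \<Rightarrow> complex ^ 'n"
  assumes open_U: "open U" and open_V: "open V" and F_holo: "holo_on U F" and \<Psi>_holo: "holo_on V \<Psi>"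
    and F_image: "F ` U = V" and \<Psi>_image: "\<Psi> ` V = U"
    and \<Psi>_F: "x \<in> U \<Longrightarrow> \<Psi> (F x) = x" and F_\<Psi>: "y \<in> V \<Longrightarrow> F (\<Psi> y) = y"
begin

lemma F_in: "x \<in> U \<Longrightarrow> F x \<in> V" using F_image by blast

lemma \<Psi>_in: "y \<in> V \<Longrightarrow> \<Psi> y \<in> U" using \<Psi>_image by blast

lemma dif_\<Psi>_F:
  assumes x: "x \<in> U"
  shows "dif \<Psi> (F x) (dif F x v) = v"
proof -
  have "dif \<Psi> (F x) (dif F x v) = dif (\<lambda>x. \<Psi> (F x)) x v"
    by (rule dif_compose_open[OF F_holo \<Psi>_holo equalityD1[OF F_image] open_U open_V x, symmetric])
  also have "\<dots> = dif (\<lambda>x. x) x v" by (rule dif_cong_open[OF open_U x \<Psi>_F])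
  finally show ?thesis by (simp add: dif_ident[OF open_U x])
qed

lemma dif_F_\<Psi>:
  assumes y: "y \<in> V"
  shows "dif F (\<Psi> y) (dif \<Psi> y v) = v"
proof -
  have "dif F (\<Psi> y) (dif \<Psi> y v) = dif (\<lambda>y. F (\<Psi> y)) y v"
    by (rule dif_compose_open[OF \<Psi>_holo F_holo equalityD1[OF \<Psi>_image] open_V open_U y, symmetric])
  also have "\<dots> = dif (\<lambda>y. y) y v" by (rule dif_cong_open[OF open_V y F_\<Psi>])
  finally show ?thesis by (simp add: dif_ident[OF open_V y])
qed

lemma dif_F_clin: "x \<in> U \<Longrightarrow> clin (dif F x)"
  by (rule holo_on_open_has_derivative(1)[OF F_holo open_U])

lemma dif_\<Psi>_clin: "y \<in> V \<Longrightarrow> clin (dif \<Psi> y)"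
  by (rule holo_on_open_has_derivative(1)[OF \<Psi>_holo open_V])

end

text \<open>
  The maps \<open>f\<^sub>Q\<close> with kernel \<open>ker (E\<^sub>Q \<circ>)\<close> add up to a chart in which every \<open>E\<^sub>Q \<circ>\<close> is constant.
\<close>

lemma (in F_manifold_idempotents) straightening:
  assumes p: "p \<in> S"
  obtains U V F \<Psi> where "biholomorphism U V F \<Psi>" "U \<subseteq> S" "p \<in> U" "F p = 0" "\<And>v. dif F p v = v"
    "\<And>Q x v. Q \<in> K \<Longrightarrow> x \<in> U \<Longrightarrow> m p (E Q p) (dif F x (m x (E Q x) v)) = dif F x (m x (E Q x) v)"
proof -
  interpret A: unital_algebra "m p" "e p" by (rule algebra_at[OF p])
  have "\<exists>T f. open T \<and> p \<in> T \<and> T \<subseteq> S \<and> holo_on T f \<and> f p = 0 \<and> (\<forall>x\<in>T. m p (E Q p) (f x) = f x) \<and>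
      (\<forall>x v. x \<in> T \<longrightarrow> m x (E Q x) v = 0 \<longrightarrow> dif f x v = 0) \<and> (\<forall>v. dif f p v = m p (E Q p) v)" if Q: "Q \<in> K" for Q
  proof -
    interpret I: involutive_kernel S p "\<lambda>x. m x (E Q x)"
      by (rule idempotent_involutive_kernel[OF p E_holo[OF Q] E_idem[OF Q]])
    obtain T f where "open T" "p \<in> T" "T \<subseteq> S" "holo_on T f" "f p = 0" "\<And>x. x \<in> T \<Longrightarrow> m p (E Q p) (f x) = f x"
      "\<And>x v. x \<in> T \<Longrightarrow> m x (E Q x) v = 0 \<Longrightarrow> dif f x v = 0" "\<And>v. dif f p v = m p (E Q p) v"
      by (rule I.first_integral) blast
    then show ?thesis by (intro exI[of _ T] exI[of _ f]) simp
  qed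
  then obtain T f where Tf: "\<And>Q. Q \<in> K \<Longrightarrow> open (T Q) \<and> p \<in> T Q \<and> T Q \<subseteq> S \<and> holo_on (T Q) (f Q) \<and> f Q p = 0 \<and>
      (\<forall>x\<in>T Q. m p (E Q p) (f Q x) = f Q x) \<and>
      (\<forall>x v. x \<in> T Q \<longrightarrow> m x (E Q x) v = 0 \<longrightarrow> dif (f Q) x v = 0) \<and> (\<forall>v. dif (f Q) p v = m p (E Q p) v)"
    by metis
  define W where "W = S \<inter> (\<Inter>Q\<in>K. T Q)"
  have W: "open W" "p \<in> W" "W \<subseteq> S" "\<And>Q. Q \<in> K \<Longrightarrow> W \<subseteq> T Q"
    using Tf p open_S finite_K by (auto simp: W_def intro!: open_Int open_INT)
  have f: "holo_on W (f Q)" "f Q p = 0" "\<And>x. x \<in> W \<Longrightarrow> m p (E Q p) (f Q x) = f Q x"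
    "\<And>x v. x \<in> W \<Longrightarrow> m x (E Q x) v = 0 \<Longrightarrow> dif (f Q) x v = 0" "\<And>v. dif (f Q) p v = m p (E Q p) v" if "Q \<in> K" for Q
    using Tf[OF that] W(4)[OF that] holo_on_subset by blast+
  define F where "F x = (\<Sum>Q\<in>K. f Q x)" for x
  have hF: "holo_on W F" unfolding F_def by (rule holo_on_sum) (rule f)
  have dF: "dif F x v = (\<Sum>Q\<in>K. dif (f Q) x v)" if "x \<in> W" for x v
    unfolding F_def by (rule dif_sum[OF W(1) that finite_K]) (rule f)
  have dFp: "dif F p v = v" for v
  proof -
    have "dif F p v = (\<Sum>Q\<in>K. m p (E Q p) v)"
      unfolding dF[OF W(2)] by (rule sum.cong) (simp_all add: f(5))
    also have "\<dots> = v" unfolding A.mult_sum_left[symmetric] E_sum[OF p] A.mult_unit ..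
    finally show ?thesis .
  qed
  obtain U V \<Psi> where UV: "open U" "p \<in> U" "U \<subseteq> W" "open V" "F ` U = V" "holo_on V \<Psi>" "\<Psi> ` V = U"
    "\<And>x. x \<in> U \<Longrightarrow> \<Psi> (F x) = x" "\<And>y. y \<in> V \<Longrightarrow> F (\<Psi> y) = y"
    using holo_inverse_function[OF W(1,2) hF dFp] by metis
  have "biholomorphism U V F \<Psi>"
    by (rule biholomorphism.intro) (use UV hF holo_on_subset in blast)+
  moreover have "F p = 0" unfolding F_def using f(2) by simp
  moreover have "m p (E Q p) (dif F x (m x (E Q x) v)) = dif F x (m x (E Q x) v)" if Q: "Q \<in> K" and x: "x \<in> U" for Q x v
  proof -
    have xW: "x \<in> W" using x UV(3) by blast
    then have xS: "x \<in> S" using W(3) by blast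
    interpret X: unital_algebra "m x" "e x" by (rule algebra_at[OF xS])
    \<comment> \<open>Vectors in the image of \<open>E Q\<close> lie in the kernel of every other
      \<open>E R\<close>, so only \<open>f Q\<close> contributes; its values, and hence its
      differential, lie in the image of the projection at \<open>p\<close>.\<close>
    have "dif (f R) x (m x (E Q x) v) = 0" if R: "R \<in> K" "R \<noteq> Q" for R
      by (rule f(4)[OF R(1) xW]) (simp add: X.mult_assoc[symmetric] E_orth[OF R(1) Q R(2) xS])
    then have "dif F x (m x (E Q x) v) = (\<Sum>R\<in>K. if R = Q then dif (f Q) x (m x (E Q x) v) else 0)"
      unfolding dF[OF xW] by (intro sum.cong) auto
    then have eq: "dif F x (m x (E Q x) v) = dif (f Q) x (m x (E Q x) v)"
      using Q finite_K by simp
    have "dif (f Q) x w = m p (E Q p) (dif (f Q) x w)" for w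
      using dif_clin_compose[OF W(1) xW A.mult_clin f(1)[OF Q], of "E Q p" w]
        dif_cong_open[OF W(1) xW, of "\<lambda>x. m p (E Q p) (f Q x)" "f Q" w] f(3)[OF Q] by simp
    then show ?thesis unfolding eq by simp
  qed
  ultimately show ?thesis using that[of U V F \<Psi>] UV(2,3) W(3) dFp by blast
qed

section \<open>Transport of an F-structure along a biholomorphism\<close>

context biholomorphism
begin

text \<open>Pushing forward produces second derivatives of \<open>F\<close>, which cancel in the
  bracket by symmetry.\<close>

lemma lie_related:
  assumes W: "open W" "W \<subseteq> U" "open W'" "F ` W \<subseteq> W'"
    and X: "holo_on W X" "holo_on W' X'" "\<And>x. x \<in> W \<Longrightarrow> X' (F x) = dif F x (X x)"
    and Y: "holo_on W Y" "holo_on W' Y'" "\<And>x. x \<in> W \<Longrightarrow> Y' (F x) = dif F x (Y x)"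
    and x: "x \<in> W"
  shows "lie X' Y' (F x) = dif F x (lie X Y x)"
proof -
  have FW: "holo_on W F" using F_holo W(2) by (rule holo_on_subset)
  have lin: "clin (dif F y)" if "y \<in> W" for y using dif_F_clin that W(2) by blast
  have *: "dif Y' (F x) (dif F x v) = dif (\<lambda>z. dif F z (Y x)) x v + dif F x (dif Y x v)"
    if Y: "holo_on W Y" "holo_on W' Y'" "\<And>x. x \<in> W \<Longrightarrow> Y' (F x) = dif F x (Y x)" for Y Y' v
  proof -
    have "dif Y' (F x) (dif F x v) = dif (\<lambda>x. Y' (F x)) x v"
      by (rule dif_compose_open[OF FW Y(2) W(4,1,3) x, symmetric])
    also have "\<dots> = dif (\<lambda>x. dif F x (Y x)) x v"
      by (rule dif_cong_open[OF W(1) x Y(3)])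
    also have "\<dots> = dif (\<lambda>z. dif F z (Y x)) x v + dif F x (dif Y x v)"
      by (rule dif_linear_family[where A="dif F", OF W(1) x lin holo_on_dif[OF W(1) FW] Y(1)])
    finally show ?thesis .
  qed
  have dX: "dif X' (F x) (dif F x v) = dif (\<lambda>z. dif F z (X x)) x v + dif F x (dif X x v)" for v
    by (rule *[OF X])
  have dY: "dif Y' (F x) (dif F x v) = dif (\<lambda>z. dif F z (Y x)) x v + dif F x (dif Y x v)" for v
    by (rule *[OF Y])
  have "lie X' Y' (F x) = (dif (\<lambda>z. dif F z (Y x)) x (X x) + dif F x (dif Y x (X x))) - (dif (\<lambda>z. dif F z (X x)) x (Y x) + dif F x (dif X x (Y x)))"
    unfolding lie_def X(3)[OF x] Y(3)[OF x] dX dY ..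
  also have "dif (\<lambda>z. dif F z (Y x)) x (X x) = dif (\<lambda>z. dif F z (X x)) x (Y x)"
    by (rule dif_dif_commute[OF W(1) FW x])
  finally show ?thesis by (simp add: lie_def clin_diff[OF lin[OF x]])
qed

end

locale transported_F_manifold = F_manifold_chart U m e + biholomorphism U V F \<Psi> for U V m e F \<Psi>
begin

definition mT where "mT y v w = dif F (\<Psi> y) (m (\<Psi> y) (dif \<Psi> y v) (dif \<Psi> y w))"
definition eT where "eT y = dif F (\<Psi> y) (e (\<Psi> y))"

lemma mT_related: "x \<in> U \<Longrightarrow> mT (F x) (dif F x v) (dif F x w) = dif F x (m x v w)"
  by (simp add: mT_def \<Psi>_F dif_\<Psi>_F)

lemma holo_push:
  assumes "W \<subseteq> V" "open W" "holo_on (\<Psi> ` W) X"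
  shows "holo_on W (\<lambda>y. dif F (\<Psi> y) (X (\<Psi> y)))"
proof (rule holo_on_linear_family[where A="\<lambda>y. dif F (\<Psi> y)"])
  have \<Psi>W: "holo_on W \<Psi>" using \<Psi>_holo assms(1) by (rule holo_on_subset)
  show "clin (dif F (\<Psi> y))" if "y \<in> W" for y using dif_F_clin \<Psi>_in that assms(1) by blast
  show "holo_on W (\<lambda>y. dif F (\<Psi> y) v)" for v
    by (rule holo_on_compose[OF \<Psi>W holo_on_dif[OF open_U F_holo]]) (use \<Psi>_in assms(1) in blast)
  show "holo_on W (\<lambda>y. X (\<Psi> y))"
    by (rule holo_on_compose[OF \<Psi>W assms(3)]) auto
qed

lemma holo_mT: "holo_on V (\<lambda>y. mT y v w)"
proof -
  have "holo_on U (\<lambda>x. m x (dif \<Psi> (F x) v) (dif \<Psi> (F x) w))"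
    by (intro holo_mult_fields holo_on_compose[OF F_holo holo_on_dif[OF open_V \<Psi>_holo]]) (use F_in in auto)
  then have "holo_on V (\<lambda>y. dif F (\<Psi> y) (m (\<Psi> y) (dif \<Psi> (F (\<Psi> y)) v) (dif \<Psi> (F (\<Psi> y)) w)))"
    by (intro holo_push[where X="\<lambda>x. m x (dif \<Psi> (F x) v) (dif \<Psi> (F x) w)"]) (auto simp: open_V \<Psi>_image)
  then show ?thesis
    by (rule holo_on_cong) (simp add: mT_def F_\<Psi>)
qed

lemma holo_eT: "holo_on V eT"
  unfolding eT_def by (rule holo_push) (auto simp: open_V \<Psi>_image unit_holo)

lemma mT_algebra: 
  assumes y: "y \<in> V"
  shows "unital_algebra (mT y) (eT y)"
proof -
  note U = \<Psi>_in[OF y]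
  interpret A: unital_algebra "m (\<Psi> y)" "e (\<Psi> y)" by (rule algebra_at[OF U])
  note lin = dif_\<Psi>_clin[OF y] dif_F_clin[OF U]
  have inv: "dif \<Psi> y (dif F (\<Psi> y) v) = v" for v
    using dif_\<Psi>_F[OF U, of v] by (simp add: F_\<Psi>[OF y])
  show ?thesis
  proof (rule unital_algebra.intro)
    show "clin (mT y v)" for v
      by (rule clinI) (simp_all add: mT_def clin_add[OF lin(1)] clin_add[OF lin(2)] clin_scale[OF lin(1)] clin_scale[OF lin(2)]
        A.mult_add_right A.mult_scale_right)
    show "mT y v w = mT y w v" for v w
      unfolding mT_def A.mult_commute[of "dif \<Psi> y v"] ..
    show "mT y (mT y u v) w = mT y u (mT y v w)" for u v w
      by (simp add: mT_def inv A.mult_assoc)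
    show "mT y (eT y) v = v" for v
      by (simp add: mT_def eT_def inv A.mult_unit dif_F_\<Psi>[OF y])
  qed
qed

definition pull where "pull X x = dif \<Psi> (F x) (X (F x))"

lemma pull_related: "x \<in> U \<Longrightarrow> X (F x) = dif F x (pull X x)"
  using dif_F_\<Psi>[OF F_in, of x "X (F x)"] by (simp add: pull_def \<Psi>_F)

lemma holo_pull:
  assumes "W \<subseteq> V" "holo_on W X"
  shows "holo_on (U \<inter> F -` W) (pull X)"
  unfolding pull_def
proof (rule holo_on_linear_family[where A="\<lambda>x. dif \<Psi> (F x)"])
  have FW: "holo_on (U \<inter> F -` W) F" using F_holo by (rule holo_on_subset) auto
  show "clin (dif \<Psi> (F x))" if "x \<in> U \<inter> F -` W" for x using dif_\<Psi>_clin F_in that by blast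
  show "holo_on (U \<inter> F -` W) (\<lambda>x. dif \<Psi> (F x) v)" for v
    by (rule holo_on_compose[OF FW holo_on_dif[OF open_V \<Psi>_holo]]) (use assms in auto)
  show "holo_on (U \<inter> F -` W) (\<lambda>x. X (F x))"
    by (rule holo_on_compose[OF FW assms(2)]) auto
qed

lemma holo_mT_fields:
  assumes "W \<subseteq> V" "holo_on W X" "holo_on W Y"
  shows "holo_on W (\<lambda>x. mT x (X x) (Y x))"
proof (rule holo_on_linear_family[where A="\<lambda>x. mT x (X x)"])
  show "clin (mT x (X x))" if "x \<in> W" for x using unital_algebra.mult_clin[OF mT_algebra] that assms(1) by blast
  show "holo_on W (\<lambda>x. mT x (X x) v)" for v
  proof (rule holo_on_linear_family[where A="\<lambda>x u. mT x u v"])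
    show "clin (\<lambda>u. mT x u v)" if "x \<in> W" for x
    proof -
      interpret A: unital_algebra "mT x" "eT x" by (rule mT_algebra) (use that assms in blast)
      show ?thesis by (rule clinI) (simp_all add: A.mult_add_left A.mult_scale_left)
    qed
    show "holo_on W (\<lambda>x. mT x u v)" for u using holo_mT assms(1) by (rule holo_on_subset)
  qed (rule assms)
qed (rule assms)

lemma lie_mult_related:
  assumes W: "open W" "W \<subseteq> U" "open W'" "W' \<subseteq> V" "F ` W \<subseteq> W'"
    and X: "holo_on W X" "holo_on W' X'" "\<And>x. x \<in> W \<Longrightarrow> X' (F x) = dif F x (X x)"
    and Z: "holo_on W Z" "holo_on W' Z'" "\<And>x. x \<in> W \<Longrightarrow> Z' (F x) = dif F x (Z x)"
    and T: "holo_on W T" "holo_on W' T'" "\<And>x. x \<in> W \<Longrightarrow> T' (F x) = dif F x (T x)"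
    and x: "x \<in> W"
  shows "lie_mult mT X' Z' T' (F x) = dif F x (lie_mult m X Z T x)"
proof -
  have xU: "x \<in> U" using x W(2) by blast
  have l: "lie X' Y' (F x) = dif F x (lie X Y x)"
    if "holo_on W Y" "holo_on W' Y'" "\<And>x. x \<in> W \<Longrightarrow> Y' (F x) = dif F x (Y x)" for Y Y'
    by (rule lie_related[OF W(1,2,3,5) X that x])
  have lZ: "lie X' Z' (F x) = dif F x (lie X Z x)" by (rule l[OF Z])
  have lT: "lie X' T' (F x) = dif F x (lie X T x)" by (rule l[OF T])
  have 1: "lie X' (\<lambda>y. mT y (Z' y) (T' y)) (F x) = dif F x (lie X (\<lambda>y. m y (Z y) (T y)) x)"
  proof (rule l)
    show "holo_on W (\<lambda>y. m y (Z y) (T y))" by (rule holo_mult_fields[OF W(2) Z(1) T(1)])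
    show "holo_on W' (\<lambda>y. mT y (Z' y) (T' y))" by (rule holo_mT_fields[OF W(4) Z(2) T(2)])
    show "mT (F y) (Z' (F y)) (T' (F y)) = dif F y (m y (Z y) (T y))" if "y \<in> W" for y
    proof -
      have "y \<in> U" using that W(2) by blast
      then show ?thesis unfolding Z(3)[OF that] T(3)[OF that] by (rule mT_related)
    qed
  qed
  show ?thesis
    unfolding lie_mult_def 1 lZ lT Z(3)[OF x] T(3)[OF x] mT_related[OF xU]
    by (simp add: clin_diff[OF dif_F_clin[OF xU]])
qed

lemma pullback_sets:
  assumes "open W'" "W' \<subseteq> V" "y \<in> W'"
  shows "open (U \<inter> F -` W')" "F ` (U \<inter> F -` W') \<subseteq> W'" "\<Psi> y \<in> U \<inter> F -` W'"
proof -
  show "open (U \<inter> F -` W')"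
    by (rule continuous_open_preimage[OF holo_on_imp_continuous_on[OF F_holo] open_U assms(1)])
  have "y \<in> V" using assms by blast
  then show "\<Psi> y \<in> U \<inter> F -` W'" using F_\<Psi> \<Psi>_in assms(3) by auto
qed auto

text \<open>Every local field on \<open>V\<close> is related by \<open>F\<close> to its pull-back,
  and \<open>lie_mult\<close> respects this relation, so integrability on \<open>U\<close> carries
  over to \<open>V\<close>.\<close>

lemma F_structure_transported: "F_structure UNIV V mT eT"
proof (rule F_structureI)
  fix W' X' Y' Z' T' y
  assume W': "open W'" "W' \<subseteq> V" and X: "holo_on W' X'" and Y: "holo_on W' Y'" and Z: "holo_on W' Z'" and T: "holo_on W' T'"
    and y: "y \<in> W'"
  let ?W = "U \<inter> F -` W'"
  define x where "x = \<Psi> y"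
  note W = pullback_sets[OF W' y]
  have yx: "y = F x" "x \<in> ?W" "x \<in> U" using F_\<Psi> W' y W(3) by (auto simp: x_def)
  have h: "holo_on ?W (pull X)" if "holo_on W' X" for X by (rule holo_pull[OF W'(2) that])
  have r: "X (F x) = dif F x (pull X x)" if "x \<in> ?W" for X x using pull_related[of x X] that by blast
  have L: "lie_mult mT A' Z' T' (F x) = dif F x (lie_mult m A (pull Z') (pull T') x)"
    if "holo_on ?W A" "holo_on W' A'" "\<And>x. x \<in> ?W \<Longrightarrow> A' (F x) = dif F x (A x)" for A A'
    by (rule lie_mult_related[OF W(1) Int_lower1 W' W(2) that h[OF Z] Z r h[OF T] T r yx(2)])
  have LX: "lie_mult mT X' Z' T' (F x) = dif F x (lie_mult m (pull X') (pull Z') (pull T') x)"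
    by (rule L[OF h[OF X] X r])
  have LY: "lie_mult mT Y' Z' T' (F x) = dif F x (lie_mult m (pull Y') (pull Z') (pull T') x)"
    by (rule L[OF h[OF Y] Y r])
  have "lie_mult mT (\<lambda>y. mT y (X' y) (Y' y)) Z' T' (F x) = dif F x (lie_mult m (\<lambda>y. m y (pull X' y) (pull Y' y)) (pull Z') (pull T') x)"
  proof (rule L)
    show "holo_on ?W (\<lambda>y. m y (pull X' y) (pull Y' y))" by (rule holo_mult_fields[OF Int_lower1 h[OF X] h[OF Y]])
    show "holo_on W' (\<lambda>y. mT y (X' y) (Y' y))" by (rule holo_mT_fields[OF W'(2) X Y])
    show "mT (F z) (X' (F z)) (Y' (F z)) = dif F z (m z (pull X' z) (pull Y' z))" if "z \<in> ?W" for z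
      unfolding r[OF that, of X'] r[OF that, of Y'] by (rule mT_related) (use that in blast)
  qed
  also have "lie_mult m (\<lambda>y. m y (pull X' y) (pull Y' y)) (pull Z') (pull T') x =
      m x (pull X' x) (lie_mult m (pull Y') (pull Z') (pull T') x) + m x (pull Y' x) (lie_mult m (pull X') (pull Z') (pull T') x)"
    by (rule integrability[OF W(1) Int_lower1 h[OF X] h[OF Y] h[OF Z] h[OF T] yx(2)])
  also have "dif F x \<dots> = mT (F x) (X' (F x)) (lie_mult mT Y' Z' T' (F x)) + mT (F x) (Y' (F x)) (lie_mult mT X' Z' T' (F x))"
    unfolding LX LY r[OF yx(2), of X'] r[OF yx(2), of Y'] mT_related[OF yx(3)]
    by (simp add: clin_add[OF dif_F_clin[OF yx(3)]])
  finally show "lie_mult mT (\<lambda>y. mT y (X' y) (Y' y)) Z' T' y =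
      mT y (X' y) (lie_mult mT Y' Z' T' y) + mT y (Y' y) (lie_mult mT X' Z' T' y)"
    unfolding yx(1) .
qed (auto simp: open_V holo_mT holo_eT mT_algebra)

lemma euler_transported:
  assumes "euler_field UNIV U m d X"
  shows "euler_field UNIV V mT d (\<lambda>y. dif F (\<Psi> y) (X (\<Psi> y)))"
proof -
  define X' where "X' y = dif F (\<Psi> y) (X (\<Psi> y))" for y
  have X: "holo_on U X" using assms by (simp add: euler_field_def vfield_def)
  have X': "holo_on V X'"
    unfolding X'_def by (rule holo_push) (auto simp: open_V \<Psi>_image X)
  have "lie_mult mT X' Z' T' y = d *s mT y (Z' y) (T' y)"
    if W': "open W'" "W' \<subseteq> V" and Z: "holo_on W' Z'" and T: "holo_on W' T'" and y: "y \<in> W'" for W' Z' T' y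
  proof -
    let ?W = "U \<inter> F -` W'"
    define x where "x = \<Psi> y"
    note W = pullback_sets[OF W' y]
    have yx: "y = F x" "x \<in> ?W" "x \<in> U" using F_\<Psi> W' y W(3) by (auto simp: x_def)
    have h: "holo_on ?W (pull X)" if "holo_on W' X" for X by (rule holo_pull[OF W'(2) that])
    have r: "X (F x) = dif F x (pull X x)" if "x \<in> ?W" for X x using pull_related[of x X] that by blast
    have "lie_mult mT X' Z' T' (F x) = dif F x (lie_mult m X (pull Z') (pull T') x)"
    proof (rule lie_mult_related[OF W(1) Int_lower1 W' W(2) _ _ _ h[OF Z] Z r h[OF T] T r yx(2)])
      show "holo_on ?W X" using X by (rule holo_on_subset) auto
      show "holo_on W' X'" using X' W'(2) by (rule holo_on_subset)
      show "X' (F x) = dif F x (X x)" if "x \<in> ?W" for x using that \<Psi>_F[of x] by (simp add: X'_def)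
    qed
    also have "lie_mult m X (pull Z') (pull T') x = d *s m x (pull Z' x) (pull T' x)"
      by (rule euler_fieldD[OF assms W(1) Int_lower1 h[OF Z] h[OF T] yx(2)])
    also have "dif F x \<dots> = d *s mT (F x) (Z' (F x)) (T' (F x))"
      unfolding r[OF yx(2), of Z'] r[OF yx(2), of T'] mT_related[OF yx(3)] clin_scale[OF dif_F_clin[OF yx(3)]] ..
    finally show ?thesis unfolding yx(1) .
  qed
  then show ?thesis
    using X' unfolding euler_field_def X'_def[abs_def, symmetric] by (auto simp: vfield_def X'_def)
qed

end

section \<open>Charts adapted to a product\<close>

text \<open>\<open>component\<close> chooses some decomposition; uniqueness in the direct sum
  identifies the choice.\<close>

lemma component_sum_eq:
  assumes D: "direct_sum K V X" and y: "\<And>j. j \<in> K \<Longrightarrow> y j \<in> V j" and k: "k \<in> K"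
  shows "component K V k (\<Sum>j\<in>K. y j) = y k"
proof -
  let ?P = "\<lambda>z. (\<forall>j\<in>K. z j \<in> V j) \<and> (\<Sum>j\<in>K. y j) = (\<Sum>j\<in>K. z j)"
  have "?P y" using y by blast
  then have "?P (Eps ?P)" by (rule someI[of ?P])
  then have z: "\<And>j. j \<in> K \<Longrightarrow> Eps ?P j \<in> V j" "(\<Sum>j\<in>K. y j) = (\<Sum>j\<in>K. Eps ?P j)" by blast+
  have sub: "vec.subspace (V j)" if "j \<in> K" for j using D that by (simp add: direct_sum_def)
  have "(\<Sum>j\<in>K. Eps ?P j - y j) = 0"
    unfolding sum_subtractf z(2)[symmetric] by simp
  moreover have "\<forall>j\<in>K. Eps ?P j - y j \<in> V j"
    using z(1) y sub by (auto intro: vec.subspace_diff)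
  moreover have "\<forall>z. (\<forall>j\<in>K. z j \<in> V j) \<and> (\<Sum>j\<in>K. z j) = 0 \<longrightarrow> (\<forall>j\<in>K. z j = 0)"
    using D unfolding direct_sum_def by (elim conjE) assumption
  ultimately have "Eps ?P k - y k = 0"
    using k by (elim allE[of _ "\<lambda>j. Eps ?P j - y j"]) blast
  then show ?thesis unfolding component_def by simp
qed

lemma direct_sum_obtain:
  assumes "direct_sum K V X" "x \<in> X"
  obtains y where "\<And>j. j \<in> K \<Longrightarrow> y j \<in> V j" "x = (\<Sum>j\<in>K. y j)"
proof -
  have "X = {\<Sum>k\<in>K. y k |y. \<forall>k\<in>K. y k \<in> V k}"
    using assms(1) unfolding direct_sum_def by (elim conjE) assumption
  then show ?thesis using assms(2) that by blast
qed

lemma component_props: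
  assumes D: "direct_sum K V X" and x: "x \<in> X"
  shows component_in: "\<And>k. k \<in> K \<Longrightarrow> component K V k x \<in> V k"
    and sum_component: "(\<Sum>k\<in>K. component K V k x) = x"
proof -
  obtain y where y: "\<And>j. j \<in> K \<Longrightarrow> y j \<in> V j" "x = (\<Sum>j\<in>K. y j)"
    by (rule direct_sum_obtain[OF D x]) (rule that)
  have eq: "component K V k x = y k" if "k \<in> K" for k
    unfolding y(2) by (rule component_sum_eq[OF D y(1) that])
  show "\<And>k. k \<in> K \<Longrightarrow> component K V k x \<in> V k" using eq y(1) by simp
  show "(\<Sum>k\<in>K. component K V k x) = x" unfolding y(2)[symmetric] using eq y(2) by simp
qed

lemma component_same:
  assumes D: "direct_sum K V X" and "k \<in> K" "v \<in> V k" "j \<in> K"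
  shows "component K V j v = (if j = k then v else 0)"
proof -
  have "finite K" using D by (simp add: direct_sum_def)
  have sub: "vec.subspace (V j)" if "j \<in> K" for j using D that by (simp add: direct_sum_def)
  have v: "v = (\<Sum>j\<in>K. if j = k then v else 0)" using assms(2) \<open>finite K\<close> by simp
  have "component K V j (\<Sum>j\<in>K. if j = k then v else 0) = (if j = k then v else 0)"
    by (rule component_sum_eq[OF D _ assms(4)]) (use sub vec.subspace_0 assms(3) in auto)
  then show ?thesis unfolding v[symmetric] .
qed

lemma direct_sum_member:
  assumes D: "direct_sum K V X" and "\<And>j. j \<in> K \<Longrightarrow> y j \<in> V j"
  shows "(\<Sum>j\<in>K. y j) \<in> X"
proof -
  have "X = {\<Sum>k\<in>K. y k |y. \<forall>k\<in>K. y k \<in> V k}"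
    using assms(1) unfolding direct_sum_def by (elim conjE) assumption
  then show ?thesis using assms(2) by blast
qed

lemma direct_sum_subspace:
  assumes D: "direct_sum K V X"
  shows "vec.subspace X"
proof (rule vec.subspaceI)
  have sub: "vec.subspace (V j)" if "j \<in> K" for j using D that by (simp add: direct_sum_def)
  have "(\<Sum>j\<in>K. 0) \<in> X" by (rule direct_sum_member[OF D]) (simp add: sub vec.subspace_0)
  then show "0 \<in> X" by simp
  show "x + y \<in> X" if "x \<in> X" "y \<in> X" for x y
  proof -
    have "(\<Sum>k\<in>K. component K V k x + component K V k y) \<in> X"
      by (rule direct_sum_member[OF D]) (simp add: sub vec.subspace_add component_in[OF D] that)
    then show ?thesis by (simp add: sum.distrib sum_component[OF D] that)
  qed
  show "c *s x \<in> X" if "x \<in> X" for c x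
  proof -
    have "(\<Sum>k\<in>K. c *s component K V k x) \<in> X"
      by (rule direct_sum_member[OF D]) (simp add: sub vec.subspace_scale component_in[OF D] that)
    then show ?thesis by (simp add: vec.scale_sum_right[symmetric] sum_component[OF D] that)
  qed
qed

text \<open>Abstract projections serve two cases at once: multiplication by the idempotents of the
  tangent algebra at \<open>p\<close>, and the \<open>component\<close> maps of an arbitrary
  decomposition.\<close>

locale direct_projections =
  fixes K :: "'k set" and V :: "'k \<Rightarrow> (complex ^ 'n) set" and \<pi> :: "'k \<Rightarrow> complex ^ 'n \<Rightarrow> complex ^ 'n"
  assumes finite_K: "finite K" and V_subspace: "k \<in> K \<Longrightarrow> vec.subspace (V k)"
    and \<pi>_clin: "k \<in> K \<Longrightarrow> clin (\<pi> k)" and \<pi>_in: "k \<in> K \<Longrightarrow> \<pi> k v \<in> V k"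
    and \<pi>_same: "k \<in> K \<Longrightarrow> v \<in> V k \<Longrightarrow> \<pi> k v = v"
    and \<pi>_other: "j \<in> K \<Longrightarrow> k \<in> K \<Longrightarrow> j \<noteq> k \<Longrightarrow> v \<in> V k \<Longrightarrow> \<pi> j v = 0"
    and \<pi>_sum: "(\<Sum>k\<in>K. \<pi> k v) = v"

lemma direct_projections_component:
  assumes D: "direct_sum K V UNIV"
  shows "direct_projections K V (component K V)"
proof (rule direct_projections.intro)
  show "finite K" "\<And>k. k \<in> K \<Longrightarrow> vec.subspace (V k)" using D by (simp_all add: direct_sum_def)
  note sub = this(2)
  fix k assume k: "k \<in> K"
  show "clin (component K V k)"
  proof (rule clinI)
    show "component K V k (x + y) = component K V k x + component K V k y" for x y
      using component_sum_eq[OF D _ k, of "\<lambda>k. component K V k x + component K V k y"] sub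
      by (simp add: sum.distrib sum_component[OF D] component_in[OF D] vec.subspace_add)
    show "component K V k (c *s x) = c *s component K V k x" for c x
      using component_sum_eq[OF D _ k, of "\<lambda>k. c *s component K V k x"] sub
      by (simp add: vec.scale_sum_right[symmetric] sum_component[OF D] component_in[OF D] vec.subspace_scale)
  qed
  show "component K V k v \<in> V k" for v by (rule component_in[OF D UNIV_I k])
  show "v \<in> V k \<Longrightarrow> component K V k v = v" for v using component_same[OF D k _ k, of v] by simp
  show "j \<in> K \<Longrightarrow> j \<noteq> k \<Longrightarrow> v \<in> V k \<Longrightarrow> component K V j v = 0" for j v
    using component_same[OF D k, of v j] by simp
next
  show "(\<Sum>k\<in>K. component K V k v) = v" for v by (rule sum_component[OF D UNIV_I])
qed

context direct_projections
begin

text \<open>A polydisc adapted to the splitting. It is convex and stable under every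
  \<open>\<pi> k\<close>, hence contains the segment from a point to its projection.\<close>

definition box where "box d = {y. \<forall>k\<in>K. norm (\<pi> k y) < d}"

lemma \<pi>_holo: "k \<in> K \<Longrightarrow> holo_on A (\<pi> k)"
  by (rule clin_holo_on[OF \<pi>_clin])

lemma \<pi>_0: "k \<in> K \<Longrightarrow> \<pi> k 0 = 0"
  by (rule clin_0[OF \<pi>_clin])

lemma \<pi>_\<pi>: "j \<in> K \<Longrightarrow> k \<in> K \<Longrightarrow> \<pi> j (\<pi> k v) = (if j = k then \<pi> k v else 0)"
  using \<pi>_same \<pi>_other \<pi>_in by auto

lemma \<pi>_sum_family: "k \<in> K \<Longrightarrow> (\<And>j. j \<in> K \<Longrightarrow> y j \<in> V j) \<Longrightarrow> \<pi> k (\<Sum>j\<in>K. y j) = y k"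
proof -
  assume k: "k \<in> K" and y: "\<And>j. j \<in> K \<Longrightarrow> y j \<in> V j"
  have "\<pi> k (\<Sum>j\<in>K. y j) = (\<Sum>j\<in>K. if j = k then y k else 0)"
    unfolding clin_sum[OF \<pi>_clin[OF k]] by (rule sum.cong) (use \<pi>_same \<pi>_other y k in auto)
  then show ?thesis using k finite_K by simp
qed

lemma open_box: "open (box d)"
proof -
  have "box d = (\<Inter>k\<in>K. \<pi> k -` ball 0 d)" by (auto simp: box_def)
  moreover have "open (\<pi> k -` ball 0 d)" if "k \<in> K" for k
    by (rule open_vimage[OF open_ball holo_on_imp_continuous_on[OF \<pi>_holo[OF that]]])
  ultimately show ?thesis using finite_K by auto
qed

lemma convex_box: "convex (box d)"
proof -
  have "box d = (\<Inter>k\<in>K. \<pi> k -` ball 0 d)" by (auto simp: box_def)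
  then show ?thesis
    by (simp add: convex_INT convex_linear_vimage bounded_linear.linear[OF clin_bounded_linear] \<pi>_clin)
qed

lemma zero_in_box: "d > 0 \<Longrightarrow> 0 \<in> box d"
  by (simp add: box_def \<pi>_0)

lemma \<pi>_in_box: "y \<in> box d \<Longrightarrow> d > 0 \<Longrightarrow> k \<in> K \<Longrightarrow> \<pi> k y \<in> box d"
  by (simp add: box_def \<pi>_\<pi>)

lemma box_in_open:
  assumes "open W" "0 \<in> W"
  obtains d where "d > 0" "box d \<subseteq> W"
proof -
  obtain r where r: "r > 0" "ball 0 r \<subseteq> W" using assms open_contains_ball by blast
  define d where "d = r / (real (card K) + 1)"
  have "d > 0" using r by (simp add: d_def add_nonneg_pos)
  moreover have "box d \<subseteq> W"
  proof
    fix y assume y: "y \<in> box d"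
    have "norm y = norm (\<Sum>k\<in>K. \<pi> k y)" by (simp add: \<pi>_sum)
    also have "\<dots> \<le> (\<Sum>k\<in>K. d)" by (rule sum_norm_le) (use y in \<open>auto simp: box_def less_imp_le\<close>)
    also have "\<dots> = real (card K) * d" by simp
    also have "\<dots> < (real (card K) + 1) * d" using \<open>d > 0\<close> by simp
    also have "\<dots> = r" unfolding d_def by (simp add: add_nonneg_eq_0_iff)
    finally show "y \<in> W" using r by auto
  qed
  ultimately show ?thesis using that by blast
qed

text \<open>The segment from \<open>\<pi> k y\<close> to \<open>y\<close> runs in a sum of
  directions from the other summands, along which the derivative vanishes.\<close>

lemma depends_on_component:
  assumes f: "holo_on (box d) f" and d: "d > 0" and k: "k \<in> K"
    and zero: "\<And>y j a. y \<in> box d \<Longrightarrow> j \<in> K \<Longrightarrow> j \<noteq> k \<Longrightarrow> a \<in> V j \<Longrightarrow> dif f y a = 0"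
    and y: "y \<in> box d"
  shows "f y = f (\<pi> k y)"
proof -
  define w where "w = y - \<pi> k y"
  have seg: "\<pi> k y + t *\<^sub>R w \<in> box d" if "t \<in> {0..1}" for t
  proof -
    have "\<pi> k y + t *\<^sub>R w = (1 - t) *\<^sub>R \<pi> k y + t *\<^sub>R y" by (simp add: w_def algebra_simps)
    then show ?thesis using convexD[OF convex_box \<pi>_in_box[OF y d k] y, of "1 - t" t] that by simp
  qed
  have "((\<lambda>t. f (\<pi> k y + t *\<^sub>R w)) has_derivative (\<lambda>h. 0)) (at t within {0..1})" if t: "t \<in> {0..1}" for t
  proof -
    note D = holo_on_open_has_derivative[OF f open_box seg[OF t]]
    have "w = (\<Sum>j\<in>K. if j = k then 0 else \<pi> j y)"
    proof -
      have "y - \<pi> k y = (\<Sum>j\<in>K - {k}. \<pi> j y)"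
        using sum.remove[OF finite_K k, of "\<lambda>j. \<pi> j y"] unfolding \<pi>_sum by (metis add_diff_cancel_left')
      moreover have "(\<Sum>j\<in>K. if j = k then 0 else \<pi> j y) = (\<Sum>j\<in>K - {k}. \<pi> j y)"
        using sum.remove[OF finite_K k, of "\<lambda>j. if j = k then 0 else \<pi> j y"] by simp
      ultimately show ?thesis by (simp add: w_def)
    qed
    then have "dif f (\<pi> k y + t *\<^sub>R w) w = (\<Sum>j\<in>K. dif f (\<pi> k y + t *\<^sub>R w) (if j = k then 0 else \<pi> j y))"
      using clin_sum[OF D(1)] by metis
    also have "\<dots> = 0"
      by (rule sum.neutral) (use zero[OF seg[OF t]] \<pi>_in clin_0[OF D(1)] in auto)
    finally have w0: "dif f (\<pi> k y + t *\<^sub>R w) w = 0" .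
    have z: "dif f (\<pi> k y + t *\<^sub>R w) (h *\<^sub>R w) = 0" for h
      unfolding scaleR_eq_smult[of h] clin_scale[OF D(1)] w0 by simp
    have "((\<lambda>t. \<pi> k y + t *\<^sub>R w) has_derivative (\<lambda>h. h *\<^sub>R w)) (at t within {0..1})"
      by (auto intro!: derivative_eq_intros)
    from has_derivative_compose[OF this D(2)] show ?thesis by (simp only: z)
  qed
  then obtain c where "\<And>t. t \<in> {0..1} \<Longrightarrow> f (\<pi> k y + t *\<^sub>R w) = c"
    using has_derivative_zero_constant[of "{0..1::real}" "\<lambda>t. f (\<pi> k y + t *\<^sub>R w)"] by auto
  from this[of 0] this[of 1] show ?thesis by (simp add: w_def)
qed

end

lemma dif_restrict:
  assumes "vec.subspace Q" "x \<in> Q" "v \<in> Q" "\<And>z. z \<in> Q \<Longrightarrow> f z = g z"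
  shows "dif f x v = dif g x v"
  using assms by (simp add: dif_def vec.subspace_add vec.subspace_scale)

text \<open>\<open>dif\<close> looks only at values along one line, so for fields with values in
  \<open>Q\<close> at \<open>x\<close> the brackets are determined by \<open>Q\<close>, although
  \<open>Q\<close> may have empty interior. This compares fields on a factor with their extensions
  to open sets.\<close>

lemma lie_mult_restrict:
  assumes Q: "vec.subspace Q" "x \<in> Q" and eq: "\<And>z. z \<in> Q \<Longrightarrow> X z = X' z" "\<And>z. z \<in> Q \<Longrightarrow> Z z = Z' z" "\<And>z. z \<in> Q \<Longrightarrow> T z = T' z"
    and val: "X x \<in> Q" "Z x \<in> Q" "T x \<in> Q" "m x (Z x) (T x) \<in> Q"
  shows "lie_mult m X Z T x = lie_mult m X' Z' T' x"
proof -
  have l: "lie X Y x = lie X' Y' x" if "\<And>z. z \<in> Q \<Longrightarrow> Y z = Y' z" "Y x \<in> Q" for Y Y'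
    unfolding lie_def eq(1)[OF Q(2), symmetric] that(1)[OF Q(2), symmetric]
    using dif_restrict[OF Q val(1) that(1)] dif_restrict[OF Q that(2) eq(1)] by simp
  have "lie X (\<lambda>y. m y (Z y) (T y)) x = lie X' (\<lambda>y. m y (Z' y) (T' y)) x"
    by (rule l) (simp_all add: eq val)
  moreover have "lie X Z x = lie X' Z' x" "lie X T x = lie X' T' x"
    by (rule l; simp add: eq val)+
  ultimately show ?thesis
    unfolding lie_mult_def eq(2)[OF Q(2)] eq(3)[OF Q(2)] by simp
qed

text \<open>
  A chart in which the multiplications by the idempotent fields are the constant projections
  \<open>\<pi> Q\<close>; so \<open>\<pi> Q (e y)\<close> is the idempotent field of \<open>Q\<close>.
\<close>

locale product_chart = F_manifold_chart S m e + direct_projections K "\<lambda>Q. Q" \<pi>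
  for S :: "(complex ^ 'n) set" and m e and K :: "(complex ^ 'n) set set" and \<pi> +
  assumes zero_in: "0 \<in> S"
    and adapted: "y \<in> S \<Longrightarrow> Q \<in> K \<Longrightarrow> m y (\<pi> Q (e y)) v = \<pi> Q v"
    and nontrivial: "Q \<in> K \<Longrightarrow> Q \<noteq> {0}"
begin

lemma \<pi>_mult:
  assumes y: "y \<in> S" and Q: "Q \<in> K"
  shows "m y (\<pi> Q v) w = \<pi> Q (m y v w)"
proof -
  interpret A: unital_algebra "m y" "e y" by (rule algebra_at[OF y])
  have "m y (\<pi> Q v) w = m y (m y (\<pi> Q (e y)) v) w" by (simp add: adapted[OF y Q])
  also have "\<dots> = m y (\<pi> Q (e y)) (m y v w)" by (rule A.mult_assoc)
  finally show ?thesis by (simp add: adapted[OF y Q])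
qed

lemma mult_in_left: "y \<in> S \<Longrightarrow> Q \<in> K \<Longrightarrow> v \<in> Q \<Longrightarrow> m y v w \<in> Q"
  using \<pi>_mult[of y Q v w] \<pi>_same[of Q v] \<pi>_in[of Q "m y v w"] by simp

lemma mult_in_right: "y \<in> S \<Longrightarrow> Q \<in> K \<Longrightarrow> w \<in> Q \<Longrightarrow> m y v w \<in> Q"
  using mult_in_left[of y Q w v] unital_algebra.mult_commute[OF algebra_at, of y v w] by simp

lemma mult_components:
  assumes y: "y \<in> S"
  shows "m y v w = (\<Sum>Q\<in>K. m y (\<pi> Q v) (\<pi> Q w))"
proof -
  interpret A: unital_algebra "m y" "e y" by (rule algebra_at[OF y])
  have "m y (\<pi> Q v) (\<pi> Q w) = \<pi> Q (m y v w)" if Q: "Q \<in> K" for Q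
  proof -
    have "m y (\<pi> Q v) (\<pi> Q w) = \<pi> Q (m y v (\<pi> Q w))" by (rule \<pi>_mult[OF y Q])
    also have "m y v (\<pi> Q w) = \<pi> Q (m y w v)" unfolding A.mult_commute[of v] by (rule \<pi>_mult[OF y Q])
    finally show ?thesis using \<pi>_\<pi>[OF Q Q] A.mult_commute[of w] by simp
  qed
  then show ?thesis by (simp add: \<pi>_sum)
qed

lemma eR_holo: "R \<in> K \<Longrightarrow> holo_on S (\<lambda>y. \<pi> R (e y))"
  by (rule holo_on_clin[OF \<pi>_clin unit_holo])

text \<open>For constant fields the derivative D is Lie_a(\<circ>) evaluated on v and w. Since a is
  its own product with the idempotent field of \<open>R\<close>, integrability puts D into
  \<open>R\<close>. On the other hand the product of v and w never leaves \<open>Q\<close>, so D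
  lies in \<open>Q\<close> as well and must be 0.\<close>

lemma dif_mult_other:
  assumes y: "y \<in> S" and Q: "Q \<in> K" and R: "R \<in> K" "R \<noteq> Q" and a: "a \<in> R" and v: "v \<in> Q" "w \<in> Q"
  shows "dif (\<lambda>y. m y v w) y a = 0"
proof -
  interpret A: unital_algebra "m y" "e y" by (rule algebra_at[OF y])
  let ?D = "dif (\<lambda>y. m y v w) y a"
  have D: "lie_mult m (\<lambda>_. a) (\<lambda>_. v) (\<lambda>_. w) y = ?D"
    by (simp add: lie_mult_def lie_def)
  have "lie_mult m (\<lambda>y. m y (\<pi> R (e y)) a) (\<lambda>_. v) (\<lambda>_. w) y = ?D"
    unfolding D[symmetric] by (rule lie_mult_cong[OF open_S y]) (simp_all add: adapted R \<pi>_same a)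
  then have "?D = m y (\<pi> R (e y)) ?D + m y a (lie_mult m (\<lambda>y. \<pi> R (e y)) (\<lambda>_. v) (\<lambda>_. w) y)"
    using integrability[OF open_S subset_refl eR_holo[OF R(1)] holo_on_const holo_on_const holo_on_const y, of a v w] D by simp
  moreover have "m y (\<pi> R (e y)) ?D \<in> R" using adapted[OF y R(1)] \<pi>_in[OF R(1)] by simp
  moreover have "m y a (lie_mult m (\<lambda>y. \<pi> R (e y)) (\<lambda>_. v) (\<lambda>_. w) y) \<in> R"
    by (rule mult_in_left[OF y R(1) a])
  ultimately have "?D \<in> R" using vec.subspace_add[OF V_subspace[OF R(1)]] by metis
  moreover have "?D \<in> Q"
    by (rule dif_in_subspace[OF mult_holo vec.subspace_UNIV _ y UNIV_I V_subspace[OF Q]])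
      (use mult_in_left[OF _ Q v(1)] open_S in auto)
  ultimately show ?thesis using \<pi>_same[OF Q] \<pi>_other[OF Q R(1)] R(2) by metis
qed

lemma mult_depends:
  assumes d: "d > 0" "box d \<subseteq> S" and y: "y \<in> box d" and Q: "Q \<in> K" and v: "v \<in> Q" "w \<in> Q"
  shows "m y v w = m (\<pi> Q y) v w"
proof (rule depends_on_component[where f="\<lambda>y. m y v w", OF holo_on_subset[OF mult_holo d(2)] d(1) Q _ y])
  show "dif (\<lambda>y. m y v w) z a = 0" if "z \<in> box d" "R \<in> K" "R \<noteq> Q" "a \<in> R" for z R a
    by (rule dif_mult_other[OF _ Q that(2-4) v]) (use that(1) d(2) in blast)
qed

text \<open>The multiplications at \<open>y\<close> and at \<open>\<pi> Q y\<close> agree on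
  \<open>Q\<close>, and a commutative algebra has only one unit.\<close>

lemma unit_depends:
  assumes d: "d > 0" "box d \<subseteq> S" and y: "y \<in> box d" and Q: "Q \<in> K"
  shows "\<pi> Q (e y) = \<pi> Q (e (\<pi> Q y))"
proof -
  have yS: "y \<in> S" "\<pi> Q y \<in> S" using y \<pi>_in_box[OF y d(1) Q] d(2) by auto
  interpret A: unital_algebra "m y" "e y" by (rule algebra_at[OF yS(1)])
  let ?u = "\<pi> Q (e (\<pi> Q y))"
  have "m y ?u (\<pi> Q (e y)) = m (\<pi> Q y) ?u (\<pi> Q (e y))"
    by (rule mult_depends[OF d y Q]) (intro \<pi>_in Q)+
  also have "\<dots> = \<pi> Q (e y)" unfolding adapted[OF yS(2) Q] using \<pi>_\<pi>[OF Q Q] by simp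
  also have "m y ?u (\<pi> Q (e y)) = ?u"
    unfolding A.mult_commute[of ?u] adapted[OF yS(1) Q] using \<pi>_\<pi>[OF Q Q] by simp
  finally show ?thesis by simp
qed

text \<open>The slice through 0. The ambient \<open>m\<close> can serve as its multiplication,
  because it maps \<open>Q\<close> to itself at the points of the chart and only arguments in
  \<open>Q\<close> matter.\<close>

definition factor where
  "factor Q = \<lparr>germ_space = Q, germ_pt = 0, germ_mult = m, germ_unit = (\<lambda>x. \<pi> Q (e x))\<rparr>"

lemma factor_simps [simp]: "germ_space (factor Q) = Q" "germ_pt (factor Q) = 0" "germ_mult (factor Q) = m"
  "germ_unit (factor Q) = (\<lambda>x. \<pi> Q (e x))"
  by (simp_all add: factor_def)

text \<open>A field on the slice is extended constantly along the other summands, so that the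
  integrability condition of the ambient chart can be applied to it.\<close>

lemma vfield_lift:
  assumes Q: "Q \<in> K" and W: "openin (top_of_set Q) W" and X: "vfield Q W X"
  shows "open (\<pi> Q -` W)" "holo_on (\<pi> Q -` W) (\<lambda>y. X (\<pi> Q y))"
proof -
  obtain O' where O: "open O'" "W = Q \<inter> O'" using W by (auto simp: openin_open)
  have "\<pi> Q -` W = \<pi> Q -` O'" using O(2) \<pi>_in[OF Q] by auto
  then show "open (\<pi> Q -` W)"
    using open_vimage[OF O(1) holo_on_imp_continuous_on[OF \<pi>_holo[OF Q]]] by simp
  show "holo_on (\<pi> Q -` W) (\<lambda>y. X (\<pi> Q y))"
    by (rule holo_on_compose[OF \<pi>_holo[OF Q]]) (use X in \<open>auto simp: vfield_def\<close>)
qed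

lemma nbhd_factor: "open W \<Longrightarrow> 0 \<in> W \<Longrightarrow> Q \<in> K \<Longrightarrow> nbhd Q 0 (W \<inter> Q)"
  using vec.subspace_0[OF V_subspace] by (auto simp: nbhd_def openin_open)

lemma F_structure_factor:
  assumes Q: "Q \<in> K"
  shows "F_structure Q (S \<inter> Q) m (\<lambda>x. \<pi> Q (e x))"
  unfolding F_structure_def
proof (intro conjI ballI allI impI)
  show "vec.subspace Q" by (rule V_subspace[OF Q])
  show "Q \<noteq> {0}" by (rule nontrivial[OF Q])
  show "openin (top_of_set Q) (S \<inter> Q)" using open_S by (auto simp: openin_open)
  show "vfield Q (S \<inter> Q) (\<lambda>x. m x v w)" if "v \<in> Q" "w \<in> Q" for v w
    using holo_on_subset[OF mult_holo] mult_in_left[OF _ Q that(1)] by (auto simp: vfield_def)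
  show "vfield Q (S \<inter> Q) (\<lambda>x. \<pi> Q (e x))"
    using holo_on_subset[OF eR_holo[OF Q]] \<pi>_in[OF Q] by (auto simp: vfield_def)
  show "m x (\<pi> Q (e x)) v = v" if "x \<in> S \<inter> Q" "v \<in> Q" for x v
    using that adapted[OF _ Q] \<pi>_same[OF Q] by simp
next
  fix x assume "x \<in> S \<inter> Q"
  then interpret A: unital_algebra "m x" "e x" by (intro algebra_at) simp
  show "m x (a *s u + b *s v) w = a *s m x u w + b *s m x v w" for a b u v w
    unfolding A.mult_add_left A.mult_scale_left ..
  show "m x v w = m x w v" for v w by (rule A.mult_commute)
  show "m x (m x u v) w = m x u (m x v w)" for u v w by (rule A.mult_assoc)
next
  fix W X Y Z T x
  assume a: "openin (top_of_set Q) W \<and> W \<subseteq> S \<inter> Q \<and> vfield Q W X \<and> vfield Q W Y \<and> vfield Q W Z \<and> vfield Q W T"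
    and x: "x \<in> W"
  have W: "openin (top_of_set Q) W" "W \<subseteq> S \<inter> Q" and vf: "vfield Q W X" "vfield Q W Y" "vfield Q W Z" "vfield Q W T"
    using a by blast+
  have xQ: "x \<in> Q" and xS: "x \<in> S" using x W(2) by blast+
  let ?W = "S \<inter> \<pi> Q -` W"
  have oW: "open ?W" by (intro open_Int open_S vfield_lift(1)[OF Q W(1) vf(1)])
  have xW: "x \<in> ?W" using x xS \<pi>_same[OF Q xQ] by simp
  have lift: "holo_on ?W (\<lambda>y. X (\<pi> Q y))" if "vfield Q W X" for X
    using vfield_lift(2)[OF Q W(1) that] by (rule holo_on_subset) auto
  have val: "X x \<in> Q" if "vfield Q W X" for X using that x by (auto simp: vfield_def)
  note int = integrability[OF oW Int_lower1 lift[OF vf(1)] lift[OF vf(2)] lift[OF vf(3)] lift[OF vf(4)] xW]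
  have r: "lie_mult m A (\<lambda>y. Z (\<pi> Q y)) (\<lambda>y. T (\<pi> Q y)) x = lie_mult m B Z T x"
    if "\<And>z. z \<in> Q \<Longrightarrow> A z = B z" "B x \<in> Q" for A B
    by (rule lie_mult_restrict[OF V_subspace[OF Q] xQ])
      (use that \<pi>_same[OF Q] val[OF vf(3)] val[OF vf(4)] mult_in_left[OF xS Q] xQ in auto)
  have 1: "lie_mult m (\<lambda>y. m y (X (\<pi> Q y)) (Y (\<pi> Q y))) (\<lambda>y. Z (\<pi> Q y)) (\<lambda>y. T (\<pi> Q y)) x = lie_mult m (\<lambda>y. m y (X y) (Y y)) Z T x"
    by (rule r) (use \<pi>_same[OF Q] val[OF vf(1)] mult_in_left[OF xS Q] in auto)
  have 2: "lie_mult m (\<lambda>y. X (\<pi> Q y)) (\<lambda>y. Z (\<pi> Q y)) (\<lambda>y. T (\<pi> Q y)) x = lie_mult m X Z T x"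
    by (rule r) (use \<pi>_same[OF Q] val[OF vf(1)] in auto)
  have 3: "lie_mult m (\<lambda>y. Y (\<pi> Q y)) (\<lambda>y. Z (\<pi> Q y)) (\<lambda>y. T (\<pi> Q y)) x = lie_mult m Y Z T x"
    by (rule r) (use \<pi>_same[OF Q] val[OF vf(2)] in auto)
  show "lie_mult m (\<lambda>y. m y (X y) (Y y)) Z T x = m x (X x) (lie_mult m Y Z T x) + m x (Y x) (lie_mult m X Z T x)"
    using int unfolding 1 2 3 \<pi>_same[OF Q xQ] .
qed

lemma F_germ_factor: "Q \<in> K \<Longrightarrow> F_germ (factor Q)"
  unfolding F_germ_def using F_structure_factor nbhd_factor[OF open_S zero_in] by auto

text \<open>Apply the Euler condition to the idempotent field e_R and the constant field a. As e_R
  \<circ> a = a, it reads [X, a] = d a + [X, e_R] \<circ> a + e_R \<circ> [X, a], and every term on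
  the right lies in \<open>R\<close>.\<close>

lemma euler_dif_in:
  assumes E: "euler_field UNIV V m d X" and V: "open V" "V \<subseteq> S" and y: "y \<in> V" and R: "R \<in> K" and a: "a \<in> R"
  shows "dif X y a \<in> R"
proof -
  have yS: "y \<in> S" using y V by blast
  interpret A: unital_algebra "m y" "e y" by (rule algebra_at[OF yS])
  have "lie_mult m X (\<lambda>y. \<pi> R (e y)) (\<lambda>_. a) y = d *s m y (\<pi> R (e y)) a"
    by (rule euler_fieldD[OF E V(1) subset_refl holo_on_subset[OF eR_holo[OF R] V(2)] holo_on_const y])
  also have "m y (\<pi> R (e y)) a = a" unfolding adapted[OF yS R] by (rule \<pi>_same[OF R a])
  finally have "lie X (\<lambda>y. m y (\<pi> R (e y)) a) y = d *s a + m y (lie X (\<lambda>y. \<pi> R (e y)) y) a + m y (\<pi> R (e y)) (lie X (\<lambda>_. a) y)"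
    unfolding lie_mult_def by (simp add: algebra_simps)
  moreover have "lie X (\<lambda>y. m y (\<pi> R (e y)) a) y = lie X (\<lambda>_. a) y"
    by (rule lie_cong[OF V(1) y]) (use V(2) adapted[OF _ R] \<pi>_same[OF R a] in auto)
  moreover have "d *s a \<in> R" using vec.subspace_scale[OF V_subspace[OF R] a] .
  moreover have "m y (lie X (\<lambda>y. \<pi> R (e y)) y) a \<in> R" by (rule mult_in_right[OF yS R a])
  moreover have "m y (\<pi> R (e y)) (lie X (\<lambda>_. a) y) \<in> R" unfolding adapted[OF yS R] by (rule \<pi>_in[OF R])
  ultimately have "lie X (\<lambda>_. a) y \<in> R" using vec.subspace_add[OF V_subspace[OF R]] by metis
  then have "- lie X (\<lambda>_. a) y \<in> R" by (rule vec.subspace_neg[OF V_subspace[OF R]])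
  then show ?thesis by (simp add: lie_def)
qed

text \<open>The differential of \<open>X\<close> preserves each summand, so its \<open>Q\<close>
  component does not vary along the others. The Euler condition of the component is that of
  \<open>X\<close>, tested on fields extended constantly from the slice.\<close>

lemma euler_components:
  assumes E: "euler_field UNIV V m c X" and V: "open V" "V \<subseteq> S" and d: "d > 0" "box d \<subseteq> V" and Q: "Q \<in> K"
  shows "y \<in> box d \<Longrightarrow> \<pi> Q (X y) = \<pi> Q (X (\<pi> Q y))"
    and "euler_field Q (box d \<inter> Q) m c (\<lambda>x. \<pi> Q (X x))"
proof -
  have X: "holo_on V X" using E by (simp add: euler_field_def vfield_def)
  have XQ: "holo_on V (\<lambda>y. \<pi> Q (X y))" by (rule holo_on_clin[OF \<pi>_clin[OF Q] X])
  have dS: "box d \<subseteq> S" using d V by blast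
  have dXQ: "dif (\<lambda>y. \<pi> Q (X y)) y v = \<pi> Q (dif X y v)" if "y \<in> V" for y v
    by (rule dif_clin_compose[OF V(1) that \<pi>_clin[OF Q] X])
  show "\<pi> Q (X y) = \<pi> Q (X (\<pi> Q y))" if y: "y \<in> box d"
  proof (rule depends_on_component[where f="\<lambda>y. \<pi> Q (X y)", OF holo_on_subset[OF XQ d(2)] d(1) Q _ y])
    fix y R a assume "y \<in> box d" "R \<in> K" "R \<noteq> Q" "a \<in> R"
    then show "dif (\<lambda>y. \<pi> Q (X y)) y a = 0"
      using dXQ[of y a] euler_dif_in[OF E V, of y R a] \<pi>_other[OF Q, of R] d(2) by auto
  qed
  show "euler_field Q (box d \<inter> Q) m c (\<lambda>x. \<pi> Q (X x))"
    unfolding euler_field_def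
  proof (intro conjI allI impI ballI)
    show "vfield Q (box d \<inter> Q) (\<lambda>x. \<pi> Q (X x))"
      using holo_on_subset[OF XQ le_infI1[OF d(2)]] \<pi>_in[OF Q] by (auto simp: vfield_def)
    fix W Z T x
    assume a: "openin (top_of_set Q) W \<and> W \<subseteq> box d \<inter> Q \<and> vfield Q W Z \<and> vfield Q W T" and x: "x \<in> W"
    have W: "openin (top_of_set Q) W" "W \<subseteq> box d \<inter> Q" and vf: "vfield Q W Z" "vfield Q W T"
      using a by blast+
    have xQ: "x \<in> Q" and xV: "x \<in> V" and xS: "x \<in> S" using x W(2) d(2) V(2) by blast+
    let ?W = "box d \<inter> \<pi> Q -` W"
    have oW: "open ?W" by (intro open_Int open_box vfield_lift(1)[OF Q W(1) vf(1)])
    have xW: "x \<in> ?W" using x W(2) \<pi>_same[OF Q xQ] by auto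
    have lift: "holo_on ?W (\<lambda>y. Z (\<pi> Q y))" if "vfield Q W Z" for Z
      using vfield_lift(2)[OF Q W(1) that] by (rule holo_on_subset) auto
    have val: "Z y \<in> Q" if "vfield Q W Z" "y \<in> W" for Z y using that by (auto simp: vfield_def)
    \<comment> \<open>A field constant along the other summands sees only the \<open>Q\<close> part
      of \<open>X\<close>, and the derivative of \<open>X\<close> in a direction of \<open>Q\<close>
      already lies in \<open>Q\<close>.\<close>
    have l: "lie X (\<lambda>y. Y (\<pi> Q y)) x = lie (\<lambda>x. \<pi> Q (X x)) Y x" if Y: "Y x \<in> Q" for Y
    proof -
      have "dif (\<lambda>y. Y (\<pi> Q y)) x v = dif Y x (\<pi> Q v)" for v
        by (simp add: dif_def clin_add[OF \<pi>_clin[OF Q]] clin_scale[OF \<pi>_clin[OF Q]] \<pi>_same[OF Q xQ])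
      moreover have "dif X x (Y x) = dif (\<lambda>y. \<pi> Q (X y)) x (Y x)"
        unfolding dXQ[OF xV] using \<pi>_same[OF Q euler_dif_in[OF E V xV Q Y]] by simp
      ultimately show ?thesis by (simp add: lie_def \<pi>_same[OF Q xQ])
    qed
    have "lie_mult m X (\<lambda>y. Z (\<pi> Q y)) (\<lambda>y. T (\<pi> Q y)) x = c *s m x (Z x) (T x)"
      using euler_fieldD[OF E oW _ lift[OF vf(1)] lift[OF vf(2)] xW] d(2) \<pi>_same[OF Q xQ] by auto
    moreover have "lie X (\<lambda>y. m y (Z (\<pi> Q y)) (T (\<pi> Q y))) x = lie (\<lambda>x. \<pi> Q (X x)) (\<lambda>y. m y (Z y) (T y)) x"
    proof -
      have "lie X (\<lambda>y. m y (Z (\<pi> Q y)) (T (\<pi> Q y))) x = lie X (\<lambda>y. m (\<pi> Q y) (Z (\<pi> Q y)) (T (\<pi> Q y))) x"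
        by (rule lie_cong[OF oW xW]) (use mult_depends[OF d(1) dS _ Q] val[OF vf(1)] val[OF vf(2)] in auto)
      also have "\<dots> = lie (\<lambda>x. \<pi> Q (X x)) (\<lambda>y. m y (Z y) (T y)) x"
        by (rule l[of "\<lambda>y. m y (Z y) (T y)"]) (rule mult_in_left[OF xS Q val[OF vf(1) x]])
      finally show ?thesis .
    qed
    ultimately show "lie_mult m (\<lambda>x. \<pi> Q (X x)) Z T x = c *s m x (Z x) (T x)"
      unfolding lie_mult_def l[where Y=Z, OF val[OF vf(1) x]] l[where Y=T, OF val[OF vf(2) x]] \<pi>_same[OF Q xQ] by simp
  qed
qed

end

section \<open>Germs of products\<close>

lemma nbhd_UNIV [simp]: "nbhd UNIV p U \<longleftrightarrow> open U \<and> p \<in> U"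
  by (simp add: nbhd_def)

lemma F_structureD:
  assumes F: "F_structure V U m e"
  shows F_subspace: "vec.subspace V" and F_nontrivial: "V \<noteq> {0}"
    and F_mult_in: "x \<in> U \<Longrightarrow> v \<in> V \<Longrightarrow> w \<in> V \<Longrightarrow> m x v w \<in> V"
    and F_mult_0: "x \<in> U \<Longrightarrow> w \<in> V \<Longrightarrow> m x 0 w = 0"
    and F_unit_in: "x \<in> U \<Longrightarrow> e x \<in> V" and F_unit_holo: "holo_on U e"
    and F_unit_mult: "x \<in> U \<Longrightarrow> v \<in> V \<Longrightarrow> m x (e x) v = v"
proof -
  show V: "vec.subspace V" and "V \<noteq> {0}"
    using F unfolding F_structure_def by blast+
  have "\<forall>v\<in>V. \<forall>w\<in>V. vfield V U (\<lambda>x. m x v w)"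
    using F unfolding F_structure_def by (elim conjE) assumption
  then show "x \<in> U \<Longrightarrow> v \<in> V \<Longrightarrow> w \<in> V \<Longrightarrow> m x v w \<in> V" by (auto simp: vfield_def)
  have lin: "\<forall>x\<in>U. \<forall>u\<in>V. \<forall>v\<in>V. \<forall>w\<in>V. \<forall>a b. m x (a *s u + b *s v) w = a *s m x u w + b *s m x v w"
    using F unfolding F_structure_def by (elim conjE) assumption
  show "m x 0 w = 0" if "x \<in> U" "w \<in> V"
  proof -
    have "m x (0 *s 0 + 0 *s 0) w = 0 *s m x 0 w + 0 *s m x 0 w"
      using lin that vec.subspace_0[OF V] by blast
    then show ?thesis by simp
  qed
  have e: "vfield V U e" using F unfolding F_structure_def by (elim conjE) assumption
  then show "holo_on U e" by (simp add: vfield_def)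
  show "x \<in> U \<Longrightarrow> e x \<in> V" using e by (auto simp: vfield_def)
  have "\<forall>x\<in>U. \<forall>v\<in>V. m x (e x) v = v"
    using F unfolding F_structure_def by (elim conjE) assumption
  then show "x \<in> U \<Longrightarrow> v \<in> V \<Longrightarrow> m x (e x) v = v" by blast
qed

lemma germ_iso_differential:
  assumes iso: "germ_iso G H f" and VG: "vec.subspace (germ_space G)" and VH: "vec.subspace (germ_space H)"
  obtains U W g where "nbhd (germ_space G) (germ_pt G) U" "nbhd (germ_space H) (germ_pt H) W"
    "f ` U = W" "g ` W = U" "holo_on U f" "holo_on W g" "f (germ_pt G) = germ_pt H"
    "\<And>x. x \<in> U \<Longrightarrow> g (f x) = x" "\<And>y. y \<in> W \<Longrightarrow> f (g y) = y"
    "\<And>x v w. x \<in> U \<Longrightarrow> v \<in> germ_space G \<Longrightarrow> w \<in> germ_space G \<Longrightarrow>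
      dif f x (germ_mult G x v w) = germ_mult H (f x) (dif f x v) (dif f x w)"
    "\<And>x. x \<in> U \<Longrightarrow> dif f x (germ_unit G x) = germ_unit H (f x)"
    "\<And>x v. x \<in> U \<Longrightarrow> v \<in> germ_space G \<Longrightarrow> dif f x v \<in> germ_space H"
    "\<And>x v. x \<in> U \<Longrightarrow> v \<in> germ_space G \<Longrightarrow> dif g (f x) (dif f x v) = v"
    "\<And>y w. y \<in> W \<Longrightarrow> w \<in> germ_space H \<Longrightarrow> dif g y w \<in> germ_space G"
    "\<And>y w. y \<in> W \<Longrightarrow> w \<in> germ_space H \<Longrightarrow> dif f (g y) (dif g y w) = w"
proof -
  obtain U W where U: "nbhd (germ_space G) (germ_pt G) U" and W: "nbhd (germ_space H) (germ_pt H) W"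
    and bij: "bij_betw f U W" and f: "holo_on U f" and g: "holo_on W (inv_into U f)" and pt: "f (germ_pt G) = germ_pt H"
    and alg: "\<forall>x\<in>U. (\<forall>v\<in>germ_space G. \<forall>w\<in>germ_space G.
        dif f x (germ_mult G x v w) = germ_mult H (f x) (dif f x v) (dif f x w)) \<and>
        dif f x (germ_unit G x) = germ_unit H (f x)"
    using iso unfolding germ_iso_def by (elim exE conjE) blast
  define g where "g = inv_into U f"
  have oU: "openin (top_of_set (germ_space G)) U" and oW: "openin (top_of_set (germ_space H)) W"
    using U W by (simp_all add: nbhd_def)
  have sU: "U \<subseteq> germ_space G" and sW: "W \<subseteq> germ_space H"
    using oU oW openin_imp_subset by blast+
  have gf: "g (f x) = x" if "x \<in> U" for x unfolding g_def by (rule bij_betw_inv_into_left[OF bij that])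
  have fg: "f (g y) = y" if "y \<in> W" for y unfolding g_def by (rule bij_betw_inv_into_right[OF bij that])
  have fU: "f ` U = W" using bij by (simp add: bij_betw_def)
  have gW: "g ` W = U" using bij_betw_inv_into[OF bij] by (simp add: bij_betw_def g_def)
  note g = g[folded g_def]
  have df: "dif f x v \<in> germ_space H" if "x \<in> U" "v \<in> germ_space G" for x v
    by (rule dif_in_subspace[OF f VG oU that VH]) (use fU sW in simp)
  have dg: "dif g y w \<in> germ_space G" if "y \<in> W" "w \<in> germ_space H" for y w
    by (rule dif_in_subspace[OF g VH oW that VG]) (use gW sU in simp)
  have dgf: "dif g (f x) (dif f x v) = v" if x: "x \<in> U" and v: "v \<in> germ_space G" for x v
  proof -
    have "dif (\<lambda>x. g (f x)) x v = dif g (f x) (dif f x v)"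
      by (rule dif_compose[OF f g _ VG oU VH oW x v df[OF x v]]) (simp add: fU)
    moreover have "dif (\<lambda>x. g (f x)) x v = dif (\<lambda>x. x) x v"
      by (rule dif_cong[OF VG oU x v]) (rule gf)
    moreover have "dif (\<lambda>x. x) x v = v" by (rule dif_clin) (auto intro: clinI)
    ultimately show ?thesis by simp
  qed
  have dfg: "dif f (g y) (dif g y w) = w" if y: "y \<in> W" and w: "w \<in> germ_space H" for y w
  proof -
    have "dif (\<lambda>y. f (g y)) y w = dif f (g y) (dif g y w)"
      by (rule dif_compose[OF g f _ VH oW VG oU y w dg[OF y w]]) (simp add: gW)
    moreover have "dif (\<lambda>y. f (g y)) y w = dif (\<lambda>x. x) y w"
      by (rule dif_cong[OF VH oW y w]) (rule fg)
    moreover have "dif (\<lambda>x. x) y w = w" by (rule dif_clin) (auto intro: clinI)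
    ultimately show ?thesis by simp
  qed
  have alg1: "dif f x (germ_mult G x v w) = germ_mult H (f x) (dif f x v) (dif f x w)"
    if "x \<in> U" "v \<in> germ_space G" "w \<in> germ_space G" for x v w using alg that by blast
  have alg2: "dif f x (germ_unit G x) = germ_unit H (f x)" if "x \<in> U" for x using alg that by blast
  show ?thesis
    by (rule that[OF U W fU gW f g pt gf fg alg1 alg2 df dgf dg dfg])
qed

lemma prod_germ_simps:
  "germ_space (prod_germ K G) = {\<Sum>k\<in>K. y k |y. \<forall>k\<in>K. y k \<in> germ_space (G k)}"
  "germ_pt (prod_germ K G) = (\<Sum>k\<in>K. germ_pt (G k))"
  "germ_mult (prod_germ K G) x v w = (\<Sum>k\<in>K. germ_mult (G k) (component K (\<lambda>k. germ_space (G k)) k x)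
     (component K (\<lambda>k. germ_space (G k)) k v) (component K (\<lambda>k. germ_space (G k)) k w))"
  "germ_unit (prod_germ K G) x = (\<Sum>k\<in>K. germ_unit (G k) (component K (\<lambda>k. germ_space (G k)) k x))"
  by (simp_all add: prod_germ_def Let_def)

lemma nbhd_subset: "nbhd V p U \<Longrightarrow> U \<subseteq> V" "nbhd V p U \<Longrightarrow> p \<in> V"
  using openin_imp_subset by (auto simp: nbhd_def)

text \<open>The differential of a product decomposition at the base point carries the product
  algebra isomorphically to the tangent algebra. The images of the two model spaces would therefore
  split an algebra assumed to be irreducible.\<close>

lemma irreducible_germI:
  assumes G: "F_germ G" and irr: "irreducible_algebra (germ_space G) (germ_mult G (germ_pt G))"
  shows "irreducible_germ G"
  unfolding irreducible_germ_def
proof (intro conjI G notI)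
  assume "\<exists>(G2 :: bool \<Rightarrow> 'a fgerm) \<Psi>. germ_decomp G UNIV G2 \<Psi>"
  then obtain G2 :: "bool \<Rightarrow> 'a fgerm" and f where dec: "germ_decomp G UNIV G2 f" by blast
  let ?V = "\<lambda>k. germ_space (G2 k)"
  let ?X = "germ_space (prod_germ UNIV G2)"
  let ?p = "germ_pt (prod_germ UNIV G2)"
  let ?c = "component UNIV ?V"
  have D: "direct_sum UNIV ?V ?X" and iso: "germ_iso (prod_germ UNIV G2) G f" and FG: "\<And>k. F_germ (G2 k)"
    using dec by (auto simp: germ_decomp_def)
  have "\<exists>U. nbhd (?V k) (germ_pt (G2 k)) U \<and> F_structure (?V k) U (germ_mult (G2 k)) (germ_unit (G2 k))" for k
    using FG[of k] unfolding F_germ_def .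
  then obtain U2 where U2: "\<And>k. nbhd (?V k) (germ_pt (G2 k)) (U2 k)"
    "\<And>k. F_structure (?V k) (U2 k) (germ_mult (G2 k)) (germ_unit (G2 k))" by metis
  have pt2: "germ_pt (G2 k) \<in> U2 k" "germ_pt (G2 k) \<in> ?V k" for k
    using U2(1)[of k] nbhd_subset(2)[OF U2(1)[of k]] by (simp_all add: nbhd_def)
  have sG: "vec.subspace (germ_space G)" using G F_subspace unfolding F_germ_def by blast
  have sX: "vec.subspace ?X" by (rule direct_sum_subspace[OF D])
  have sV: "vec.subspace (?V k)" for k using D by (simp add: direct_sum_def)
  obtain U W g where U: "nbhd ?X ?p U" and W: "nbhd (germ_space G) (germ_pt G) W" and f: "holo_on U f" "holo_on W g"
    "f ?p = germ_pt G" "\<And>x. x \<in> U \<Longrightarrow> g (f x) = x"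
    and alg: "\<And>x v w. x \<in> U \<Longrightarrow> v \<in> ?X \<Longrightarrow> w \<in> ?X \<Longrightarrow>
      dif f x (germ_mult (prod_germ UNIV G2) x v w) = germ_mult G (f x) (dif f x v) (dif f x w)"
    and df: "\<And>x v. x \<in> U \<Longrightarrow> v \<in> ?X \<Longrightarrow> dif f x v \<in> germ_space G"
    and dgf: "\<And>x v. x \<in> U \<Longrightarrow> v \<in> ?X \<Longrightarrow> dif g (f x) (dif f x v) = v"
    and dg: "\<And>y w. y \<in> W \<Longrightarrow> w \<in> germ_space G \<Longrightarrow> dif g y w \<in> ?X"
    and dfg: "\<And>y w. y \<in> W \<Longrightarrow> w \<in> germ_space G \<Longrightarrow> dif f (g y) (dif g y w) = w"
    by (rule germ_iso_differential[OF iso sX sG]) (rule that)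
  have pU: "?p \<in> U" and qW: "germ_pt G \<in> W" using U W by (simp_all add: nbhd_def)
  have gq: "g (germ_pt G) = ?p" using f(4)[OF pU] f(3) by simp
  have "openin (top_of_set ?X) U" using U by (simp add: nbhd_def)
  then obtain L where L: "clin L" "\<And>v. v \<in> ?X \<Longrightarrow> dif f ?p v = L v"
    using dif_props[OF f(1) sX _ pU] by metis
  have VX: "?V k \<subseteq> ?X" for k
  proof
    fix v assume v: "v \<in> ?V k"
    have "(\<Sum>j\<in>UNIV. if j = k then v else 0) \<in> ?X"
      by (rule direct_sum_member[OF D]) (use v sV vec.subspace_0 in auto)
    then show "v \<in> ?X" by simp
  qed
  have L_inj: "v = 0" if "v \<in> ?X" "L v = 0" for v
  proof -
    have "dif f ?p v = dif f ?p 0" using that L vec.subspace_0[OF sX] clin_0[OF L(1)] by simp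
    then show ?thesis using dgf[OF pU that(1)] dgf[OF pU vec.subspace_0[OF sX]] by simp
  qed
  have L_in: "L v \<in> germ_space G" if "v \<in> ?X" for v using df[OF pU that] L(2)[OF that] by simp
  have L_surj: "\<exists>v\<in>?X. w = L v" if w: "w \<in> germ_space G" for w
    using dfg[OF qW w] dg[OF qW w] L(2) gq by (intro bexI[of _ "dif g (germ_pt G) w"]) auto
  have zero: "?c j v = (if j = k then v else 0)" if "v \<in> ?V k" for j k v
    by (rule component_same[OF D UNIV_I that UNIV_I])
  have ptc: "?c k ?p = germ_pt (G2 k)" for k
    unfolding prod_germ_simps(2) by (rule component_sum_eq[OF D pt2(2) UNIV_I])
  have m0: "germ_mult (G2 k) (germ_pt (G2 k)) 0 w = 0" if "w \<in> ?V k" for k w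
    by (rule F_mult_0[OF U2(2) pt2(1) that])
  have mcomm0: "germ_mult (G2 k) (germ_pt (G2 k)) w 0 = 0" if "w \<in> ?V k" for k w
  proof -
    have "\<forall>x\<in>U2 k. \<forall>v\<in>?V k. \<forall>w\<in>?V k. germ_mult (G2 k) x v w = germ_mult (G2 k) x w v"
      using U2(2)[of k] unfolding F_structure_def by (elim conjE) assumption
    then show ?thesis using m0[OF that] that pt2(1) vec.subspace_0[OF sV] by metis
  qed
  have multL: "germ_mult G (germ_pt G) (L v) (L w) = L (\<Sum>k\<in>UNIV. germ_mult (G2 k) (germ_pt (G2 k)) (?c k v) (?c k w))"
    if "v \<in> ?X" "w \<in> ?X" for v w
  proof -
    let ?s = "\<Sum>k\<in>UNIV. germ_mult (G2 k) (germ_pt (G2 k)) (?c k v) (?c k w)"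
    have "?s \<in> ?X"
      by (rule direct_sum_member[OF D]) (rule F_mult_in[OF U2(2) pt2(1) component_in[OF D that(1) UNIV_I] component_in[OF D that(2) UNIV_I]])
    then have s: "dif f ?p ?s = L ?s" by (rule L(2))
    have "germ_mult (prod_germ UNIV G2) ?p v w = ?s"
      unfolding prod_germ_simps(3) ptc ..
    then show ?thesis
      using alg[OF pU that] unfolding f(3) L(2)[OF that(1)] L(2)[OF that(2)] by (simp only: s)
  qed
  define A where "A k = L ` ?V k" for k
  have "direct_sum UNIV A (germ_space G)"
    unfolding direct_sum_def
  proof (intro conjI ballI allI impI)
    show "vec.subspace (A k)" for k unfolding A_def by (rule vec.linear_subspace_image[OF L(1) sV])
    show "germ_space G = {\<Sum>k\<in>UNIV. y k |y. \<forall>k\<in>UNIV. y k \<in> A k}"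
    proof (intro set_eqI iffI)
      fix w assume "w \<in> germ_space G"
      then obtain v where v: "v \<in> ?X" "w = L v" using L_surj by blast
      have "w = (\<Sum>k\<in>UNIV. L (?c k v))"
        unfolding clin_sum[OF L(1), symmetric] sum_component[OF D v(1)] by (rule v(2))
      moreover have "L (?c k v) \<in> A k" for k unfolding A_def using component_in[OF D v(1)] by blast
      ultimately show "w \<in> {\<Sum>k\<in>UNIV. y k |y. \<forall>k\<in>UNIV. y k \<in> A k}" by blast
    next
      fix w assume "w \<in> {\<Sum>k\<in>UNIV. y k |y. \<forall>k\<in>UNIV. y k \<in> A k}"
      then obtain y where y: "w = (\<Sum>k\<in>UNIV. y k)" "\<And>k. y k \<in> A k" by blast
      have "y k \<in> germ_space G" for k
      proof -
        obtain v where v: "v \<in> ?V k" "y k = L v" using y(2)[of k] unfolding A_def by (elim imageE)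
        show ?thesis unfolding v(2) by (rule L_in[OF subsetD[OF VX v(1)]])
      qed
      then show "w \<in> germ_space G" unfolding y(1) by (intro vec.subspace_sum[OF sG])
    qed
    fix y k assume y: "(\<forall>k\<in>UNIV. y k \<in> A k) \<and> (\<Sum>k\<in>UNIV. y k) = 0"
    have "\<exists>v. v \<in> ?V k \<and> y k = L v" for k
    proof -
      have "y k \<in> L ` ?V k" using y unfolding A_def by simp
      then show ?thesis by (elim imageE) (intro exI conjI)
    qed
    then obtain v where v: "\<And>k. v k \<in> ?V k" "\<And>k. y k = L (v k)" by metis
    have "L (\<Sum>k\<in>UNIV. v k) = 0" unfolding clin_sum[OF L(1)] using y v(2) by simp
    then have v0: "(\<Sum>k\<in>UNIV. v k) = 0" by (rule L_inj[OF direct_sum_member[OF D v(1)]])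
    have "\<forall>z. (\<forall>j\<in>UNIV. z j \<in> ?V j) \<and> (\<Sum>j\<in>UNIV. z j) = 0 \<longrightarrow> (\<forall>j\<in>UNIV. z j = 0)"
      using D unfolding direct_sum_def by (elim conjE) assumption
    from this[rule_format, of v k] v(1) v0 have "v k = 0" by simp
    then show "y k = 0" using v(2) clin_0[OF L(1)] by simp
  qed simp
  moreover have "A k \<noteq> {0}" for k
  proof -
    obtain v where "v \<in> ?V k" "v \<noteq> 0" using F_nontrivial[OF U2(2)[of k]] vec.subspace_0[OF sV] by blast
    then have "L v \<noteq> 0" "L v \<in> A k" using L_inj[OF subsetD[OF VX]] unfolding A_def by blast+
    then show ?thesis by (metis singletonD)
  qed
  moreover have "germ_mult G (germ_pt G) v w \<in> A k" if vw: "v \<in> A k" "w \<in> A k" for k v w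
  proof -
    obtain a b where ab: "a \<in> ?V k" "b \<in> ?V k" "v = L a" "w = L b" using vw unfolding A_def by (elim imageE)
    have "(\<Sum>j\<in>UNIV. germ_mult (G2 j) (germ_pt (G2 j)) (?c j a) (?c j b)) =
      (\<Sum>j\<in>UNIV. if j = k then germ_mult (G2 k) (germ_pt (G2 k)) a b else 0)"
      by (rule sum.cong) (simp_all add: zero[OF ab(1)] zero[OF ab(2)] m0 vec.subspace_0[OF sV])
    then have "germ_mult G (germ_pt G) v w = L (germ_mult (G2 k) (germ_pt (G2 k)) a b)"
      unfolding ab(3,4) multL[OF subsetD[OF VX ab(1)] subsetD[OF VX ab(2)]] by simp
    then show ?thesis unfolding A_def using F_mult_in[OF U2(2) pt2(1) ab(1,2)] by (rule image_eqI)
  qed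
  moreover have "germ_mult G (germ_pt G) v w = 0" if vw: "v \<in> A True" "w \<in> A False" for v w
  proof -
    obtain a b where ab: "a \<in> ?V True" "b \<in> ?V False" "v = L a" "w = L b" using vw unfolding A_def by (elim imageE)
    have "(\<Sum>j\<in>UNIV. germ_mult (G2 j) (germ_pt (G2 j)) (?c j a) (?c j b)) = 0"
    proof (intro sum.neutral ballI)
      show "germ_mult (G2 j) (germ_pt (G2 j)) (?c j a) (?c j b) = 0" for j
        using zero[OF ab(1), of j] zero[OF ab(2), of j] m0[OF ab(2)] mcomm0[OF ab(1)] by (cases j) simp_all
    qed
    then show ?thesis
      unfolding ab(3,4) multL[OF subsetD[OF VX ab(1)] subsetD[OF VX ab(2)]] by (simp add: clin_0[OF L(1)])
  qed
  ultimately have "\<exists>A. direct_sum UNIV A (germ_space G) \<and>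
      (\<forall>i. A i \<noteq> {0} \<and> (\<forall>v\<in>A i. \<forall>w\<in>A i. germ_mult G (germ_pt G) v w \<in> A i)) \<and>
      (\<forall>v\<in>A True. \<forall>w\<in>A False. germ_mult G (germ_pt G) v w = 0)"
    by (intro exI[of _ A] conjI allI ballI)
  then show False using irr unfolding irreducible_algebra_def by (elim conjE notE)
qed

section \<open>Comparison of arbitrary decompositions with the idempotent fields\<close>

locale decomposed_germ = F_manifold_idempotents S m e K E + A: decomposed_algebra "m p" "e p" K \<epsilon>
  for S :: "(complex ^ 'n) set" and m e and K :: "(complex ^ 'n) set set" and E p \<epsilon> +
  assumes p_in: "p \<in> S" and E_p: "Q \<in> K \<Longrightarrow> E Q p = \<epsilon> Q"
begin

definition H where "H = \<lparr>germ_space = UNIV, germ_pt = p, germ_mult = m, germ_unit = e\<rparr>"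

lemma H_simps [simp]: "germ_space H = UNIV" "germ_pt H = p" "germ_mult H = m" "germ_unit H = e"
  by (simp_all add: H_def)

text \<open>
  Every decomposition extending the eigenspaces carries the projections to its factors to the
  multiplications by the idempotent fields \<open>E\<close>, since idempotents are isolated.
\<close>

lemma extends_to_chart:
  fixes G :: "(complex ^ 'n) set \<Rightarrow> 'n fgerm"
  assumes ext: "extends_to H K (\<lambda>Q. Q) G \<Psi>"
  defines "V \<equiv> \<lambda>Q. germ_space (G Q)"
  defines "\<pi> \<equiv> component K V"
  obtains N M F where "biholomorphism N M \<Psi> F" "(\<Sum>Q\<in>K. germ_pt (G Q)) \<in> N" "p \<in> M" "M \<subseteq> S"
    "\<Psi> (\<Sum>Q\<in>K. germ_pt (G Q)) = p" "direct_projections K V \<pi>" "\<And>Q. Q \<in> K \<Longrightarrow> germ_pt (G Q) \<in> V Q"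
    "\<And>y Q w. y \<in> N \<Longrightarrow> Q \<in> K \<Longrightarrow> dif \<Psi> y (\<pi> Q w) = m (\<Psi> y) (E Q (\<Psi> y)) (dif \<Psi> y w)"
    "\<And>y v w. y \<in> N \<Longrightarrow> dif \<Psi> y (\<Sum>Q\<in>K. germ_mult (G Q) (\<pi> Q y) (\<pi> Q v) (\<pi> Q w)) = m (\<Psi> y) (dif \<Psi> y v) (dif \<Psi> y w)"
    "\<And>y. y \<in> N \<Longrightarrow> dif \<Psi> y (\<Sum>Q\<in>K. germ_unit (G Q) (\<pi> Q y)) = e (\<Psi> y)"
    "\<And>y Q v w. y \<in> N \<Longrightarrow> Q \<in> K \<Longrightarrow> v \<in> V Q \<Longrightarrow> w \<in> V Q \<Longrightarrow> germ_mult (G Q) (\<pi> Q y) v w \<in> V Q"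
    "\<And>y Q w. y \<in> N \<Longrightarrow> Q \<in> K \<Longrightarrow> w \<in> V Q \<Longrightarrow> germ_mult (G Q) (\<pi> Q y) 0 w = 0"
    "\<And>y Q. y \<in> N \<Longrightarrow> Q \<in> K \<Longrightarrow> germ_unit (G Q) (\<pi> Q y) \<in> V Q"
    "germ_space (prod_germ K G) = UNIV"
proof -
  let ?X = "germ_space (prod_germ K G)"
  let ?p = "\<Sum>Q\<in>K. germ_pt (G Q)"
  let ?m = "\<lambda>y v w. \<Sum>Q\<in>K. germ_mult (G Q) (\<pi> Q y) (\<pi> Q v) (\<pi> Q w)"
  have D: "direct_sum K V ?X" and iso: "germ_iso (prod_germ K G) H \<Psi>" and FG: "\<And>Q. Q \<in> K \<Longrightarrow> F_germ (G Q)"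
    and im: "\<And>Q. Q \<in> K \<Longrightarrow> dif \<Psi> ?p ` V Q = Q"
    using ext by (auto simp: extends_to_def germ_decomp_def V_def prod_germ_simps(2))
  have "\<exists>U. nbhd (V Q) (germ_pt (G Q)) U \<and> F_structure (V Q) U (germ_mult (G Q)) (germ_unit (G Q))" if "Q \<in> K" for Q
    using FG[OF that] unfolding F_germ_def V_def .
  then obtain U2 where U2: "\<And>Q. Q \<in> K \<Longrightarrow> nbhd (V Q) (germ_pt (G Q)) (U2 Q)"
    "\<And>Q. Q \<in> K \<Longrightarrow> F_structure (V Q) (U2 Q) (germ_mult (G Q)) (germ_unit (G Q))" by metis
  have pt: "germ_pt (G Q) \<in> U2 Q" "germ_pt (G Q) \<in> V Q" if "Q \<in> K" for Q
    using U2(1)[OF that] nbhd_subset(2)[OF U2(1)[OF that]] by (simp_all add: nbhd_def)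
  have sX: "vec.subspace ?X" by (rule direct_sum_subspace[OF D])
  obtain U W g where U: "nbhd ?X ?p U" and W: "nbhd (germ_space H) (germ_pt H) W" and f: "\<Psi> ` U = W" "g ` W = U"
    "holo_on U \<Psi>" "holo_on W g" "\<Psi> ?p = p" "\<And>x. x \<in> U \<Longrightarrow> g (\<Psi> x) = x" "\<And>y. y \<in> W \<Longrightarrow> \<Psi> (g y) = y"
    and alg: "\<And>x v w. x \<in> U \<Longrightarrow> v \<in> ?X \<Longrightarrow> w \<in> ?X \<Longrightarrow> dif \<Psi> x (?m x v w) = m (\<Psi> x) (dif \<Psi> x v) (dif \<Psi> x w)"
    and unit: "\<And>x. x \<in> U \<Longrightarrow> dif \<Psi> x (\<Sum>Q\<in>K. germ_unit (G Q) (\<pi> Q x)) = e (\<Psi> x)"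
    and dg: "\<And>y w. y \<in> W \<Longrightarrow> w \<in> germ_space H \<Longrightarrow> dif g y w \<in> ?X"
    and dfg: "\<And>y w. y \<in> W \<Longrightarrow> w \<in> germ_space H \<Longrightarrow> dif \<Psi> (g y) (dif g y w) = w"
    by (rule germ_iso_differential[OF iso sX, unfolded H_simps prod_germ_simps(2-4), folded V_def \<pi>_def])
      (use vec.subspace_UNIV in \<open>auto simp: prod_germ_simps(2) intro: that\<close>)
  have pU: "?p \<in> U" and W': "open W" "p \<in> W" using U W by (simp_all add: nbhd_def)
  have gp: "g p = ?p" using f(5,6) pU by metis
  \<comment> \<open>A linear extension \<open>L\<close> of the differential is already surjective on
    \<open>?X\<close>. By dimension \<open>L\<close> is injective, so no vector can lie outside
    \<open>?X\<close>.\<close>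
  have X: "?X = UNIV"
  proof -
    have "openin (top_of_set ?X) U" using U by (simp add: nbhd_def)
    then obtain L where L: "clin L" "\<And>v. v \<in> ?X \<Longrightarrow> dif \<Psi> ?p v = L v"
      using dif_props[OF f(3) sX _ pU] by metis
    have surj: "\<exists>v\<in>?X. w = L v" for w
      using dfg[OF W'(2), of w] dg[OF W'(2), of w] L(2) gp by (intro bexI[of _ "dif g p w"]) auto
    then have "surj L" by (metis surjI surj_def)
    then have "inj L" using vec.linear_surjective_imp_injective[OF L(1)] by blast
    have "x \<in> ?X" for x using surj[of "L x"] \<open>inj L\<close> by (metis injD)
    then show ?thesis by blast
  qed
  have D: "direct_sum K V UNIV" using D X by simp
  have dp: "direct_projections K V \<pi>" unfolding \<pi>_def by (rule direct_projections_component[OF D])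
  interpret dp: direct_projections K V \<pi> by (rule dp)
  have oU: "open U" using U X by (simp add: nbhd_def)
  have \<pi>p: "\<pi> Q ?p = germ_pt (G Q)" if "Q \<in> K" for Q
    by (rule dp.\<pi>_sum_family[OF that pt(2)])
  define N0 where "N0 = U \<inter> (\<Inter>Q\<in>K. \<pi> Q -` U2 Q)"
  have "open (\<pi> Q -` U2 Q)" if Q: "Q \<in> K" for Q
  proof -
    obtain O' where O: "open O'" "U2 Q = V Q \<inter> O'" using U2(1)[OF Q] by (auto simp: nbhd_def openin_open)
    have "\<pi> Q -` U2 Q = \<pi> Q -` O'" using O(2) dp.\<pi>_in[OF Q] by auto
    then show ?thesis using open_vimage[OF O(1) holo_on_imp_continuous_on[OF dp.\<pi>_holo[OF Q]]] by simp
  qed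
  then have N0: "open N0" "?p \<in> N0" "N0 \<subseteq> U"
    unfolding N0_def using oU pU finite_K \<pi>p pt(1) by (auto intro!: open_Int open_INT)
  have N0U: "\<pi> Q y \<in> U2 Q" if "y \<in> N0" "Q \<in> K" for y Q using that by (auto simp: N0_def)
  \<comment> \<open>The unit field of the factor \<open>Q\<close>, viewed in the product: there it
    is the idempotent that projects to this factor.\<close>
  define u where "u Q y = germ_unit (G Q) (\<pi> Q y)" for Q y
  have uV: "u Q y \<in> V Q" if "y \<in> N0" "Q \<in> K" for Q y
    unfolding u_def by (rule F_unit_in[OF U2(2)[OF that(2)] N0U[OF that]])
  have mu: "?m y (u Q y) w = \<pi> Q w" if y: "y \<in> N0" and Q: "Q \<in> K" for y Q w
  proof -
    have "?m y (u Q y) w = (\<Sum>R\<in>K. if R = Q then \<pi> Q w else 0)"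
    proof (rule sum.cong)
      fix R assume R: "R \<in> K"
      show "germ_mult (G R) (\<pi> R y) (\<pi> R (u Q y)) (\<pi> R w) = (if R = Q then \<pi> Q w else 0)"
      proof (cases "R = Q")
        case True
        have "germ_mult (G Q) (\<pi> Q y) (u Q y) (\<pi> Q w) = \<pi> Q w"
          unfolding u_def by (rule F_unit_mult[OF U2(2)[OF Q] N0U[OF y Q] dp.\<pi>_in[OF Q]])
        then show ?thesis using True dp.\<pi>_same[OF Q uV[OF y Q]] by simp
      next
        case False
        then show ?thesis
          using dp.\<pi>_other[OF R Q False uV[OF y Q]] F_mult_0[OF U2(2)[OF R] N0U[OF y R] dp.\<pi>_in[OF R]] by simp
      qed
    qed simp
    then show ?thesis using Q finite_K by simp
  qed
  have key: "dif \<Psi> y (\<pi> Q w) = m (\<Psi> y) (dif \<Psi> y (u Q y)) (dif \<Psi> y w)" if "y \<in> N0" "Q \<in> K" for y Q w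
    using alg[of y "u Q y" w] mu[OF that] that(1) N0(3) X by auto
  define b where "b Q x = dif \<Psi> (g x) (u Q (g x))" for Q x
  define M0 where "M0 = (W \<inter> g -` N0) \<inter> S"
  have M0: "open M0" "p \<in> M0" "M0 \<subseteq> S" "M0 \<subseteq> W" "\<And>x. x \<in> M0 \<Longrightarrow> g x \<in> N0"
    unfolding M0_def using continuous_open_preimage[OF holo_on_imp_continuous_on[OF f(4)] W'(1) N0(1)] open_S W'(2) gp N0(2) p_in
    by auto
  have b_holo: "holo_on M0 (b Q)" if Q: "Q \<in> K" for Q
  proof -
    have gh: "holo_on M0 g" using f(4) M0(4) by (rule holo_on_subset)
    have uh: "holo_on N0 (u Q)"
      unfolding u_def by (rule holo_on_compose[OF dp.\<pi>_holo[OF Q] F_unit_holo[OF U2(2)[OF Q]]]) (use N0U Q in blast)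
    have "holo_on N0 (\<lambda>y. dif \<Psi> y (u Q y))"
      by (rule holo_on_linear_family[where A="dif \<Psi>", OF _ holo_on_subset[OF holo_on_dif[OF oU f(3)] N0(3)] uh])
        (use holo_on_open_has_derivative(1)[OF f(3) oU] N0(3) in blast)
    then show ?thesis unfolding b_def by (rule holo_on_compose[OF gh]) (use M0(5) in blast)
  qed
  have \<Psi>g: "\<Psi> (g x) = x" if "x \<in> M0" for x using f(7) that M0(4) by blast
  have b_idem: "m x (b Q x) (b Q x) = b Q x" if "x \<in> M0" "Q \<in> K" for x Q
    using key[OF M0(5)[OF that(1)] that(2), of "u Q (g x)"] \<Psi>g[OF that(1)] dp.\<pi>_same[OF that(2) uV[OF M0(5)[OF that(1)] that(2)]]
    by (simp add: b_def)
  \<comment> \<open>Both are units of the eigenspace \<open>Q\<close>: the transported idempotent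
    lies in \<open>Q\<close> since the differential maps the model space of the factor onto
    \<open>Q\<close>.\<close>
  have b_p: "b Q p = E Q p" if Q: "Q \<in> K" for Q
  proof -
    have "b Q p = dif \<Psi> ?p (u Q ?p)" by (simp add: b_def gp)
    then have bQ: "b Q p \<in> Q" using im[OF Q] uV[OF N0(2) Q] by blast
    obtain v where v: "v \<in> V Q" "\<epsilon> Q = dif \<Psi> ?p v" using im[OF Q] A.e_in[OF Q] by blast
    have "\<epsilon> Q = m p (b Q p) (\<epsilon> Q)"
      using key[OF N0(2) Q, of v] dp.\<pi>_same[OF Q v(1)] v(2) f(5) by (simp add: b_def gp)
    also have "\<dots> = b Q p" unfolding A.mult_commute[of "b Q p"] by (rule A.e_mult_same[OF Q bQ])
    finally show ?thesis by (simp add: E_p[OF Q])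
  qed
  have "\<forall>\<^sub>F x in nhds p. b Q x = E Q x" if Q: "Q \<in> K" for Q
  proof (rule idempotent_fields_agree[where a="b Q" and b="E Q", OF M0(1,2,3)])
    show "continuous_on M0 (b Q)" by (rule holo_on_imp_continuous_on[OF b_holo[OF Q]])
    show "continuous_on M0 (E Q)" by (rule holo_on_imp_continuous_on[OF holo_on_subset[OF E_holo[OF Q] M0(3)]])
    show "m x (E Q x) (E Q x) = E Q x" if "x \<in> M0" for x by (rule E_idem[OF Q]) (use that M0(3) in blast)
  qed (simp_all add: b_p[OF Q] b_idem[OF _ Q])
  then have "\<forall>\<^sub>F x in nhds p. \<forall>Q\<in>K. b Q x = E Q x"
    by (intro eventually_ball_finite finite_K ballI)
  moreover have "\<forall>\<^sub>F x in nhds p. x \<in> M0" using M0(1,2) by (intro eventually_nhds_in_open)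
  ultimately have "\<forall>\<^sub>F x in nhds p. (\<forall>Q\<in>K. b Q x = E Q x) \<and> x \<in> M0" by eventually_elim simp
  then obtain M where M: "open M" "p \<in> M" "\<And>x. x \<in> M \<Longrightarrow> (\<forall>Q\<in>K. b Q x = E Q x) \<and> x \<in> M0"
    by (rule eventually_nhdsE) (rule that)
  have MM0: "M \<subseteq> M0" using M(3) by blast
  define N where "N = g ` M"
  have NU: "N = U \<inter> \<Psi> -` M"
    unfolding N_def using f(1,2,6,7) MM0 M0(4) by (auto simp: image_iff) (metis subsetD)+
  have oN: "open N" unfolding NU by (rule continuous_open_preimage[OF holo_on_imp_continuous_on[OF f(3)] oU M(1)])
  have NN0: "N \<subseteq> N0" unfolding N_def using MM0 M0(5) by blast
  have bi: "biholomorphism N M \<Psi> g"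
  proof (rule biholomorphism.intro)
    show "holo_on N \<Psi>" using f(3) by (rule holo_on_subset) (simp add: NU)
    show "holo_on M g" using f(4) by (rule holo_on_subset) (use MM0 M0(4) in blast)
    show "\<Psi> ` N = M" unfolding N_def image_image using \<Psi>g MM0 by force
    show "g ` M = N" by (simp add: N_def)
    show "g (\<Psi> x) = x" if "x \<in> N" for x using f(6) that by (simp add: NU)
    show "\<Psi> (g y) = y" if "y \<in> M" for y using \<Psi>g that MM0 by blast
  qed (rule oN M(1))+
  have aE: "dif \<Psi> y (u Q y) = E Q (\<Psi> y)" if "y \<in> N" "Q \<in> K" for y Q
  proof -
    have "y \<in> U" "\<Psi> y \<in> M" using that by (auto simp: NU)
    then show ?thesis using M(3)[of "\<Psi> y"] that(2) f(6) by (simp add: b_def)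
  qed
  show ?thesis
  proof (rule that[OF bi _ M(2) _ f(5) dp pt(2)])
    show "?p \<in> N" using pU M(2) f(5) by (simp add: NU)
    show "M \<subseteq> S" using MM0 M0(3) by blast
    fix y assume y: "y \<in> N"
    then have y0: "y \<in> N0" and yU: "y \<in> U" using NN0 by (auto simp: NU)
    show "dif \<Psi> y (\<pi> Q w) = m (\<Psi> y) (E Q (\<Psi> y)) (dif \<Psi> y w)" if "Q \<in> K" for Q w
      unfolding key[OF y0 that] aE[OF y that] ..
    show "dif \<Psi> y (?m y v w) = m (\<Psi> y) (dif \<Psi> y v) (dif \<Psi> y w)" for v w
      by (rule alg[OF yU]) (simp_all add: X)
    show "dif \<Psi> y (\<Sum>Q\<in>K. germ_unit (G Q) (\<pi> Q y)) = e (\<Psi> y)" by (rule unit[OF yU])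
    show "germ_mult (G Q) (\<pi> Q y) v w \<in> V Q" if "Q \<in> K" "v \<in> V Q" "w \<in> V Q" for Q v w
      by (rule F_mult_in[OF U2(2) N0U]) (use that y0 in auto)
    show "germ_mult (G Q) (\<pi> Q y) 0 w = 0" if "Q \<in> K" "w \<in> V Q" for Q w
      by (rule F_mult_0[OF U2(2) N0U]) (use that y0 in auto)
    show "germ_unit (G Q) (\<pi> Q y) \<in> V Q" if "Q \<in> K" for Q
      using uV[OF y0 that] by (simp add: u_def)
  qed (auto simp: X)
qed

end

section \<open>Uniqueness\<close>

context decomposed_germ
begin

text \<open>Both splittings are carried to multiplication by the same idempotent fields, so the
  differential of the change of coordinates \<open>\<Theta>\<close> commutes with the projections.
  Hence each component of \<open>\<Theta>\<close> depends on the corresponding coordinate alone, and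
  \<open>\<Theta>\<close> is a product of maps between the factors. Base points at 0 place the
  polydisc around the base point of the product.\<close>

theorem decomposition_unique:
  fixes G G' :: "(complex ^ 'n) set \<Rightarrow> 'n fgerm"
  assumes ext: "extends_to H K (\<lambda>Q. Q) G \<Psi>" and ext': "extends_to H K (\<lambda>Q. Q) G' \<Psi>'"
    and pt0: "\<And>Q. Q \<in> K \<Longrightarrow> germ_pt (G Q) = 0"
  obtains \<theta> U where "\<And>Q. Q \<in> K \<Longrightarrow> germ_iso (G Q) (G' Q) (\<theta> Q)" "open U" "0 \<in> U"
    "\<And>x. x \<in> U \<Longrightarrow> \<Psi> x = \<Psi>' (\<Sum>Q\<in>K. \<theta> Q (component K (\<lambda>Q. germ_space (G Q)) Q x))"
proof -
  let ?V = "\<lambda>Q. germ_space (G Q)" and ?V' = "\<lambda>Q. germ_space (G' Q)"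
  define \<pi> where "\<pi> = component K ?V"
  define \<pi>' where "\<pi>' = component K ?V'"
  let ?q = "\<Sum>Q\<in>K. germ_pt (G' Q)"
  let ?m = "\<lambda>y v w. \<Sum>Q\<in>K. germ_mult (G Q) (\<pi> Q y) (\<pi> Q v) (\<pi> Q w)"
  let ?m' = "\<lambda>y v w. \<Sum>Q\<in>K. germ_mult (G' Q) (\<pi>' Q y) (\<pi>' Q v) (\<pi>' Q w)"
  let ?u = "\<lambda>y. \<Sum>Q\<in>K. germ_unit (G Q) (\<pi> Q y)"
  let ?u' = "\<lambda>y. \<Sum>Q\<in>K. germ_unit (G' Q) (\<pi>' Q y)"
  have p0: "(\<Sum>Q\<in>K. germ_pt (G Q)) = 0" by (rule sum.neutral) (simp add: pt0)
  obtain N M F where B: "biholomorphism N M \<Psi> F" and N0: "0 \<in> N" and "p \<in> M" and \<Psi>0: "\<Psi> 0 = p"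
    and dp: "direct_projections K ?V \<pi>"
    and c1: "\<And>y Q w. y \<in> N \<Longrightarrow> Q \<in> K \<Longrightarrow> dif \<Psi> y (\<pi> Q w) = m (\<Psi> y) (E Q (\<Psi> y)) (dif \<Psi> y w)"
    and c2: "\<And>y v w. y \<in> N \<Longrightarrow> dif \<Psi> y (?m y v w) = m (\<Psi> y) (dif \<Psi> y v) (dif \<Psi> y w)"
    and c3: "\<And>y. y \<in> N \<Longrightarrow> dif \<Psi> y (?u y) = e (\<Psi> y)"
    and c4: "\<And>y Q v w. y \<in> N \<Longrightarrow> Q \<in> K \<Longrightarrow> v \<in> ?V Q \<Longrightarrow> w \<in> ?V Q \<Longrightarrow> germ_mult (G Q) (\<pi> Q y) v w \<in> ?V Q"
    and c5: "\<And>y Q w. y \<in> N \<Longrightarrow> Q \<in> K \<Longrightarrow> w \<in> ?V Q \<Longrightarrow> germ_mult (G Q) (\<pi> Q y) 0 w = 0"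
    and c6: "\<And>y Q. y \<in> N \<Longrightarrow> Q \<in> K \<Longrightarrow> germ_unit (G Q) (\<pi> Q y) \<in> ?V Q"
    by (rule extends_to_chart[OF ext, folded \<pi>_def, unfolded p0]) (rule that)
  obtain N' M' F' where B': "biholomorphism N' M' \<Psi>' F'" and qN: "?q \<in> N'" and pM': "p \<in> M'" and \<Psi>q: "\<Psi>' ?q = p"
    and dp': "direct_projections K ?V' \<pi>'" and pt': "\<And>Q. Q \<in> K \<Longrightarrow> germ_pt (G' Q) \<in> ?V' Q"
    and d1: "\<And>y Q w. y \<in> N' \<Longrightarrow> Q \<in> K \<Longrightarrow> dif \<Psi>' y (\<pi>' Q w) = m (\<Psi>' y) (E Q (\<Psi>' y)) (dif \<Psi>' y w)"
    and d2: "\<And>y v w. y \<in> N' \<Longrightarrow> dif \<Psi>' y (?m' y v w) = m (\<Psi>' y) (dif \<Psi>' y v) (dif \<Psi>' y w)"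
    and d3: "\<And>y. y \<in> N' \<Longrightarrow> dif \<Psi>' y (?u' y) = e (\<Psi>' y)"
    and "\<And>y Q v w. y \<in> N' \<Longrightarrow> Q \<in> K \<Longrightarrow> v \<in> ?V' Q \<Longrightarrow> w \<in> ?V' Q \<Longrightarrow> germ_mult (G' Q) (\<pi>' Q y) v w \<in> ?V' Q"
    and d5: "\<And>y Q w. y \<in> N' \<Longrightarrow> Q \<in> K \<Longrightarrow> w \<in> ?V' Q \<Longrightarrow> germ_mult (G' Q) (\<pi>' Q y) 0 w = 0"
    and d6: "\<And>y Q. y \<in> N' \<Longrightarrow> Q \<in> K \<Longrightarrow> germ_unit (G' Q) (\<pi>' Q y) \<in> ?V' Q"
    by (rule extends_to_chart[OF ext', folded \<pi>'_def]) (rule that)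
  interpret B: biholomorphism N M \<Psi> F by (rule B)
  interpret B': biholomorphism N' M' \<Psi>' F' by (rule B')
  interpret P: direct_projections K ?V \<pi> by (rule dp)
  interpret P': direct_projections K ?V' \<pi>' by (rule dp')
  have "open (N \<inter> \<Psi> -` M')"
    by (rule continuous_open_preimage[OF holo_on_imp_continuous_on[OF B.F_holo] B.open_U B'.open_V])
  moreover have "0 \<in> N \<inter> \<Psi> -` M'" using N0 \<Psi>0 pM' by simp
  ultimately obtain d where d: "d > 0" "P.box d \<subseteq> N \<inter> \<Psi> -` M'"
    by (rule P.box_in_open)
  let ?B = "P.box d"
  have BN: "y \<in> N" and BM': "\<Psi> y \<in> M'" if "y \<in> ?B" for y using d(2) that by auto
  define \<Theta> where "\<Theta> y = F' (\<Psi> y)" for y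
  have \<Theta>N': "\<Theta> y \<in> N'" if "y \<in> ?B" for y unfolding \<Theta>_def by (rule B'.\<Psi>_in[OF BM'[OF that]])
  have \<Psi>\<Theta>: "\<Psi>' (\<Theta> y) = \<Psi> y" if "y \<in> ?B" for y unfolding \<Theta>_def by (rule B'.F_\<Psi>[OF BM'[OF that]])
  have \<Theta>_holo: "holo_on ?B \<Theta>"
    unfolding \<Theta>_def
    by (rule holo_on_compose[OF holo_on_subset[OF B.F_holo] B'.\<Psi>_holo]) (use BN BM' in auto)
  have d\<Theta>: "dif \<Psi>' (\<Theta> y) (dif \<Theta> y v) = dif \<Psi> y v" if y: "y \<in> ?B" for y v
  proof -
    have "dif \<Psi>' (\<Theta> y) (dif \<Theta> y v) = dif (\<lambda>y. \<Psi>' (\<Theta> y)) y v"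
      by (rule dif_compose_open[OF \<Theta>_holo B'.F_holo _ P.open_box B'.open_U y, symmetric]) (use \<Theta>N' in auto)
    also have "\<dots> = dif \<Psi> y v" by (rule dif_cong_open[OF P.open_box y \<Psi>\<Theta>])
    finally show ?thesis .
  qed
  have inj: "v = w" if "y \<in> ?B" "dif \<Psi>' (\<Theta> y) v = dif \<Psi>' (\<Theta> y) w" for y v w
    using B'.dif_\<Psi>_F[OF \<Theta>N'[OF that(1)]] that(2) by metis
  have e1: "dif \<Theta> y (\<pi> Q w) = \<pi>' Q (dif \<Theta> y w)" if y: "y \<in> ?B" and Q: "Q \<in> K" for y Q w
    by (rule inj[OF y]) (simp only: d\<Theta>[OF y] d1[OF \<Theta>N'[OF y] Q] c1[OF BN[OF y] Q] \<Psi>\<Theta>[OF y])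
  have e2: "dif \<Theta> y (?m y v w) = ?m' (\<Theta> y) (dif \<Theta> y v) (dif \<Theta> y w)" if y: "y \<in> ?B" for y v w
    by (rule inj[OF y]) (simp only: d\<Theta>[OF y] d2[OF \<Theta>N'[OF y]] c2[OF BN[OF y]] \<Psi>\<Theta>[OF y])
  have e3: "dif \<Theta> y (?u y) = ?u' (\<Theta> y)" if y: "y \<in> ?B" for y
    by (rule inj[OF y]) (simp only: d\<Theta>[OF y] d3[OF \<Theta>N'[OF y]] c3[OF BN[OF y]] \<Psi>\<Theta>[OF y])
  define h where "h Q y = \<pi>' Q (\<Theta> y)" for Q y
  have h_holo: "holo_on ?B (h Q)" if "Q \<in> K" for Q
    unfolding h_def by (rule holo_on_clin[OF P'.\<pi>_clin[OF that] \<Theta>_holo])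
  have dh: "dif (h Q) y v = \<pi>' Q (dif \<Theta> y v)" if "Q \<in> K" "y \<in> ?B" for Q y v
    unfolding h_def by (rule dif_clin_compose[OF P.open_box that(2) P'.\<pi>_clin[OF that(1)] \<Theta>_holo])
  have h_dep: "h Q y = h Q (\<pi> Q y)" if Q: "Q \<in> K" and y: "y \<in> ?B" for Q y
  proof (rule P.depends_on_component[OF h_holo[OF Q] d(1) Q _ y])
    fix y R a assume *: "y \<in> ?B" "R \<in> K" "R \<noteq> Q" "a \<in> ?V R"
    have "dif \<Theta> y a = \<pi>' R (dif \<Theta> y a)" using e1[OF *(1,2), of a] P.\<pi>_same[OF *(2,4)] by simp
    then have "\<pi>' Q (dif \<Theta> y a) = \<pi>' Q (\<pi>' R (dif \<Theta> y a))" by simp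
    also have "\<dots> = 0" using P'.\<pi>_\<pi>[OF Q *(2)] *(3) by simp
    finally show "dif (h Q) y a = 0" unfolding dh[OF Q *(1)] .
  qed
  have \<Theta>0: "\<Theta> 0 = ?q" unfolding \<Theta>_def \<Psi>0 using B'.\<Psi>_F[OF qN] \<Psi>q by simp
  have B0: "0 \<in> ?B" by (rule P.zero_in_box[OF d(1)])
  have h0: "h Q 0 = germ_pt (G' Q)" if "Q \<in> K" for Q
    unfolding h_def \<Theta>0 by (rule P'.\<pi>_sum_family[OF that pt'])
  have \<Theta>_sum: "\<Theta> y = (\<Sum>Q\<in>K. h Q (\<pi> Q y))" if "y \<in> ?B" for y
  proof -
    have "\<Theta> y = (\<Sum>Q\<in>K. h Q y)" unfolding h_def P'.\<pi>_sum ..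
    also have "\<dots> = (\<Sum>Q\<in>K. h Q (\<pi> Q y))" by (rule sum.cong) (use h_dep that in auto)
    finally show ?thesis .
  qed
  have hR: "h R y = germ_pt (G' R)" if "Q \<in> K" "R \<in> K" "R \<noteq> Q" "y \<in> ?B" "y \<in> ?V Q" for Q R y
    using h_dep[OF that(2,4)] P.\<pi>_other[OF that(2,1,3,5)] h0[OF that(2)] by simp
  \<comment> \<open>The base point of the remaining factors: on the slice of \<open>Q\<close> the
    map \<open>\<Theta>\<close> is \<open>h Q\<close> translated by this vector.\<close>
  define c where "c Q = (\<Sum>R\<in>K - {Q}. germ_pt (G' R))" for Q
  have \<Theta>c: "\<Theta> y = h Q y + c Q" if Q: "Q \<in> K" and y: "y \<in> ?B" "y \<in> ?V Q" for Q y
  proof -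
    have "\<Theta> y = (\<Sum>R\<in>K. h R y)" unfolding h_def P'.\<pi>_sum ..
    also have "\<dots> = h Q y + (\<Sum>R\<in>K - {Q}. h R y)" by (rule sum.remove[OF finite_K Q])
    also have "(\<Sum>R\<in>K - {Q}. h R y) = c Q"
      unfolding c_def by (rule sum.cong) (use hR[OF Q _ _ y] in auto)
    finally show ?thesis .
  qed
  define O' where "O' = N' \<inter> \<Psi>' -` M"
  have O': "open O'" unfolding O'_def
    by (rule continuous_open_preimage[OF holo_on_imp_continuous_on[OF B'.F_holo] B'.open_U B.open_V])
  define \<Xi> where "\<Xi> z = F (\<Psi>' z)" for z
  have \<Xi>_holo: "holo_on O' \<Xi>"
    unfolding \<Xi>_def by (rule holo_on_compose[OF holo_on_subset[OF B'.F_holo] B.\<Psi>_holo]) (auto simp: O'_def)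
  have \<Xi>\<Theta>: "\<Xi> (\<Theta> y) = y" "\<Theta> y \<in> O'" if "y \<in> ?B" for y
    using \<Psi>\<Theta>[OF that] B.\<Psi>_F[OF BN[OF that]] B.F_in[OF BN[OF that]] \<Theta>N'[OF that] by (simp_all add: \<Xi>_def O'_def)
  have \<Theta>\<Xi>: "\<Theta> (\<Xi> z) = z" if "z \<in> O'" for z
    using that B.F_\<Psi>[of "\<Psi>' z"] B'.\<Psi>_F[of z] by (simp add: \<Theta>_def \<Xi>_def O'_def)
  define D where "D = O' \<inter> \<Xi> -` ?B"
  have oD: "open D" unfolding D_def
    by (rule continuous_open_preimage[OF holo_on_imp_continuous_on[OF \<Xi>_holo] O' P.open_box])
  have iso: "germ_iso (G Q) (G' Q) (h Q)" if Q: "Q \<in> K" for Q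
  proof -
    define U where "U = ?B \<inter> ?V Q"
    define W where "W = h Q ` U"
    have UB: "y \<in> ?B" "y \<in> ?V Q" if "y \<in> U" for y using that by (auto simp: U_def)
    have \<Xi>h: "\<Xi> (h Q y + c Q) = y" if "y \<in> U" for y
      using \<Xi>\<Theta>(1)[OF UB(1)[OF that]] \<Theta>c[OF Q UB[OF that]] by simp
    have injh: "inj_on (h Q) U" using \<Xi>h by (metis inj_onI)
    have oU: "nbhd (?V Q) (germ_pt (G Q)) U"
      using P.open_box B0 P.V_subspace[OF Q] pt0[OF Q] by (auto simp: nbhd_def U_def openin_open vec.subspace_0)
    have cQ: "\<pi>' Q (c Q) = 0"
      unfolding c_def clin_sum[OF P'.\<pi>_clin[OF Q]]
      by (rule sum.neutral) (use P'.\<pi>_other[OF Q] pt' in auto)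
    \<comment> \<open>The image of the slice is written as a slice of the translated open set
      \<open>D\<close>; this gives its relative openness, which injectivity of \<open>h Q\<close>
      alone would not.\<close>
    have Weq: "W = ?V' Q \<inter> (\<lambda>z. z + c Q) -` D"
    proof (intro set_eqI iffI)
      fix z assume "z \<in> W"
      then obtain y where y: "y \<in> U" "z = h Q y" by (auto simp: W_def)
      have "z + c Q = \<Theta> y" using \<Theta>c[OF Q UB[OF y(1)]] y(2) by simp
      then show "z \<in> ?V' Q \<inter> (\<lambda>z. z + c Q) -` D"
        using \<Xi>\<Theta>[OF UB(1)[OF y(1)]] UB(1)[OF y(1)] P'.\<pi>_in[OF Q] by (simp add: D_def y(2) h_def)
    next
      fix z assume "z \<in> ?V' Q \<inter> (\<lambda>z. z + c Q) -` D"
      then have z: "z \<in> ?V' Q" "z + c Q \<in> O'" "\<Xi> (z + c Q) \<in> ?B" by (auto simp: D_def)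
      let ?y = "\<Xi> (z + c Q)"
      have "z = \<pi>' Q (z + c Q)" by (simp add: clin_add[OF P'.\<pi>_clin[OF Q]] cQ P'.\<pi>_same[OF Q z(1)])
      also have "\<dots> = h Q ?y" by (simp add: h_def \<Theta>\<Xi>[OF z(2)])
      also have "\<dots> = h Q (\<pi> Q ?y)" by (rule h_dep[OF Q z(3)])
      finally show "z \<in> W"
        unfolding W_def U_def using P.\<pi>_in_box[OF z(3) d(1) Q] P.\<pi>_in[OF Q] by blast
    qed
    have "open ((\<lambda>z. z + c Q) -` D)" by (rule open_vimage[OF oD]) (intro continuous_intros)
    then have "openin (top_of_set (?V' Q)) W"
      unfolding openin_open using Weq by blast
    moreover have "germ_pt (G' Q) \<in> W"
      unfolding W_def U_def using h0[OF Q] B0 vec.subspace_0[OF P.V_subspace[OF Q]] by (intro image_eqI[of _ _ 0]) auto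
    ultimately have oW: "nbhd (?V' Q) (germ_pt (G' Q)) W" by (simp add: nbhd_def)
    have inv: "inv_into U (h Q) z = \<Xi> (z + c Q)" if zW: "z \<in> W" for z
    proof -
      obtain y where y: "y \<in> U" "z = h Q y" using zW by (auto simp: W_def)
      then show ?thesis using inv_into_f_f[OF injh y(1)] \<Xi>h[OF y(1)] by simp
    qed
    have hinv: "holo_on W (inv_into U (h Q))"
    proof (rule holo_on_cong)
      show "holo_on W (\<lambda>z. \<Xi> (z + c Q))"
        by (rule holo_on_compose[OF _ \<Xi>_holo]) (use Weq in \<open>auto intro!: holo_on_add simp: D_def\<close>)
    qed (simp add: inv)
    have dhQ: "dif (h Q) x v = dif \<Theta> x v" "dif \<Theta> x v \<in> ?V' Q" if "x \<in> U" "v \<in> ?V Q" for x v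
      using e1[OF UB(1)[OF that(1)] Q, of v] P.\<pi>_same[OF Q that(2)] dh[OF Q UB(1)[OF that(1)], of v] P'.\<pi>_in[OF Q, of "dif \<Theta> x v"]
      by simp_all
    have mult: "dif (h Q) x (germ_mult (G Q) x v w) = germ_mult (G' Q) (h Q x) (dif (h Q) x v) (dif (h Q) x w)"
      if x: "x \<in> U" and v: "v \<in> ?V Q" and w: "w \<in> ?V Q" for x v w
    proof -
      have xx: "\<pi> Q x = x" by (rule P.\<pi>_same[OF Q UB(2)[OF x]])
      have "?m x v w = (\<Sum>R\<in>K. if R = Q then germ_mult (G Q) x v w else 0)"
        by (rule sum.cong) (use P.\<pi>_same[OF Q] P.\<pi>_other[OF _ Q] v w xx c5[OF BN[OF UB(1)[OF x]]] vec.subspace_0[OF P.V_subspace] in auto)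
      then have 1: "?m x v w = germ_mult (G Q) x v w" using Q finite_K by simp
      have "?m' (\<Theta> x) (dif \<Theta> x v) (dif \<Theta> x w) = (\<Sum>R\<in>K. if R = Q then germ_mult (G' Q) (h Q x) (dif \<Theta> x v) (dif \<Theta> x w) else 0)"
        by (rule sum.cong) (use P'.\<pi>_same[OF Q] P'.\<pi>_other[OF _ Q] dhQ(2)[OF x v] dhQ(2)[OF x w] d5[OF \<Theta>N'[OF UB(1)[OF x]]] vec.subspace_0[OF P'.V_subspace] h_def in auto)
      then have 2: "?m' (\<Theta> x) (dif \<Theta> x v) (dif \<Theta> x w) = germ_mult (G' Q) (h Q x) (dif \<Theta> x v) (dif \<Theta> x w)" using Q finite_K by simp
      have mem: "germ_mult (G Q) x v w \<in> ?V Q" using c4[OF BN[OF UB(1)[OF x]] Q v w] xx by simp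
      show ?thesis
        using e2[OF UB(1)[OF x], of v w] unfolding 1 2 dhQ(1)[OF x v] dhQ(1)[OF x w] dhQ(1)[OF x mem] .
    qed
    have unit: "dif (h Q) x (germ_unit (G Q) x) = germ_unit (G' Q) (h Q x)" if x: "x \<in> U" for x
    proof -
      have xB: "x \<in> ?B" by (rule UB(1)[OF x])
      have 1: "\<pi> Q (?u x) = germ_unit (G Q) x"
        using P.\<pi>_sum_family[OF Q c6[OF BN[OF xB]]] P.\<pi>_same[OF Q UB(2)[OF x]] by simp
      have 2: "\<pi>' Q (?u' (\<Theta> x)) = germ_unit (G' Q) (h Q x)"
        using P'.\<pi>_sum_family[OF Q d6[OF \<Theta>N'[OF xB]]] by (simp add: h_def)
      have mem: "germ_unit (G Q) x \<in> ?V Q" unfolding 1[symmetric] by (rule P.\<pi>_in[OF Q])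
      have "dif \<Theta> x (\<pi> Q (?u x)) = \<pi>' Q (?u' (\<Theta> x))" unfolding e1[OF xB Q] e3[OF xB] ..
      then show ?thesis unfolding 1 2 dhQ(1)[OF x mem] .
    qed
    have holoU: "holo_on U (h Q)" using h_holo[OF Q] by (rule holo_on_subset) (simp add: U_def)
    have bij: "bij_betw (h Q) U W" unfolding W_def bij_betw_def using injh by simp
    show ?thesis
      unfolding germ_iso_def
      by (intro exI[of _ U] exI[of _ W] conjI ballI oU oW bij holoU hinv mult unit) (simp_all add: pt0[OF Q] h0[OF Q])
  qed
  show ?thesis
  proof (rule that[of h ?B])
    show "germ_iso (G Q) (G' Q) (h Q)" if "Q \<in> K" for Q by (rule iso[OF that])
    show "\<Psi> x = \<Psi>' (\<Sum>Q\<in>K. h Q (component K ?V Q x))" if "x \<in> ?B" for x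
      using \<Psi>\<Theta>[OF that] \<Theta>_sum[OF that] by (simp add: \<pi>_def)
  qed (rule P.open_box B0)+
qed

end

section \<open>Existence\<close>

lemma (in biholomorphism) restrict_domain:
  assumes "open U'" "U' \<subseteq> U"
  shows "biholomorphism U' (F ` U') F \<Psi>"
proof (rule biholomorphism.intro)
  have eq: "F ` U' = V \<inter> \<Psi> -` U'"
  proof (intro set_eqI iffI)
    fix y assume "y \<in> F ` U'"
    then obtain x where "x \<in> U'" "y = F x" by blast
    then show "y \<in> V \<inter> \<Psi> -` U'" using assms(2) F_in \<Psi>_F by auto
  next
    fix y assume "y \<in> V \<inter> \<Psi> -` U'"
    then show "y \<in> F ` U'" using F_\<Psi>[of y] by (metis IntD1 IntD2 image_eqI vimageE)
  qed
  show "open (F ` U')"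
    unfolding eq by (rule continuous_open_preimage[OF holo_on_imp_continuous_on[OF \<Psi>_holo] open_V assms(1)])
  show "holo_on U' F" using F_holo assms(2) by (rule holo_on_subset)
  show "holo_on (F ` U') \<Psi>" using \<Psi>_holo by (rule holo_on_subset) (simp add: eq)
  show "\<Psi> ` F ` U' = U'" unfolding image_image using \<Psi>_F assms(2) by force
  show "\<Psi> (F x) = x" if "x \<in> U'" for x using \<Psi>_F that assms(2) by blast
  show "F (\<Psi> y) = y" if "y \<in> F ` U'" for y using F_\<Psi> that by (simp add: eq)
qed (auto simp: assms(1))

lemma euler_field_restrict:
  assumes E: "euler_field UNIV U m d X" and T: "open T" "T \<subseteq> U"
  shows "euler_field UNIV T m d X"
proof -
  have "holo_on T X" using E T(2) holo_on_subset by (auto simp: euler_field_def vfield_def)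
  moreover have "lie_mult m X Z V x = d *s m x (Z x) (V x)"
    if "open W" "W \<subseteq> T" "holo_on W Z" "holo_on W V" "x \<in> W" for W Z V x
    by (rule euler_fieldD[OF E that(1) _ that(3-5)]) (use that(2) T(2) in blast)
  ultimately show ?thesis unfolding euler_field_def by (auto simp: vfield_def)
qed

context decomposed_germ
begin

text \<open>The factors are the slices through 0 of the straightened chart, where multiplication by
  each idempotent field is a constant projection. Since that chart has identity differential at the
  base point, the tangent algebras of the factors are the eigenspaces themselves and not just
  isomorphic to them.\<close>

theorem decomposition:
  obtains G \<Psi> where "extends_to H K (\<lambda>Q. Q) G \<Psi>"
    "\<And>Q. Q \<in> K \<Longrightarrow> germ_space (G Q) = Q" "\<And>Q. Q \<in> K \<Longrightarrow> germ_pt (G Q) = 0"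
    "germ_space (prod_germ K G) = UNIV" "germ_pt (prod_germ K G) = 0" "\<And>v. dif \<Psi> 0 v = v"
    "\<And>Q v w. Q \<in> K \<Longrightarrow> germ_mult (G Q) 0 v w = m p v w"
    "\<And>X c. euler_germ H c X \<Longrightarrow> \<exists>F. (\<forall>Q\<in>K. euler_germ (G Q) c (F Q)) \<and>
      (\<exists>U. open U \<and> 0 \<in> U \<and> (\<forall>x\<in>U. X (\<Psi> x) = dif \<Psi> x (\<Sum>Q\<in>K. F Q (component K (\<lambda>Q. germ_space (G Q)) Q x))))"
proof -
  define \<pi> where "\<pi> Q = m p (\<epsilon> Q)" for Q
  have KK: "direct_sum K (\<lambda>Q. Q) UNIV" by (rule A.eigenspaces_direct_sum)
  have \<pi>_comp: "component K (\<lambda>Q. Q) Q x = \<pi> Q x" if "Q \<in> K" for Q x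
    unfolding \<pi>_def by (rule A.component_eq[OF that])
  have dp: "direct_projections K (\<lambda>Q. Q) \<pi>"
    by (rule direct_projections.intro)
      (use A.finite_K A.eigenspaces_direct_sum A.mult_clin A.e_mult_in A.e_mult_same A.e_mult_other A.sum_e_mult
        in \<open>auto simp: \<pi>_def direct_sum_def\<close>)
  interpret P: direct_projections K "\<lambda>Q. Q" \<pi> by (rule dp)
  obtain U V F \<Psi> where B: "biholomorphism U V F \<Psi>" and U: "U \<subseteq> S" "p \<in> U" and F0: "F p = 0" and dFp: "\<And>v. dif F p v = v"
    and adapt: "\<And>Q x v. Q \<in> K \<Longrightarrow> x \<in> U \<Longrightarrow> m p (E Q p) (dif F x (m x (E Q x) v)) = dif F x (m x (E Q x) v)"
    using straightening[OF p_in] by metis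
  interpret B: biholomorphism U V F \<Psi> by (rule B)
  have FU: "F_manifold_chart U m e" by (rule F_manifold_chart.intro[OF restrict[OF B.open_U U(1)]])
  interpret T: transported_F_manifold U V m e F \<Psi>
    by (rule transported_F_manifold.intro[OF FU B])
  have V0: "0 \<in> V" using B.F_in[OF U(2)] F0 by simp
  have \<Psi>0: "\<Psi> 0 = p" using B.\<Psi>_F[OF U(2)] F0 by simp
  have d\<Psi>0: "dif \<Psi> 0 v = v" for v using B.dif_\<Psi>_F[OF U(2), of v] by (simp add: F0 dFp)
  have mT0: "T.mT 0 v w = m p v w" for v w by (simp add: T.mT_def \<Psi>0 d\<Psi>0 dFp)
  \<comment> \<open>The vectors \<open>?P R\<close> lie in the respective \<open>R\<close> by the
    straightening property and add up to \<open>v\<close>, so they are the components of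
    \<open>v\<close>.\<close>
  have proj: "dif F (\<Psi> y) (m (\<Psi> y) (E Q (\<Psi> y)) (dif \<Psi> y v)) = \<pi> Q v" if y: "y \<in> V" and Q: "Q \<in> K" for y Q v
  proof -
    let ?P = "\<lambda>R. dif F (\<Psi> y) (m (\<Psi> y) (E R (\<Psi> y)) (dif \<Psi> y v))"
    have yU: "\<Psi> y \<in> U" by (rule B.\<Psi>_in[OF y])
    interpret X: unital_algebra "m (\<Psi> y)" "e (\<Psi> y)" by (rule algebra_at) (use yU U(1) in blast)
    have PR: "?P R \<in> R" if "R \<in> K" for R
      using adapt[OF that yU, of "dif \<Psi> y v"] A.e_mult_in[OF that, of "?P R"] by (simp add: E_p[OF that])
    have "(\<Sum>R\<in>K. ?P R) = dif F (\<Psi> y) (m (\<Psi> y) (\<Sum>R\<in>K. E R (\<Psi> y)) (dif \<Psi> y v))"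
      unfolding clin_sum[OF B.dif_F_clin[OF yU], symmetric] X.mult_sum_left ..
    also have "\<dots> = v"
      using yU U(1) by (simp add: E_sum subsetD X.mult_unit B.dif_F_\<Psi>[OF y])
    finally have "\<pi> Q v = \<pi> Q (\<Sum>R\<in>K. ?P R)" by simp
    also have "\<dots> = ?P Q" by (rule P.\<pi>_sum_family[OF Q PR])
    finally show ?thesis by simp
  qed
  have adapted: "T.mT y (\<pi> Q (T.eT y)) v = \<pi> Q v" if y: "y \<in> V" and Q: "Q \<in> K" for y Q v
  proof -
    have yU: "\<Psi> y \<in> U" by (rule B.\<Psi>_in[OF y])
    interpret X: unital_algebra "m (\<Psi> y)" "e (\<Psi> y)" by (rule algebra_at) (use yU U(1) in blast)
    have inv: "dif \<Psi> y (dif F (\<Psi> y) w) = w" for w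
      using B.dif_\<Psi>_F[OF yU, of w] by (simp add: B.F_\<Psi>[OF y])
    have "\<pi> Q (T.eT y) = dif F (\<Psi> y) (m (\<Psi> y) (E Q (\<Psi> y)) (dif \<Psi> y (T.eT y)))"
      by (rule proj[OF y Q, symmetric])
    also have "\<dots> = dif F (\<Psi> y) (E Q (\<Psi> y))"
      unfolding T.eT_def inv X.mult_commute[of "E Q (\<Psi> y)"] X.mult_unit ..
    finally have "T.mT y (\<pi> Q (T.eT y)) v = dif F (\<Psi> y) (m (\<Psi> y) (E Q (\<Psi> y)) (dif \<Psi> y v))"
      by (simp add: T.mT_def inv)
    then show ?thesis unfolding proj[OF y Q] .
  qed
  have "F_manifold_chart V T.mT T.eT" by (rule F_manifold_chart.intro[OF T.F_structure_transported])
  moreover have "product_chart_axioms V T.mT T.eT K \<pi>"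
  proof (rule product_chart_axioms.intro)
    show "Q \<noteq> {0}" if "Q \<in> K" for Q using A.eigenspace_props(3)[of Q] that A.K_def by simp
  qed (rule V0 adapted; assumption)+
  ultimately interpret C: product_chart V T.mT T.eT K \<pi>
    using dp by (intro product_chart.intro)
  let ?G = C.factor
  have comp: "component K (\<lambda>Q. germ_space (?G Q)) Q x = \<pi> Q x" if "Q \<in> K" for Q x
    by (simp add: \<pi>_comp[OF that])
  have spc: "germ_space (prod_germ K ?G) = UNIV"
  proof -
    have "UNIV = {\<Sum>k\<in>K. y k |y. \<forall>k\<in>K. y k \<in> k}" using KK unfolding direct_sum_def by (elim conjE) assumption
    then show ?thesis by (simp add: prod_germ_simps)
  qed
  have pt: "germ_pt (prod_germ K ?G) = 0" by (simp add: prod_germ_simps)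
  obtain d where d: "d > 0" "P.box d \<subseteq> V" by (rule P.box_in_open[OF B.open_V V0])
  \<comment> \<open>In the polydisc each factor multiplication may be evaluated at \<open>x\<close>
    in place of \<open>\<pi> Q x\<close>, and products of vectors from different factors
    vanish.\<close>
  have pm: "germ_mult (prod_germ K ?G) x v w = T.mT x v w" if x: "x \<in> P.box d" for x v w
  proof -
    have "germ_mult (prod_germ K ?G) x v w = (\<Sum>Q\<in>K. T.mT (\<pi> Q x) (\<pi> Q v) (\<pi> Q w))"
      unfolding prod_germ_simps by (rule sum.cong) (simp_all add: \<pi>_comp)
    also have "\<dots> = (\<Sum>Q\<in>K. T.mT x (\<pi> Q v) (\<pi> Q w))"
      by (rule sum.cong) (simp_all add: C.mult_depends[OF d x] P.\<pi>_in)
    also have "\<dots> = T.mT x v w" by (rule C.mult_components[symmetric]) (use x d in blast)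
    finally show ?thesis .
  qed
  have pu: "germ_unit (prod_germ K ?G) x = T.eT x" if x: "x \<in> P.box d" for x
  proof -
    have "germ_unit (prod_germ K ?G) x = (\<Sum>Q\<in>K. \<pi> Q (T.eT (\<pi> Q x)))"
      unfolding prod_germ_simps by (rule sum.cong) (simp_all add: \<pi>_comp)
    also have "\<dots> = (\<Sum>Q\<in>K. \<pi> Q (T.eT x))"
      by (rule sum.cong) (simp_all add: C.unit_depends[OF d x, symmetric])
    finally show ?thesis by (simp add: P.\<pi>_sum)
  qed
  have inv: "dif \<Psi> x (dif F (\<Psi> x) w) = w" if "x \<in> V" for x w
    using B.dif_\<Psi>_F[OF B.\<Psi>_in[OF that], of w] by (simp add: B.F_\<Psi>[OF that])
  have box0: "0 \<in> P.box d" by (rule P.zero_in_box[OF d(1)])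
  have iso: "germ_iso (prod_germ K ?G) H \<Psi>"
  proof -
    have W: "\<Psi> ` P.box d = U \<inter> F -` P.box d"
    proof (intro set_eqI iffI)
      fix x assume "x \<in> \<Psi> ` P.box d"
      then show "x \<in> U \<inter> F -` P.box d" using d(2) B.\<Psi>_in B.F_\<Psi> by auto
    next
      fix x assume x: "x \<in> U \<inter> F -` P.box d"
      then have "x = \<Psi> (F x)" using B.\<Psi>_F by simp
      then show "x \<in> \<Psi> ` P.box d" using x by blast
    qed
    have injb: "inj_on \<Psi> (P.box d)" using B.F_\<Psi> d(2) by (metis inj_onI subsetD)
    have "open (\<Psi> ` P.box d)"
      unfolding W by (rule continuous_open_preimage[OF holo_on_imp_continuous_on[OF B.F_holo] B.open_U P.open_box])
    moreover have "p \<in> \<Psi> ` P.box d" using box0 \<Psi>0 by (metis imageI)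
    ultimately have n: "nbhd UNIV 0 (P.box d)" "nbhd UNIV p (\<Psi> ` P.box d)"
      by (simp_all add: P.open_box box0)
    have bij: "bij_betw \<Psi> (P.box d) (\<Psi> ` P.box d)" using injb by (simp add: bij_betw_def)
    have h: "holo_on (P.box d) \<Psi>" using B.\<Psi>_holo d(2) by (rule holo_on_subset)
    have hi: "holo_on (\<Psi> ` P.box d) (inv_into (P.box d) \<Psi>)"
    proof (rule holo_on_cong)
      show "holo_on (\<Psi> ` P.box d) F" using B.F_holo by (rule holo_on_subset) (simp add: W)
      fix x assume "x \<in> \<Psi> ` P.box d"
      then obtain y where y: "y \<in> P.box d" "x = \<Psi> y" by blast
      then show "F x = inv_into (P.box d) \<Psi> x" using inv_into_f_f[OF injb y(1)] B.F_\<Psi>[of y] d(2) by auto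
    qed
    have mu: "dif \<Psi> x (germ_mult (prod_germ K ?G) x v w) = m (\<Psi> x) (dif \<Psi> x v) (dif \<Psi> x w)" if "x \<in> P.box d" for x v w
      unfolding pm[OF that] T.mT_def inv[OF subsetD[OF d(2) that]] ..
    have un: "dif \<Psi> x (germ_unit (prod_germ K ?G) x) = e (\<Psi> x)" if "x \<in> P.box d" for x
      unfolding pu[OF that] T.eT_def inv[OF subsetD[OF d(2) that]] ..
    show ?thesis
      unfolding germ_iso_def spc pt H_simps
      by (intro exI[of _ "P.box d"] exI[of _ "\<Psi> ` P.box d"] conjI ballI n bij h hi \<Psi>0 mu un)
  qed
  have ext: "extends_to H K (\<lambda>Q. Q) ?G \<Psi>"
    unfolding extends_to_def germ_decomp_def pt spc
    using iso KK C.F_germ_factor by (simp add: d\<Psi>0)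
  have euler: "\<exists>Fs. (\<forall>Q\<in>K. euler_germ (?G Q) c (Fs Q)) \<and>
      (\<exists>U. open U \<and> 0 \<in> U \<and> (\<forall>x\<in>U. X (\<Psi> x) = dif \<Psi> x (\<Sum>Q\<in>K. Fs Q (component K (\<lambda>Q. germ_space (?G Q)) Q x))))"
    if X: "euler_germ H c X" for X c
  proof -
    obtain UE where UE: "open UE" "p \<in> UE" "euler_field UNIV UE m c X"
      using X unfolding euler_germ_def by auto
    \<comment> \<open>An Euler germ lives only near \<open>p\<close>, so the chart is shrunk to its
      domain; \<open>mT\<close> does not change, since its definition does not mention the
      domain.\<close>
    define U' where "U' = U \<inter> UE"
    have U': "open U'" "U' \<subseteq> U" "U' \<subseteq> UE" "p \<in> U'" using UE(1,2) B.open_U U(2) by (auto simp: U'_def)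
    let ?V' = "F ` U'"
    have B': "biholomorphism U' ?V' F \<Psi>" by (rule B.restrict_domain[OF U'(1,2)])
    interpret T': transported_F_manifold U' ?V' m e F \<Psi>
      by (rule transported_F_manifold.intro[OF F_manifold_chart.intro[OF restrict] B']) (use U' U(1) in auto)
    define X' where "X' y = dif F (\<Psi> y) (X (\<Psi> y))" for y
    have EX: "euler_field UNIV ?V' T.mT c X'"
      using T'.euler_transported[OF euler_field_restrict[OF UE(3) U'(1,3)]] unfolding X'_def .
    have V'V: "?V' \<subseteq> V" using B.F_in U'(2) by blast
    have V'0: "0 \<in> ?V'" using U'(4) F0 by (metis imageI)
    obtain d' where d': "d' > 0" "P.box d' \<subseteq> ?V'"
      by (rule P.box_in_open[OF T'.open_V V'0])
    note ec = C.euler_components[OF EX T'.open_V V'V d']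
    show ?thesis
    proof (intro exI[of _ "\<lambda>Q x. \<pi> Q (X' x)"] conjI ballI exI[of _ "P.box d'"] P.open_box P.zero_in_box[OF d'(1)])
      show "euler_germ (?G Q) c (\<lambda>x. \<pi> Q (X' x))" if Q: "Q \<in> K" for Q
        unfolding euler_germ_def C.factor_simps
        using ec(2)[OF Q] C.nbhd_factor[OF P.open_box P.zero_in_box[OF d'(1)] Q] by blast
      fix x assume x: "x \<in> P.box d'"
      then have xV: "x \<in> V" using d'(2) V'V by blast
      have "(\<Sum>Q\<in>K. \<pi> Q (X' (component K (\<lambda>Q. germ_space (?G Q)) Q x))) = (\<Sum>Q\<in>K. \<pi> Q (X' x))"
        by (rule sum.cong) (simp_all add: \<pi>_comp ec(1)[OF _ x, symmetric])
      also have "\<dots> = X' x" by (rule P.\<pi>_sum)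
      finally show "X (\<Psi> x) = dif \<Psi> x (\<Sum>Q\<in>K. \<pi> Q (X' (component K (\<lambda>Q. germ_space (?G Q)) Q x)))"
        by (simp add: X'_def inv[OF xV])
    qed
  qed
  show ?thesis
    by (rule that[OF ext _ _ spc pt d\<Psi>0 _ euler]) (simp_all add: mT0)
qed

end

lemma F_manifold_chart_germ:
  fixes M :: "('a, 'n::finite) fmanifold" and c :: "('a, 'n) chart"
  assumes "F_manifold M" "c \<in> man_charts M"
  shows "F_manifold_chart (snd c ` fst c) (man_mult M c) (man_unit M c)"
  using assms unfolding F_manifold_def by (intro F_manifold_chart.intro) blast

text \<open>Model spaces and base points of a product decomposition can be chosen freely, so
  uniqueness means isomorphisms \<open>\<theta> Q\<close> of corresponding factors whose product is
  compatible with \<open>\<Psi>\<close> and \<open>\<Psi>'\<close>; as parts of the given germ the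
  factors then coincide.\<close>

theorem theorem4p2:
  fixes M :: "('a, 'n::finite) fmanifold" and c :: "('a, 'n) chart" and p :: 'a
  assumes "F_manifold M" and "c \<in> man_charts M" and "p \<in> fst c"
  shows "let H = germ_at M c p; \<mu> = man_mult M c (snd c p); K = eigenspaces UNIV \<mu> in
    direct_sum K (\<lambda>Q. Q) UNIV \<and>
    (\<exists>G \<Psi>.
      extends_to H K (\<lambda>Q. Q) G \<Psi> \<and>
      (\<forall>Q\<in>K. algebra_iso (germ_space (G Q)) (germ_mult (G Q) (germ_pt (G Q))) Q \<mu>
                 (dif \<Psi> (germ_pt (prod_germ K G)))) \<and>
      (\<forall>G' \<Psi>'. extends_to H K (\<lambda>Q. Q) G' \<Psi>' \<longrightarrow>
        (\<exists>\<theta>. (\<forall>Q\<in>K. germ_iso (G Q) (G' Q) (\<theta> Q)) \<and>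
          (\<exists>U. nbhd (germ_space (prod_germ K G)) (germ_pt (prod_germ K G)) U \<and>
            (\<forall>x\<in>U. \<Psi> x = \<Psi>' (\<Sum>Q\<in>K. \<theta> Q (component K (\<lambda>Q. germ_space (G Q)) Q x)))))) \<and>
      (\<forall>Q\<in>K. irreducible_germ (G Q)) \<and>
      (\<forall>Q\<in>K. irreducible_algebra Q \<mu> \<and>
         irreducible_algebra (germ_space (G Q)) (germ_mult (G Q) (germ_pt (G Q)))) \<and>
      (\<forall>E d. euler_germ H d E \<longrightarrow>
        (\<exists>F. (\<forall>Q\<in>K. euler_germ (G Q) d (F Q)) \<and>
          (\<exists>U. nbhd (germ_space (prod_germ K G)) (germ_pt (prod_germ K G)) U \<and>
            (\<forall>x\<in>U. E (\<Psi> x) =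
               dif \<Psi> x (\<Sum>Q\<in>K. F Q (component K (\<lambda>Q. germ_space (G Q)) Q x)))))))"
proof -
  define S where "S = snd c ` fst c"
  define m where "m = man_mult M c"
  define e where "e = man_unit M c"
  define x where "x = snd c p"
  define K where "K = eigenspaces UNIV (m x)"
  have x: "x \<in> S" using assms(3) by (simp add: x_def S_def)
  interpret M: F_manifold_chart S m e
    unfolding S_def m_def e_def by (rule F_manifold_chart_germ[OF assms(1,2)])
  interpret X: unital_algebra "m x" "e x" by (rule M.algebra_at[OF x])
  obtain \<epsilon> where \<epsilon>: "finite K" "\<And>Q. Q \<in> K \<Longrightarrow> \<epsilon> Q \<in> Q" "(\<Sum>Q\<in>K. \<epsilon> Q) = e x"
    using X.unit_decomposition unfolding K_def by metis
  have D: "decomposed_algebra (m x) (e x) K \<epsilon>"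
    by (rule decomposed_algebra.intro[OF M.algebra_at[OF x] decomposed_algebra_axioms.intro]) (use \<epsilon> K_def in auto)
  obtain T E where T: "open T" "x \<in> T" "T \<subseteq> S" and E: "\<And>Q. Q \<in> K \<Longrightarrow> holo_on T (E Q)" "\<And>Q. Q \<in> K \<Longrightarrow> E Q x = \<epsilon> Q"
    "\<And>Q y. Q \<in> K \<Longrightarrow> y \<in> T \<Longrightarrow> m y (E Q y) (E Q y) = E Q y"
    "\<And>Q R y. Q \<in> K \<Longrightarrow> R \<in> K \<Longrightarrow> Q \<noteq> R \<Longrightarrow> y \<in> T \<Longrightarrow> m y (E Q y) (E R y) = 0"
    "\<And>y. y \<in> T \<Longrightarrow> (\<Sum>Q\<in>K. E Q y) = e y"
    by (rule M.orthogonal_idempotents_extend[OF x D]) (rule that)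
  have "F_manifold_idempotents T m e K E"
    by (rule F_manifold_idempotents.intro[OF F_manifold_chart.intro[OF M.restrict[OF T(1,3)]] F_manifold_idempotents_axioms.intro])
      (use \<epsilon>(1) E in auto)
  moreover have "decomposed_germ_axioms T K E x \<epsilon>"
    by (rule decomposed_germ_axioms.intro) (rule T(2) E(2); assumption)+
  ultimately interpret D: decomposed_germ T m e K E x \<epsilon>
    using D by (intro decomposed_germ.intro)
  obtain G \<Psi> where G: "extends_to D.H K (\<lambda>Q. Q) G \<Psi>"
    "\<And>Q. Q \<in> K \<Longrightarrow> germ_space (G Q) = Q" "\<And>Q. Q \<in> K \<Longrightarrow> germ_pt (G Q) = 0"
    "germ_space (prod_germ K G) = UNIV" "germ_pt (prod_germ K G) = 0" "\<And>v. dif \<Psi> 0 v = v"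
    "\<And>Q v w. Q \<in> K \<Longrightarrow> germ_mult (G Q) 0 v w = m x v w"
    "\<And>X c. euler_germ D.H c X \<Longrightarrow> \<exists>F. (\<forall>Q\<in>K. euler_germ (G Q) c (F Q)) \<and>
      (\<exists>U. open U \<and> 0 \<in> U \<and> (\<forall>x\<in>U. X (\<Psi> x) = dif \<Psi> x (\<Sum>Q\<in>K. F Q (component K (\<lambda>Q. germ_space (G Q)) Q x))))"
    by (rule D.decomposition) (rule that)
  have H: "germ_at M c p = D.H" unfolding germ_at_def x_def[symmetric] m_def[symmetric] e_def[symmetric] D.H_def ..
  have irr: "irreducible_algebra Q (m x)" if "Q \<in> K" for Q by (rule D.A.eigenspace_irreducible[OF that])
  have irr': "irreducible_algebra (germ_space (G Q)) (germ_mult (G Q) (germ_pt (G Q)))" if Q: "Q \<in> K" for Q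
  proof -
    have "germ_mult (G Q) (germ_pt (G Q)) = m x" by (intro ext) (simp add: G(3)[OF Q] G(7)[OF Q])
    then show ?thesis using irr[OF Q] G(2)[OF Q] by simp
  qed
  have uniq: "\<exists>\<theta>. (\<forall>Q\<in>K. germ_iso (G Q) (G' Q) (\<theta> Q)) \<and>
          (\<exists>U. nbhd UNIV 0 U \<and> (\<forall>x\<in>U. \<Psi> x = \<Psi>' (\<Sum>Q\<in>K. \<theta> Q (component K (\<lambda>Q. germ_space (G Q)) Q x))))"
    if ext': "extends_to D.H K (\<lambda>Q. Q) G' \<Psi>'" for G' \<Psi>'
  proof -
    obtain \<theta> U where t: "\<And>Q. Q \<in> K \<Longrightarrow> germ_iso (G Q) (G' Q) (\<theta> Q)" "open U" "0 \<in> U"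
      "\<And>x. x \<in> U \<Longrightarrow> \<Psi> x = \<Psi>' (\<Sum>Q\<in>K. \<theta> Q (component K (\<lambda>Q. germ_space (G Q)) Q x))"
      by (rule D.decomposition_unique[OF G(1) ext']) (erule G(3), rule that)
    show ?thesis
      by (intro exI[of _ \<theta>] conjI ballI exI[of _ U] t) (simp_all add: t(2,3))
  qed
  have alg: "algebra_iso (germ_space (G Q)) (germ_mult (G Q) (germ_pt (G Q))) Q (m x) (dif \<Psi> 0)" if Q: "Q \<in> K" for Q
  proof -
    \<comment> \<open>The normalisation of the chart reduces the algebra isomorphism to the identity
      map of \<open>Q\<close>.\<close>
    have "dif \<Psi> 0 = id" by (rule ext) (simp add: G(6))
    then show ?thesis
      unfolding algebra_iso_def by (simp add: G(2)[OF Q] G(3)[OF Q] G(7)[OF Q])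
  qed
  have irrg: "irreducible_germ (G Q)" if "Q \<in> K" for Q
    by (rule irreducible_germI[OF _ irr'[OF that]]) (use G(1) that in \<open>auto simp: extends_to_def germ_decomp_def\<close>)
  have eul: "\<exists>F. (\<forall>Q\<in>K. euler_germ (G Q) d (F Q)) \<and>
      (\<exists>U. nbhd UNIV 0 U \<and> (\<forall>x\<in>U. X (\<Psi> x) = dif \<Psi> x (\<Sum>Q\<in>K. F Q (component K (\<lambda>Q. germ_space (G Q)) Q x))))"
    if "euler_germ D.H d X" for X d
    using G(8)[OF that] unfolding nbhd_UNIV conj_assoc .
  show ?thesis
    unfolding Let_def H x_def[symmetric] m_def[symmetric] K_def[symmetric]
    by (intro conjI exI[of _ G] exI[of _ \<Psi>] ballI allI impI; (unfold G(4) G(5))?)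
      (rule D.A.eigenspaces_direct_sum G(1) alg uniq irrg irr irr' eul; assumption)+
qed

end
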